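(* Let $\mathcal{M}$ be a semifinite von Neumann algebra with faithful normal semifinite trace $\tau_{\mathcal{M}}$ and let $\psi$ be an Orlicz function with complementary function $\psi^*$. Given a closed densely defined operator $a$ affiliated with $\mathcal{M}$, we have $a\in L_\psi(\mathcal{M},\tau_{\mathcal{M}})$ if and only if $a\otimes\widetilde{\varphi}_\psi(e^t)$ belongs to $\widetilde{\mathcal{A}}$. Moreover, for any $a\in L_\psi(\mathcal{M},\tau_{\mathcal{M}})$ the Orlicz norm is given by $$\|a\|^O_\psi=\sup\{\mathrm{tr}(|(a\otimes\varphi_\psi(e^t))(b\otimes\widetilde{\varphi}_{\psi^*}(e^t))|): b\in L^{\psi^*}(\mathcal{M},\tau_{\mathcal{M}}),\ \mu_1(b\otimes\varphi_{\psi^*}(e^t))\le1\}$$ $$=\sup\{\mathrm{tr}(|(b\otimes\widetilde{\varphi}_{\psi^*}(e^t))(a\otimes\varphi_\psi(e^t))|): b\in L^{\psi^*}(\mathcal{M},\tau_{\mathcal{M}}),\ \mu_1(b\otimes\varphi_{\psi^*}(e^t))\le1\}.$$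
   Context: An Orlicz function is a convex function $\psi:[0,\infty)\to[0,\infty]$ with $\psi(0)=0$, $\lim_{u\to\infty}\psi(u)=\infty$, neither identically zero nor infinite valued on all of $(0,\infty)$, and left continuous at $b_\psi=\sup\{u>0:\psi(u)<\infty\}$. Its complementary function is $\psi^*(u)=\sup_{v>0}(uv-\psi(v))$. Put $\psi^{-1}(t)=\sup\{s:\psi(s)\le t\}$. The fundamental function of $L^\psi(\mathbb{R})$ with the Luxemburg norm is $\varphi_\psi(t)=1/\psi^{-1}(1/t)$, and that of $L_\psi(\mathbb{R})$ (the same space with the Orlicz norm) is $\widetilde{\varphi}_\psi(t)=t/\varphi_{\psi^*}(t)=t(\psi^* )^{-1}(1/t)$, for $t>0$ (both vanish at $0$). $L^\psi(\mathcal{M},\tau_{\mathcal{M}})$ consists of the $\tau_{\mathcal{M}}$-measurable operators $a$ with $\mu(a)\in L^\psi(0,\infty)$ (equivalently $\tau_{\mathcal{M}}(\psi(\alpha|a|))<\infty$ for some $\alpha>0$), with Luxemburg norm $\|a\|_\psi=\inf\{\lambda>0:\tau_{\mathcal{M}}(\psi(|a|/\lambda))\le1\}$. $L_\psi(\mathcal{M},\tau_{\mathcal{M}})$ is the same set with the Orlicz norm $\|a\|^O_\psi=\sup\{\tau_{\mathcal{M}}(|ab|):b\in L^{\psi^*}(\mathcal{M},\tau_{\mathcal{M}}),\|b\|_{\psi^*}\le1\}$. The crossed product $\mathcal{A}=\mathcal{M}\rtimes\mathbb{R}$ by the modular group of $\tau_{\mathcal{M}}$ is identified with $\mathcal{M}\otimes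 L^\infty(\mathbb{R})$, with canonical trace $\tau_{\mathcal{A}}=\tau_{\mathcal{M}}\otimes\int_{\mathbb{R}}\cdot\,e^{-t}dt$. $\widetilde{\mathcal{A}}$ is the $*$-algebra of $\tau_{\mathcal{A}}$-measurable operators (products are strong products), $f(e^t)$ denotes multiplication by $t\mapsto f(e^t)$ on $\mathbb{R}$, and $\mu_t(x)=\inf\{s\ge0:\tau_{\mathcal{A}}(\chi_{(s,\infty)}(|x|))\le t\}$. The Haagerup space $L^1(\mathcal{M})\subset\widetilde{\mathcal{A}}$ is $\{g\otimes e^t:g\in L^1(\mathcal{M},\tau_{\mathcal{M}})\}$ and $\mathrm{tr}(g\otimes e^t)=\tau_{\mathcal{M}}(g)$. (One has $\varphi_\psi(t)\widetilde{\varphi}_{\psi^*}(t)=t$, so the products above equal $ab\otimes e^t$, resp. $ba\otimes e^t$, and lie in $L^1(\mathcal{M})$.) *)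

theory Defs
  imports "HOL-Analysis.Analysis" "HOL-Library.Nonpos_Ints"
begin

section \<open>Complex Hilbert spaces\<close>

text \<open>The inner product \<open>cinner\<close> is conjugate linear in its first argument; the real inner
  product of the underlying real Hilbert space is its real part.\<close>

class chilbert_space = real_inner + complete_space +
  fixes scaleC :: "complex \<Rightarrow> 'a \<Rightarrow> 'a" (infixr "*\<^sub>C" 75)
    and cinner :: "'a \<Rightarrow> 'a \<Rightarrow> complex"
  assumes scaleC_add_right: "c *\<^sub>C (x + y) = c *\<^sub>C x + c *\<^sub>C y"
    and scaleC_add_left: "(c + d) *\<^sub>C x = c *\<^sub>C x + d *\<^sub>C x"
    and scaleC_scaleC: "c *\<^sub>C d *\<^sub>C x = (c * d) *\<^sub>C x"
    and scaleC_of_real: "complex_of_real r *\<^sub>C x = r *\<^sub>R x"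
    and cinner_commute: "cinner x y = cnj (cinner y x)"
    and cinner_add_right: "cinner x (y + z) = cinner x y + cinner x z"
    and cinner_scaleC_right: "cinner x (c *\<^sub>C y) = c * cinner x y"
    and Re_cinner: "Re (cinner x y) = inner x y"

instantiation prod :: (chilbert_space, chilbert_space) chilbert_space
begin

definition scaleC_prod :: "complex \<Rightarrow> 'a \<times> 'b \<Rightarrow> 'a \<times> 'b"
  where "scaleC_prod c p = (c *\<^sub>C fst p, c *\<^sub>C snd p)"

definition cinner_prod :: "'a \<times> 'b \<Rightarrow> 'a \<times> 'b \<Rightarrow> complex"
  where "cinner_prod p q = cinner (fst p) (fst q) + cinner (snd p) (snd q)"

instance
proof
  fix x y :: "'a \<times> 'b"
  show "cinner x y = cnj (cinner y x)"
    unfolding cinner_prod_def complex_cnj_add by (metis cinner_commute)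
qed (auto simp: scaleC_prod_def cinner_prod_def scaleC_add_right scaleC_add_left scaleC_scaleC
    scaleC_of_real cinner_add_right cinner_scaleC_right Re_cinner inner_prod_def
    algebra_simps prod_eq_iff)

end

definition csubspace :: "'a::chilbert_space set \<Rightarrow> bool" where
  "csubspace S \<longleftrightarrow> 0 \<in> S \<and> (\<forall>x\<in>S. \<forall>y\<in>S. x + y \<in> S) \<and> (\<forall>c. \<forall>x\<in>S. c *\<^sub>C x \<in> S)"

definition closed_cspan :: "'a::chilbert_space set \<Rightarrow> 'a set" where
  "closed_cspan S = closure (csubspace hull S)"


section \<open>Bounded operators and von Neumann algebras\<close>

definition bounded_clinear :: "('a::chilbert_space \<Rightarrow> 'b::chilbert_space) \<Rightarrow> bool" where
  "bounded_clinear f \<longleftrightarrow> bounded_linear f \<and> (\<forall>c x. f (c *\<^sub>C x) = c *\<^sub>C f x)"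

definition cadjoint :: "('a::chilbert_space \<Rightarrow> 'a) \<Rightarrow> 'a \<Rightarrow> 'a" where
  "cadjoint f = (THE g. \<forall>x y. cinner (f x) y = cinner x (g y))"

definition positive_op :: "('a::chilbert_space \<Rightarrow> 'a) \<Rightarrow> bool" where
  "positive_op f \<longleftrightarrow> bounded_clinear f \<and> (\<forall>x. cinner x (f x) \<in> \<real>\<^sub>\<ge>\<^sub>0)"

definition op_le :: "('a::chilbert_space \<Rightarrow> 'a) \<Rightarrow> ('a \<Rightarrow> 'a) \<Rightarrow> bool" where
  "op_le f g \<longleftrightarrow> positive_op (\<lambda>x. g x - f x)"

definition projection_op :: "('a::chilbert_space \<Rightarrow> 'a) \<Rightarrow> bool" where
  "projection_op p \<longleftrightarrow> bounded_clinear p \<and> p \<circ> p = p \<and> cadjoint p = p"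

definition unitary_op :: "('a::chilbert_space \<Rightarrow> 'a) \<Rightarrow> bool" where
  "unitary_op u \<longleftrightarrow> bounded_clinear u \<and> cadjoint u \<circ> u = id \<and> u \<circ> cadjoint u = id"

definition commutant :: "('a::chilbert_space \<Rightarrow> 'a) set \<Rightarrow> ('a \<Rightarrow> 'a) set" where
  "commutant S = {f. bounded_clinear f \<and> (\<forall>g\<in>S. f \<circ> g = g \<circ> f)}"

definition von_neumann_algebra :: "('a::chilbert_space \<Rightarrow> 'a) set \<Rightarrow> bool" where
  "von_neumann_algebra M \<longleftrightarrow>
     (\<forall>f\<in>M. bounded_clinear f) \<and> (\<forall>f\<in>M. cadjoint f \<in> M) \<and> commutant (commutant M) = M"

definition pos_part :: "('a::chilbert_space \<Rightarrow> 'a) set \<Rightarrow> ('a \<Rightarrow> 'a) set" where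
  "pos_part M = {f\<in>M. positive_op f}"


section \<open>Traces\<close>

text \<open>A trace is a \<open>[0,\<infinity>]\<close>-valued function on the positive cone; its values elsewhere are
  irrelevant.\<close>

definition is_trace :: "('a::chilbert_space \<Rightarrow> 'a) set \<Rightarrow> (('a \<Rightarrow> 'a) \<Rightarrow> ennreal) \<Rightarrow> bool" where
  "is_trace M \<tau> \<longleftrightarrow>
     (\<forall>f\<in>pos_part M. \<forall>g\<in>pos_part M. \<tau> (\<lambda>x. f x + g x) = \<tau> f + \<tau> g) \<and>
     (\<forall>f\<in>pos_part M. \<forall>r\<ge>0. \<tau> (\<lambda>x. r *\<^sub>R f x) = ennreal r * \<tau> f) \<and>
     (\<forall>f\<in>M. \<tau> (cadjoint f \<circ> f) = \<tau> (f \<circ> cadjoint f))"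

definition faithful_trace ::
  "('a::chilbert_space \<Rightarrow> 'a) set \<Rightarrow> (('a \<Rightarrow> 'a) \<Rightarrow> ennreal) \<Rightarrow> bool" where
  "faithful_trace M \<tau> \<longleftrightarrow> (\<forall>f\<in>pos_part M. \<tau> f = 0 \<longrightarrow> f = (\<lambda>x. 0))"

definition semifinite_trace ::
  "('a::chilbert_space \<Rightarrow> 'a) set \<Rightarrow> (('a \<Rightarrow> 'a) \<Rightarrow> ennreal) \<Rightarrow> bool" where
  "semifinite_trace M \<tau> \<longleftrightarrow>
     (\<forall>f\<in>pos_part M. f \<noteq> (\<lambda>x. 0) \<longrightarrow>
        (\<exists>g\<in>pos_part M. g \<noteq> (\<lambda>x. 0) \<and> op_le g f \<and> \<tau> g < \<infinity>))"

text \<open>Normality: \<open>\<tau> (sup D) = sup (\<tau> ` D)\<close> for every upward directed \<open>D\<close> in the positive cone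
  that has a supremum there.\<close>

definition normal_trace ::
  "('a::chilbert_space \<Rightarrow> 'a) set \<Rightarrow> (('a \<Rightarrow> 'a) \<Rightarrow> ennreal) \<Rightarrow> bool" where
  "normal_trace M \<tau> \<longleftrightarrow>
     (\<forall>D s. D \<noteq> {} \<and> D \<subseteq> pos_part M \<and>
        (\<forall>f\<in>D. \<forall>g\<in>D. \<exists>h\<in>D. op_le f h \<and> op_le g h) \<and>
        s \<in> pos_part M \<and> (\<forall>f\<in>D. op_le f s) \<and>
        (\<forall>z\<in>pos_part M. (\<forall>f\<in>D. op_le f z) \<longrightarrow> op_le s z)
      \<longrightarrow> \<tau> s = (SUP f\<in>D. \<tau> f))"

definition fns_trace ::
  "('a::chilbert_space \<Rightarrow> 'a) set \<Rightarrow> (('a \<Rightarrow> 'a) \<Rightarrow> ennreal) \<Rightarrow> bool" where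
  "fns_trace M \<tau> \<longleftrightarrow>
     is_trace M \<tau> \<and> faithful_trace M \<tau> \<and> normal_trace M \<tau> \<and> semifinite_trace M \<tau>"


section \<open>Unbounded operators, as graphs\<close>

text \<open>An operator is identified with its graph \<open>{(\<xi>, T \<xi>) | \<xi> \<in> dom T}\<close>, so its domain is
  \<open>Domain T\<close>, the algebraic product \<open>S T\<close> is the relational composition \<open>T O S\<close>,
  and the closure of a closable operator is the topological closure of its graph.\<close>

type_synonym 'a graph = "('a \<times> 'a) set"

definition closed_dd_op :: "'a::chilbert_space graph \<Rightarrow> bool" where
  "closed_dd_op T \<longleftrightarrow>
     csubspace T \<and> single_valued T \<and> closed T \<and> closure (Domain T) = UNIV"

definition op_adjoint :: "'a::chilbert_space graph \<Rightarrow> 'a graph" where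
  "op_adjoint T = {(y, z). \<forall>(x, w)\<in>T. cinner w y = cinner x z}"

definition positive_selfadjoint :: "'a::chilbert_space graph \<Rightarrow> bool" where
  "positive_selfadjoint T \<longleftrightarrow>
     closed_dd_op T \<and> op_adjoint T = T \<and> (\<forall>(x, y)\<in>T. cinner x y \<in> \<real>\<^sub>\<ge>\<^sub>0)"

definition op_abs :: "'a::chilbert_space graph \<Rightarrow> 'a graph" where
  "op_abs T = (THE h. positive_selfadjoint h \<and> h O h = T O op_adjoint T)"

definition strong_prod :: "'a::chilbert_space graph \<Rightarrow> 'a graph \<Rightarrow> 'a graph" where
  "strong_prod S T = closure (T O S)"

text \<open>\<open>T\<close> is affiliated with \<open>M\<close> iff \<open>u T u\<^sup>* = T\<close> for all unitaries \<open>u\<close> in the commutant.\<close>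

definition affiliated :: "('a::chilbert_space \<Rightarrow> 'a) set \<Rightarrow> 'a graph \<Rightarrow> bool" where
  "affiliated M T \<longleftrightarrow> (\<forall>u\<in>commutant M. unitary_op u \<longrightarrow> map_prod u u ` T = T)"


section \<open>Spectral measures\<close>

text \<open>The value on non-Borel sets is fixed so that the spectral measure is a unique function.\<close>

definition projection_valued_measure :: "(real set \<Rightarrow> 'a::chilbert_space \<Rightarrow> 'a) \<Rightarrow> bool" where
  "projection_valued_measure E \<longleftrightarrow>
     (\<forall>B\<in>sets borel. projection_op (E B)) \<and>
     (\<forall>B. B \<notin> sets borel \<longrightarrow> E B = (\<lambda>\<xi>. 0)) \<and>
     E UNIV = id \<and>
     (\<forall>B\<in>sets borel. \<forall>C\<in>sets borel. E (B \<inter> C) = E B \<circ> E C) \<and>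
     (\<forall>A \<xi>. range A \<subseteq> sets borel \<and> disjoint_family A \<longrightarrow>
        (\<lambda>n::nat. E (A n) \<xi>) sums E (\<Union>n. A n) \<xi>)"

definition scalar_measure ::
  "(real set \<Rightarrow> 'a::chilbert_space \<Rightarrow> 'a) \<Rightarrow> 'a \<Rightarrow> real measure" where
  "scalar_measure E \<xi> = measure_of UNIV (sets borel) (\<lambda>B. ennreal (Re (cinner \<xi> (E B \<xi>))))"

text \<open>\<open>h = \<integral> s dE(s)\<close>: the domain of \<open>h\<close> is the set of \<open>\<xi>\<close> with
  \<open>\<integral> s\<^sup>2 d\<langle>\<xi>, E(s) \<xi>\<rangle> < \<infinity>\<close>, and \<open>\<langle>\<xi>, h \<xi>\<rangle> = \<integral> s d\<langle>\<xi>, E(s) \<xi>\<rangle>\<close> on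
  that domain. By polarization the diagonal matrix coefficients determine \<open>h\<close>.\<close>

definition is_spectral_integral ::
  "'a::chilbert_space graph \<Rightarrow> (real set \<Rightarrow> 'a \<Rightarrow> 'a) \<Rightarrow> bool" where
  "is_spectral_integral h E \<longleftrightarrow>
     Domain h = {\<xi>. (\<integral>\<^sup>+ s. ennreal (s\<^sup>2) \<partial>scalar_measure E \<xi>) < \<infinity>} \<and>
     (\<forall>(\<xi>, \<eta>)\<in>h. cinner \<xi> \<eta> = complex_of_real (\<integral>s. s \<partial>scalar_measure E \<xi>))"

definition spectral_measure :: "'a::chilbert_space graph \<Rightarrow> real set \<Rightarrow> 'a \<Rightarrow> 'a" where
  "spectral_measure h = (THE E. projection_valued_measure E \<and> is_spectral_integral h E)"


section \<open>Measurable operators and generalized singular values\<close>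

text \<open>\<open>\<tau> (f(h)) = \<integral> f d(\<tau> \<circ> E\<^sub>h)\<close> for a positive self-adjoint \<open>h\<close> and a Borel
  function \<open>f\<close> from \<open>[0,\<infinity>)\<close> to \<open>[0,\<infinity>]\<close>; with \<open>f\<close> the identity this is the extension of
  \<open>\<tau>\<close> to positive affiliated operators.\<close>

definition trace_fun ::
  "(('a::chilbert_space \<Rightarrow> 'a) \<Rightarrow> ennreal) \<Rightarrow> (real \<Rightarrow> ennreal) \<Rightarrow> 'a graph \<Rightarrow> ennreal" where
  "trace_fun \<tau> f h =
     (\<integral>\<^sup>+ s\<in>{0..}. f s \<partial>measure_of UNIV (sets borel) (\<lambda>B. \<tau> (spectral_measure h B)))"

definition trace_pos :: "(('a::chilbert_space \<Rightarrow> 'a) \<Rightarrow> ennreal) \<Rightarrow> 'a graph \<Rightarrow> ennreal" where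
  "trace_pos \<tau> h = trace_fun \<tau> ennreal h"

text \<open>The last condition says that the domain is \<open>\<tau>\<close>-dense. Since \<open>T\<close> is closed, \<open>T p\<close> is then
  automatically bounded.\<close>

definition measurable_ops ::
  "('a::chilbert_space \<Rightarrow> 'a) set \<Rightarrow> (('a \<Rightarrow> 'a) \<Rightarrow> ennreal) \<Rightarrow> 'a graph set" where
  "measurable_ops M \<tau> =
     {T. closed_dd_op T \<and> affiliated M T \<and>
        (\<forall>\<delta>>0. \<exists>p\<in>M. projection_op p \<and> range p \<subseteq> Domain T \<and> \<tau> (\<lambda>\<xi>. \<xi> - p \<xi>) \<le> ennreal \<delta>)}"

definition singular_value ::
  "(('a::chilbert_space \<Rightarrow> 'a) \<Rightarrow> ennreal) \<Rightarrow> real \<Rightarrow> 'a graph \<Rightarrow> ennreal" where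
  "singular_value \<tau> t x =
     (INF s\<in>{s. 0 \<le> s \<and> \<tau> (spectral_measure (op_abs x) {s<..}) \<le> ennreal t}. ennreal s)"


section \<open>Orlicz functions\<close>

text \<open>An Orlicz function is represented by \<open>\<psi> :: real \<Rightarrow> ennreal\<close>, of which only the
  restriction to \<open>[0,\<infinity>)\<close> is used.\<close>

definition orlicz_b :: "(real \<Rightarrow> ennreal) \<Rightarrow> ereal" where
  "orlicz_b \<psi> = (SUP u\<in>{u. 0 < u \<and> \<psi> u < \<infinity>}. ereal u)"

definition orlicz_function :: "(real \<Rightarrow> ennreal) \<Rightarrow> bool" where
  "orlicz_function \<psi> \<longleftrightarrow>
     (\<forall>x\<ge>0. \<forall>y\<ge>0. \<forall>r\<in>{0..1}.
        \<psi> ((1 - r) * x + r * y) \<le> ennreal (1 - r) * \<psi> x + ennreal r * \<psi> y) \<and>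
     \<psi> 0 = 0 \<and> (\<psi> \<longlongrightarrow> \<infinity>) at_top \<and>
     (\<exists>u>0. \<psi> u \<noteq> 0) \<and> (\<exists>u>0. \<psi> u \<noteq> \<infinity>) \<and>
     (\<forall>b. ereal b = orlicz_b \<psi> \<longrightarrow> (\<psi> \<longlongrightarrow> \<psi> b) (at_left b))"

text \<open>Subtraction on \<open>ennreal\<close> truncates at 0. This does not affect the supremum, which is
  nonnegative because \<open>u v - \<psi> v\<close> tends to 0 as \<open>v\<close> decreases to 0.\<close>

definition orlicz_conj :: "(real \<Rightarrow> ennreal) \<Rightarrow> real \<Rightarrow> ennreal" where
  "orlicz_conj \<psi> u = (SUP v\<in>{0<..}. ennreal (u * v) - \<psi> v)"

definition orlicz_inv :: "(real \<Rightarrow> ennreal) \<Rightarrow> real \<Rightarrow> real" where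
  "orlicz_inv \<psi> t = Sup {s. 0 \<le> s \<and> \<psi> s \<le> ennreal t}"

definition fund_lux :: "(real \<Rightarrow> ennreal) \<Rightarrow> real \<Rightarrow> real" where
  "fund_lux \<psi> t = (if t = 0 then 0 else 1 / orlicz_inv \<psi> (1 / t))"

definition fund_orl :: "(real \<Rightarrow> ennreal) \<Rightarrow> real \<Rightarrow> real" where
  "fund_orl \<psi> t = (if t = 0 then 0 else t / fund_lux (orlicz_conj \<psi>) t)"


section \<open>Orlicz spaces of measurable operators\<close>

definition orlicz_half_line :: "(real \<Rightarrow> ennreal) \<Rightarrow> (real \<Rightarrow> real) set" where
  "orlicz_half_line \<psi> =
     {f. set_borel_measurable lborel {0<..} f \<and>
         (\<exists>\<alpha>>0. (\<integral>\<^sup>+ t\<in>{0<..}. \<psi> (\<alpha> * \<bar>f t\<bar>) \<partial>lborel) < \<infinity>)}"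

text \<open>The common underlying set of the Luxemburg and the Orlicz version of the space. The
  singular values \<open>\<mu>\<^sub>t(a)\<close>, \<open>t > 0\<close>, of a measurable operator are finite.\<close>

definition orlicz_space ::
  "('a::chilbert_space \<Rightarrow> 'a) set \<Rightarrow> (('a \<Rightarrow> 'a) \<Rightarrow> ennreal) \<Rightarrow> (real \<Rightarrow> ennreal) \<Rightarrow> 'a graph set"
  where
  "orlicz_space M \<tau> \<psi> =
     {a\<in>measurable_ops M \<tau>. (\<lambda>t. enn2real (singular_value \<tau> t a)) \<in> orlicz_half_line \<psi>}"

definition luxemburg_norm ::
  "(('a::chilbert_space \<Rightarrow> 'a) \<Rightarrow> ennreal) \<Rightarrow> (real \<Rightarrow> ennreal) \<Rightarrow> 'a graph \<Rightarrow> ennreal" where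
  "luxemburg_norm \<tau> \<psi> a =
     (INF r\<in>{r. 0 < r \<and> trace_fun \<tau> (\<lambda>s. \<psi> (s / r)) (op_abs a) \<le> 1}. ennreal r)"

definition orlicz_norm ::
  "('a::chilbert_space \<Rightarrow> 'a) set \<Rightarrow> (('a \<Rightarrow> 'a) \<Rightarrow> ennreal) \<Rightarrow> (real \<Rightarrow> ennreal) \<Rightarrow> 'a graph \<Rightarrow> ennreal"
  where
  "orlicz_norm M \<tau> \<psi> a =
     (SUP b\<in>{b\<in>orlicz_space M \<tau> (orlicz_conj \<psi>). luxemburg_norm \<tau> (orlicz_conj \<psi>) b \<le> 1}.
        trace_pos \<tau> (op_abs (strong_prod a b)))"

definition L1_ops ::
  "('a::chilbert_space \<Rightarrow> 'a) set \<Rightarrow> (('a \<Rightarrow> 'a) \<Rightarrow> ennreal) \<Rightarrow> 'a graph set" where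
  "L1_ops M \<tau> = {g\<in>measurable_ops M \<tau>. trace_pos \<tau> (op_abs g) < \<infinity>}"


section \<open>The crossed product\<close>

definition square_integrable :: "(real \<Rightarrow> complex) \<Rightarrow> bool" where
  "square_integrable f \<longleftrightarrow>
     f \<in> borel_measurable lborel \<and> integrable lborel (\<lambda>t. (cmod (f t))\<^sup>2)"

definition ess_bounded :: "(real \<Rightarrow> complex) \<Rightarrow> bool" where
  "ess_bounded f \<longleftrightarrow>
     f \<in> borel_measurable lborel \<and> (\<exists>C. AE t in lborel. cmod (f t) \<le> C)"

text \<open>A realization of the Hilbert space tensor product of \<open>'a\<close> and \<open>L\<^sup>2(\<real>)\<close> on \<open>'k\<close>:
  \<open>T \<xi> f\<close> is the elementary tensor of \<open>\<xi>\<close> and the class of \<open>f\<close>. The two conditions determine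
  \<open>('k, T)\<close> up to a unique unitary; the first implies that \<open>T\<close> is bilinear and respects
  equality almost everywhere on square integrable functions.\<close>

definition L2_tensor ::
  "('a::chilbert_space \<Rightarrow> (real \<Rightarrow> complex) \<Rightarrow> 'k::chilbert_space) \<Rightarrow> bool" where
  "L2_tensor T \<longleftrightarrow>
     (\<forall>\<xi> \<eta> f g. square_integrable f \<and> square_integrable g \<longrightarrow>
        cinner (T \<xi> f) (T \<eta> g) = cinner \<xi> \<eta> * (\<integral>t. cnj (f t) * g t \<partial>lborel)) \<and>
     closed_cspan {T \<xi> f |\<xi> f. square_integrable f} = UNIV"

definition is_elementary ::
  "('a::chilbert_space \<Rightarrow> (real \<Rightarrow> complex) \<Rightarrow> 'k::chilbert_space) \<Rightarrow>
   ('a \<Rightarrow> 'a) \<Rightarrow> (real \<Rightarrow> complex) \<Rightarrow> ('k \<Rightarrow> 'k) \<Rightarrow> bool" where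
  "is_elementary T x f y \<longleftrightarrow>
     bounded_clinear y \<and>
     (\<forall>\<xi> g. square_integrable g \<longrightarrow> y (T \<xi> g) = T (x \<xi>) (\<lambda>t. f t * g t))"

text \<open>The von Neumann algebra tensor product of \<open>M\<close> and \<open>L\<^sup>\<infinity>(\<real>)\<close>, with which the crossed
  product is identified, and its canonical trace: the product of the trace \<open>\<tau>\<close> and
  integration against \<open>e\<^sup>-\<^sup>t dt\<close>. A faithful normal semifinite trace is uniquely determined by
  these values on elementary tensors.\<close>

definition crossed_product ::
  "('a::chilbert_space \<Rightarrow> (real \<Rightarrow> complex) \<Rightarrow> 'k::chilbert_space) \<Rightarrow>
   ('a \<Rightarrow> 'a) set \<Rightarrow> ('k \<Rightarrow> 'k) set" where
  "crossed_product T M =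
     commutant (commutant {y. \<exists>x\<in>M. \<exists>f. ess_bounded f \<and> is_elementary T x f y})"

definition canonical_trace ::
  "('a::chilbert_space \<Rightarrow> (real \<Rightarrow> complex) \<Rightarrow> 'k::chilbert_space) \<Rightarrow>
   ('a \<Rightarrow> 'a) set \<Rightarrow> (('a \<Rightarrow> 'a) \<Rightarrow> ennreal) \<Rightarrow> (('k \<Rightarrow> 'k) \<Rightarrow> ennreal) \<Rightarrow> bool" where
  "canonical_trace T M \<tau> \<tau>A \<longleftrightarrow>
     fns_trace (crossed_product T M) \<tau>A \<and>
     (\<forall>x\<in>pos_part M. \<forall>f y. (\<forall>t. 0 \<le> f t) \<and> ess_bounded (\<lambda>t. complex_of_real (f t)) \<and>
        is_elementary T x (\<lambda>t. complex_of_real (f t)) y \<longrightarrow>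
        \<tau>A y = \<tau> x * (\<integral>\<^sup>+ t. ennreal (f t * exp (- t)) \<partial>lborel))"

text \<open>\<open>op_tensor T a f\<close> is the closed tensor product of \<open>a\<close> and multiplication by
  \<open>t \<mapsto> f (e\<^sup>t)\<close>: the closure of the algebraic tensor product of the two operators.\<close>

definition op_tensor ::
  "('a::chilbert_space \<Rightarrow> (real \<Rightarrow> complex) \<Rightarrow> 'k::chilbert_space) \<Rightarrow>
   'a graph \<Rightarrow> (real \<Rightarrow> real) \<Rightarrow> 'k graph" where
  "op_tensor T a f =
     closed_cspan {(T \<xi> g, T \<eta> (\<lambda>t. complex_of_real (f (exp t)) * g t)) |\<xi> \<eta> g.
        (\<xi>, \<eta>) \<in> a \<and> square_integrable g \<and>
        square_integrable (\<lambda>t. complex_of_real (f (exp t)) * g t)}"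

text \<open>The Haagerup space, and its functional \<open>tr\<close> restricted to positive elements, where it has
  values in \<open>[0,\<infinity>)\<close>. Outside the Haagerup space the value is set to \<open>\<infinity>\<close>.\<close>

definition haagerup_L1 ::
  "('a::chilbert_space \<Rightarrow> (real \<Rightarrow> complex) \<Rightarrow> 'k::chilbert_space) \<Rightarrow>
   ('a \<Rightarrow> 'a) set \<Rightarrow> (('a \<Rightarrow> 'a) \<Rightarrow> ennreal) \<Rightarrow> 'k graph set" where
  "haagerup_L1 T M \<tau> = {op_tensor T g (\<lambda>s. s) |g. g \<in> L1_ops M \<tau>}"

definition haagerup_tr ::
  "('a::chilbert_space \<Rightarrow> (real \<Rightarrow> complex) \<Rightarrow> 'k::chilbert_space) \<Rightarrow>
   ('a \<Rightarrow> 'a) set \<Rightarrow> (('a \<Rightarrow> 'a) \<Rightarrow> ennreal) \<Rightarrow> 'k graph \<Rightarrow> ennreal" where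
  "haagerup_tr T M \<tau> x =
     (if x \<in> haagerup_L1 T M \<tau>
      then trace_pos \<tau> (THE g. g \<in> L1_ops M \<tau> \<and> x = op_tensor T g (\<lambda>s. s))
      else \<infinity>)"

end

theory Submission
  imports Defs "HOL-Probability.Helly_Selection" "HOL-Computational_Algebra.Polynomial"
begin

text \<open>Write \<open>d\<^sub>a(s) = \<tau>(E\<^bsub>|a|\<^esub>(s,\<infinity>))\<close>. Cutting the line into intervals on which \<open>f\<close> is constant up to a
  factor \<open>e\<^sup>\<epsilon>\<close> and comparing \<open>a \<otimes> f(e\<^sup>t)\<close> with a direct sum of multiples of \<open>a\<close> shows that the distribution
  function of \<open>a \<otimes> f(e\<^sup>t)\<close> at \<open>s\<close> is \<open>\<integral> d\<^sub>a(s / f(e\<^sup>t)) e\<^sup>-\<^sup>t dt\<close>. For \<open>f = \<phi>\<^sub>\<psi>\<close> the layer cake formula turns this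
  into \<open>\<tau>(\<psi>(|a| / s))\<close>. Hence \<open>a \<otimes> \<phi>\<^sub>\<psi>(e\<^sup>t)\<close> is measurable iff \<open>a\<close> lies in the Orlicz space, \<open>\<mu>\<^sub>1\<close> of it is the
  Luxemburg norm, and by \<open>\<phi>\<^sub>\<psi> \<le> \<phi>~\<^sub>\<psi> \<le> 2 \<phi>\<^sub>\<psi>\<close> the same criterion holds for \<open>\<phi>~\<^sub>\<psi>\<close>. Since \<open>\<psi>\<^sup>*\<^sup>* = \<psi>\<close>, one has
  \<open>\<phi>\<^sub>\<psi>(t) \<phi>~\<^bsub>\<psi>*\<^esub>(t) = t\<close>, so both products are elementary tensors with second factor \<open>e\<^sup>t\<close>, and the traces are
  \<open>\<tau>(|ab|)\<close> and \<open>\<tau>(|ba|)\<close>. The suprema of the two agree by polar decomposition and passage to adjoints.\<close>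

section \<open>Hilbert space geometry\<close>

text \<open>All spectral theory of a closed operator a is drawn from one bounded operator, the
  resolvent \<open>Rop a\<close>, which is (1 + |a|^2)^(-1): Borel functions of |a| become Borel
  functions on [0,1], and |a| itself is \<open>lam\<close> of the resolvent. A function f(R) is
  defined vector by vector, as a limit of polynomials in the scalar spectral measure, so that
  unbounded f fits the same scheme. Since \<open>op_abs\<close>, \<open>spectral_measure\<close> and
  the functional tr are definite descriptions, each needs a uniqueness proof before it can be
  computed. Most comparisons of traces rest on one fact: projections e and p with trivial
  intersection satisfy \<tau>(e) \<le> \<tau>(1 - p). It turns norm bounds on ranges into estimates
  of distribution functions. The formula for the distribution function of a tensor product is
  obtained as two inequalities between values at s < s', the price of approximating f by step
  functions; infima and finiteness statements absorb the gap. In the two suprema, the set over which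
  b ranges enters only through its stability under decreasing distribution functions.\<close>

abbreviation cr :: "real => complex" where "cr == complex_of_real"
abbreviation "ind == indicator"
abbreviation "bcl == bounded_clinear"
abbreviation "adj == op_adjoint"
abbreviation bmeas :: "('a::topological_space => 'b::topological_space) set"
  where "bmeas == borel_measurable borel"
abbreviation lim_seq :: "(nat => 'a::topological_space) => 'a => bool" ("((_)/ ---> (_))" [60, 60] 60)
  where "X ---> L == X \<longlonglongrightarrow> L"

instance chilbert_space \<subseteq> banach ..

lemma cinner_scaleC_left: "cinner (c *\<^sub>C x) y = cnj c * cinner x y"
 by (metis cinner_commute cinner_scaleC_right complex_cnj_mult)

lemma cinner_add_left: "cinner (x + y) z = cinner x z + cinner y z"
 by (metis cinner_commute cinner_add_right complex_cnj_add)

lemma cinner_self: "cinner x x = cr ((norm x)^2)"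
proof -
 have "Im (cinner x x) = 0"
  by (metis cinner_commute cnj.sel(2) equal_neg_zero)
 then show ?thesis by (simp add: complex_eq_iff Re_cinner power2_norm_eq_inner)
qed

lemma norm_scaleC: "norm (c *\<^sub>C x) = cmod c * norm x"
proof -
 have "cr ((norm (c *\<^sub>C x))^2) = cnj c * c * cr ((norm x)^2)"
  unfolding cinner_self[symmetric] cinner_scaleC_left cinner_scaleC_right by simp
 also have "... = cr ((cmod c * norm x)^2)"
  by (metis complex_norm_square mult.commute of_real_mult power_mult_distrib)
 finally have "(norm (c *\<^sub>C x))^2 = (cmod c * norm x)^2" using of_real_eq_iff by blast
 then show ?thesis by (simp add: power2_eq_iff_nonneg)
qed

lemma cmod_cinner_le: "cmod (cinner x y) <= norm x * norm y"
proof -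
 \<comment> \<open>A unimodular phase making the inner product real and nonnegative, so that the
   real Cauchy-Schwarz inequality applies.\<close>
 define c where "c = (if cinner x y = 0 then 1 else cnj (cinner x y) / cmod (cinner x y))"
 have c: "cmod c = 1" by (simp add: c_def norm_divide)
 have "c * cinner x y = cr (cmod (cinner x y))"
  by (auto simp: c_def complex_norm_square[symmetric] mult.commute power2_eq_square)
 then have "cmod (cinner x y) = inner x (c *\<^sub>C y)"
  by (metis Re_cinner Re_complex_of_real cinner_scaleC_right)
 also have "... <= norm x * norm (c *\<^sub>C y)" by (rule norm_cauchy_schwarz)
 finally show ?thesis by (simp add: norm_scaleC c)
qed

lemma scaleC_minus1: "(-1) *\<^sub>C x = - x"
 using scaleC_of_real[of "-1" x] by simp

interpretation cinner: bounded_bilinear "cinner :: 'a::chilbert_space => 'a => complex"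
proof
 fix r :: real and a b a' b' :: 'a
 show "cinner (r *\<^sub>R a) b = r *\<^sub>R cinner a b" "cinner a (r *\<^sub>R b) = r *\<^sub>R cinner a b"
  by (simp_all add: scaleC_of_real[symmetric] cinner_scaleC_left cinner_scaleC_right scaleR_conv_of_real)
 show "\<exists>K. \<forall>a b :: 'a. norm (cinner a b) <= norm a * norm b * K"
  using cmod_cinner_le by (intro exI[of _ 1]) auto
qed (auto simp: cinner_add_left cinner_add_right)

interpretation scaleC: bounded_bilinear "scaleC :: complex => 'a::chilbert_space => 'a"
proof
 fix r :: real and a b :: 'a and c :: complex
 show "(r *\<^sub>R c) *\<^sub>C a = r *\<^sub>R (c *\<^sub>C a)" "c *\<^sub>C (r *\<^sub>R a) = r *\<^sub>R (c *\<^sub>C a)"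
  by (simp_all only: scaleC_of_real[symmetric] scaleC_scaleC scaleR_conv_of_real mult.commute)
 show "\<exists>K. \<forall>c (a :: 'a). norm (c *\<^sub>C a) <= norm c * norm a * K"
  by (intro exI[of _ 1]) (auto simp: norm_scaleC)
qed (auto simp: scaleC_add_left scaleC_add_right)

lemma scaleC_one [simp]: "1 *\<^sub>C x = x"
 using scaleC_of_real[of 1 x] by simp

lemma norm2_cinner: "(norm x)^2 = Re (cinner x x)"
 by (simp add: cinner_self)

lemma cinner_eq_zero_D: "(!!y. cinner y x = 0) ==> x = 0"
 using cinner_self[of x] by simp

lemma cinner_ext: "(!!z. cinner z x = cinner z y) ==> x = y"
 using cinner_eq_zero_D[of "x - y"] by (simp add: cinner.diff_right)

lemma cinner_zero_sym: "cinner x y = 0 \<longleftrightarrow> cinner y x = 0"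
 by (metis cinner_commute complex_cnj_zero)

lemma norm_add_sq_orth: "cinner x y = 0 ==> (norm (x + y))^2 = (norm x)^2 + (norm y)^2"
 using cinner_zero_sym[of x y] by (simp add: norm2_cinner cinner.add_left cinner.add_right)

lemma csub_0: "csubspace S ==> 0 \<in> S"
 and csub_add: "csubspace S ==> x \<in> S ==> y \<in> S ==> x + y \<in> S"
 and csub_scaleC: "csubspace S ==> x \<in> S ==> c *\<^sub>C x \<in> S"
 by (auto simp: csubspace_def)

lemma csub_scaleR: "csubspace S ==> x \<in> S ==> r *\<^sub>R x \<in> S"
 by (metis csub_scaleC scaleC_of_real)

lemma csubspace_minus: "csubspace S ==> x \<in> S ==> - x \<in> S"
 by (metis csub_scaleC scaleC_minus1)

lemma csub_diff: "csubspace S ==> x \<in> S ==> y \<in> S ==> x - y \<in> S"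
 using csub_add[of S x "-y"] csubspace_minus[of S y] by simp

lemma csub_closure:
 assumes S: "csubspace (S :: 'a::chilbert_space set)" shows "csubspace (closure S)"
 unfolding csubspace_def
proof (intro conjI ballI allI)
 show "0 \<in> closure S" using S closure_subset csub_0 by blast
next
 fix x y assume "x \<in> closure S" "y \<in> closure S"
 then obtain f g where "!!n::nat. f n \<in> S" "f ---> x" "!!n::nat. g n \<in> S" "g ---> y"
  by (auto simp: closure_sequential)
 then show "x + y \<in> closure S"
  unfolding closure_sequential
  by (intro exI[of _ "%n. f n + g n"]) (auto intro: tendsto_add csub_add[OF S])
next
 fix c x assume "x \<in> closure S"
 then obtain f where "!!n::nat. f n \<in> S" "f ---> x"
  by (auto simp: closure_sequential)
 then show "c *\<^sub>C x \<in> closure S"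
  unfolding closure_sequential
  by (intro exI[of _ "%n. c *\<^sub>C f n"]) (auto intro: scaleC.tendsto csub_scaleC[OF S])
qed

lemma csubspace_Inter: "(!!S. S \<in> A ==> csubspace S) ==> csubspace (\<Inter>A)"
 by (auto simp: csubspace_def)

lemma csubspace_hull: "csubspace (csubspace hull S)"
 by (simp add: csubspace_Inter hull_in)

lemma closed_closed_cspan: "closed (closed_cspan S)"
 by (simp add: closed_cspan_def)

lemma csubspace_closed_cspan: "csubspace (closed_cspan S)"
 by (simp add: closed_cspan_def csub_closure csubspace_hull)

lemma closed_cspan_superset: "S \<subseteq> closed_cspan S"
 by (metis closed_cspan_def closure_subset hull_subset order_trans)

lemma closed_cspan_minimal:
 assumes "S \<subseteq> V" "csubspace V" "closed V" shows "closed_cspan S \<subseteq> V"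
 by (simp add: assms closed_cspan_def closure_minimal hull_minimal)

definition ocomp :: "'a::chilbert_space set => 'a set" where
 "ocomp S = {y. \<forall>x\<in>S. cinner x y = 0}"

lemma csubspace_ocomp: "csubspace (ocomp S)"
 by (auto simp: csubspace_def ocomp_def cinner.zero_right cinner_add_right cinner_scaleC_right)

lemma closed_ocomp: "closed (ocomp S)"
proof -
 have "ocomp S = (\<Inter>x\<in>S. {y. cinner x y = 0})" by (auto simp: ocomp_def)
 moreover have "closed {y. cinner x y = 0}" for x :: 'a
  by (intro closed_Collect_eq continuous_intros cinner.continuous_on)
 ultimately show ?thesis by auto
qed

lemma orthogonal_projection_exists:
 assumes S: "csubspace S" "closed (S :: 'a::chilbert_space set)"
 shows "\<exists>y\<in>S. \<forall>z\<in>S. cinner z (x - y) = 0"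
proof -
 define A where "A = (%y. (norm (x - y))^2) ` S"
 define d where "d = Inf A"
 have ne: "A ~= {}" using csub_0[OF S(1)] by (auto simp: A_def)
 have bb: "bdd_below A" by (intro bdd_belowI[of _ 0]) (auto simp: A_def)
 have dle: "d <= (norm (x - y))^2" if "y \<in> S" for y
  unfolding d_def using bb that by (intro cInf_lower) (auto simp: A_def)
 have "\<exists>y\<in>S. (norm (x - y))^2 < d + 1 / real (Suc n)" for n
 proof -
  have "d < d + 1 / real (Suc n)" by simp
  then obtain a where "a \<in> A" "a < d + 1 / real (Suc n)"
   using cInf_lessD[OF ne] unfolding d_def by blast
  then show ?thesis by (auto simp: A_def)
 qed
 then obtain y where yS: "!!n. y n \<in> S" and yd: "!!n. (norm (x - y n))^2 < d + 1 / real (Suc n)"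
  by metis
 \<comment> \<open>Parallelogram law: the midpoint of two almost minimizers lies in S, hence at
   squared distance at least d from x.\<close>
 have par: "(norm (y n - y m))^2 <= 2 / real (Suc n) + 2 / real (Suc m)" for n m
 proof -
  let ?m = "(1/2) *\<^sub>R (y n + y m)"
  have "d <= (norm (x - ?m))^2"
   using S yS by (intro dle) (simp add: csub_scaleR csub_add)
  moreover have "(norm (y n - y m))^2 = 2 * (norm (x - y n))^2 + 2 * (norm (x - y m))^2 - 4 * (norm (x - ?m))^2"
   by (simp add: power2_norm_eq_inner inner_add_left inner_add_right inner_diff_left inner_diff_right inner_commute algebra_simps)
  ultimately show ?thesis using yd[of n] yd[of m] by linarith
 qed
 have "Cauchy y"
 proof (rule metric_CauchyI)
  fix e :: real assume e: "e > 0"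
  obtain N where N: "4 / e^2 < real N" using reals_Archimedean2 by blast
  show "\<exists>M. \<forall>m\<ge>M. \<forall>n\<ge>M. dist (y m) (y n) < e"
  proof (intro exI allI impI)
   fix m n assume mn: "N <= m" "N <= n"
   have N0: "0 < real N" using N e by (smt (verit) divide_pos_pos zero_less_power)
   have "2 / real (Suc m) <= 2 / real N" "2 / real (Suc n) <= 2 / real N"
    using mn N0 by (auto intro!: divide_left_mono)
   moreover have "4 / real N = 2 / real N + 2 / real N" by simp
   ultimately have "(norm (y m - y n))^2 <= 4 / real N" using par[of m n] by linarith
   also have "... < e^2" using N N0 e by (simp add: field_simps)
   finally show "dist (y m) (y n) < e" using e by (simp add: dist_norm power2_less_imp_less)
  qed
 qed
 then obtain l where l: "y ---> l" using Cauchy_convergent convergent_def by blast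
 have lS: "l \<in> S" using S(2) yS l closed_sequentially by blast
 have "(norm (x - l))^2 <= d"
 proof (rule LIMSEQ_le)
  show "(%n. (norm (x - y n))^2) ---> (norm (x - l))^2" by (intro tendsto_intros l)
  have "(%n. d + 1 / real (Suc n)) ---> d + 0" by (intro tendsto_intros LIMSEQ_Suc[OF lim_1_over_n])
  then show "(%n. d + 1 / real (Suc n)) ---> d" by simp
  show "\<exists>N. \<forall>n\<ge>N. (norm (x - y n))^2 <= d + 1 / real (Suc n)" using yd less_imp_le by blast
 qed
 then have min: "(norm (x - l))^2 <= (norm (x - (l + z)))^2" if "z \<in> S" for z
  using dle[OF csub_add[OF S(1) lS that]] by (rule order_trans)
 have re: "inner z (x - l) = 0" if z: "z \<in> S" for z
 proof (cases "z = 0")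
  case False
  \<comment> \<open>The step along z that would decrease the distance most; it lowers the square by
    c^2 |z|^2, so minimality of l forces c = 0.\<close>
  define c where "c = inner z (x - l) / (norm z)^2"
  have c: "inner z (x - l) = c * (norm z)^2" using False by (simp add: c_def)
  have "(norm (x - l))^2 <= (norm (x - (l + c *\<^sub>R z)))^2"
   by (intro min csub_scaleR S z)
  also have "... = (norm (x - l))^2 - 2 * c * inner z (x - l) + c * (c * (norm z)^2)"
   unfolding power2_norm_eq_inner
   by (simp add: inner_add_left inner_add_right inner_diff_left inner_diff_right inner_commute algebra_simps)
  finally have "c * (c * (norm z)^2) <= 0" unfolding c by simp
  then have "c^2 * (norm z)^2 <= 0" by (simp add: power2_eq_square mult.assoc)
  then have "c = 0" using False by (simp add: mult_le_0_iff)
  then show ?thesis using c by simp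
 qed simp
 \<comment> \<open>Minimality only controls the real part; the imaginary part follows by applying
   \<open>re\<close> to the vector i z, which is again in S.\<close>
 have "cinner z (x - l) = 0" if z: "z \<in> S" for z
 proof -
  have "Re (cinner (\<i> *\<^sub>C z) (x - l)) = 0" using re csub_scaleC[OF S(1) z] by (simp add: Re_cinner)
  then show ?thesis using re[OF z] by (simp add: complex_eq_iff Re_cinner cinner_scaleC_left)
 qed
 with lS show ?thesis by blast
qed

definition hproj :: "'a::chilbert_space set => 'a => 'a" where
 "hproj S x = (THE y. y \<in> S \<and> (\<forall>z\<in>S. cinner z (x - y) = 0))"

lemma hproj_unique:
 assumes S: "csubspace S" and "y \<in> S" "!!z. z \<in> S ==> cinner z (x - y) = 0"
  and "y' \<in> S" "!!z. z \<in> S ==> cinner z (x - y') = 0"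
 shows "y = (y' :: 'a::chilbert_space)"
proof -
 have "y - y' \<in> S" by (simp add: S assms csub_diff)
 then have "cinner (y - y') (x - y') - cinner (y - y') (x - y) = 0" using assms by simp
 then have "cinner (y - y') (y - y') = 0" by (simp add: cinner.diff_right)
 then show ?thesis by (simp add: cinner_self)
qed

lemma hproj_works:
 assumes "csubspace S" "closed S"
 shows "hproj S x \<in> S" "z \<in> S ==> cinner z (x - hproj S x) = 0"
proof -
 have "\<exists>!y. y \<in> S \<and> (\<forall>z\<in>S. cinner z (x - y) = 0)"
  using orthogonal_projection_exists[OF assms, of x] hproj_unique[OF assms(1)] by (metis (no_types))
 from theI'[OF this] show "hproj S x \<in> S" "z \<in> S ==> cinner z (x - hproj S x) = 0"
  by (auto simp: hproj_def)
qed

lemma hproj_eqI: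
 assumes "csubspace S" "closed S" "y \<in> S" "!!z. z \<in> S ==> cinner z (x - y) = 0"
 shows "hproj S x = y"
 using hproj_unique[OF assms(1)] hproj_works[OF assms(1,2)] assms by metis

lemma closure_csubspace_UNIV:
 assumes "csubspace S" "ocomp S \<subseteq> {0}" shows "closure (S :: 'a::chilbert_space set) = UNIV"
proof -
 have "x \<in> closure S" for x
 proof -
  have "x - hproj (closure S) x \<in> ocomp S"
   using hproj_works(2)[OF csub_closure[OF assms(1)] closed_closure] closure_subset
   by (fastforce simp: ocomp_def)
  then have "x = hproj (closure S) x" using assms(2) by auto
  then show ?thesis using hproj_works(1)[OF csub_closure[OF assms(1)] closed_closure] by metis
 qed
 then show ?thesis by auto
qed

lemma dense_cinner_zero:
 assumes "closure S = UNIV" "!!z. z \<in> S ==> cinner z x = 0" shows "x = (0 :: 'a::chilbert_space)"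
proof -
 have "closed {y. cinner y x = 0}"
  by (intro closed_Collect_eq continuous_intros cinner.continuous_on)
 then have "closure S \<subseteq> {y. cinner y x = 0}" using assms(2) by (intro closure_minimal) auto
 then have "cinner y x = 0" for y using assms(1) by auto
 then show ?thesis by (rule cinner_eq_zero_D)
qed

lemma dense_cinner_ext:
 assumes "closure S = UNIV" "!!z. z \<in> S ==> cinner z x = cinner z y" shows "x = (y :: 'a::chilbert_space)"
 using dense_cinner_zero[of S "x - y"] assms by (simp add: cinner.diff_right)


section \<open>Bounded operators\<close>

lemma bclI:
 assumes "!!x y. f (x + y) = f x + f y" "!!c x. f (c *\<^sub>C x) = c *\<^sub>C f x" "!!x. norm (f x) <= K * norm x"
 shows "bcl f"
 unfolding bounded_clinear_def
proof (intro conjI allI)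
 show "bounded_linear f"
  by (rule bounded_linear_intro[where K=K]) (use assms in \<open>auto simp: scaleC_of_real[symmetric] mult.commute\<close>)
qed (rule assms)

lemma bcl_add: "bcl f ==> f (x + y) = f x + f y"
 and bcl_scaleC: "bcl f ==> f (c *\<^sub>C x) = c *\<^sub>C f x"
 and bcl_scaleR: "bcl f ==> f (r *\<^sub>R x) = r *\<^sub>R f x"
 and bcl_0: "bcl f ==> f 0 = 0"
 and bcl_diff: "bcl f ==> f (x - y) = f x - f y"
 and bcl_minus: "bcl f ==> f (- x) = - f x"
 and bcl_sum: "bcl f ==> f (\<Sum>i\<in>I. g i) = (\<Sum>i\<in>I. f (g i))"
 and bcl_linear: "bcl f ==> bounded_linear f"
 by (auto simp: bounded_clinear_def linear_add linear_diff linear_neg linear_sum bounded_linear.linear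
   linear_0 linear_scale)

lemma bcl_bound: "bcl f ==> \<exists>K>0. \<forall>x. norm (f x) <= K * norm x"
 using bounded_linear.pos_bounded[of f] by (auto simp: bounded_clinear_def mult.commute)

lemma bcl_tendsto: "bcl f ==> (g \<longlongrightarrow> l) F ==> ((%n. f (g n)) \<longlongrightarrow> f l) F"
 by (simp add: bounded_clinear_def bounded_linear.tendsto)

lemma bcl_continuous: "bcl f ==> continuous_on S f"
 by (simp add: bounded_clinear_def linear_continuous_on)

lemma bcl_id: "bcl (%x. x)" "bcl id"
 by (auto simp: bounded_clinear_def id_def)

lemma bcl_zero: "bcl (%x. 0)"
 by (rule bclI[where K=0]) (auto simp: scaleC.zero_right)

lemma bcl_comp: "bcl f ==> bcl g ==> bcl (%x. f (g x))"
 by (auto simp: bounded_clinear_def bounded_linear_compose)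

lemma bcl_plus: "bcl f ==> bcl g ==> bcl (%x. f x + g x)"
 by (auto simp: bounded_clinear_def bounded_linear_add scaleC_add_right)

lemma bcl_subtract: "bcl f ==> bcl g ==> bcl (%x. f x - g x)"
 by (auto simp: bounded_clinear_def bounded_linear_sub scaleC.diff_right)

lemma bcl_cmult: "bcl f ==> bcl (%x. c *\<^sub>C f x)"
 by (auto simp: bounded_clinear_def scaleC_scaleC mult.commute
   intro: bounded_linear_compose[OF scaleC.bounded_linear_right])

lemma bcl_rmult: "bcl f ==> bcl (%x. r *\<^sub>R f x)"
 using bcl_cmult[of f "cr r"] by (simp add: scaleC_of_real)

lemma riesz_representation:
 fixes f :: "'a::chilbert_space => complex"
 assumes add: "!!x y. f (x + y) = f x + f y" and scale: "!!c x. f (c *\<^sub>C x) = c * f x"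
  and bd: "!!x. cmod (f x) <= K * norm x"
 shows "\<exists>y. \<forall>x. f x = cinner y x"
proof (cases "\<forall>x. f x = 0")
 case True then show ?thesis by (intro exI[of _ 0]) (simp add: cinner.zero_left)
next
 case False
 then obtain w where w: "f w ~= 0" by auto
 define S where "S = {x. f x = 0}"
 have bl: "bounded_linear f"
  by (rule bounded_linear_intro[where K=K])
   (use assms in \<open>auto simp: scaleC_of_real[symmetric] mult.commute scaleR_conv_of_real\<close>)
 have S: "csubspace S" "closed S"
  using scale[of 0 0] add scale linear_continuous_on[OF bl]
  by (auto simp: csubspace_def S_def scaleC.zero_left intro!: closed_Collect_eq)
 define v where "v = w - hproj S w"
 have "hproj S w \<in> S" using hproj_works S by blast
 then have fv: "f v ~= 0" using w bounded_linear.linear[OF bl] by (simp add: v_def linear_diff S_def)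
 have v: "cinner v z = 0" if "z \<in> S" for z
  using hproj_works(2)[OF S that, of w] cinner_zero_sym v_def by blast
 have nv: "norm v ~= 0" using fv scale[of 0 0] by (auto simp: scaleC.zero_left)
 have "f x = cinner ((cnj (f v) / (norm v)^2) *\<^sub>C v) x" for x
 proof -
  have "x - (f x / f v) *\<^sub>C v \<in> S"
   using fv bounded_linear.linear[OF bl] by (simp add: S_def linear_diff scale)
  from v[OF this] have "cinner v x = (f x / f v) * (norm v)^2"
   by (simp add: cinner.diff_right cinner_scaleC_right cinner_self)
  then show ?thesis using nv fv by (simp add: cinner_scaleC_left)
 qed
 then show ?thesis by blast
qed

definition hadj :: "('a::chilbert_space => 'b::chilbert_space) => 'b => 'a" where
 "hadj f = (THE g. \<forall>x y. cinner (f x) y = cinner x (g y))"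

lemma cadjoint_hadj: "cadjoint f = hadj f"
 by (simp add: cadjoint_def hadj_def)

lemma adjoint_unique:
 assumes "!!x y. cinner (f x) y = cinner x (g y)" "!!x y. cinner (f x) y = cinner x (h y)"
 shows "g = h"
proof
 fix y show "g y = h y" by (rule cinner_ext) (metis assms)
qed

lemma hadj_eqI:
 assumes "!!x y. cinner (f x) y = cinner x (g y)" shows "hadj f = g"
 unfolding hadj_def using assms adjoint_unique by (intro the_equality) blast+

lemma hadj_exists:
 assumes f: "bcl f"
 shows "\<exists>g. (\<forall>x y. cinner (f x) y = cinner x (g y))"
proof -
 obtain K where K: "K > 0" "!!x. norm (f x) <= K * norm x" using bcl_bound[OF f] by auto
 have "\<exists>z. \<forall>x. cinner y (f x) = cinner z x" for y
 proof (rule riesz_representation[where K="norm y * K"])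
  fix x
  have "cmod (cinner y (f x)) <= norm y * norm (f x)" by (rule cmod_cinner_le)
  also have "... <= norm y * (K * norm x)" using K by (intro mult_left_mono) auto
  finally show "cmod (cinner y (f x)) <= norm y * K * norm x" by (simp add: mult.assoc)
 qed (simp_all add: bcl_add[OF f] bcl_scaleC[OF f] cinner_add_right cinner_scaleC_right)
 then obtain g where "!!y x. cinner y (f x) = cinner (g y) x" by metis
 then show ?thesis by (metis cinner_commute)
qed

lemma cinner_hadj: "bcl f ==> cinner (f x) y = cinner x (hadj f y)"
 using hadj_exists[of f] hadj_eqI by metis

lemma cinner_hadj': "bcl f ==> cinner x (f y) = cinner (hadj f x) y"
 by (metis cinner_hadj cinner_commute)

lemma hadj_bound:
 assumes f: "bcl f" and K: "!!x. norm (f x) <= K * norm x" "0 <= K"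
 shows "norm (hadj f y) <= K * norm y"
proof (cases "hadj f y = 0")
 case True
 then show ?thesis using K by simp
next
 case False
 have "(norm (hadj f y))^2 = cmod (cinner (hadj f y) (hadj f y))"
  unfolding cinner_self norm_of_real by simp
 also have "... = cmod (cinner (f (hadj f y)) y)" by (simp add: cinner_hadj[OF f])
 also have "... <= norm (f (hadj f y)) * norm y" by (rule cmod_cinner_le)
 also have "... <= K * norm (hadj f y) * norm y" by (intro mult_right_mono K) auto
 finally show ?thesis using False by (simp add: power2_eq_square)
qed

lemma bcl_hadj: assumes f: "bcl f" shows "bcl (hadj f)"
proof -
 obtain K where K: "K > 0" "!!x. norm (f x) <= K * norm x" using bcl_bound[OF f] by auto
 show ?thesis
 proof (rule bclI)
  show "hadj f (x + y) = hadj f x + hadj f y" for x y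
   by (rule cinner_ext) (simp add: cinner_hadj[OF f, symmetric] cinner_add_right)
  show "hadj f (c *\<^sub>C x) = c *\<^sub>C hadj f x" for c x
   by (rule cinner_ext) (simp add: cinner_hadj[OF f, symmetric] cinner_scaleC_right)
 qed (use hadj_bound[OF f K(2)] K(1) in simp)
qed

lemma hadj_hadj: "bcl f ==> hadj (hadj f) = f"
 by (rule hadj_eqI) (metis cinner_hadj')

lemma hadj_comp: "bcl f ==> bcl g ==> hadj (%x. f (g x)) = (%x. hadj g (hadj f x))"
 by (rule hadj_eqI) (simp add: cinner_hadj)

text \<open>The bound at first component 0 already makes the relation single valued, so a map given
  on formal sums needs no separate check of well-definedness. This is how
  \<open>elementary_exists\<close> uses it.\<close>

lemma bounded_extension:
 fixes V :: "('a::chilbert_space \<times> 'b::chilbert_space) set"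
 assumes V: "csubspace V" and bd: "!!x y. (x, y) \<in> V ==> norm y <= C * norm x" and dense: "closure (Domain V) = UNIV"
 shows "\<exists>f. bcl f \<and> (\<forall>x. (x, f x) \<in> closure V) \<and> (\<forall>(x, y)\<in>V. f x = y) \<and> (\<forall>x. norm (f x) <= C * norm x)"
proof -
 let ?W = "closure V"
 have W: "csubspace ?W" by (rule csub_closure[OF V])
 have bdW: "norm y <= C * norm x" if "(x, y) \<in> ?W" for x y
 proof -
  have "closed {p :: 'a \<times> 'b. norm (snd p) <= C * norm (fst p)}"
   by (intro closed_Collect_le continuous_intros)
  then have "?W \<subseteq> {p. norm (snd p) <= C * norm (fst p)}" using bd by (intro closure_minimal) auto
  then show ?thesis using that by auto
 qed
 have uniq: "y = y'" if "(x, y) \<in> ?W" "(x, y') \<in> ?W" for x y y'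
  using bdW[of 0 "y - y'"] csub_diff[OF W that] by simp
 have ex: "\<exists>y. (x, y) \<in> ?W" for x
 proof -
  obtain f where f: "!!n::nat. f n \<in> Domain V" "f ---> x" using dense by (metis UNIV_I closure_sequential)
  then have "\<forall>n. \<exists>y. (f n, y) \<in> V" by blast
  then obtain g where g: "!!n. (f n, g n) \<in> V" by metis
  have "Cauchy g"
  proof (rule metric_CauchyI)
   fix e :: real assume e: "e > 0"
   have "Cauchy f" using f LIMSEQ_imp_Cauchy by blast
   then obtain N where N: "!!m n. m \<ge> N ==> n \<ge> N ==> dist (f m) (f n) < e / (\<bar>C\<bar> + 1)"
    using e metric_CauchyD[of f "e / (\<bar>C\<bar> + 1)"]
    by (metis abs_ge_zero add_nonneg_pos divide_pos_pos zero_less_one)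
   show "\<exists>M. \<forall>m\<ge>M. \<forall>n\<ge>M. dist (g m) (g n) < e"
   proof (intro exI allI impI)
    fix m n assume "m \<ge> N" "n \<ge> N"
    have "(f m - f n, g m - g n) \<in> V" using csub_diff[OF V g[of m] g[of n]] by simp
    then have "norm (g m - g n) <= C * norm (f m - f n)" by (rule bd)
    also have "... <= (\<bar>C\<bar> + 1) * norm (f m - f n)" by (intro mult_right_mono) auto
    also have "... < e" using N[OF \<open>m \<ge> N\<close> \<open>n \<ge> N\<close>] by (simp add: dist_norm field_simps)
    finally show "dist (g m) (g n) < e" by (simp add: dist_norm)
   qed
  qed
  then obtain l where "g ---> l" using Cauchy_convergent convergent_def by blast
  then have "(%n. (f n, g n)) ---> (x, l)" using f by (intro tendsto_Pair)
  moreover have "\<forall>n. (f n, g n) \<in> V" using g by blast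
  ultimately have "(x, l) \<in> ?W" unfolding closure_sequential by (intro exI[of _ "%n. (f n, g n)"] conjI)
  then show ?thesis by blast
 qed
 then obtain f where f: "!!x. (x, f x) \<in> ?W" by metis
 have "bcl f"
 proof (rule bclI)
  show "f (x + y) = f x + f y" for x y
   using uniq[OF f[of "x + y"]] csub_add[OF W f[of x] f[of y]] by simp
  show "f (c *\<^sub>C x) = c *\<^sub>C f x" for c x
   using uniq[OF f[of "c *\<^sub>C x"]] csub_scaleC[OF W f[of x], of c] by (simp add: scaleC_prod_def)
  show "norm (f x) <= C * norm x" for x using bdW f by blast
 qed
 moreover have "f x = y" if "(x, y) \<in> V" for x y using uniq[OF f[of x]] that closure_subset by blast
 ultimately show ?thesis using f bdW by blast
qed

text \<open>Polarization: the diagonal at x + y gives B x y + B y x = 0, and replacing y by i y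
  gives B x y = B y x. It is stated on a subspace because one application is to the graph of an
  isometry.\<close>

lemma sesquilinear_diagonal_zero:
 fixes B :: "'a::chilbert_space => 'a => complex"
 assumes D: "csubspace D"
  and "!!x y z. x \<in> D ==> y \<in> D ==> z \<in> D ==> B x (y + z) = B x y + B x z"
  and "!!x y z. x \<in> D ==> y \<in> D ==> z \<in> D ==> B (x + y) z = B x z + B y z"
  and "!!c x y. x \<in> D ==> y \<in> D ==> B x (c *\<^sub>C y) = c * B x y"
  and "!!c x y. x \<in> D ==> y \<in> D ==> B (c *\<^sub>C x) y = cnj c * B x y"
  and diag: "!!x. x \<in> D ==> B x x = 0" and x: "x \<in> D" and y: "y \<in> D"
 shows "B x y = 0"
proof -
 have 1: "B x y + B y x = 0" if "x \<in> D" "y \<in> D" for x y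
 proof -
  have "B (x + y) (x + y) = B x x + B y x + (B x y + B y y)"
   using that csub_add[OF D] assms(2,3) by simp
  then show ?thesis using diag that csub_add[OF D that] by (simp add: add.commute)
 qed
 have "\<i> * B x y - \<i> * B y x = 0"
  using 1[OF x csub_scaleC[OF D y, of \<i>]] assms(4)[OF x y, of \<i>] assms(5)[OF y x, of \<i>] by simp
 then have "B x y = B y x" by simp
 then show ?thesis using 1[OF x y] by simp
qed

lemma csubspace_UNIV: "csubspace UNIV" by (simp add: csubspace_def)

lemma real_diagonal_symmetric:
 assumes f: "bcl f" and re: "!!x. cinner x (f x) \<in> \<real>"
 shows "cinner (f x) y = cinner x (f y)"
proof -
 have "cinner x (f y) - cinner (f x) y = 0"
 proof (rule sesquilinear_diagonal_zero[OF csubspace_UNIV, where B = "%x y. cinner x (f y) - cinner (f x) y"])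
  show "cinner x (f x) - cinner (f x) x = 0" for x
   using re[of x] by (metis Reals_cnj_iff cinner_commute right_minus_eq)
 qed (auto simp: bcl_add[OF f] bcl_scaleC[OF f] cinner_add_left cinner_add_right
   cinner_scaleC_left cinner_scaleC_right algebra_simps)
 then show ?thesis by simp
qed

lemma positive_op_sym: "positive_op f ==> cinner (f x) y = cinner x (f y)"
 by (rule real_diagonal_symmetric) (auto simp: positive_op_def complex_nonneg_Reals_iff complex_is_Real_iff)

lemma positive_opI:
 assumes "bcl f" "!!x y. cinner (f x) y = cinner x (f y)" "!!x. 0 <= Re (cinner x (f x))"
 shows "positive_op f"
 using assms unfolding positive_op_def
 by (metis cinner_commute complex_nonneg_Reals_iff cnj.simps(2) equal_neg_zero)

lemma projI:
 assumes "bcl p" "!!x. p (p x) = p x" "!!x y. cinner (p x) y = cinner x (p y)"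
 shows "projection_op p"
 using assms hadj_eqI[of p p] by (auto simp: projection_op_def cadjoint_hadj)

lemma projD:
 assumes "projection_op p"
 shows "bcl p" "p (p x) = p x" "cinner (p x) y = cinner x (p y)"
proof -
 show "bcl p" using assms by (simp add: projection_op_def)
 show "p (p x) = p x" using assms by (metis projection_op_def comp_apply)
 show "cinner (p x) y = cinner x (p y)"
  using assms cinner_hadj[of p x y] by (simp add: projection_op_def cadjoint_hadj)
qed

lemma projection_range: "projection_op p ==> x \<in> range p \<longleftrightarrow> p x = x"
 using projD(2) by (metis rangeE rangeI)

lemma proj_cinner: "projection_op p ==> cinner x (p x) = cr ((norm (p x))^2)"
 by (metis projD(2,3) cinner_self)

lemma projection_norm_split: "projection_op p ==> (norm x)^2 = (norm (p x))^2 + (norm (x - p x))^2"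
 using norm_add_sq_orth[of "p x" "x - p x"]
 by (simp add: cinner.diff_right projD(3) projD(2))

lemma proj_norm_le: "projection_op p ==> norm (p x) <= norm x"
 using projection_norm_split[of p x] by (simp add: power2_le_imp_le)

lemma projection_positive: "projection_op p ==> positive_op p"
 by (rule positive_opI) (auto simp: projD proj_cinner)

lemma proj_compl: "projection_op p ==> projection_op (%x. x - p x)"
 by (rule projI) (auto simp: projD bcl_subtract bcl_id
   bcl_diff cinner.diff_right cinner.diff_left)

lemma proj_hproj:
 assumes S: "csubspace S" "closed (S :: 'a::chilbert_space set)"
 shows "projection_op (hproj S)" "range (hproj S) = S"
proof -
 note h = hproj_works[OF S]
 have idem: "hproj S x = x" if "x \<in> S" for x
  using that by (intro hproj_eqI[OF S]) (auto simp: cinner.zero_right)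
 have o: "cinner (hproj S x) (y - hproj S y) = 0" "cinner (y - hproj S y) (hproj S x) = 0" for x y
  using h cinner_zero_sym by blast+
 have n: "norm (hproj S x) <= norm x" for x
  using norm_add_sq_orth[OF o(1)[of x x]] by (simp add: power2_le_imp_le)
 show "projection_op (hproj S)"
 proof (rule projI)
  show "bcl (hproj S)"
  proof (rule bclI[where K=1])
   show "hproj S (x + y) = hproj S x + hproj S y" for x y
   proof (rule hproj_eqI[OF S])
    show "cinner z (x + y - (hproj S x + hproj S y)) = 0" if "z \<in> S" for z
     using h(2)[OF that, of x] h(2)[OF that, of y] by (simp add: cinner.diff_right cinner_add_right algebra_simps)
   qed (use h S csub_add in blast)
   show "hproj S (c *\<^sub>C x) = c *\<^sub>C hproj S x" for c x
   proof (rule hproj_eqI[OF S])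
    show "cinner z (c *\<^sub>C x - c *\<^sub>C hproj S x) = 0" if "z \<in> S" for z
     using h(2)[OF that, of x] by (simp add: scaleC.diff_right[symmetric] cinner_scaleC_right)
   qed (use h S csub_scaleC in blast)
  qed (use n in simp)
  show "hproj S (hproj S x) = hproj S x" for x by (simp add: h idem)
  show "cinner (hproj S x) y = cinner x (hproj S y)" for x y
   using o(1)[of x y] o(2)[of x y] by (simp add: cinner.diff_right cinner.diff_left)
 qed
 show "range (hproj S) = S" using h idem by (metis image_subset_iff rangeI subsetI subset_antisym UNIV_I)
qed

section \<open>Closed operators and their adjoints\<close>

lemma adj_iff: "(y, z) \<in> adj T \<longleftrightarrow> (\<forall>x w. (x, w) \<in> T --> cinner w y = cinner x z)"
 by (auto simp: op_adjoint_def)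

lemma csub_adjoint: "csubspace (adj T)"
 unfolding csubspace_def by (auto simp: adj_iff zero_prod_def scaleC_prod_def cinner.zero_right
   cinner_add_right cinner_scaleC_right)

lemma closed_op_adjoint: "closed (adj T)"
proof -
 have "adj T = (\<Inter>(x, w)\<in>T. {p. cinner w (fst p) = cinner x (snd p)})"
  by (auto simp: op_adjoint_def)
 moreover have "closed {p. cinner w (fst p) = cinner x (snd p)}" for w x :: 'a
  by (intro closed_Collect_eq cinner.continuous_on continuous_intros)
 ultimately show ?thesis by auto
qed

lemma single_valued_op_adjoint: "closure (Domain T) = UNIV ==> single_valued (adj T)"
 using dense_cinner_ext[of "Domain T"] by (intro single_valuedI) (metis adj_iff DomainE)

lemma graph_add: "csubspace V ==> (x, y) \<in> V ==> (x', y') \<in> V ==> (x + x', y + y') \<in> V"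
 using csub_add by fastforce

lemma graph_diff: "csubspace V ==> (x, y) \<in> V ==> (x', y') \<in> V ==> (x - x', y - y') \<in> V"
 using csub_diff by fastforce

lemma graph_scaleC: "csubspace V ==> (x, y) \<in> V ==> (c *\<^sub>C x, c *\<^sub>C y) \<in> V"
 using csub_scaleC[of V "(x, y)" c] by (simp add: scaleC_prod_def)

lemma graph_0: "csubspace V ==> (0, 0) \<in> V"
 using csub_0 by (fastforce simp: zero_prod_def)

lemma csubspace_Domain: "csubspace V ==> csubspace (Domain V)"
 unfolding csubspace_def[of "Domain V"] by (blast intro: graph_add graph_scaleC graph_0)

lemma graph_tendsto: "closed V ==> (!!n. (f n, g n) \<in> V) ==> f ---> x ==> g ---> y ==> (x, y) \<in> V"
 using closed_sequentially[of V "%n. (f n, g n)" "(x, y)"] tendsto_Pair by blast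

lemma cddD:
 assumes "closed_dd_op T"
 shows "csubspace T" "single_valued T" "closed T" "closure (Domain T) = UNIV"
 using assms by (auto simp: closed_dd_op_def)

lemma sv_eq: "single_valued T ==> (x, y) \<in> T ==> (x, z) \<in> T ==> y = z"
 by (auto simp: single_valued_def)

text \<open>The adjoint graph is the orthogonal complement of the graph, rotated by a quarter turn.
  If (p, q) is what remains of a point of the double adjoint after projection onto a, then (q, -p)
  lies in \<open>adj a\<close>, and pairing both gives -|p|^2 = |q|^2.\<close>

lemma op_adjoint_op_adjoint:
 assumes "csubspace a" "closed a" shows "adj (adj a) = a"
proof
 show sub: "a \<subseteq> adj (adj a)" by (auto simp: adj_iff) (metis cinner_commute)
 show "adj (adj a) \<subseteq> a"
 proof clarify
  fix x w assume xw: "(x, w) \<in> adj (adj a)"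
  obtain x0 w0 where 0: "hproj a (x, w) = (x0, w0)" by fastforce
  then have a0: "(x0, w0) \<in> a" using hproj_works(1)[OF assms] by metis
  have "cinner z ((x, w) - hproj a (x, w)) = 0" if "z \<in> a" for z
   using hproj_works(2)[OF assms that] .
  then have "(w - w0, - (x - x0)) \<in> adj a"
   by (force simp: adj_iff 0 cinner_prod_def cinner.diff_right cinner.minus_right algebra_simps)
  moreover have "(x - x0, w - w0) \<in> adj (adj a)"
   using graph_diff[OF csub_adjoint xw] a0 sub by blast
  ultimately have "cinner (- (x - x0)) (x - x0) = cinner (w - w0) (w - w0)"
   by (simp add: adj_iff)
  then have "- cinner (x - x0) (x - x0) = cinner (w - w0) (w - w0)"
   by (simp only: cinner.minus_left)
  then have "- ((norm (x - x0))^2) = (norm (w - w0))^2"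
   by (metis norm2_cinner uminus_complex.sel(1))
  then have "(norm (x - x0))^2 = 0" "(norm (w - w0))^2 = 0"
   using zero_le_power2[of "norm (x - x0)"] zero_le_power2[of "norm (w - w0)"] by linarith+
  then show "(x, w) \<in> a" using a0 by simp
 qed
qed

text \<open>A vector y orthogonal to the domain of the adjoint yields (0, y) in the double adjoint,
  which is a itself, so y = 0 by single-valuedness.\<close>

lemma closed_dd_op_adjoint:
 assumes a: "closed_dd_op a" shows "closed_dd_op (adj a)"
 unfolding closed_dd_op_def
proof (intro conjI closed_op_adjoint csub_adjoint single_valued_op_adjoint cddD[OF a])
 show "closure (Domain (adj a)) = UNIV"
 proof (rule closure_csubspace_UNIV[OF csubspace_Domain[OF csub_adjoint]])
  show "ocomp (Domain (adj a)) \<subseteq> {0}"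
  proof
   fix y assume "y \<in> ocomp (Domain (adj a))"
   then have "(0, y) \<in> adj (adj a)"
    by (auto simp: ocomp_def adj_iff[of 0 y "adj a"] cinner.zero_right Domain_iff)
   then have "(0, y) \<in> a" by (simp add: op_adjoint_op_adjoint cddD[OF a])
   then show "y \<in> {0}" using graph_0 cddD[OF a] by (auto simp: single_valued_def)
  qed
 qed
qed

section \<open>The resolvent of the square of the absolute value\<close>

definition Rop :: "'a::chilbert_space graph => 'a => 'a" where
 "Rop a x = fst (hproj a (x, 0))"

definition Bop :: "'a::chilbert_space graph => 'a => 'a" where
 "Bop a x = snd (hproj a (x, 0))"

definition pcon :: "('a::chilbert_space => 'a) => bool" where
 "pcon R \<longleftrightarrow> bcl R \<and> (\<forall>x y. cinner (R x) y = cinner x (R y)) \<and>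
   (\<forall>x. 0 <= Re (cinner x (R x)) \<and> Re (cinner x (R x)) <= (norm x)^2)"

text \<open>\<open>Rop a = (1 + a\<^sup>* a)\<^sup>-\<^sup>1\<close> and \<open>Bop a = a (1 + a\<^sup>* a)\<^sup>-\<^sup>1\<close>: the components of the
  projection of \<open>H \<oplus> 0\<close> onto the graph of \<open>a\<close> (von Neumann).\<close>

context
 fixes a :: "'a::chilbert_space graph"
 assumes a: "closed_dd_op a"
begin

private lemma aS: "csubspace a" "closed a"
 using a cddD by auto

lemma Rop_graph: "(Rop a z, Bop a z) \<in> a"
 using hproj_works(1)[OF aS, of "(z, 0)"] by (simp add: Rop_def Bop_def)

lemma Bop_graph: "(Bop a z, z - Rop a z) \<in> adj a"
proof -
 have "cinner p ((z, 0) - hproj a (z, 0)) = 0" if "p \<in> a" for p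
  using hproj_works(2)[OF aS that] .
 then show ?thesis
  by (force simp: adj_iff Rop_def Bop_def cinner_prod_def cinner.diff_right cinner.minus_right cinner.zero_right)
qed

text \<open>The two memberships say y = a x and z = x + \<open>adj a\<close> y, the normal equations
  for projecting (z, 0) onto the graph. Later identities for \<open>Rop\<close> and
  \<open>Bop\<close> are recognized through them.\<close>

lemma Rop_unique:
 assumes "(x, y) \<in> a" "(y, z - x) \<in> adj a" shows "Rop a z = x" "Bop a z = y"
proof -
 have "hproj a (z, 0) = (x, y)"
 proof (rule hproj_eqI[OF aS assms(1)])
  fix p assume "p \<in> a"
  then have "cinner (snd p) y = cinner (fst p) (z - x)" using assms(2) by (auto simp: op_adjoint_def)
  then show "cinner p ((z, 0) - (x, y)) = 0" by (simp add: cinner_prod_def cinner.minus_right)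
 qed
 then show "Rop a z = x" "Bop a z = y" by (simp_all add: Rop_def Bop_def)
qed

text \<open>Moving \<open>Bop a w\<close> across a produces w - \<open>Rop a w\<close>. The
  right-hand side is hermitian in z and w and nonnegative on the diagonal, which gives symmetry and
  positivity of the resolvent.\<close>

lemma Rop_inner: "cinner (Rop a z) w = cinner (Rop a z) (Rop a w) + cinner (Bop a z) (Bop a w)"
proof -
 have "cinner (Bop a z) (Bop a w) = cinner (Rop a z) (w - Rop a w)"
  using Bop_graph[of w] Rop_graph[of z] by (simp add: adj_iff)
 then show ?thesis by (simp add: cinner.diff_right)
qed

lemma Rop_sym: "cinner (Rop a z) w = cinner z (Rop a w)"
proof -
 have "cinner (Rop a z) w = cnj (cinner (Rop a w) z)"
  unfolding Rop_inner[of z w] Rop_inner[of w z] by (simp add: cinner_commute[symmetric])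
 then show ?thesis by (simp add: cinner_commute[symmetric])
qed

lemma Rop_quadratic: "cinner z (Rop a z) = cr ((norm (Rop a z))^2 + (norm (Bop a z))^2)"
 using Rop_inner[of z z] by (simp add: Rop_sym[symmetric] cinner_self)

lemma Rop_linear: 
 shows "Rop a (x + y) = Rop a x + Rop a y" "Rop a (c *\<^sub>C x) = c *\<^sub>C Rop a x"
  "Bop a (x + y) = Bop a x + Bop a y" "Bop a (c *\<^sub>C x) = c *\<^sub>C Bop a x"
proof -
 note add = Rop_unique[OF graph_add[OF aS(1) Rop_graph Rop_graph, of x y], of "x + y"]
 note sc = Rop_unique[OF graph_scaleC[OF aS(1) Rop_graph, of c x], of "c *\<^sub>C x"]
 have "(Bop a x + Bop a y, x + y - (Rop a x + Rop a y)) \<in> adj a"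
  using graph_add[OF csub_adjoint Bop_graph Bop_graph, of x y] by (simp add: algebra_simps)
 with add show "Rop a (x + y) = Rop a x + Rop a y" "Bop a (x + y) = Bop a x + Bop a y" by auto
 have "(c *\<^sub>C Bop a x, c *\<^sub>C x - c *\<^sub>C Rop a x) \<in> adj a"
  using graph_scaleC[OF csub_adjoint Bop_graph, of c x] by (simp add: scaleC.diff_right)
 with sc show "Rop a (c *\<^sub>C x) = c *\<^sub>C Rop a x" "Bop a (c *\<^sub>C x) = c *\<^sub>C Bop a x" by auto
qed

lemma Rop_Bop_norm: "norm (Rop a z) <= norm z" "norm (Bop a z) <= norm z" "Re (cinner z (Rop a z)) <= (norm z)^2"
proof -
 have le: "(norm (Rop a z))^2 + (norm (Bop a z))^2 <= norm z * norm (Rop a z)"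
  using cmod_cinner_le[of z "Rop a z"] unfolding Rop_quadratic norm_of_real by linarith
 then have "(norm (Rop a z))^2 <= norm z * norm (Rop a z)" by (smt (verit) zero_le_power2)
 then show R: "norm (Rop a z) <= norm z"
  by (cases "norm (Rop a z) = 0") (auto simp: power2_eq_square)
 then have "norm z * norm (Rop a z) <= (norm z)^2" by (simp add: power2_eq_square mult_left_mono)
 with le show "Re (cinner z (Rop a z)) <= (norm z)^2" unfolding Rop_quadratic by simp
 have "(norm (Bop a z))^2 <= (norm z)^2" using le \<open>norm z * norm (Rop a z) <= (norm z)^2\<close>
  by (smt (verit) zero_le_power2)
 then show "norm (Bop a z) <= norm z" by (rule power2_le_imp_le) simp
qed

lemma bcl_Rop: "bcl (Rop a)" and bcl_Bop: "bcl (Bop a)"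
 by (rule bclI[where K=1]; use Rop_linear Rop_Bop_norm in simp)+

lemma pcon_Rop: "pcon (Rop a)"
 unfolding pcon_def using bcl_Rop Rop_sym Rop_Bop_norm(3) Rop_quadratic by auto

lemma Rop_inj: "Rop a z = 0 ==> z = 0"
proof -
 assume z: "Rop a z = 0"
 have "Bop a z = 0" using Rop_graph[of z] z graph_0[OF aS(1)] cddD(2)[OF a] sv_eq by metis
 then have "(0, z) \<in> adj a" using Bop_graph[of z] z by simp
 then show "z = 0"
  using graph_0[OF csub_adjoint] cddD(2)[OF closed_dd_op_adjoint[OF a]] sv_eq by metis
qed

text \<open>The left-hand relation is the graph of \<open>adj a\<close> after a; the right-hand one
  is R^(-1) - 1 with R = \<open>Rop a\<close>, parametrized by z.\<close>

lemma square_graph: "a O adj a = {(Rop a z, z - Rop a z) | z. True}"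
proof safe
 fix x y w assume "(x, y) \<in> a" "(y, w) \<in> adj a"
 then have "Rop a (x + w) = x" using Rop_unique[of x y "x + w"] by simp
 then show "\<exists>z. (x, w) = (Rop a z, z - Rop a z) \<and> True" by (intro exI[of _ "x + w"]) simp
next
 fix z show "(Rop a z, z - Rop a z) \<in> a O adj a" using Rop_graph Bop_graph by blast
qed

end

text \<open>Turns the defining condition of \<open>op_abs\<close>, an equation between squares of
  unbounded operators, into equality of bounded resolvents.\<close>

lemma Rop_cong:
 assumes "closed_dd_op a" "closed_dd_op b" "a O adj a = b O adj b"
 shows "Rop a = Rop b"
proof
 fix z
 have "(Rop a z, z - Rop a z) \<in> b O adj b" using assms square_graph by blast
 then obtain y where "(Rop a z, y) \<in> b" "(y, z - Rop a z) \<in> adj b" by blast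
 then show "Rop a z = Rop b z" using Rop_unique(1)[OF assms(2)] by metis
qed

section \<open>Polynomials of a positive contraction\<close>

definition pop :: "('a::chilbert_space => 'a) => real poly => 'a => 'a" where
 "pop R p x = (\<Sum>i\<le>degree p. coeff p i *\<^sub>R (R ^^ i) x)"

lemma pop_ge: "degree p <= n ==> pop R p x = (\<Sum>i\<le>n. coeff p i *\<^sub>R (R ^^ i) x)"
 unfolding pop_def by (rule sum.mono_neutral_left) (auto simp: coeff_eq_0)

lemma pop_add: "pop R (p + q) x = pop R p x + pop R q x"
proof -
 let ?n = "max (degree p) (degree q)"
 have "degree (p + q) <= ?n" by (rule degree_add_le) auto
 then show ?thesis
  by (simp add: pop_ge[of _ ?n] scaleR_add_left sum.distrib)
qed

lemma pop_smult: "pop R (smult c p) x = c *\<^sub>R pop R p x"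
 using pop_ge[of "smult c p" "degree p" R x] by (simp add: pop_def scaleR_sum_right degree_smult_le)

lemma pop_0 [simp]: "pop R 0 x = 0" by (simp add: pop_def)

lemma pop_const: "pop R [:c:] x = c *\<^sub>R x" by (simp add: pop_def)

lemma pop_1 [simp]: "pop R 1 x = x" by (simp add: pop_def)

lemma pop_diff: "pop R (p - q) x = pop R p x - pop R q x"
 using pop_add[of R p "- q"] by (simp add: pop_def[of R "- q"] pop_def[of R q] sum_negf)

lemma pop_sum: "pop R (\<Sum>i\<in>I. p i) x = (\<Sum>i\<in>I. pop R (p i) x)"
 by (induction I rule: infinite_finite_induct) (auto simp: pop_add)

context
 fixes R :: "'a::chilbert_space => 'a"
 assumes R: "pcon R"
begin

private lemma bR: "bcl R" and symR: "cinner (R x) y = cinner x (R y)"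
 using R by (auto simp: pcon_def)

lemma pop_pCons: "pop R (pCons c p) x = c *\<^sub>R x + R (pop R p x)"
proof -
 have "pop R (pCons c p) x = (\<Sum>i\<le>Suc (degree p). coeff (pCons c p) i *\<^sub>R (R ^^ i) x)"
  by (rule pop_ge) (simp add: degree_pCons_le)
 also have "... = c *\<^sub>R x + (\<Sum>i\<le>degree p. coeff p i *\<^sub>R R ((R ^^ i) x))"
  by (simp only: sum.atMost_Suc_shift coeff_pCons_0 coeff_pCons_Suc funpow.simps id_apply comp_apply)
 also have "(\<Sum>i\<le>degree p. coeff p i *\<^sub>R R ((R ^^ i) x)) = R (pop R p x)"
  by (simp add: pop_def bcl_sum[OF bR] bcl_scaleR[OF bR])
 finally show ?thesis .
qed

lemma pop_X: "pop R [:0, 1:] x = R x"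
 by (simp add: pop_pCons pop_const)

lemma bcl_pop: "bcl (pop R p)"
proof (induction p rule: pCons_induct)
 case 0
 have "pop R 0 = (%x. 0)" by auto
 then show ?case using bcl_zero by metis
next
 case (pCons c p)
 have "pop R (pCons c p) = (%x. c *\<^sub>R x + R (pop R p x))" by (auto simp: pop_pCons)
 then show ?case
  by (auto intro!: pCons bR bcl_plus bcl_rmult bcl_comp[OF bR] bcl_id)
qed

lemma pop_mult: "pop R (p * q) x = pop R p (pop R q x)"
 by (induction p rule: pCons_induct) (simp_all add: pop_pCons pop_add pop_smult)

lemma pop_R: "pop R p (R x) = R (pop R p x)"
 using pop_mult[of p "[:0,1:]" x] pop_mult[of "[:0,1:]" p x] by (simp add: mult.commute pop_X)

lemma pop_sym: "cinner (pop R p x) y = cinner x (pop R p y)"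
proof (induction p arbitrary: x y rule: pCons_induct)
 case 0 show ?case by (simp add: cinner.zero_left cinner.zero_right)
next
 case (pCons c p)
 have "cinner (R (pop R p x)) y = cinner x (R (pop R p y))"
  by (simp add: symR pCons.IH pop_R)
 then show ?case by (simp add: pop_pCons cinner_add_left cinner_add_right cinner.scaleR_left cinner.scaleR_right)
qed

lemma pop_inner: "cinner (pop R p x) (pop R q x) = cinner x (pop R (p * q) x)"
 by (simp add: pop_sym pop_mult)

lemma pop_real: "cinner x (pop R p x) = cr (Re (cinner x (pop R p x)))"
proof -
 have "cinner x (pop R p x) = cnj (cinner x (pop R p x))" by (metis pop_sym cinner_commute)
 then show ?thesis by (simp add: complex_eq_iff)
qed

lemma pop_norm: "(norm (pop R p x))^2 = Re (cinner x (pop R (p^2) x))"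
 by (simp only: norm2_cinner pop_inner power2_eq_square[of p])

lemma pop_commute:
 assumes X: "bcl X" and XR: "!!x. X (R x) = R (X x)"
 shows "X (pop R p x) = pop R p (X x)"
 by (induction p arbitrary: x rule: pCons_induct)
   (simp_all add: pop_pCons bcl_add[OF X] bcl_scaleR[OF X] bcl_0[OF X] XR)

lemma pop_compl: "pop R [:1, -1:] x = x - R x"
 by (simp add: pop_pCons pop_const bcl_minus[OF bR])

definition bern :: "nat => nat => real poly" where
 "bern i j = [:0, 1:] ^ i * [:1, -1:] ^ j"

text \<open>Half of each exponent is moved to either side of the inner product, which leaves
  exponents 0 or 1. The only remainder not immediate is R(1-R), and it equals R(1-R)R + (1-R)R(1-R),
  a sum of visibly positive terms.\<close>

lemma bern_nonneg: "0 <= Re (cinner x (pop R (bern k m) x))"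
proof -
 have 1: "0 <= Re (cinner y (R y))" "0 <= Re (cinner y (y - R y))" for y
  using R by (auto simp: pcon_def cinner.diff_right norm2_cinner)
 have 2: "0 <= Re (cinner y (pop R (bern 1 1) y))" for y
 proof -
  have id: "bern 1 1 = [:0, 1:] * ([:1, -1:] * [:0, 1:]) + [:1, -1:] * ([:0, 1:] * [:1, -1:])"
   by (simp add: bern_def algebra_simps)
  have "cinner y (pop R (bern 1 1) y) = cinner (R y) (R y - R (R y)) + cinner (y - R y) (R (y - R y))"
   unfolding id pop_add pop_mult cinner_add_right pop_X pop_compl
   by (simp add: symR bcl_diff[OF bR] cinner.diff_left cinner.diff_right)
  then show ?thesis using 1(2)[of "R y"] 1(1)[of "y - R y"] by simp
 qed
 have b: "bern 0 0 = 1" "bern 1 0 = [:0, 1:]" "bern 0 1 = [:1, -1:]" by (simp_all add: bern_def)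
 have base: "0 <= Re (cinner y (pop R (bern a c) y))" if ac: "a < 2" "c < 2" for a c y
 proof -
  consider "a = 0" "c = 0" | "a = 1" "c = 0" | "a = 0" "c = 1" | "a = 1" "c = 1" using ac by linarith
  then show ?thesis
   by cases (use 1[of y] 2[of y] in \<open>simp_all only: b pop_1 pop_X pop_compl cinner_self Re_complex_of_real zero_le_power2\<close>)
 qed
 define q where "q = bern (k div 2) (m div 2)"
 have k: "k = k div 2 + k div 2 + k mod 2" and m: "m = m div 2 + m div 2 + m mod 2" by presburger+
 have bm: "bern (i + i') (j + j') = bern i j * bern i' j'" for i i' j j'
  unfolding bern_def power_add by (simp only: mult.left_commute mult.assoc)
 have "bern k m = q * (bern (k mod 2) (m mod 2) * q)"
  unfolding q_def bm[symmetric] using k m by (metis add.commute add.left_commute)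
 then have "cinner x (pop R (bern k m) x) = cinner (pop R q x) (pop R (bern (k mod 2) (m mod 2)) (pop R q x))"
  by (simp only: pop_mult pop_sym)
 then show ?thesis using base[of "k mod 2" "m mod 2"] by (simp only: mod_less_divisor zero_less_numeral)
qed

text \<open>The mass that the n-th Bernstein approximation of the scalar spectral measure of R at x
  places at the node k/n.\<close>

definition bw :: "'a => nat => nat => real" where
 "bw x n k = Re (cinner x (pop R (smult (of_nat (n choose k)) (bern k (n - k))) x))"

lemma bw_nonneg: "0 <= bw x n k"
 using bern_nonneg[of x k "n - k"] unfolding bw_def pop_smult by (simp add: cinner.scaleR_right)

text \<open>Factorial moments of the binomial law: (n choose k)(k choose j) = (n choose j)(n-j
  choose k-j) leaves the full binomial expansion of (X + (1 - X))^(n-j), which is 1.\<close>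

lemma bern_moment:
 assumes "j <= n"
 shows "(\<Sum>k\<le>n. smult (of_nat (k choose j) / of_nat (n choose j)) (smult (of_nat (n choose k)) (bern k (n - k)))) = [:0, 1::real:] ^ j"
proof -
 have X1: "([:0, 1:] + [:1, -1:]) = (1 :: real poly)" by (simp add: one_pCons)
 have nz: "n choose j ~= 0" using assms by simp
 have "(\<Sum>k\<le>n. smult (of_nat (k choose j) / of_nat (n choose j)) (smult (of_nat (n choose k)) (bern k (n - k)))) =
  (\<Sum>k\<in>{j..n}. smult (of_nat ((n - j) choose (k - j))) (bern k (n - k)))"
 proof (rule sum.mono_neutral_cong_right)
  fix k assume k: "k \<in> {j..n}"
  have "real (n choose k) * real (k choose j) = real (n choose j) * real ((n - j) choose (k - j))"
   using choose_mult[of j k n] k by (simp flip: of_nat_mult)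
  then show "smult (of_nat (k choose j) / of_nat (n choose j)) (smult (of_nat (n choose k)) (bern k (n - k))) =
   smult (of_nat ((n - j) choose (k - j))) (bern k (n - k))"
   using nz by (simp add: field_simps)
 qed auto
 also have "... = (\<Sum>i\<le>n - j. smult (of_nat ((n - j) choose i)) (bern (i + j) (n - j - i)))"
  using assms by (intro sum.reindex_bij_witness[of _ "%i. i + j" "%k. k - j"]) auto
 also have "... = [:0, 1:] ^ j * (\<Sum>i\<le>n - j. of_nat ((n - j) choose i) * [:0, 1:] ^ i * [:1, -1:] ^ (n - j - i))"
  by (simp add: bern_def sum_distrib_left power_add of_nat_poly mult_ac)
 also have "... = [:0, 1:] ^ j"
  unfolding binomial_ring[symmetric] X1 by simp
 finally show ?thesis .
qed

lemma bw_moment: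
 assumes "j <= n" shows "(\<Sum>k\<le>n. of_nat (k choose j) / of_nat (n choose j) * bw x n k) = Re (cinner x ((R ^^ j) x))"
proof -
 have "pop R ([:0, 1:] ^ j) x = (R ^^ j) x" for x by (induction j) (simp_all add: pop_mult pop_X del: mult_pCons_left)
 then have "Re (cinner x ((R ^^ j) x)) = Re (cinner x (pop R (\<Sum>k\<le>n. smult (of_nat (k choose j) / of_nat (n choose j)) (smult (of_nat (n choose k)) (bern k (n - k)))) x))"
  by (simp only: bern_moment[OF assms])
 also have "... = (\<Sum>k\<le>n. of_nat (k choose j) / of_nat (n choose j) * bw x n k)"
  by (simp only: pop_sum pop_smult[where c = "_ / _"] bw_def cinner.sum_right cinner.scaleR_right Re_sum scaleR_complex.sel(1))
 finally show ?thesis by simp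
qed

end

lemma binomial_ratio:
 assumes "k <= n" "j <= n"
 shows "real (k choose j) / real (n choose j) = (\<Prod>i<j. real (k - i) / real (n - i))"
proof (cases "j <= k")
 case True
 have "real (k choose j) / real (n choose j) = (\<Prod>i<j. (real (k - i) / real (j - i)) / (real (n - i) / real (j - i)))"
  unfolding binomial_altdef_of_nat[OF True] binomial_altdef_of_nat[OF assms(2)] atLeast0LessThan
  by (rule prod_dividef[symmetric])
 also have "... = (\<Prod>i<j. real (k - i) / real (n - i))" by (rule prod.cong) auto
 finally show ?thesis .
next
 case False
 then have "(\<Prod>i<j. real (k - i) / real (n - i)) = 0" by (intro prod_zero) (auto intro!: bexI[of _ k])
 moreover have "k choose j = 0" using False by simp
 ultimately show ?thesis by (simp only: of_nat_0 div_0)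
qed

text \<open>Compares factorial moments, which the Bernstein weights reproduce exactly, with power
  moments. Both are products of j factors of modulus at most 1, and corresponding factors differ by
  at most j/n.\<close>

lemma binomial_ratio_power:
 assumes "k <= n" "j <= n" "0 < n"
 shows "\<bar>real (k choose j) / real (n choose j) - (real k / real n) ^ j\<bar> <= (real j)^2 / real n"
proof -
 have fac: "\<bar>real (k - i) / real (n - i) - real k / real n\<bar> <= real j / real n"
  and le1: "\<bar>real (k - i) / real (n - i)\<bar> <= 1" if i: "i < j" for i
 proof -
  show "\<bar>real (k - i) / real (n - i)\<bar> <= 1" using assms i by (simp add: divide_le_eq)
  have ni: "0 < real (n - i)" using i assms by simp
  show "\<bar>real (k - i) / real (n - i) - real k / real n\<bar> <= real j / real n"
  proof (cases "i <= k")
   case True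
   have "real (k - i) / real (n - i) - real k / real n = - (real i / real n) * (real (n - k) / real (n - i))"
    using ni assms True i by (simp add: of_nat_diff field_simps)
   then have "\<bar>real (k - i) / real (n - i) - real k / real n\<bar> = (real i / real n) * (real (n - k) / real (n - i))"
    by (simp add: abs_mult)
   also have "... <= (real i / real n) * 1"
    using ni True by (intro mult_left_mono) (auto simp: divide_le_eq)
   also have "... <= real j / real n" using i by (simp add: divide_right_mono)
   finally show ?thesis .
  next
   case False then show ?thesis using i by (simp add: divide_right_mono)
  qed
 qed
 have "\<bar>(\<Prod>i<j. real (k - i) / real (n - i)) - (\<Prod>i<j. real k / real n)\<bar> <= (\<Sum>i<j. \<bar>real (k - i) / real (n - i) - real k / real n\<bar>)"
  using norm_prod_diff[of "{..<j}" "%i. real (k - i) / real (n - i)" "%_. real k / real n"] le1 assms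
  by (simp add: divide_le_eq)
 also have "... <= (\<Sum>i<j. real j / real n)" by (intro sum_mono fac) auto
 also have "... = (real j)^2 / real n" by (simp add: power2_eq_square)
 finally show ?thesis by (simp add: binomial_ratio[OF assms(1,2)])
qed

section \<open>Scalar spectral measures by the Hausdorff moment problem\<close>

definition umeas :: "real measure => bool" where
 "umeas \<mu> \<longleftrightarrow> sets \<mu> = sets borel \<and> finite_measure \<mu> \<and> (AE t in \<mu>. 0 <= t \<and> t <= 1)"

text \<open>Helly selection applied to the discrete measures with masses \<open>bw\<close> at the
  nodes k/n. Normalization of x makes them probability measures, and the index \<open>Suc n\<close>
  avoids the degenerate n = 0.\<close>

lemma umeas_moment_unit:
 assumes R: "pcon R" and x: "norm x = 1"
 shows "\<exists>\<mu>. umeas \<mu> \<and> (\<forall>j. integral\<^sup>L \<mu> (%t. t ^ j) = Re (cinner x ((R ^^ j) x)))"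
proof -
 let ?w = "bw R x"
 define N where "N n = point_measure {..Suc n} (%k. ennreal (?w (Suc n) k))" for n
 define \<mu> where "\<mu> n = distr (N n) borel (%k. real k / real (Suc n))" for n
 have w0: "0 <= ?w n k" for n k by (rule bw_nonneg[OF R])
 have w1: "(\<Sum>k\<le>n. ?w n k) = 1" for n
  using bw_moment[OF R, of 0 n x] x by (simp add: cinner_self)
 have emN: "emeasure (N n) A = ennreal (\<Sum>k\<in>A. ?w (Suc n) k)" if "A \<subseteq> {..Suc n}" for n A
  using that unfolding N_def by (subst emeasure_point_measure_finite) (auto simp: sum_ennreal w0)
 have mN: "(%k. real k / real (Suc n)) \<in> measurable (N n) borel" for n
  by (simp add: N_def)
 have pN: "prob_space (N n)" for n
  by (rule prob_spaceI) (simp add: w1 N_def space_point_measure emN[unfolded N_def] del: sum.atMost_Suc)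
 have rd: "real_distribution (\<mu> n)" for n
  unfolding real_distribution_def real_distribution_axioms_def \<mu>_def
  using prob_space.prob_space_distr[OF pN mN] by simp
 have spN: "space (N n) = {..Suc n}" for n by (simp add: N_def space_point_measure)
 have I: "integral\<^sup>L (\<mu> n) f = (\<Sum>k\<le>Suc n. ?w (Suc n) k * f (real k / real (Suc n)))" if "f \<in> bmeas" for f n
  unfolding \<mu>_def using that mN[of n]
  by (subst integral_distr) (auto simp: N_def lebesgue_integral_point_measure_finite w0)
 have "tight \<mu>" unfolding tight_def
 proof (intro conjI allI impI rd)
  fix e :: real assume "e > 0"
  have "measure (\<mu> n) {-1<..2} = 1" for n
  proof -
   have "(%k. real k / real (Suc n)) -` {-1<..2} \<inter> space (N n) = space (N n)"
    unfolding spN by (auto simp: divide_le_eq less_divide_eq)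
   then show ?thesis unfolding \<mu>_def using mN[of n] prob_space.prob_space[OF pN] by (simp add: measure_distr)
  qed
  then show "\<exists>a b. a < b \<and> (\<forall>n. 1 - e < measure (\<mu> n) {a<..b})"
   using \<open>e > 0\<close> by (intro exI[of _ "-1"] exI[of _ 2]) auto
 qed
 then obtain r M where r: "strict_mono (r :: nat => nat)" and M: "real_distribution M"
  and wc: "weak_conv_m (\<mu> \<circ> id \<circ> r) M"
  using tight_imp_convergent_subsubsequence[of \<mu> id] by (auto simp: strict_mono_id)
 interpret M: real_distribution M by fact
 have conv: "(%n. integral\<^sup>L (\<mu> (r n)) f) ---> integral\<^sup>L M f"
  if "!!x. isCont f x" "!!x. norm (f x) <= B" for f :: "real => real" and B
  using weak_conv_imp_integral_bdd_continuous_conv[of "\<mu> \<circ> id \<circ> r" M f B] wc that rd M by simp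
 \<comment> \<open>Weak convergence only tests bounded continuous functions, so powers are clamped
   to [0,1]; on the nodes the clamp changes nothing.\<close>
 let ?c = "%t::real. max 0 (min 1 t)"
 have c01: "?c (real k / real (Suc n)) = real k / real (Suc n)" if "k <= Suc n" for k n
  using that by (simp add: min_def max_def divide_le_eq)
 have mom: "integral\<^sup>L M (%t. ?c t ^ j) = Re (cinner x ((R ^^ j) x))" for j
 proof (rule LIMSEQ_unique)
  show "(%n. integral\<^sup>L (\<mu> (r n)) (%t. ?c t ^ j)) ---> integral\<^sup>L M (%t. ?c t ^ j)"
   by (rule conv[of _ 1]) (auto intro!: continuous_intros simp: power_abs abs_le_iff power_le_one)
  have "(%n. integral\<^sup>L (\<mu> n) (%t. ?c t ^ j)) ---> Re (cinner x ((R ^^ j) x))"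
  proof (rule LIM_zero_cancel, rule tendsto_norm_zero_cancel, rule tendsto_sandwich[of "%_. 0" _ _ "%n. (real j)^2 / real (Suc n)"])
   show "\<forall>\<^sub>F n in sequentially. norm (integral\<^sup>L (\<mu> n) (%t. ?c t ^ j) - Re (cinner x ((R ^^ j) x))) <= (real j)^2 / real (Suc n)"
   proof (rule eventually_sequentiallyI[of j])
    fix n assume "j <= n"
    then have j: "j <= Suc n" by simp
    have "integral\<^sup>L (\<mu> n) (%t. ?c t ^ j) - Re (cinner x ((R ^^ j) x)) =
     (\<Sum>k\<le>Suc n. ?w (Suc n) k * (real k / real (Suc n)) ^ j) - (\<Sum>k\<le>Suc n. of_nat (k choose j) / of_nat (Suc n choose j) * ?w (Suc n) k)"
     unfolding bw_moment[OF R j] by (subst I) (auto intro!: sum.cong simp: c01 simp del: of_nat_Suc sum.atMost_Suc)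
    also have "... = (\<Sum>k\<le>Suc n. ?w (Suc n) k * ((real k / real (Suc n)) ^ j - of_nat (k choose j) / of_nat (Suc n choose j)))"
     by (simp add: sum_subtractf[symmetric] algebra_simps del: of_nat_Suc sum.atMost_Suc)
    also have "norm ... <= (\<Sum>k\<le>Suc n. ?w (Suc n) k * ((real j)^2 / real (Suc n)))"
     using binomial_ratio_power[OF _ j]
     by (intro sum_norm_le) (auto simp: abs_mult w0 abs_minus_commute simp del: of_nat_Suc times_divide_eq_right intro!: mult_left_mono)
    also have "... = (real j)^2 / real (Suc n)" by (simp only: sum_distrib_right[symmetric] w1 mult_1)
    finally show "norm (integral\<^sup>L (\<mu> n) (%t. ?c t ^ j) - Re (cinner x ((R ^^ j) x))) <= (real j)^2 / real (Suc n)" .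
   qed
   show "(%n. (real j)^2 / real (Suc n)) ---> 0"
    using LIMSEQ_Suc[OF lim_const_over_n[of "(real j)^2"]] by simp
  qed auto
  from LIMSEQ_subseq_LIMSEQ[OF this r] show "(%n. integral\<^sup>L (\<mu> (r n)) (%t. ?c t ^ j)) ---> Re (cinner x ((R ^^ j) x))"
   by (simp add: o_def)
 qed
 \<comment> \<open>A bounded continuous function vanishing exactly on [0,1]. Its integral is 0 along
   the sequence, hence in the limit, so the limit measure is carried by [0,1].\<close>
 let ?g = "%t::real. min 1 (\<bar>t - ?c t\<bar>)"
 have ge: "?g (real k / real (Suc n)) = 0" if "k <= Suc n" for k n
  using c01[OF that] by simp
 have "integral\<^sup>L M ?g = 0"
 proof (rule LIMSEQ_unique)
  show "(%n. integral\<^sup>L (\<mu> (r n)) ?g) ---> integral\<^sup>L M ?g"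
   by (rule conv[of _ 1]) (auto intro!: continuous_intros)
  have "integral\<^sup>L (\<mu> (r n)) ?g = 0" for n
   by (subst I) (auto intro!: sum.neutral simp: c01 simp del: of_nat_Suc)
  then show "(%n. integral\<^sup>L (\<mu> (r n)) ?g) ---> 0" by simp
 qed
 then have "AE t in M. ?g t = 0"
  by (subst (asm) integral_nonneg_eq_0_iff_AE) (auto intro!: M.integrable_const_bound[of _ 1])
 then have ae: "AE t in M. 0 <= t \<and> t <= 1" by eventually_elim (auto simp: min_def max_def split: if_splits)
 have "umeas M" unfolding umeas_def using ae by (auto simp: M.finite_measure_axioms)
 moreover have "integral\<^sup>L M (%t. t ^ j) = Re (cinner x ((R ^^ j) x))" for j
 proof -
  have "AE t in M. t ^ j = ?c t ^ j" using ae by eventually_elim (simp add: min_absorb2 max_absorb2)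
  then show ?thesis unfolding mom[symmetric] by (intro integral_cong_AE) auto
 qed
 ultimately show ?thesis by blast
qed

lemma umeas_integrable:
 assumes u: "umeas \<mu>" and f: "f \<in> bmeas" and "!!t. 0 <= t ==> t <= 1 ==> \<bar>f t\<bar> <= (B::real)"
 shows "integrable \<mu> f"
proof -
 interpret finite_measure \<mu> using u by (simp add: umeas_def)
 have "f \<in> borel_measurable \<mu>" using u f by (simp add: umeas_def cong: measurable_cong_sets)
 moreover have "AE t in \<mu>. \<bar>f t\<bar> <= B"
  using u assms(3) unfolding umeas_def by (blast intro: eventually_mono)
 ultimately show ?thesis by (intro integrable_const_bound[of _ B]) auto
qed

lemma poly_bounded01: "\<exists>B. \<forall>t. 0 <= t --> t <= 1 --> \<bar>poly p t\<bar> <= (B::real)"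
proof -
 have "compact (poly p ` {0..1})" by (intro compact_continuous_image continuous_intros) auto
 then obtain B where "!!y. y \<in> poly p ` {0..1} ==> norm y <= B" using compact_imp_bounded bounded_iff by metis
 then show ?thesis by (intro exI[of _ B]) auto
qed

lemma poly_borel [measurable]: "poly (p :: real poly) \<in> bmeas"
 by (intro borel_measurable_continuous_onI continuous_intros)

lemma umeas_exists:
 assumes R: "pcon R"
 shows "\<exists>\<mu>. umeas \<mu> \<and> (\<forall>p. integral\<^sup>L \<mu> (poly p) = Re (cinner x (pop R p x)))"
proof -
 have "\<exists>\<mu>. umeas \<mu> \<and> (\<forall>j. integral\<^sup>L \<mu> (%t. t ^ j) = Re (cinner x ((R ^^ j) x)))"
 proof (cases "x = 0")
  case True
  have "(R ^^ j) 0 = 0" for j using R by (induction j) (auto simp: pcon_def bcl_0)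
  moreover have "integral\<^sup>L (density lborel (%_. 0)) (%t::real. t ^ j) = (0::real)" for j
   using integral_density[of "%t::real. t ^ j" lborel "%_. 0 :: real"] by simp
  ultimately show ?thesis using True
   by (intro exI[of _ "density lborel (%_. 0)"])
     (auto simp: umeas_def integral_density cinner.zero_left AE_density finite_measureI emeasure_density intro!: finite_measureI)
 next
  case False
  define y where "y = (1 / norm x) *\<^sub>R x"
  have x: "x = norm x *\<^sub>R y" using False by (simp add: y_def)
  have "norm y = 1" using False by (simp add: y_def)
  then obtain \<mu> where u: "umeas \<mu>" and m: "!!j. integral\<^sup>L \<mu> (%t. t ^ j) = Re (cinner y ((R ^^ j) y))"
   using umeas_moment_unit[OF R] by blast
  have "(R ^^ j) (c *\<^sub>R z) = c *\<^sub>R (R ^^ j) z" for c j z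
   using R by (induction j) (auto simp: pcon_def bcl_scaleR)
  then have "Re (cinner x ((R ^^ j) x)) = (norm x)^2 * Re (cinner y ((R ^^ j) y))" for j
   by (subst (1 2) x) (simp add: cinner.scaleR_left cinner.scaleR_right power2_eq_square del: x)
  then show ?thesis using u m finite_measure.emeasure_finite[of \<mu> "space \<mu>"]
   by (intro exI[of _ "density \<mu> (%_. ennreal ((norm x)^2))"])
     (auto simp: umeas_def integral_density AE_density emeasure_density_const ennreal_mult_eq_top_iff
      borel_measurable_continuous_onI continuous_intros cong: measurable_cong_sets intro!: finite_measureI)
 qed
 then obtain \<mu> where u: "umeas \<mu>" and m: "!!j. integral\<^sup>L \<mu> (%t. t ^ j) = Re (cinner x ((R ^^ j) x))" by blast
 have "integral\<^sup>L \<mu> (poly p) = Re (cinner x (pop R p x))" for p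
 proof -
  have i: "integrable \<mu> (%t. t ^ j)" for j
   using u by (rule umeas_integrable[where B=1]) (auto simp: power_abs abs_le_iff power_le_one)
  have "integral\<^sup>L \<mu> (poly p) = integral\<^sup>L \<mu> (%t. \<Sum>j\<le>degree p. coeff p j * t ^ j)"
   by (simp add: poly_altdef[abs_def])
  also have "... = (\<Sum>j\<le>degree p. coeff p j * Re (cinner x ((R ^^ j) x)))"
   using i by (simp add: m)
  finally show ?thesis by (simp add: pop_def cinner.sum_right cinner.scaleR_right)
 qed
 with u show ?thesis by blast
qed

section \<open>Polynomial approximation in mean square\<close>

text \<open>The square of the mean square distance. Without the root the triangle inequality costs a
  factor 2, and the value in \<open>ennreal\<close> avoids integrability conditions.\<close>

definition L2d :: "real measure => (real => real) => (real => real) => ennreal" where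
 "L2d \<mu> f g = (\<integral>\<^sup>+t. ennreal ((f t - g t)^2) \<partial>\<mu>)"

definition L2 :: "real measure => (real => real) => bool" where
 "L2 \<mu> f \<longleftrightarrow> f \<in> bmeas \<and> (\<integral>\<^sup>+t. ennreal ((f t)^2) \<partial>\<mu>) < \<infinity>"

lemma umeasD:
 assumes "umeas \<mu>"
 shows "sets \<mu> = sets borel" "finite_measure \<mu>" "AE t in \<mu>. 0 <= t \<and> t <= 1" "space \<mu> = UNIV"
 using assms sets_eq_imp_space_eq[of \<mu> borel] by (auto simp only: umeas_def space_borel)

lemma umeas_measurable: "umeas \<mu> ==> f \<in> bmeas ==> f \<in> borel_measurable \<mu>"
 using umeasD(1) measurable_cong_sets by blast

lemma square_sum_le: "((a::real) + b)^2 <= 2 * a^2 + 2 * b^2"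
 using zero_le_power2[of "a - b"] by (simp add: power2_sum power2_diff)

lemma L2d_commute: "L2d \<mu> f g = L2d \<mu> g f"
 by (simp add: L2d_def power2_commute)

lemma L2d_triangle:
 assumes u: "umeas \<mu>" and [measurable]: "f \<in> bmeas" "g \<in> bmeas" "h \<in> bmeas"
 shows "L2d \<mu> f h <= 2 * L2d \<mu> f g + 2 * L2d \<mu> g h"
proof -
 note [measurable_cong] = umeasD(1)[OF u]
 have "L2d \<mu> f h <= (\<integral>\<^sup>+t. 2 * ennreal ((f t - g t)^2) + 2 * ennreal ((g t - h t)^2) \<partial>\<mu>)"
  unfolding L2d_def
 proof (rule nn_integral_mono)
  fix t
  have "(f t - h t)^2 <= 2 * (f t - g t)^2 + 2 * (g t - h t)^2"
   using square_sum_le[of "f t - g t" "g t - h t"] by simp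
  then show "ennreal ((f t - h t)^2) <= 2 * ennreal ((f t - g t)^2) + 2 * ennreal ((g t - h t)^2)"
   by (simp add: ennreal_leI flip: ennreal_plus ennreal_mult' ennreal_numeral)
 qed
 also have "... = 2 * L2d \<mu> f g + 2 * L2d \<mu> g h"
  unfolding L2d_def by (subst nn_integral_add) (auto simp: nn_integral_cmult)
 finally show ?thesis .
qed

lemma L2_borel: "L2 \<mu> f ==> f \<in> bmeas"
 by (simp add: L2_def)

lemma L2_integrable_mult:
 assumes u: "umeas \<mu>" and f: "L2 \<mu> f" and g: "L2 \<mu> g"
 shows "integrable \<mu> (%t. f t * g t)"
proof (rule integrableI_bounded)
 note [measurable] = umeas_measurable[OF u L2_borel[OF f]] umeas_measurable[OF u L2_borel[OF g]]
 show "(%t. f t * g t) \<in> borel_measurable \<mu>" by measurable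
 have "(\<integral>\<^sup>+t. ennreal (norm (f t * g t)) \<partial>\<mu>) <= (\<integral>\<^sup>+t. ennreal ((f t)^2) + ennreal ((g t)^2) \<partial>\<mu>)"
 proof (rule nn_integral_mono)
  fix t
  have "2 * \<bar>f t * g t\<bar> <= (f t)^2 + (g t)^2"
   using sum_squares_bound[of "\<bar>f t\<bar>" "\<bar>g t\<bar>"] by (simp add: abs_mult)
  then have "norm (f t * g t) <= (f t)^2 + (g t)^2"
   using abs_ge_zero[of "f t * g t"] unfolding real_norm_def by linarith
  then show "ennreal (norm (f t * g t)) <= ennreal ((f t)^2) + ennreal ((g t)^2)"
   by (simp add: ennreal_leI flip: ennreal_plus)
 qed
 also have "... < \<infinity>" using f g by (subst nn_integral_add) (auto simp: L2_def)
 finally show "(\<integral>\<^sup>+t. ennreal (norm (f t * g t)) \<partial>\<mu>) < \<infinity>" .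
qed

lemma L2_integrable_square: "umeas \<mu> ==> L2 \<mu> f ==> integrable \<mu> (%t. (f t)^2)"
 using L2_integrable_mult[of \<mu> f f] by (simp add: power2_eq_square)

lemma L2_add:
 assumes u: "umeas \<mu>" and f: "L2 \<mu> f" and g: "L2 \<mu> g"
 shows "L2 \<mu> (%t. f t + g t)"
proof -
 note [measurable] = L2_borel[OF f] L2_borel[OF g]
 have "L2d \<mu> f (%t. - g t) <= 2 * L2d \<mu> f (%_. 0) + 2 * L2d \<mu> (%_. 0) (%t. - g t)"
  by (rule L2d_triangle[OF u]) auto
 also have "... < \<infinity>" using f g by (auto simp: L2d_def L2_def ennreal_mult_less_top)
 finally show ?thesis by (simp add: L2_def L2d_def)
qed

lemma L2_cmult: assumes u: "umeas \<mu>" and f: "L2 \<mu> f" shows "L2 \<mu> (%t. c * f t)"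
proof -
 note [measurable] = L2_borel[OF f]
 note [measurable_cong] = umeasD(1)[OF u]
 have "(\<integral>\<^sup>+t. ennreal ((c * f t)^2) \<partial>\<mu>) = ennreal (c^2) * (\<integral>\<^sup>+t. ennreal ((f t)^2) \<partial>\<mu>)"
  by (subst nn_integral_cmult[symmetric]) (auto simp: power_mult_distrib ennreal_mult')
 then show ?thesis using f by (simp add: L2_def ennreal_mult_less_top)
qed

lemma L2_diff: "umeas \<mu> ==> L2 \<mu> f ==> L2 \<mu> g ==> L2 \<mu> (%t. f t - g t)"
 using L2_add[of \<mu> f "%t. -1 * g t"] L2_cmult[of \<mu> g "-1"] by simp

lemma L2_mono:
 assumes u: "umeas \<mu>" and g: "L2 \<mu> g" and f: "f \<in> bmeas"
  and le: "!!t. 0 <= t ==> t <= 1 ==> \<bar>f t\<bar> <= \<bar>g t\<bar>"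
 shows "L2 \<mu> f"
proof -
 have "(\<integral>\<^sup>+t. ennreal ((f t)^2) \<partial>\<mu>) <= (\<integral>\<^sup>+t. ennreal ((g t)^2) \<partial>\<mu>)"
 proof (rule nn_integral_mono_AE)
  show "AE t in \<mu>. ennreal ((f t)^2) <= ennreal ((g t)^2)"
   using umeasD(3)[OF u] by eventually_elim (use le in \<open>auto intro!: ennreal_leI simp: abs_le_square_iff[symmetric]\<close>)
 qed
 then show ?thesis using f g by (auto simp: L2_def)
qed

lemma L2_const: "umeas \<mu> ==> L2 \<mu> (%_. c)"
 using umeasD(2)[of \<mu>] finite_measure.emeasure_finite[of \<mu> "space \<mu>"]
 by (auto simp: L2_def ennreal_mult_less_top top.not_eq_extremum)

lemma L2_bounded:
 assumes "umeas \<mu>" "f \<in> bmeas" "!!t. 0 <= t ==> t <= 1 ==> \<bar>f t\<bar> <= B"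
 shows "L2 \<mu> f"
 by (rule L2_mono[OF assms(1) L2_const[of \<mu> B]]) (use assms in \<open>force+\<close>)

lemma L2_poly: "umeas \<mu> ==> L2 \<mu> (poly p)"
 using poly_bounded01[of p] L2_bounded[OF _ poly_borel] by blast

lemma L2d_eq_integral:
 assumes "umeas \<mu>" "L2 \<mu> f" "L2 \<mu> g" shows "L2d \<mu> f g = ennreal (integral\<^sup>L \<mu> (%t. (f t - g t)^2))"
 unfolding L2d_def using L2_integrable_square[OF assms(1) L2_diff[OF assms]] by (intro nn_integral_eq_integral) auto

text \<open>Continuity of the inner product of L2. The difference of products is split into (p-f)g +
  (q-g)f + (p-f)(q-g), and each term is bounded by a weighted Young inequality instead of
  Cauchy-Schwarz.\<close>

lemma L2_integral_tendsto:
 assumes u: "umeas \<mu>" and p: "!!n. L2 \<mu> (p n)" and q: "!!n::nat. L2 \<mu> (q n)" and f: "L2 \<mu> f" and g: "L2 \<mu> g"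
  and pf: "(%n. L2d \<mu> (p n) f) ---> 0" and qg: "(%n. L2d \<mu> (q n) g) ---> 0"
 shows "(%n. integral\<^sup>L \<mu> (%t. p n t * q n t)) ---> integral\<^sup>L \<mu> (%t. f t * g t)"
proof -
 define P where "P n = integral\<^sup>L \<mu> (%t. (p n t - f t)^2)" for n
 define Q where "Q n = integral\<^sup>L \<mu> (%t. (q n t - g t)^2)" for n
 define C where "C = integral\<^sup>L \<mu> (%t. (f t)^2) + integral\<^sup>L \<mu> (%t. (g t)^2)"
 have C0: "0 <= C" by (simp add: C_def)
 have P: "P ---> 0" and Q: "Q ---> 0"
  using pf qg L2d_eq_integral[OF u p f] L2d_eq_integral[OF u q g] unfolding P_def Q_def
  by (simp_all add: ennreal_tendsto_0_iff)
 note I = L2_integrable_square[OF u L2_diff[OF u p f]] L2_integrable_square[OF u L2_diff[OF u q g]]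
  L2_integrable_square[OF u f] L2_integrable_square[OF u g] L2_integrable_mult[OF u p q] L2_integrable_mult[OF u f g]
 \<comment> \<open>The parameter d balances two errors: for fixed d the first summand tends to 0
   with n, and the fixed second summand d C is made small at the end.\<close>
 have bound: "\<bar>integral\<^sup>L \<mu> (%t. p n t * q n t) - integral\<^sup>L \<mu> (%t. f t * g t)\<bar> <= (1 / d + 1) * (P n + Q n) + d * C"
  if d: "0 < d" for d n
 proof -
  have young: "\<bar>a * b\<bar> <= a^2 / d + d * b^2" if d: "0 < d" for a b d :: real
  proof -
   have "2 * (\<bar>a\<bar> * (d * \<bar>b\<bar>)) <= a^2 + (d * b)^2"
    using sum_squares_bound[of "\<bar>a\<bar>" "d * \<bar>b\<bar>"] by (simp add: power_mult_distrib mult.assoc)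
   moreover have "0 <= \<bar>a\<bar> * (d * \<bar>b\<bar>)" using d by simp
   ultimately have "\<bar>a\<bar> * (d * \<bar>b\<bar>) <= a^2 + (d * b)^2" by linarith
   then show ?thesis using d by (simp add: field_simps power2_eq_square abs_mult)
  qed
  have "\<bar>integral\<^sup>L \<mu> (%t. p n t * q n t) - integral\<^sup>L \<mu> (%t. f t * g t)\<bar> <= integral\<^sup>L \<mu> (%t. \<bar>p n t * q n t - f t * g t\<bar>)"
   using I integral_abs_bound[of \<mu> "%t. p n t * q n t - f t * g t"] by simp
  also have "... <= integral\<^sup>L \<mu> (%t. (1 / d + 1) * ((p n t - f t)^2 + (q n t - g t)^2) + d * ((f t)^2 + (g t)^2))"
  proof (rule integral_mono)
   fix t
   have "p n t * q n t - f t * g t = (p n t - f t) * g t + (q n t - g t) * f t + (p n t - f t) * (q n t - g t)"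
    by (simp add: algebra_simps)
   then have "\<bar>p n t * q n t - f t * g t\<bar> <= \<bar>(p n t - f t) * g t\<bar> + \<bar>(q n t - g t) * f t\<bar> + \<bar>(p n t - f t) * (q n t - g t)\<bar>"
    by linarith
   also have "... <= (1 / d + 1) * ((p n t - f t)^2 + (q n t - g t)^2) + d * ((f t)^2 + (g t)^2)"
    using young[OF d, of "p n t - f t" "g t"] young[OF d, of "q n t - g t" "f t"] young[of 1 "p n t - f t" "q n t - g t"]
    by (simp add: distrib_right distrib_left)
   finally show "\<bar>p n t * q n t - f t * g t\<bar> <= (1 / d + 1) * ((p n t - f t)^2 + (q n t - g t)^2) + d * ((f t)^2 + (g t)^2)" .
  qed (use I in \<open>auto intro!: integrable_abs Bochner_Integration.integrable_diff\<close>)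
  also have "... = (1 / d + 1) * (P n + Q n) + d * C"
   using I by (simp add: P_def Q_def C_def)
  finally show ?thesis .
 qed
 show ?thesis
 proof (rule LIMSEQ_I)
  fix e :: real assume e: "0 < e"
  define d where "d = e / (2 * (C + 1))"
  have "e * C < e * (2 * (C + 1))" using e C0 by (intro mult_strict_left_mono) auto
  then have d: "0 < d" "d * C < e" using e C0 by (simp_all add: d_def divide_less_eq)
  have "(%n. (1 / d + 1) * (P n + Q n) + d * C) ---> (1 / d + 1) * (0 + 0) + d * C"
   by (intro tendsto_intros P Q)
  then have "\<forall>\<^sub>F n in sequentially. (1 / d + 1) * (P n + Q n) + d * C < e"
   using d by (intro order_tendstoD(2)) auto
  then obtain m where m: "!!n. m <= n ==> (1 / d + 1) * (P n + Q n) + d * C < e"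
   unfolding eventually_sequentially by blast
  show "\<exists>no. \<forall>n\<ge>no. norm (integral\<^sup>L \<mu> (%t. p n t * q n t) - integral\<^sup>L \<mu> (%t. f t * g t)) < e"
   using le_less_trans[OF bound[OF d(1)] m] unfolding real_norm_def by blast
 qed
qed

text \<open>One polynomial must serve all measures of N at once. Thus a single sequence p_n computes
  f(R) at several vectors simultaneously, and linearity, symmetry and commutation pass from p_n(R)
  to f(R).\<close>

definition papprox :: "real measure set => (real => real) => bool" where
 "papprox N f \<longleftrightarrow> (\<forall>e>0. \<exists>p. \<forall>\<mu>\<in>N. L2d \<mu> (poly p) f <= ennreal e)"

context
 fixes N :: "real measure set"
 assumes fin: "finite N" and u: "!!\<mu>. \<mu> \<in> N ==> umeas \<mu>"
begin

lemma papprox_limit: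
 assumes [measurable]: "f \<in> bmeas" "!!n::nat. g n \<in> bmeas"
  and g: "!!n. papprox N (g n)"
  and lim: "!!t. (%n. g n t) ---> f t" and W: "!!n t. \<bar>g n t - f t\<bar> <= W t" "!!\<mu>. \<mu> \<in> N ==> L2 \<mu> W"
 shows "papprox N f"
 unfolding papprox_def
proof (intro allI impI)
 fix e :: real assume e: "e > 0"
 have "(%n. L2d \<mu> (g n) f) ---> (\<integral>\<^sup>+t. 0 \<partial>\<mu>)" if \<mu>: "\<mu> \<in> N" for \<mu>
  unfolding L2d_def
 proof (rule nn_integral_dominated_convergence)
  note [measurable] = L2_borel[OF W(2)[OF \<mu>]]
  show "(%t. ennreal ((g n t - f t)^2)) \<in> borel_measurable \<mu>" for n
   by (rule umeas_measurable[OF u[OF \<mu>]]) measurable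
  show "(%t. ennreal ((W t)^2)) \<in> borel_measurable \<mu>"
   by (rule umeas_measurable[OF u[OF \<mu>]]) measurable
  show "AE t in \<mu>. ennreal ((g n t - f t)^2) <= ennreal ((W t)^2)" for n
  proof (intro AE_I2 ennreal_leI)
   fix t show "(g n t - f t)^2 <= (W t)^2"
    using W(1)[of n t] by (intro abs_le_square_iff[THEN iffD1]) linarith
  qed
  show "(\<integral>\<^sup>+ t. ennreal ((W t)^2) \<partial>\<mu>) < \<infinity>" using W(2)[OF \<mu>] by (simp add: L2_def)
  have "(%n. ennreal ((g n t - f t)^2)) ---> ennreal ((f t - f t)^2)" for t
   by (intro tendsto_ennrealI tendsto_intros lim)
  then show "AE t in \<mu>. (%n. ennreal ((g n t - f t)^2)) ---> 0" by simp
 qed auto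
 then have "\<forall>\<mu>\<in>N. \<forall>\<^sub>F n in sequentially. L2d \<mu> (g n) f < ennreal (e / 4)"
  using e by (auto intro!: order_tendstoD(2)[of _ 0])
 then have "\<forall>\<^sub>F n in sequentially. \<forall>\<mu>\<in>N. L2d \<mu> (g n) f < ennreal (e / 4)"
  using fin by (simp add: eventually_ball_finite)
 then obtain n where n: "!!\<mu>. \<mu> \<in> N ==> L2d \<mu> (g n) f < ennreal (e / 4)"
  by (auto simp: eventually_sequentially)
 obtain p where p: "!!\<mu>. \<mu> \<in> N ==> L2d \<mu> (poly p) (g n) <= ennreal (e / 4)"
  using g[of n] e unfolding papprox_def by (metis divide_pos_pos zero_less_numeral)
 have "L2d \<mu> (poly p) f <= ennreal e" if "\<mu> \<in> N" for \<mu>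
 proof -
  have "L2d \<mu> (poly p) f <= 2 * L2d \<mu> (poly p) (g n) + 2 * L2d \<mu> (g n) f"
   by (rule L2d_triangle[OF u[OF that]]) auto
  also have "... <= 2 * ennreal (e / 4) + 2 * ennreal (e / 4)"
   by (intro add_mono mult_left_mono p n[THEN less_imp_le] that) auto
  also have "... = ennreal e" using e by (simp flip: ennreal_plus ennreal_mult' ennreal_numeral)
  finally show ?thesis .
 qed
 then show "\<exists>p. \<forall>\<mu>\<in>N. L2d \<mu> (poly p) f <= ennreal e" by blast
qed

lemma papprox_lincomb:
 assumes [measurable]: "f \<in> bmeas" "g \<in> bmeas" and f: "papprox N f" and g: "papprox N g"
 shows "papprox N (%t. f t + c * g t)"
 unfolding papprox_def
proof (intro allI impI)
 fix e :: real assume e: "e > 0"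
 have c: "0 < c^2 + 1" by (simp add: add_nonneg_pos)
 then have "0 < e / 4" "0 < e / 4 / (c^2 + 1)" using e by simp_all
 then obtain p q where p: "!!\<mu>. \<mu> \<in> N ==> L2d \<mu> (poly p) f <= ennreal (e / 4)"
  and q: "!!\<mu>. \<mu> \<in> N ==> L2d \<mu> (poly q) g <= ennreal (e / 4 / (c^2 + 1))"
  using f g unfolding papprox_def by meson
 have "L2d \<mu> (poly (p + smult c q)) (%t. f t + c * g t) <= ennreal e" if "\<mu> \<in> N" for \<mu>
 proof -
  note [measurable_cong] = umeasD(1)[OF u[OF that]]
  have "L2d \<mu> (poly (p + smult c q)) (%t. f t + c * g t) <= 2 * L2d \<mu> (poly (p + smult c q)) (%t. f t + c * poly q t) + 2 * L2d \<mu> (%t. f t + c * poly q t) (%t. f t + c * g t)"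
   by (rule L2d_triangle[OF u[OF that]]) auto
  also have "... = 2 * L2d \<mu> (poly p) f + 2 * (ennreal (c^2) * L2d \<mu> (poly q) g)"
   unfolding L2d_def by (subst (2) nn_integral_cmult[symmetric])
    (auto simp: ennreal_mult'[symmetric] power_mult_distrib[symmetric] right_diff_distrib)
  also have "... <= 2 * ennreal (e / 4) + 2 * (ennreal (c^2) * ennreal (e / 4 / (c^2 + 1)))"
   by (intro add_mono mult_left_mono p q that) auto
  also have "ennreal (c^2) * ennreal (e / 4 / (c^2 + 1)) <= ennreal (e / 4)"
   using e c by (simp flip: ennreal_mult') (simp add: field_simps ennreal_leI)
  also have "2 * ennreal (e / 4) + 2 * ennreal (e / 4) = ennreal e" using e by (simp flip: ennreal_plus ennreal_mult' ennreal_numeral)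
  finally show ?thesis by (simp add: add_left_mono mult_left_mono)
 qed
 then show "\<exists>p. \<forall>\<mu>\<in>N. L2d \<mu> (poly p) (%t. f t + c * g t) <= ennreal e" by blast
qed

lemma papprox_continuous:
 fixes f :: "real => real"
 assumes f: "continuous_on UNIV f" shows "papprox N f"
 unfolding papprox_def
proof (intro allI impI)
 fix e :: real assume e: "e > 0"
 define C where "C = (\<Sum>\<mu>\<in>N. measure \<mu> (space \<mu>))"
 have C: "measure \<mu> (space \<mu>) <= C" if "\<mu> \<in> N" for \<mu>
  unfolding C_def using fin that by (intro member_le_sum) auto
 have C0: "0 <= C" by (simp add: C_def sum_nonneg)
 define d where "d = sqrt (e / (C + 1))"
 have d: "0 < d" "d^2 * C <= e"
  using e C0 by (auto simp: d_def add_nonneg_pos field_simps)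
 obtain n where n: "!!t. t \<in> {0..1} ==> \<bar>f t - (\<Sum>k\<le>n. f (real k / real n) * Bernstein n k t)\<bar> < d"
  using Bernstein_Weierstrass[OF continuous_on_subset[OF f] d(1)] by (metis order_refl subset_UNIV)
 define p where "p = (\<Sum>k\<le>n. smult (f (real k / real n)) (smult (of_nat (n choose k)) ([:0, 1:] ^ k * [:1, -1:] ^ (n - k))))"
 have p: "poly p t = (\<Sum>k\<le>n. f (real k / real n) * Bernstein n k t)" for t
  by (simp add: p_def poly_sum Bernstein_def mult.assoc)
 have "L2d \<mu> (poly p) f <= ennreal e" if \<mu>: "\<mu> \<in> N" for \<mu>
 proof -
  have "L2d \<mu> (poly p) f <= (\<integral>\<^sup>+t. ennreal (d^2) \<partial>\<mu>)"
   unfolding L2d_def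
  proof (rule nn_integral_mono_AE)
   show "AE t in \<mu>. ennreal ((poly p t - f t)^2) <= ennreal (d^2)"
    using umeasD(3)[OF u[OF \<mu>]]
   proof eventually_elim
    case (elim t)
    then have "\<bar>poly p t - f t\<bar> <= \<bar>d\<bar>" using n[of t] d p by (simp add: abs_minus_commute)
    then show ?case by (intro ennreal_leI) (simp add: abs_le_square_iff)
   qed
  qed
  also have "... = ennreal (d^2) * ennreal (measure \<mu> (space \<mu>))"
   using finite_measure.emeasure_eq_measure[OF umeasD(2)[OF u[OF \<mu>]]] by simp
  also have "... <= ennreal (d^2 * C)"
   using C[OF \<mu>] by (simp flip: ennreal_mult') (simp add: ennreal_leI mult_left_mono)
  also have "... <= ennreal e" using d by (simp add: ennreal_leI)
  finally show ?thesis .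
 qed
 then show "\<exists>p. \<forall>\<mu>\<in>N. L2d \<mu> (poly p) f <= ennreal e" by blast
qed

lemma papprox_sum:
 assumes "!!i. i \<in> I ==> f i \<in> bmeas" "!!i. i \<in> I ==> papprox N (f i)"
 shows "papprox N (%t. \<Sum>i\<in>I. f i t)"
 using assms
proof (induction I rule: infinite_finite_induct)
 case (insert i I)
 then show ?case using papprox_lincomb[of "f i" "%t. \<Sum>i\<in>I. f i t" 1] by auto
qed (auto intro!: papprox_continuous)

text \<open>Continuous functions falling linearly from 1 to 0 on [s, s + 1/n] tend pointwise to the
  indicator, with differences bounded by 1.\<close>

lemma papprox_atMost: "papprox N (ind {..s})"
proof (rule papprox_limit[where g = "%n t. max 0 (min 1 (1 - real n * (t - s)))" and W = "%_. 1"])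
 show "papprox N (%t. max 0 (min 1 (1 - real n * (t - s))))" for n
  by (intro papprox_continuous continuous_intros)
 show "(%n. max 0 (min 1 (1 - real n * (t - s)))) ---> ind {..s} t" for t
 proof (cases "t <= s")
  case True
  then have "real n * (t - s) <= 0" for n by (simp add: mult_nonneg_nonpos)
  then have "max 0 (min 1 (1 - real n * (t - s))) = 1" for n by (simp add: min_def)
  then show ?thesis using True by simp
 next
  case False
  obtain k where k: "1 / (t - s) < real k" using reals_Archimedean2 by blast
  have "max 0 (min 1 (1 - real n * (t - s))) = 0" if "k <= n" for n
  proof -
   have "1 / (t - s) <= real n" using k that by linarith
   then have "1 <= real n * (t - s)" using False by (simp add: divide_le_eq)
   then show ?thesis by simp
  qed
  then show ?thesis using False by (intro tendsto_eventually eventually_sequentiallyI[of k]) auto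
 qed
 show "\<bar>max 0 (min 1 (1 - real n * (t - s))) - ind {..s} t\<bar> <= 1" for n t
  by (auto simp: indicator_def)
qed (auto intro!: borel_measurable_continuous_onI continuous_intros L2_const u)

lemma papprox_indicator:
 assumes "B \<in> sets borel" shows "papprox N (ind B)"
proof -
 have b: "sigma_sets UNIV (range (%a::real. {..a})) = sets borel"
  by (subst borel_eq_atMost) simp
 have "Int_stable (range (%a::real. {..a}))" by (auto simp: Int_stable_def)
 moreover have "range (%a::real. {..a}) \<subseteq> Pow UNIV" by simp
 moreover have "B \<in> sigma_sets UNIV (range (%a::real. {..a}))" using assms b by simp
 ultimately show ?thesis
 proof (induction rule: sigma_sets_induct_disjoint)
  case (basic A) then show ?case using papprox_atMost by auto
 next
  case empty
  then show ?case by (auto intro!: papprox_continuous)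
 next
  case (compl A)
  have "papprox N (%t. 1 + -1 * ind A t)"
   using compl b by (intro papprox_lincomb) (auto intro!: papprox_continuous)
  moreover have "(%t. 1 + -1 * ind A t) = (ind (UNIV - A) :: real => real)"
   by (auto simp: indicator_def)
  ultimately show ?case by simp
 next
  case (union A)
  have A: "A i \<in> sets borel" for i using union(2) b by auto
  have sm: "(%i. ind (A i) t :: real) sums ind (\<Union>i. A i) t" for t
   using union(1) by (intro indicator_sums) (auto simp: disjoint_family_on_def)
  show ?case
  proof (rule papprox_limit[where g = "%n t. \<Sum>i<n. ind (A i) t" and W = "%_. 1"])
   show "papprox N (%t. \<Sum>i<n. ind (A i) t)" for n
    using union(3) A by (intro papprox_sum) auto
   show "(%n. \<Sum>i<n. ind (A i) t) ---> (ind (\<Union>i. A i) t :: real)" for t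
    using sm by (simp add: sums_def)
   show "\<bar>(\<Sum>i<n. ind (A i) t) - ind (\<Union>i. A i) t\<bar> <= (1::real)" for n t
   proof -
    have "(\<Sum>i<n. ind (A i) t) <= (ind (\<Union>i. A i) t :: real)"
     using sm by (metis sum_le_suminf sums_unique sums_summable finite_lessThan indicator_pos_le)
    moreover have "0 <= (\<Sum>i<n. ind (A i) t :: real)" by (intro sum_nonneg) auto
    moreover have "(ind (\<Union>i. A i) t :: real) <= 1" by (simp add: indicator_def)
    ultimately show ?thesis by linarith
   qed
  qed (use A in \<open>auto intro!: L2_const u\<close>)
 qed
qed

lemma papprox_nonneg:
 assumes "f \<in> bmeas" "!!t. 0 <= f t" and "\<forall>\<mu>\<in>N. L2 \<mu> f"
 shows "papprox N f"
 using assms(1,2,3)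
proof (induction f rule: borel_measurable_induct_real)
 case (set A) then show ?case using papprox_indicator by simp
next
 case (mult f c)
 show ?case
 proof (cases "c = 0")
  case True then show ?thesis by (auto intro!: papprox_continuous)
 next
  case False
  have "L2 \<mu> f" if "\<mu> \<in> N" for \<mu>
   using L2_cmult[OF u[OF that], of "%t. c * f t" "1 / c"] mult that False by simp
  then show ?thesis using mult papprox_lincomb[OF _ _ papprox_continuous[OF continuous_on_const], of 0 f c] by simp
 qed
next
 case (add f g)
 have "L2 \<mu> f" "L2 \<mu> g" if "\<mu> \<in> N" for \<mu>
 proof -
  have "\<bar>f t\<bar> <= \<bar>g t + f t\<bar>" "\<bar>g t\<bar> <= \<bar>g t + f t\<bar>" for t
   using add.hyps(2)[of t] add.hyps(4)[of t] by linarith+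
  moreover have G: "L2 \<mu> (%t. g t + f t)" using add.prems that by blast
  ultimately show "L2 \<mu> f" "L2 \<mu> g"
   by (auto intro!: L2_mono[OF u[OF that] G add.hyps(1)] L2_mono[OF u[OF that] G add.hyps(3)])
 qed
 then show ?case using papprox_lincomb[OF add.hyps(3,1), of 1] add.IH by simp
next
 case (seq U)
 have lim: "(%i. U i t) ---> f t" for t using seq.hyps(4) by auto
 have Uf: "U i t <= f t" for i t using seq.hyps(3) lim by (intro incseq_le) (auto simp: incseq_def le_fun_def)
 have f0: "0 <= f t" for t using seq.hyps(2)[of 0 t] Uf[of 0 t] by linarith
 have [measurable]: "f \<in> bmeas"
  by (rule borel_measurable_LIMSEQ_real[OF lim seq.hyps(1)])
 show ?case
 proof (rule papprox_limit[where g = U and W = f])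
  show "papprox N (U i)" for i
  proof (rule seq.IH)
   show "\<forall>\<mu>\<in>N. L2 \<mu> (U i)"
   proof
    fix \<mu> assume \<mu>: "\<mu> \<in> N"
    then have "L2 \<mu> f" using seq.prems by blast
    moreover have "\<bar>U i t\<bar> <= \<bar>f t\<bar>" for t using Uf[of i t] seq.hyps(2)[of i t] by linarith
    ultimately show "L2 \<mu> (U i)" by (intro L2_mono[OF u[OF \<mu>] _ seq.hyps(1)])
   qed
  qed
  show "\<bar>U n t - f t\<bar> <= f t" for n t using Uf[of n t] seq.hyps(2)[of n t] by linarith
  show "U n \<in> bmeas" for n by (rule seq.hyps(1))
  show "L2 \<mu> f" if "\<mu> \<in> N" for \<mu> using seq.prems that by blast
 qed (use lim in auto)
qed

lemma papprox_L2:
 assumes f: "f \<in> bmeas" and L: "!!\<mu>. \<mu> \<in> N ==> L2 \<mu> f"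
 shows "papprox N f"
proof -
 note [measurable] = f
 have "L2 \<mu> (%t. max 0 (f t))" "L2 \<mu> (%t. max 0 (- f t))" if "\<mu> \<in> N" for \<mu>
  by (rule L2_mono[OF u[OF that] L[OF that]]; auto)+
 then have "papprox N (%t. max 0 (f t))" "papprox N (%t. max 0 (- f t))"
  by (intro papprox_nonneg; auto)+
 then have "papprox N (%t. max 0 (f t) + -1 * max 0 (- f t))"
  by (intro papprox_lincomb) auto
 moreover have "(%t. max 0 (f t) + -1 * max 0 (- f t)) = f" by (auto simp: max_def)
 ultimately show ?thesis by simp
qed

lemma polynomial_sequence_L2:
 assumes "f \<in> bmeas" "!!\<mu>. \<mu> \<in> N ==> L2 \<mu> f"
 shows "\<exists>p :: nat => real poly. \<forall>\<mu>\<in>N. (%n. L2d \<mu> (poly (p n)) f) ---> 0"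
proof -
 have "\<exists>p. \<forall>\<mu>\<in>N. L2d \<mu> (poly p) f <= ennreal (1 / real (Suc n))" for n
  using papprox_L2[OF assms] unfolding papprox_def by (simp del: of_nat_Suc)
 then obtain p where p: "!!n \<mu>. \<mu> \<in> N ==> L2d \<mu> (poly (p n)) f <= ennreal (1 / real (Suc n))" by metis
 have l: "(%n. ennreal (1 / real (Suc n))) ---> 0"
  using tendsto_ennrealI[OF LIMSEQ_Suc[OF lim_1_over_n]] by simp
 have "(%n. L2d \<mu> (poly (p n)) f) ---> 0" if "\<mu> \<in> N" for \<mu>
  by (rule tendsto_sandwich[OF _ _ tendsto_const l]) (use p that in auto)
 then show ?thesis by blast
qed

end

text \<open>One polynomial sequence approximates the indicator of B in mean square for both
  measures. Integrating it against the constant 1 recovers the measure of B on either side.\<close>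

lemma umeas_eqI:
 assumes \<mu>: "umeas \<mu>" and \<nu>: "umeas \<nu>" and eq: "!!p. integral\<^sup>L \<mu> (poly p) = integral\<^sup>L \<nu> (poly p)"
 shows "\<mu> = \<nu>"
proof (rule measure_eqI)
 show "sets \<mu> = sets \<nu>" by (simp add: umeasD(1)[OF \<mu>] umeasD(1)[OF \<nu>])
 fix B assume "B \<in> sets \<mu>"
 then have B: "B \<in> sets borel" by (simp add: umeasD(1)[OF \<mu>])
 have L: "L2 \<rho> (ind B)" if "umeas \<rho>" for \<rho>
  using B that by (intro L2_bounded[where B=1]) (auto simp: indicator_def)
 obtain p :: "nat => real poly" where p: "\<forall>\<rho>\<in>{\<mu>, \<nu>}. (%n. L2d \<rho> (poly (p n)) (ind B)) ---> 0"
  using polynomial_sequence_L2[of "{\<mu>, \<nu>}" "ind B"] \<mu> \<nu> L B by auto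
 have lim: "(%n. integral\<^sup>L \<rho> (poly (p n))) ---> measure \<rho> B" if "umeas \<rho>" "\<rho> \<in> {\<mu>, \<nu>}" for \<rho>
 proof -
  have "(%n. L2d \<rho> (poly (p n)) (ind B)) ---> 0" using p that(2) by blast
  moreover have "(%n::nat. L2d \<rho> (%_. 1) (%_. 1)) ---> 0" by (simp add: L2d_def)
  ultimately show ?thesis
   using L2_integral_tendsto[OF that(1) L2_poly L2_const[of _ 1] L L2_const[of _ 1], of p] that(1) B umeasD(1,4)[OF that(1)]
   by simp
 qed
 have "measure \<mu> B = measure \<nu> B"
  using lim[OF \<mu>] lim[OF \<nu>] LIMSEQ_unique unfolding eq by blast
 then show "emeasure \<mu> B = emeasure \<nu> B"
  by (simp add: finite_measure.emeasure_eq_measure umeasD(2)[OF \<mu>] umeasD(2)[OF \<nu>])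
qed

section \<open>Functional calculus of a positive contraction\<close>

definition pmu :: "('a::chilbert_space => 'a) => 'a => real measure" where
 "pmu R x = (SOME \<mu>. umeas \<mu> \<and> (\<forall>p. integral\<^sup>L \<mu> (poly p) = Re (cinner x (pop R p x))))"

definition fdom :: "('a::chilbert_space => 'a) => (real => real) => 'a set" where
 "fdom R f = {x. L2 (pmu R x) f}"

text \<open>\<open>fc R f x\<close> is \<open>f(R) x\<close>: the limit of \<open>p\<^sub>n(R) x\<close> for polynomials \<open>p\<^sub>n\<close> tending to \<open>f\<close> in
  \<open>L\<^sup>2\<close> of the spectral measure \<open>pmu R x\<close>. The constant 2 only makes existence convenient.\<close>

definition fc :: "('a::chilbert_space => 'a) => (real => real) => 'a => 'a" where
 "fc R f x = (SOME y. \<forall>p. ennreal ((norm (pop R p x - y))^2) <= 2 * L2d (pmu R x) (poly p) f)"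

lemma fdom_borel: "x \<in> fdom R f ==> f \<in> bmeas"
 by (simp add: fdom_def L2_def)

definition truncf :: "(real => real) => nat => real => real" where
 "truncf f n t = (if \<bar>f t\<bar> <= real n then f t else 0)"

lemma truncf_measurable: assumes [measurable]: "f \<in> bmeas" shows "truncf f n \<in> bmeas"
 unfolding truncf_def[abs_def] by measurable

lemma truncf_le: "\<bar>truncf f n t\<bar> <= \<bar>f t\<bar>" by (simp add: truncf_def)

lemma tendsto_of_sq_bound:
 assumes "!!n. ennreal ((norm (y n - l))^2) <= C * d n" "d ---> (0 :: ennreal)" "C < \<infinity>"
 shows "y ---> (l :: 'a::real_normed_vector)"
proof -
 have "(%n. C * d n) ---> C * 0" using assms by (intro ennreal_tendsto_cmult) auto
 then have l: "(%n. C * d n) ---> 0" by simp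
 have "(%n. ennreal ((norm (y n - l))^2)) ---> 0"
  by (rule tendsto_sandwich[OF _ _ tendsto_const l]) (use assms in auto)
 then have "(%n. (norm (y n - l))^2) ---> 0" by (simp add: ennreal_tendsto_0_iff)
 then have "(%n. sqrt ((norm (y n - l))^2)) ---> sqrt 0" by (intro tendsto_real_sqrt)
 then show ?thesis by (simp add: tendsto_norm_zero_iff LIM_zero_iff)
qed

lemma ennreal_tendsto_zero_Cauchy:
 fixes y :: "nat => 'a::real_normed_vector"
 assumes d: "d ---> (0 :: ennreal)" and le: "!!n m. ennreal ((norm (y n - y m))^2) <= 2 * d n + 2 * d m"
 shows "Cauchy y"
proof (rule metric_CauchyI)
 fix e :: real assume e: "e > 0"
 have "\<forall>\<^sub>F n in sequentially. d n < ennreal (e^2 / 8)" using d e by (intro order_tendstoD(2)) auto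
 then obtain N where N: "!!n. n \<ge> N ==> d n < ennreal (e^2 / 8)" unfolding eventually_sequentially by blast
 show "\<exists>M. \<forall>m\<ge>M. \<forall>n\<ge>M. dist (y m) (y n) < e"
 proof (intro exI allI impI)
  fix m n assume mn: "N <= m" "N <= n"
  have "ennreal ((norm (y m - y n))^2) <= 2 * d m + 2 * d n" by (rule le)
  also have "... <= 2 * ennreal (e^2 / 8) + 2 * ennreal (e^2 / 8)"
   using mn by (intro add_mono mult_left_mono N[THEN less_imp_le]) auto
  also have "... = ennreal (e^2 / 2)" by (simp flip: ennreal_plus ennreal_mult' ennreal_numeral)
  finally have "(norm (y m - y n))^2 <= e^2 / 2" using e by simp
  also have "... < e^2" using e by simp
  finally show "dist (y m) (y n) < e" using e by (simp add: dist_norm power2_less_imp_less)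
 qed
qed

context
 fixes R :: "'a::chilbert_space => 'a"
 assumes R: "pcon R"
begin

lemma umeas_pmu: "umeas (pmu R x)" and pmu_poly: "integral\<^sup>L (pmu R x) (poly p) = Re (cinner x (pop R p x))"
 using someI_ex[OF umeas_exists[OF R, of x]] unfolding pmu_def by auto

lemma pmu_unique:
 assumes "umeas \<mu>" "!!p. integral\<^sup>L \<mu> (poly p) = Re (cinner x (pop R p x))" shows "\<mu> = pmu R x"
 using assms by (intro umeas_eqI umeas_pmu) (simp_all add: pmu_poly)

lemma sets_pmu [simp, measurable_cong]: "sets (pmu R x) = sets borel"
 using umeasD(1)[OF umeas_pmu] .

lemma space_pmu [simp]: "space (pmu R x) = UNIV"
 using umeasD(4)[OF umeas_pmu] .

lemma fdom_L2: "x \<in> fdom R f ==> L2 (pmu R x) f"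
 by (simp add: fdom_def)

lemma fdom_bounded:
 assumes "f \<in> bmeas" "!!t. 0 <= t ==> t <= 1 ==> \<bar>f t\<bar> <= B" shows "x \<in> fdom R f"
 unfolding fdom_def using L2_bounded[OF umeas_pmu assms] by simp

lemma fdom_poly: "x \<in> fdom R (poly p)"
 unfolding fdom_def using L2_poly[OF umeas_pmu] by simp

lemma fdom_const: "x \<in> fdom R (%_. c)"
 unfolding fdom_def using L2_const[OF umeas_pmu] by simp

lemma fdom_mono: "x \<in> fdom R g ==> f \<in> bmeas ==> (!!t. 0 <= t ==> t <= 1 ==> \<bar>f t\<bar> <= \<bar>g t\<bar>) ==> x \<in> fdom R f"
 unfolding fdom_def using L2_mono[OF umeas_pmu] by blast

lemma fdom_add: "x \<in> fdom R f ==> x \<in> fdom R g ==> x \<in> fdom R (%t. f t + g t)"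
 unfolding fdom_def using L2_add[OF umeas_pmu] by blast

lemma fdom_diff: "x \<in> fdom R f ==> x \<in> fdom R g ==> x \<in> fdom R (%t. f t - g t)"
 unfolding fdom_def using L2_diff[OF umeas_pmu] by blast

lemma fdom_cmult: "x \<in> fdom R f ==> x \<in> fdom R (%t. c * f t)"
 unfolding fdom_def using L2_cmult[OF umeas_pmu] by blast

lemma pop_L2d: "ennreal ((norm (pop R p x - pop R q x))^2) = L2d (pmu R x) (poly p) (poly q)"
proof -
 have "(norm (pop R p x - pop R q x))^2 = integral\<^sup>L (pmu R x) (poly ((p - q)^2))"
  unfolding pmu_poly pop_diff[symmetric] pop_norm[OF R] ..
 also have "poly ((p - q)^2) = (%t. (poly p t - poly q t)^2)" by auto
 finally show ?thesis by (simp add: L2d_eq_integral umeas_pmu L2_poly)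
qed

lemma fc_approx:
 assumes "finite X" "X ~= {}" "!!x. x \<in> X ==> x \<in> fdom R f"
 shows "\<exists>p :: nat => real poly. \<forall>x\<in>X. (%n. L2d (pmu R x) (poly (p n)) f) ---> 0"
proof -
 have "f \<in> bmeas" using assms fdom_borel by blast
 then have "\<exists>p :: nat => real poly. \<forall>\<mu>\<in>pmu R ` X. (%n. L2d \<mu> (poly (p n)) f) ---> 0"
  using assms umeas_pmu fdom_L2 by (intro polynomial_sequence_L2) auto
 then show ?thesis by simp
qed

lemma fc_bound:
 assumes x: "x \<in> fdom R f"
 shows "ennreal ((norm (pop R p x - fc R f x))^2) <= 2 * L2d (pmu R x) (poly p) f"
proof -
 note [measurable] = fdom_borel[OF x]
 obtain q :: "nat => real poly" where q: "(%n. L2d (pmu R x) (poly (q n)) f) ---> 0"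
  using fc_approx[of "{x}" f] x by auto
 have tri: "ennreal ((norm (pop R p x - pop R (q n) x))^2) <= 2 * L2d (pmu R x) (poly p) f + 2 * L2d (pmu R x) (poly (q n)) f" for p n
  unfolding pop_L2d using L2d_triangle[OF umeas_pmu, of "poly p" f "poly (q n)" x] by (simp add: L2d_commute[of _ f])
 have "Cauchy (%n. pop R (q n) x)"
  by (rule ennreal_tendsto_zero_Cauchy[OF q]) (rule tri)
 then obtain y where y: "(%n. pop R (q n) x) ---> y" using Cauchy_convergent convergent_def by blast
 have "ennreal ((norm (pop R p x - y))^2) <= 2 * L2d (pmu R x) (poly p) f" for p
 proof (rule LIMSEQ_le)
  show "(%n. ennreal ((norm (pop R p x - pop R (q n) x))^2)) ---> ennreal ((norm (pop R p x - y))^2)"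
   by (intro tendsto_ennrealI tendsto_intros y)
  have "(%n. 2 * L2d (pmu R x) (poly p) f + 2 * L2d (pmu R x) (poly (q n)) f) ---> 2 * L2d (pmu R x) (poly p) f + 2 * 0"
   by (intro tendsto_add tendsto_const ennreal_tendsto_cmult q) simp
  then show "(%n. 2 * L2d (pmu R x) (poly p) f + 2 * L2d (pmu R x) (poly (q n)) f) ---> 2 * L2d (pmu R x) (poly p) f" by simp
 qed (use tri in blast)
 then have "\<forall>p. ennreal ((norm (pop R p x - fc R f x))^2) <= 2 * L2d (pmu R x) (poly p) f"
  unfolding fc_def by (intro someI[where P = "%y. \<forall>p. ennreal ((norm (pop R p x - y))^2) <= 2 * L2d (pmu R x) (poly p) f"]) blast
 then show ?thesis by blast
qed

lemma fc_tendsto: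
 assumes "x \<in> fdom R f" "(%n. L2d (pmu R x) (poly (p n)) f) ---> 0"
 shows "(%n. pop R (p n) x) ---> fc R f x"
 by (rule tendsto_of_sq_bound[OF fc_bound[OF assms(1)] assms(2)]) simp

lemma fc_lim:
 assumes "finite X" "X ~= {}" "!!x. x \<in> X ==> x \<in> fdom R f"
 shows "\<exists>p :: nat => real poly. \<forall>x\<in>X. (%n. L2d (pmu R x) (poly (p n)) f) ---> 0 \<and> (%n. pop R (p n) x) ---> fc R f x"
 using fc_approx[OF assms] fc_tendsto assms(3) by meson

text \<open>For fixed x the map sending f to f(R)x is an isometry on L2 of \<open>pmu R x\<close>:
  for polynomials this is the defining property of the measure, and both sides are continuous in
  mean square.\<close>

lemma fc_inner:
 assumes f: "x \<in> fdom R f" and g: "x \<in> fdom R g"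
 shows "cinner (fc R f x) (fc R g x) = cr (integral\<^sup>L (pmu R x) (%t. f t * g t))"
proof -
 obtain p :: "nat => real poly" where p: "(%n. L2d (pmu R x) (poly (p n)) f) ---> 0" "(%n. pop R (p n) x) ---> fc R f x"
  using fc_lim[of "{x}" f] f by auto
 obtain q :: "nat => real poly" where q: "(%n. L2d (pmu R x) (poly (q n)) g) ---> 0" "(%n. pop R (q n) x) ---> fc R g x"
  using fc_lim[of "{x}" g] g by auto
 have eq: "cinner (pop R (p n) x) (pop R (q n) x) = cr (integral\<^sup>L (pmu R x) (%t. poly (p n) t * poly (q n) t))" for n
 proof -
  have "cinner (pop R (p n) x) (pop R (q n) x) = cr (Re (cinner x (pop R (p n * q n) x)))"
   by (metis pop_inner[OF R] pop_real[OF R])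
  also have "... = cr (integral\<^sup>L (pmu R x) (poly (p n * q n)))" by (simp only: pmu_poly)
  also have "poly (p n * q n) = (%t. poly (p n) t * poly (q n) t)" by auto
  finally show ?thesis .
 qed
 have "(%n. cr (integral\<^sup>L (pmu R x) (%t. poly (p n) t * poly (q n) t))) ---> cr (integral\<^sup>L (pmu R x) (%t. f t * g t))"
  by (intro tendsto_of_real L2_integral_tendsto[OF umeas_pmu L2_poly[OF umeas_pmu] L2_poly[OF umeas_pmu] fdom_L2[OF f] fdom_L2[OF g] p(1) q(1)])
 moreover have "(%n. cinner (pop R (p n) x) (pop R (q n) x)) ---> cinner (fc R f x) (fc R g x)"
  by (intro cinner.tendsto p q)
 ultimately show ?thesis unfolding eq by (rule LIMSEQ_unique[rotated])
qed

lemma fc_norm: "x \<in> fdom R f ==> (norm (fc R f x))^2 = integral\<^sup>L (pmu R x) (%t. (f t)^2)"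
 unfolding norm2_cinner by (simp add: fc_inner) (simp add: power2_eq_square)

lemma fc_norm_nn: "x \<in> fdom R f ==> ennreal ((norm (fc R f x))^2) = (\<integral>\<^sup>+t. ennreal ((f t)^2) \<partial>pmu R x)"
 unfolding fc_norm using L2_integrable_square[OF umeas_pmu fdom_L2] by (intro nn_integral_eq_integral[symmetric]) auto

lemma fc_L2d:
 assumes f: "x \<in> fdom R f" and g: "x \<in> fdom R g"
 shows "ennreal ((norm (fc R f x - fc R g x))^2) = L2d (pmu R x) f g"
proof -
 have "cinner (fc R f x - fc R g x) (fc R f x - fc R g x) = cr
   (integral\<^sup>L (pmu R x) (%t. f t * f t) - integral\<^sup>L (pmu R x) (%t. f t * g t)
   - (integral\<^sup>L (pmu R x) (%t. g t * f t) - integral\<^sup>L (pmu R x) (%t. g t * g t)))"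
  by (simp add: cinner.diff_left cinner.diff_right fc_inner f g)
 also have "integral\<^sup>L (pmu R x) (%t. f t * f t) - integral\<^sup>L (pmu R x) (%t. f t * g t)
   - (integral\<^sup>L (pmu R x) (%t. g t * f t) - integral\<^sup>L (pmu R x) (%t. g t * g t)) =
   integral\<^sup>L (pmu R x) (%t. f t * f t - f t * g t - (g t * f t - g t * g t))"
  using L2_integrable_mult[OF umeas_pmu fdom_L2 fdom_L2] f g by (simp add: mult.commute)
 also have "(%t. f t * f t - f t * g t - (g t * f t - g t * g t)) = (%t. (f t - g t)^2)"
  by (auto simp: power2_eq_square algebra_simps)
 finally have "(norm (fc R f x - fc R g x))^2 = integral\<^sup>L (pmu R x) (%t. (f t - g t)^2)"
  by (simp add: norm2_cinner)
 then show ?thesis using f g by (simp add: L2d_eq_integral umeas_pmu fdom_L2)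
qed

lemma fc_eqI:
 assumes "x \<in> fdom R f" "!!n. pop R (p n) x = y n" "(%n::nat. L2d (pmu R x) (poly (p n)) f) ---> 0" "y ---> l"
 shows "fc R f x = l"
 using fc_tendsto[OF assms(1,3)] assms(2,4) LIMSEQ_unique by simp

lemma fc_poly: "fc R (poly p) x = pop R p x"
 by (rule fc_eqI[where p = "%_. p" and y = "%_. pop R p x"]) (auto simp: fdom_poly L2d_def)

lemma fc_const: "fc R (%_. c) x = c *\<^sub>R x"
 using fc_poly[of "[:c:]" x] by (simp add: pop_const poly_pCons[abs_def])

lemma fc_ident: "fc R (%t. t) x = R x"
 using fc_poly[of "[:0, 1:]" x] by (simp add: pop_X[OF R] poly_pCons[abs_def])

lemma fdom_ident: "x \<in> fdom R (%t. t)"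
 using fdom_poly[of x "[:0, 1:]"] by (simp add: poly_pCons[abs_def])

lemma fc_cong_AE:
 assumes "AE t in pmu R x. f t = g t" shows "fc R f x = fc R g x"
proof -
 have "L2d (pmu R x) (poly p) f = L2d (pmu R x) (poly p) g" for p
  unfolding L2d_def by (rule nn_integral_cong_AE) (use assms in eventually_elim, simp)
 then show ?thesis by (simp add: fc_def)
qed

lemma AE_pmu: "AE t in pmu R x. 0 <= t \<and> t <= 1"
 using umeasD(3)[OF umeas_pmu] .

lemma fc_cong: "(!!t. 0 <= t ==> t <= 1 ==> f t = g t) ==> fc R f x = fc R g x"
 by (rule fc_cong_AE) (use AE_pmu[of x] in eventually_elim, simp)

lemma fc_add:
 assumes f: "x \<in> fdom R f" and g: "x \<in> fdom R g"
 shows "fc R (%t. f t + g t) x = fc R f x + fc R g x"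
proof -
 note [measurable] = fdom_borel[OF f] fdom_borel[OF g]
 obtain p :: "nat => real poly" where p: "(%n. L2d (pmu R x) (poly (p n)) f) ---> 0" "(%n. pop R (p n) x) ---> fc R f x"
  using fc_lim[of "{x}" f] f by auto
 obtain q :: "nat => real poly" where q: "(%n. L2d (pmu R x) (poly (q n)) g) ---> 0" "(%n. pop R (q n) x) ---> fc R g x"
  using fc_lim[of "{x}" g] g by auto
 show ?thesis
 proof (rule fc_eqI[where p = "%n. p n + q n" and y = "%n. pop R (p n) x + pop R (q n) x"])
  have le: "L2d (pmu R x) (poly (p n + q n)) (%t. f t + g t) <= 2 * L2d (pmu R x) (poly (p n)) f + 2 * L2d (pmu R x) (poly (q n)) g" for n
  proof -
   have "L2d (pmu R x) (poly (p n + q n)) (%t. f t + g t) <= 2 * L2d (pmu R x) (poly (p n + q n)) (%t. f t + poly (q n) t)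
     + 2 * L2d (pmu R x) (%t. f t + poly (q n) t) (%t. f t + g t)"
    by (rule L2d_triangle[OF umeas_pmu]) auto
   then show ?thesis by (simp add: L2d_def)
  qed
  have "(%n. 2 * L2d (pmu R x) (poly (p n)) f + 2 * L2d (pmu R x) (poly (q n)) g) ---> 2 * 0 + 2 * 0"
   by (intro tendsto_add ennreal_tendsto_cmult p q) auto
  then have l: "(%n. 2 * L2d (pmu R x) (poly (p n)) f + 2 * L2d (pmu R x) (poly (q n)) g) ---> 0" by simp
  show "(%n. L2d (pmu R x) (poly (p n + q n)) (%t. f t + g t)) ---> 0"
   by (rule tendsto_sandwich[OF _ _ tendsto_const l]) (use le in auto)
 qed (use f g p q in \<open>auto intro!: fdom_add tendsto_add simp: pop_add\<close>)
qed

lemma fc_poly_mult: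
 assumes f: "x \<in> fdom R f"
 shows "x \<in> fdom R (%t. poly p t * f t)" "fc R (%t. poly p t * f t) x = pop R p (fc R f x)"
proof -
 note [measurable] = fdom_borel[OF f]
 obtain B where B: "!!t. 0 <= t ==> t <= 1 ==> \<bar>poly p t\<bar> <= B" using poly_bounded01 by metis
 show d: "x \<in> fdom R (%t. poly p t * f t)"
 proof (rule fdom_mono[OF fdom_cmult[OF f, of B]])
  fix t :: real assume "0 <= t" "t <= 1"
  with B[of t] show "\<bar>poly p t * f t\<bar> <= \<bar>B * f t\<bar>" by (auto simp: abs_mult intro!: mult_right_mono)
 qed measurable
 obtain q :: "nat => real poly" where q: "(%n. L2d (pmu R x) (poly (q n)) f) ---> 0" "(%n. pop R (q n) x) ---> fc R f x"
  using fc_lim[of "{x}" f] f by auto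
 show "fc R (%t. poly p t * f t) x = pop R p (fc R f x)"
 proof (rule fc_eqI[OF d, where p = "%n. p * q n" and y = "%n. pop R p (pop R (q n) x)"])
  have le: "L2d (pmu R x) (poly (p * q n)) (%t. poly p t * f t) <= ennreal (B^2) * L2d (pmu R x) (poly (q n)) f" for n
  proof -
   have "L2d (pmu R x) (poly (p * q n)) (%t. poly p t * f t) <= (\<integral>\<^sup>+t. ennreal (B^2) * ennreal ((poly (q n) t - f t)^2) \<partial>pmu R x)"
    unfolding L2d_def
   proof (rule nn_integral_mono_AE)
    show "AE t in pmu R x. ennreal ((poly (p * q n) t - poly p t * f t)^2) <= ennreal (B^2) * ennreal ((poly (q n) t - f t)^2)"
     using AE_pmu[of x]
    proof eventually_elim
     case (elim t)
     have "(poly p t)^2 <= B^2" using B[of t] elim by (intro abs_le_square_iff[THEN iffD1]) auto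
     then show ?case
      by (simp flip: ennreal_mult' right_diff_distrib add: power_mult_distrib ennreal_leI mult_right_mono)
    qed
   qed
   also have "... = ennreal (B^2) * L2d (pmu R x) (poly (q n)) f" unfolding L2d_def by (rule nn_integral_cmult) measurable
   finally show ?thesis .
  qed
  have "(%n. ennreal (B^2) * L2d (pmu R x) (poly (q n)) f) ---> ennreal (B^2) * 0"
   by (intro ennreal_tendsto_cmult q) auto
  then have l: "(%n. ennreal (B^2) * L2d (pmu R x) (poly (q n)) f) ---> 0" by simp
  show "(%n. L2d (pmu R x) (poly (p * q n)) (%t. poly p t * f t)) ---> 0"
   by (rule tendsto_sandwich[OF _ _ tendsto_const l]) (use le in auto)
  show "(%n. pop R p (pop R (q n) x)) ---> pop R p (fc R f x)"
   by (rule bcl_tendsto[OF bcl_pop[OF R] q(2)])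
 qed (simp add: pop_mult[OF R])
qed

lemma fc_cmult:
 assumes f: "x \<in> fdom R f" shows "fc R (%t. c * f t) x = c *\<^sub>R fc R f x"
 using fc_poly_mult(2)[OF f, of "[:c:]"] by (simp add: pop_const)

lemma fc_diff:
 assumes "x \<in> fdom R f" "x \<in> fdom R g" shows "fc R (%t. f t - g t) x = fc R f x - fc R g x"
 using fc_add[OF assms(1) fdom_cmult[OF assms(2), of "-1"]] fc_cmult[OF assms(2), of "-1"] by simp

text \<open>The polynomial moments of f(R)x are the integrals of f p f, and these determine the
  measure. The formula converts conditions at the vector f(R)x into conditions at x, which is what
  makes composition of unbounded functions (\<open>fdom_fc\<close>, \<open>fc_fc\<close>) exact,
  domains included.\<close>

lemma pmu_fc:
 assumes f: "x \<in> fdom R f"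
 shows "pmu R (fc R f x) = density (pmu R x) (%t. ennreal ((f t)^2))"
proof (rule sym, rule pmu_unique)
 note [measurable] = fdom_borel[OF f]
 have "emeasure (density (pmu R x) (%t. ennreal ((f t)^2))) UNIV = (\<integral>\<^sup>+t. ennreal ((f t)^2) \<partial>pmu R x)"
  by (subst emeasure_density) auto
 then have "emeasure (density (pmu R x) (%t. ennreal ((f t)^2))) UNIV ~= \<infinity>"
  using fdom_L2[OF f] by (simp add: L2_def)
 then show "umeas (density (pmu R x) (%t. ennreal ((f t)^2)))"
  unfolding umeas_def using AE_pmu[of x] by (auto simp: AE_density intro!: finite_measureI)
 fix p
 have "integral\<^sup>L (density (pmu R x) (%t. ennreal ((f t)^2))) (poly p) = integral\<^sup>L (pmu R x) (%t. f t * (poly p t * f t))"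
  by (subst integral_density) (auto simp: power2_eq_square ac_simps)
 also have "... = Re (cinner (fc R f x) (pop R p (fc R f x)))"
  using fc_inner[OF f fc_poly_mult(1)[OF f, of p]] fc_poly_mult(2)[OF f, of p] by simp
 finally show "integral\<^sup>L (density (pmu R x) (%t. ennreal ((f t)^2))) (poly p) = Re (cinner (fc R f x) (pop R p (fc R f x)))" .
qed

lemma nn_integral_pmu_fc:
 assumes f: "x \<in> fdom R f" and [measurable]: "g \<in> bmeas"
 shows "(\<integral>\<^sup>+t. g t \<partial>pmu R (fc R f x)) = (\<integral>\<^sup>+t. ennreal ((f t)^2) * g t \<partial>pmu R x)"
 unfolding pmu_fc[OF f] using fdom_borel[OF f] by (intro nn_integral_density) auto

lemma fdom_fc:
 assumes f: "x \<in> fdom R f" and [measurable]: "g \<in> bmeas"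
 shows "fc R f x \<in> fdom R g \<longleftrightarrow> x \<in> fdom R (%t. g t * f t)"
 using fdom_borel[OF f] by (simp add: fdom_def L2_def nn_integral_pmu_fc[OF f] power_mult_distrib ennreal_mult mult.commute)

lemma fc_fc:
 assumes f: "x \<in> fdom R f" and fg: "x \<in> fdom R (%t. g t * f t)" and [measurable]: "g \<in> bmeas"
 shows "fc R g (fc R f x) = fc R (%t. g t * f t) x"
proof -
 note [measurable] = fdom_borel[OF f]
 have g: "fc R f x \<in> fdom R g" using fdom_fc[OF f] fg by simp
 obtain p :: "nat => real poly" where p: "(%n. L2d (pmu R (fc R f x)) (poly (p n)) g) ---> 0" "(%n. pop R (p n) (fc R f x)) ---> fc R g (fc R f x)"
  using fc_lim[of "{fc R f x}" g] g by auto
 have "L2d (pmu R (fc R f x)) (poly (p n)) g = L2d (pmu R x) (%t. poly (p n) t * f t) (%t. g t * f t)" for n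
  unfolding L2d_def
  by (subst nn_integral_pmu_fc[OF f]) (auto simp flip: ennreal_mult' power_mult_distrib simp: algebra_simps intro!: nn_integral_cong)
 then have "ennreal ((norm (pop R (p n) (fc R f x) - fc R (%t. g t * f t) x))^2) = L2d (pmu R (fc R f x)) (poly (p n)) g" for n
  by (simp add: fc_L2d[OF fc_poly_mult(1)[OF f] fg, symmetric] fc_poly_mult(2)[OF f])
 then have "(%n. pop R (p n) (fc R f x)) ---> fc R (%t. g t * f t) x"
  by (intro tendsto_of_sq_bound[OF _ p(1), of _ _ 1]) auto
 then show ?thesis using p(2) LIMSEQ_unique by blast
qed

lemma fc_tendsto_dominated:
 assumes W: "x \<in> fdom R W" and [measurable]: "!!n. g n \<in> bmeas" "f \<in> bmeas"
  and le: "!!n t. 0 <= t ==> t <= 1 ==> \<bar>g n t\<bar> <= \<bar>W t\<bar>" "!!t. 0 <= t ==> t <= 1 ==> \<bar>f t\<bar> <= \<bar>W t\<bar>"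
  and lim: "AE t in pmu R x. (%n. g n t) ---> f t"
 shows "(%n::nat. fc R (g n) x) ---> fc R f x"
proof -
 note [measurable] = fdom_borel[OF W]
 have g: "x \<in> fdom R (g n)" for n using le by (intro fdom_mono[OF W]) auto
 have f: "x \<in> fdom R f" using le by (intro fdom_mono[OF W]) auto
 have "(%n. L2d (pmu R x) (g n) f) ---> (\<integral>\<^sup>+t. 0 \<partial>pmu R x)"
  unfolding L2d_def
 proof (rule nn_integral_dominated_convergence)
  show "AE t in pmu R x. ennreal ((g n t - f t)^2) <= ennreal ((2 * W t)^2)" for n
   using AE_pmu[of x]
  proof eventually_elim
   case (elim t)
   then have "\<bar>g n t - f t\<bar> <= \<bar>2 * W t\<bar>" using le(1)[of t n] le(2)[of t] by linarith
   then show ?case by (intro ennreal_leI) (simp only: abs_le_square_iff)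
  qed
  show "(\<integral>\<^sup>+t. ennreal ((2 * W t)^2) \<partial>pmu R x) < \<infinity>"
   using fdom_L2[OF fdom_cmult[OF W, of 2]] by (simp add: L2_def)
  show "AE t in pmu R x. (%n. ennreal ((g n t - f t)^2)) ---> 0"
   using lim
  proof eventually_elim
   case (elim t)
   then have "(%n. ennreal ((g n t - f t)^2)) ---> ennreal ((f t - f t)^2)" by (intro tendsto_ennrealI tendsto_intros)
   then show ?case by simp
  qed
 qed measurable
 then have "(%n. L2d (pmu R x) (g n) f) ---> 0" by simp
 then show ?thesis using fc_L2d[OF g f] by (intro tendsto_of_sq_bound[of _ _ 1]) auto
qed

lemma fc_sym:
 assumes x: "x \<in> fdom R f" and y: "y \<in> fdom R f" shows "cinner (fc R f x) y = cinner x (fc R f y)"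
proof -
 obtain p :: "nat => real poly" where p: "(%n. pop R (p n) x) ---> fc R f x" "(%n. pop R (p n) y) ---> fc R f y"
  using fc_lim[of "{x, y}" f] x y by auto
 have "(%n. cinner (pop R (p n) x) y) ---> cinner (fc R f x) y" "(%n. cinner x (pop R (p n) y)) ---> cinner x (fc R f y)"
  by (intro cinner.tendsto p tendsto_const)+
 then show ?thesis unfolding pop_sym[OF R] using LIMSEQ_unique by blast
qed

lemma fc_additive:
 assumes "x \<in> fdom R f" "y \<in> fdom R f" "x + y \<in> fdom R f" shows "fc R f (x + y) = fc R f x + fc R f y"
proof -
 obtain p :: "nat => real poly" where p: "(%n. pop R (p n) x) ---> fc R f x" "(%n. pop R (p n) y) ---> fc R f y"
   "(%n. pop R (p n) (x + y)) ---> fc R f (x + y)"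
  using fc_lim[of "{x, y, x + y}" f] assms by auto
 then have "(%n. pop R (p n) (x + y)) ---> fc R f x + fc R f y"
  using tendsto_add[OF p(1,2)] by (simp add: bcl_add[OF bcl_pop[OF R]])
 then show ?thesis using p LIMSEQ_unique by blast
qed

lemma fc_commute_weak:
 assumes X: "bcl X" and XR: "!!x. X (R x) = R (X x)" and "x \<in> fdom R f" "X x \<in> fdom R f"
 shows "fc R f (X x) = X (fc R f x)"
proof -
 obtain p :: "nat => real poly" where p: "(%n. pop R (p n) x) ---> fc R f x" "(%n. pop R (p n) (X x)) ---> fc R f (X x)"
  using fc_lim[of "{x, X x}" f] assms by auto
 then show ?thesis
  using bcl_tendsto[OF X p(1)] by (simp add: pop_commute[OF R X XR] LIMSEQ_unique)
qed

lemma truncf_fdom: "f \<in> bmeas ==> x \<in> fdom R (truncf f n)"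
 by (rule fdom_bounded[OF truncf_measurable, of _ _ "real n"]) (auto simp: truncf_def)

text \<open>Monotone convergence turns a uniform bound on the truncations into membership in the
  domain. Since \<open>pmu R x\<close> is not additive in x, closure of \<open>fdom\<close> under
  sums and under commuting operators is reached only this way.\<close>

lemma fdom_truncfI:
 assumes [measurable]: "f \<in> bmeas" and le: "!!n. (norm (fc R (truncf f n) x))^2 <= C"
 shows "x \<in> fdom R f"
proof -
 note [measurable] = truncf_measurable[OF assms(1)]
 have tr: "(truncf f n t)^2 = (if \<bar>f t\<bar> <= real n then (f t)^2 else 0)" for n t
  by (simp add: truncf_def)
 have lim: "(%n. ennreal ((truncf f n t)^2)) ---> ennreal ((f t)^2)" for t
 proof -
  obtain m where "\<bar>f t\<bar> <= real m" using real_arch_simple by blast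
  then have "(truncf f n t)^2 = (f t)^2" if "m <= n" for n using that unfolding tr by auto
  then show ?thesis by (intro tendsto_eventually eventually_sequentiallyI[of m]) auto
 qed
 have "(%n. \<integral>\<^sup>+t. ennreal ((truncf f n t)^2) \<partial>pmu R x) ---> (\<integral>\<^sup>+t. ennreal ((f t)^2) \<partial>pmu R x)"
 proof (rule nn_integral_LIMSEQ)
  show "incseq (%n t. ennreal ((truncf f n t)^2))"
   unfolding tr by (auto simp: incseq_def le_fun_def intro!: ennreal_leI)
 qed (use lim in auto)
 moreover have "(\<integral>\<^sup>+t. ennreal ((truncf f n t)^2) \<partial>pmu R x) <= ennreal C" for n
  unfolding fc_norm_nn[OF truncf_fdom[OF assms(1)], symmetric] by (intro ennreal_leI le)
 ultimately have "(\<integral>\<^sup>+t. ennreal ((f t)^2) \<partial>pmu R x) <= ennreal C"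
  by (intro LIMSEQ_le_const2) auto
 then have "(\<integral>\<^sup>+t. ennreal ((f t)^2) \<partial>pmu R x) < \<infinity>" by (simp add: le_less_trans)
 then show ?thesis by (simp add: fdom_def L2_def)
qed

lemma truncf_norm_le: "x \<in> fdom R f ==> norm (fc R (truncf f n) x) <= norm (fc R f x)"
proof -
 assume x: "x \<in> fdom R f"
 have "ennreal ((norm (fc R (truncf f n) x))^2) <= ennreal ((norm (fc R f x))^2)"
  unfolding fc_norm_nn[OF x] fc_norm_nn[OF truncf_fdom[OF fdom_borel[OF x]]]
  by (intro nn_integral_mono ennreal_leI) (auto simp: abs_le_square_iff[symmetric] truncf_le)
 then have "(norm (fc R (truncf f n) x))^2 <= (norm (fc R f x))^2" by simp
 then show ?thesis by (rule power2_le_imp_le) simp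
qed

lemma fdom_add_vec:
 assumes x: "x \<in> fdom R f" and y: "y \<in> fdom R f" shows "x + y \<in> fdom R f"
proof (rule fdom_truncfI[OF fdom_borel[OF x]])
 fix n
 note b = truncf_fdom[OF fdom_borel[OF x]]
 have "norm (fc R (truncf f n) (x + y)) <= norm (fc R f x) + norm (fc R f y)"
  unfolding fc_additive[OF b b b] using truncf_norm_le[OF x, of n] truncf_norm_le[OF y, of n] norm_triangle_ineq
  by (smt (verit))
 then show "(norm (fc R (truncf f n) (x + y)))^2 <= (norm (fc R f x) + norm (fc R f y))^2"
  by (intro power_mono) auto
qed

lemma fdom_commute:
 assumes X: "bcl X" and XR: "!!x. X (R x) = R (X x)" and x: "x \<in> fdom R f"
 shows "X x \<in> fdom R f"
proof -
 obtain K where K: "K > 0" "!!x. norm (X x) <= K * norm x" using bcl_bound[OF X] by auto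
 show ?thesis
 proof (rule fdom_truncfI[OF fdom_borel[OF x]])
  fix n
  note b = truncf_fdom[OF fdom_borel[OF x]]
  have "norm (fc R (truncf f n) (X x)) <= K * norm (fc R (truncf f n) x)"
   unfolding fc_commute_weak[OF X XR b b] by (rule K)
  also have "... <= K * norm (fc R f x)" using K truncf_norm_le[OF x] by (intro mult_left_mono) auto
  finally show "(norm (fc R (truncf f n) (X x)))^2 <= (K * norm (fc R f x))^2" by (intro power_mono) auto
 qed
qed

lemma fc_commute:
 assumes X: "bcl X" and XR: "!!x. X (R x) = R (X x)" and x: "x \<in> fdom R f"
 shows "fc R f (X x) = X (fc R f x)"
 by (rule fc_commute_weak[OF X XR x fdom_commute[OF X XR x]])

lemma fc_scaleC:
 assumes x: "x \<in> fdom R f" shows "c *\<^sub>C x \<in> fdom R f" "fc R f (c *\<^sub>C x) = c *\<^sub>C fc R f x"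
proof -
 have X: "bcl (%x::'a. c *\<^sub>C x)" using bcl_cmult[OF bcl_id(1)] .
 have XR: "c *\<^sub>C R x = R (c *\<^sub>C x)" for x using R by (simp add: pcon_def bcl_scaleC)
 show "c *\<^sub>C x \<in> fdom R f" "fc R f (c *\<^sub>C x) = c *\<^sub>C fc R f x"
  using fdom_commute[OF X XR x] fc_commute[OF X XR x] by auto
qed

lemma fc_plus: "x \<in> fdom R f ==> y \<in> fdom R f ==> fc R f (x + y) = fc R f x + fc R f y"
 by (simp add: fc_additive fdom_add_vec)

lemma fc_norm_bound:
 assumes f: "f \<in> bmeas" and B: "!!t. 0 <= t ==> t <= 1 ==> \<bar>f t\<bar> <= B"
 shows "norm (fc R f x) <= B * norm x"
proof -
 note [measurable] = f
 have x: "x \<in> fdom R f" by (rule fdom_bounded[OF f B])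
 have "0 <= B" using B[of 0] by simp
 have "ennreal ((norm (fc R f x))^2) <= (\<integral>\<^sup>+t. ennreal (B^2) \<partial>pmu R x)"
  unfolding fc_norm_nn[OF x]
 proof (rule nn_integral_mono_AE)
  show "AE t in pmu R x. ennreal ((f t)^2) <= ennreal (B^2)"
   using AE_pmu[of x]
  proof eventually_elim
   case (elim t)
   then have "\<bar>f t\<bar> <= \<bar>B\<bar>" using B[of t] by linarith
   then show ?case by (intro ennreal_leI) (simp only: abs_le_square_iff)
  qed
 qed
 also have "... = ennreal ((norm (fc R (%_. B) x))^2)"
  by (rule fc_norm_nn[OF fdom_const, symmetric])
 also have "... = ennreal ((B * norm x)^2)" using \<open>0 <= B\<close> by (simp add: fc_const)
 finally have "(norm (fc R f x))^2 <= (B * norm x)^2" by simp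
 then show ?thesis using \<open>0 <= B\<close> by (intro power2_le_imp_le[of "norm (fc R f x)"]) auto
qed

lemma bcl_fc:
 assumes f: "f \<in> bmeas" and B: "!!t. 0 <= t ==> t <= 1 ==> \<bar>f t\<bar> <= B"
 shows "bcl (fc R f)"
proof (rule bclI[where K=B])
 note x = fdom_bounded[OF f B]
 show "fc R f (x + y) = fc R f x + fc R f y" for x y by (intro fc_plus x)
 show "fc R f (c *\<^sub>C x) = c *\<^sub>C fc R f x" for c x by (intro fc_scaleC x)
 show "norm (fc R f x) <= B * norm x" for x by (rule fc_norm_bound[OF f B])
qed

end

section \<open>The absolute value of a closed operator\<close>

definition fcgr :: "('a::chilbert_space => 'a) => (real => real) => 'a graph" where
 "fcgr R f = {(x, fc R f x) | x. x \<in> fdom R f}"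

definition chi :: "(real => real) => nat => real => real" where
 "chi f n t = (if \<bar>f t\<bar> <= real n then 1 else 0)"

lemma chi_measurable: assumes [measurable]: "f \<in> bmeas" shows "chi f n \<in> bmeas"
 unfolding chi_def[abs_def] by measurable

lemma truncf_chi: "f t * chi f n t = truncf f n t" by (simp add: chi_def truncf_def)

lemma chi_LIMSEQ: "(%n. chi f n t) ---> 1"
proof -
 obtain m where m: "\<bar>f t\<bar> <= real m" using real_arch_simple by blast
 show ?thesis
  by (rule tendsto_eventually, rule eventually_sequentiallyI[of m]) (use m in \<open>auto simp: chi_def\<close>)
qed

lemma truncf_LIMSEQ: "(%n. truncf f n t) ---> f t"
 using tendsto_mult[OF tendsto_const chi_LIMSEQ, of "f t" f t] by (simp add: truncf_chi)

context
 fixes R :: "'a::chilbert_space => 'a"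
 assumes R: "pcon R"
begin

lemma chi_fdom: "f \<in> bmeas ==> x \<in> fdom R (chi f n)"
 by (rule fdom_bounded[OF R chi_measurable, of _ _ 1]) (auto simp: chi_def)

lemma bcl_chi: "f \<in> bmeas ==> bcl (fc R (chi f n))"
 by (rule bcl_fc[OF R chi_measurable, of _ _ 1]) (auto simp: chi_def)

lemma chi_norm: "f \<in> bmeas ==> norm (fc R (chi f n) x) <= norm x"
 using fc_norm_bound[OF R chi_measurable, of f n 1 x] by (auto simp: chi_def)

lemma fc_chi_tendsto: "f \<in> bmeas ==> (%n. fc R (chi f n) x) ---> x"
 using fc_tendsto_dominated[OF R fdom_const[OF R, of x 1], where g = "chi f" and f = "%_. 1"] chi_LIMSEQ[of f] chi_measurable
 by (simp add: fc_const[OF R]) (simp add: chi_def)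

lemma fc_chi:
 assumes f: "f \<in> bmeas"
 shows "fc R (chi f n) x \<in> fdom R f" "fc R f (fc R (chi f n) x) = fc R (truncf f n) x"
proof -
 have "x \<in> fdom R (%t. f t * chi f n t)" using truncf_fdom[OF R f] by (simp add: truncf_chi)
 then show "fc R (chi f n) x \<in> fdom R f" "fc R f (fc R (chi f n) x) = fc R (truncf f n) x"
  using fdom_fc[OF R chi_fdom[OF f] f] fc_fc[OF R chi_fdom[OF f] _ f] by (simp_all add: truncf_chi)
qed

lemma fc_truncf_tendsto: "x \<in> fdom R f ==> (%n. fc R (truncf f n) x) ---> fc R f x"
 using fdom_borel[of x R f]
 by (intro fc_tendsto_dominated[OF R, where W = f]) (auto simp: truncf_LIMSEQ truncf_le truncf_measurable)

lemma fdom_dense: "f \<in> bmeas ==> closure (fdom R f) = UNIV"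
 using fc_chi_tendsto[of f] fc_chi(1)[of f] by (auto simp: closure_sequential) metis

text \<open>Testing a point (y, z) of the adjoint on cut-off vectors, where f is bounded, shows that
  the n-th truncation of f(R) sends y to the n-th cut-off of z. These are bounded by |z|, so y is in
  the domain, and n tends to infinity.\<close>

lemma fcgr_selfadjoint:
 assumes f: "f \<in> bmeas" shows "adj (fcgr R f) = fcgr R f"
proof
 show "fcgr R f \<subseteq> adj (fcgr R f)"
  using fc_sym[OF R] by (auto simp: fcgr_def adj_iff)
 show "adj (fcgr R f) \<subseteq> fcgr R f"
 proof clarify
  fix y z assume "(y, z) \<in> adj (fcgr R f)"
  then have yz: "cinner (fc R f x) y = cinner x z" if "x \<in> fdom R f" for x
   using that by (auto simp: fcgr_def adj_iff)
  have eq: "fc R (truncf f n) y = fc R (chi f n) z" for n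
  proof (rule cinner_ext)
   fix w
   have "cinner w (fc R (truncf f n) y) = cinner (fc R (truncf f n) w) y"
    by (rule fc_sym[OF R truncf_fdom[OF R f] truncf_fdom[OF R f], symmetric])
   also have "... = cinner (fc R (chi f n) w) z" using yz[OF fc_chi(1)[OF f]] by (simp add: fc_chi[OF f])
   also have "... = cinner w (fc R (chi f n) z)" by (rule fc_sym[OF R chi_fdom[OF f] chi_fdom[OF f]])
   finally show "cinner w (fc R (truncf f n) y) = cinner w (fc R (chi f n) z)" .
  qed
  have y: "y \<in> fdom R f"
   by (rule fdom_truncfI[OF R f, of _ "(norm z)^2"]) (simp add: eq chi_norm[OF f] power_mono)
  have "fc R f y = z"
   using fc_truncf_tendsto[OF y] fc_chi_tendsto[OF f, of z] LIMSEQ_unique unfolding eq by blast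
  then show "(y, z) \<in> fcgr R f" using y by (auto simp: fcgr_def)
 qed
qed

lemma Domain_fcgr: "Domain (fcgr R f) = fdom R f" by (auto simp: fcgr_def)

lemma closed_dd_fcgr: assumes f: "f \<in> bmeas" shows "closed_dd_op (fcgr R f)"
 unfolding closed_dd_op_def Domain_fcgr
 using csub_adjoint[of "fcgr R f"] closed_op_adjoint[of "fcgr R f"] fdom_dense[OF f]
 by (auto simp: fcgr_selfadjoint[OF f] single_valued_def) (auto simp: fcgr_def)

lemma fc_quadratic: "x \<in> fdom R f ==> cinner x (fc R f x) = cr (integral\<^sup>L (pmu R x) f)"
 using fc_inner[OF R fdom_const[OF R, of x 1], of f] by (simp add: fc_const[OF R])

lemma psa_fcgr:
 assumes f: "f \<in> bmeas" and pos: "!!t. 0 <= f t" shows "positive_selfadjoint (fcgr R f)"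
proof -
 have "cinner x (fc R f x) \<in> \<real>\<^sub>\<ge>\<^sub>0" if "x \<in> fdom R f" for x
  using fc_quadratic[OF that] pos by (simp add: complex_nonneg_Reals_iff)
 then show ?thesis
  unfolding positive_selfadjoint_def using closed_dd_fcgr[OF f] fcgr_selfadjoint[OF f] by (auto simp: fcgr_def)
qed

end

text \<open>Solves t = 1/(1 + s^2) for s \<ge> 0. Since \<open>Rop a\<close> is (1 + |a|^2)^(-1),
  applying \<open>lam\<close> to it gives |a|. The value at 0 is irrelevant because
  \<open>Rop a\<close> is injective, see \<open>AE_pmu_Rop\<close>.\<close>

definition lam :: "real => real" where
 "lam t = (if 0 < t \<and> t <= 1 then sqrt (1 / t - 1) else 0)"

lemma lam_meas [measurable]: "lam \<in> bmeas"
 unfolding lam_def[abs_def] by measurable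

lemma lam_nonneg: "0 <= lam t" by (simp add: lam_def)

lemma lam_sq: "0 < t ==> t <= 1 ==> (lam t)^2 = 1 / t - 1"
 by (simp add: lam_def)

lemma lam_le_iff: "0 < t ==> t <= 1 ==> 0 <= s ==> lam t <= s \<longleftrightarrow> 1 / t <= s^2 + 1"
 using lam_sq[of t] lam_nonneg[of t] abs_le_square_iff[of "lam t" s] by auto

definition absg :: "'a::chilbert_space graph => 'a graph" where
 "absg a = fcgr (Rop a) lam"

text \<open>\<open>kap k\<close> is \<open>k(t) / t\<close>; thus \<open>Bop a \<circ> fc (Rop a) (kap k) = a k(Rop a)\<close>.\<close>

definition kap :: "(real => real) => real => real" where
 "kap k t = (if 0 < t \<and> t <= 1 then k t / t else 0)"

lemma kap_measurable: assumes [measurable]: "k \<in> bmeas" shows "kap k \<in> bmeas"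
 unfolding kap_def[abs_def] by measurable

lemma kap_bound:
 assumes "!!t. 0 < t ==> t <= 1 ==> \<bar>k t\<bar> <= C" "!!t. 0 < t ==> t <= 1 ==> k t ~= 0 ==> lam t <= s" "0 <= s" "0 <= C"
 shows "\<bar>kap k t\<bar> <= C * (s^2 + 1)"
proof (cases "0 < t \<and> t <= 1 \<and> k t ~= 0")
 case True
 then have "1 / t <= s^2 + 1" using assms(2,3) lam_le_iff by blast
 then have "\<bar>k t\<bar> * (1 / t) <= C * (s^2 + 1)" using assms(1) True assms(4) by (intro mult_mono) auto
 then show ?thesis using True by (simp add: kap_def abs_divide)
next
 case False
 then show ?thesis using assms(3,4) by (auto simp: kap_def)
qed

context
 fixes a :: "'a::chilbert_space graph"
 assumes a: "closed_dd_op a"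
begin

private abbreviation "R \<equiv> Rop a"
private lemmas pR = pcon_Rop[OF a]

text \<open>The spectral projection of R at 0 produces a vector annihilated by R, and
  \<open>Rop a\<close> is injective; so {0} is a null set of every scalar spectral measure.\<close>

lemma AE_pmu_Rop: "AE t in pmu R x. 0 < t \<and> t <= 1"
proof -
 have d: "x \<in> fdom R (ind {0})" by (rule fdom_bounded[OF pR, of _ 1]) (auto simp: indicator_def)
 have "R (fc R (ind {0}) x) = fc R (%t. poly [:0, 1:] t * ind {0} t) x"
  by (simp only: fc_poly_mult(2)[OF pR d] pop_X[OF pR])
 also have "(%t. poly [:0, 1:] t * ind {0} t) = (%_. 0 :: real)" by (auto simp: indicator_def)
 also have "fc R (%_. 0) x = 0" by (simp add: fc_const[OF pR])
 finally have "fc R (ind {0}) x = 0" by (rule Rop_inj[OF a])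
 then have "(\<integral>\<^sup>+t. ennreal ((ind {0} t)^2) \<partial>pmu R x) = 0"
  using fc_norm_nn[OF pR d] by simp
 moreover have "(%t::real. ennreal ((ind {0} t)^2)) = ind {0}" by (auto simp: indicator_def)
 ultimately have "emeasure (pmu R x) {0} = 0" by (simp add: sets_pmu[OF pR])
 then have "AE t in pmu R x. t ~= 0"
  by (intro AE_I[of _ _ "{0}"]) (auto simp: sets_pmu[OF pR])
 then show ?thesis using AE_pmu[OF pR, of x] by eventually_elim auto
qed

lemma fc_Rop_cong: "(!!t. 0 < t ==> t <= 1 ==> f t = g t) ==> fc R f x = fc R g x"
 by (rule fc_cong_AE[OF pR]) (use AE_pmu_Rop[of x] in eventually_elim, simp)

lemma R_fc: "x \<in> fdom R f ==> R (fc R f x) = fc R (%t. t * f t) x"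
 using fc_poly_mult(2)[OF pR, of x f "[:0,1:]"] by (simp add: pop_X[OF pR])

lemma lam_R: "R z \<in> fdom R lam" "fc R lam (R z) = fc R (%t. lam t * t) z" "z \<in> fdom R (%t. lam t * t)"
proof -
 show d: "z \<in> fdom R (%t. lam t * t)"
 proof (rule fdom_bounded[OF pR, of _ 1])
  fix t :: real assume t: "0 <= t" "t <= 1"
  show "\<bar>lam t * t\<bar> <= 1"
  proof (cases "t = 0")
   case False
   have "(lam t * t)^2 = (1 - t) * t"
    using False t by (simp add: power_mult_distrib lam_sq power2_eq_square[of t] algebra_simps)
   also have "... <= 1 * 1" using t by (intro mult_mono) auto
   finally show ?thesis by (simp add: abs_square_le_1)
  qed simp
 qed measurable
 show "R z \<in> fdom R lam" "fc R lam (R z) = fc R (%t. lam t * t) z"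
  using fdom_fc[OF pR fdom_ident[OF pR] lam_meas, of z] fc_fc[OF pR fdom_ident[OF pR] d lam_meas] d
  by (simp_all add: fc_ident[OF pR])
qed

text \<open>Both squared norms are the quadratic form of R - R^2 at z, because (\<open>lam\<close> t
  t)^2 = t - t^2. It says that |a| and a have equal norms on the range of R.\<close>

lemma Bop_norm_lam: "norm (Bop a z) = norm (fc R lam (R z))"
proof -
 have "(norm (fc R lam (R z)))^2 = integral\<^sup>L (pmu R z) (%t. (lam t * t)^2)"
  by (simp add: lam_R fc_norm[OF pR])
 also have "... = integral\<^sup>L (pmu R z) (poly ([:0, 1:] - [:0, 1:]^2))"
 proof (rule integral_cong_AE)
  show "AE t in pmu R z. (lam t * t)^2 = poly ([:0, 1:] - [:0, 1:]^2) t"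
   using AE_pmu_Rop[of z]
   by eventually_elim (simp add: power_mult_distrib lam_sq, simp add: power2_eq_square field_simps)
 qed (simp_all add: measurable_cong_sets[OF sets_pmu[OF pR] refl])
 also have "... = Re (cinner z (R z)) - (norm (R z))^2"
  by (simp only: pmu_poly[OF pR] pop_diff pop_norm[OF pR, symmetric] pop_X[OF pR] cinner.diff_right minus_complex.simps)
 also have "... = (norm (Bop a z))^2" by (simp add: Rop_quadratic[OF a])
 finally show ?thesis by (simp add: power2_eq_iff_nonneg)
qed

lemma chi_lam_R:
 shows "kap (chi lam n) \<in> bmeas" "\<bar>kap (chi lam n) t\<bar> <= (real n)^2 + 1"
  "x \<in> fdom R (kap (chi lam n))" "R (fc R (kap (chi lam n)) x) = fc R (chi lam n) x"
proof -
 show m: "kap (chi lam n) \<in> bmeas" by (intro kap_measurable chi_measurable) measurable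
 show b: "\<bar>kap (chi lam n) t\<bar> <= (real n)^2 + 1" for t
  using kap_bound[of "chi lam n" 1 "real n" t] by (auto simp: chi_def split: if_splits)
 show d: "x \<in> fdom R (kap (chi lam n))" by (rule fdom_bounded[OF pR m b])
 show "R (fc R (kap (chi lam n)) x) = fc R (chi lam n) x"
  unfolding R_fc[OF d] by (rule fc_Rop_cong) (simp add: kap_def)
qed

text \<open>With z_n the vector R^(-1) applied to the n-th cut-off of x, the points R z_n tend to x
  and their images under a are \<open>Bop a\<close> z_n. By \<open>Bop_norm_lam\<close> these images
  are as Cauchy as the vectors |a| R z_n, and a is closed.\<close>

lemma fdom_lam_graph:
 assumes x: "x \<in> fdom R lam" shows "\<exists>y. (x, y) \<in> a \<and> norm y = norm (fc R lam x)"
proof -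
 define z where "z n = fc R (kap (chi lam n)) x" for n
 have Rz: "R (z n) = fc R (chi lam n) x" for n by (simp add: z_def chi_lam_R)
 have lz: "fc R lam (R (z n)) = fc R (truncf lam n) x" for n
  unfolding Rz by (rule fc_chi[OF pR lam_meas])
 have conv: "(%n. fc R lam (R (z n))) ---> fc R lam x"
  unfolding lz by (rule fc_truncf_tendsto[OF pR x])
 have diff: "norm (Bop a (z n) - Bop a (z m)) = norm (fc R lam (R (z n)) - fc R lam (R (z m)))" for n m
 proof -
  have "norm (Bop a (z n) - Bop a (z m)) = norm (fc R lam (R (z n - z m)))"
   using Bop_norm_lam[of "z n - z m"] bcl_diff[OF bcl_Bop[OF a]] by simp
  also have "fc R lam (R (z n - z m)) = fc R lam (R (z n)) - fc R lam (R (z m))"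
   using fc_plus[OF pR lam_R(1)[of "z n"] lam_R(1)[of "- z m"]] fc_scaleC[OF pR lam_R(1)[of "z m"], of "-1"]
   by (simp add: bcl_diff[OF bcl_Rop[OF a]] bcl_minus[OF bcl_Rop[OF a]] scaleC_minus1)
  finally show ?thesis .
 qed
 have "Cauchy (%n. Bop a (z n))"
  using LIMSEQ_imp_Cauchy[OF conv] unfolding Cauchy_def dist_norm diff .
 then obtain y where y: "(%n. Bop a (z n)) ---> y" using Cauchy_convergent convergent_def by blast
 have "(%n. R (z n)) ---> x" unfolding Rz by (rule fc_chi_tendsto[OF pR lam_meas])
 then have "(x, y) \<in> a" using y by (rule graph_tendsto[OF cddD(3)[OF a] Rop_graph[OF a]])
 moreover have "norm y = norm (fc R lam x)"
  using tendsto_norm[OF y] tendsto_norm[OF conv] unfolding Bop_norm_lam by (rule LIMSEQ_unique)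
 ultimately show ?thesis by blast
qed

text \<open>For the cut-off vector z the pairing of y with \<open>Bop a z\<close> equals the
  integral of the truncated \<open>lam\<close> squared, that is |\<open>Bop a z\<close>|^2.
  Cauchy-Schwarz then bounds all truncations of |a|x by |y|.\<close>

lemma graph_fdom_lam:
 assumes xy: "(x, y) \<in> a" shows "x \<in> fdom R lam"
proof (rule fdom_truncfI[OF pR lam_meas])
 fix n
 define z where "z = fc R (kap (chi lam n)) x"
 have Rz: "R z = fc R (chi lam n) x" by (simp add: z_def chi_lam_R)
 have lz: "fc R lam (R z) = fc R (truncf lam n) x"
  unfolding Rz by (rule fc_chi[OF pR lam_meas])
 have d: "x \<in> fdom R (truncf lam n)" by (rule truncf_fdom[OF pR lam_meas])
 have "cinner y (Bop a z) = cinner x (z - R z)"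
  using xy Bop_graph[OF a, of z] by (simp add: adj_iff)
 also have "z - R z = fc R (%t. kap (chi lam n) t - chi lam n t) x"
  by (simp add: fc_diff[OF pR chi_lam_R(3) chi_fdom[OF pR lam_meas]] Rz, simp add: z_def)
 also have "cinner x ... = cr (integral\<^sup>L (pmu R x) (%t. kap (chi lam n) t - chi lam n t))"
  by (rule fc_quadratic[OF pR fdom_diff[OF pR chi_lam_R(3) chi_fdom[OF pR lam_meas]]])
 also have "integral\<^sup>L (pmu R x) (%t. kap (chi lam n) t - chi lam n t) = integral\<^sup>L (pmu R x) (%t. (truncf lam n t)^2)"
 proof (rule integral_cong_AE)
  show "AE t in pmu R x. kap (chi lam n) t - chi lam n t = (truncf lam n t)^2"
   using AE_pmu_Rop[of x]
   by eventually_elim (auto simp: kap_def chi_def truncf_def lam_sq)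
 qed (use chi_lam_R(1) chi_measurable[OF lam_meas] truncf_measurable[OF lam_meas] in
   \<open>simp_all add: measurable_cong_sets[OF sets_pmu[OF pR] refl]\<close>)
 also have "... = (norm (Bop a z))^2" by (simp add: fc_norm[OF pR d, symmetric] Bop_norm_lam lz)
 finally have "(norm (Bop a z))^2 <= norm y * norm (Bop a z)"
  using cmod_cinner_le[of y "Bop a z"] by (simp del: of_real_power)
 then have "norm (Bop a z) <= norm y"
  by (cases "norm (Bop a z) = 0") (auto simp: power2_eq_square)
 then show "(norm (fc R (truncf lam n) x))^2 <= (norm y)^2"
  by (intro power_mono) (simp_all add: Bop_norm_lam lz)
qed

lemma Domain_absg: "Domain (absg a) = Domain a"
 unfolding absg_def Domain_fcgr[OF pR] using fdom_lam_graph graph_fdom_lam by blast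

lemma absg_norm: "(x, y) \<in> a ==> (x, w) \<in> absg a ==> norm w = norm y"
proof -
 assume xy: "(x, y) \<in> a" and "(x, w) \<in> absg a"
 then have "w = fc R lam x" "x \<in> fdom R lam" by (auto simp: absg_def fcgr_def)
 with fdom_lam_graph[of x] obtain y' where "(x, y') \<in> a" "norm y' = norm w" by blast
 then show ?thesis using sv_eq[OF cddD(2)[OF a] xy] by metis
qed

lemma psa_absg: "positive_selfadjoint (absg a)"
 unfolding absg_def by (rule psa_fcgr[OF pR lam_meas lam_nonneg])

text \<open>In the variable t the inclusions are the identities t(1 + \<open>lam\<close>^2) = 1 and
  \<open>lam\<close>^2 t = 1 - t, valid off the null point 0.\<close>

lemma absg_square: "absg a O absg a = a O adj a"
 unfolding square_graph[OF a]
proof safe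
 fix x y w assume xy: "(x, y) \<in> absg a" and yw: "(y, w) \<in> absg a"
 then have x: "x \<in> fdom R lam" and y: "y = fc R lam x" and yd: "fc R lam x \<in> fdom R lam" and w: "w = fc R lam y"
  by (auto simp: absg_def fcgr_def)
 have d: "x \<in> fdom R (%t. lam t * lam t)" using yd fdom_fc[OF pR x lam_meas] by simp
 have w: "w = fc R (%t. lam t * lam t) x" unfolding w y by (rule fc_fc[OF pR x d lam_meas])
 have z: "x + w = fc R (%t. 1 + lam t * lam t) x"
  by (simp add: w fc_add[OF pR fdom_const[OF pR] d] fc_const[OF pR])
 have "R (x + w) = fc R (%t. t * (1 + lam t * lam t)) x"
  unfolding z by (rule R_fc[OF fdom_add[OF pR fdom_const[OF pR] d]])
 also have "... = fc R (%_. 1) x"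
  by (rule fc_Rop_cong) (simp add: power2_eq_square[symmetric] lam_sq)
 finally have "R (x + w) = x" by (simp add: fc_const[OF pR])
 then show "\<exists>z. (x, w) = (R z, z - R z) \<and> True" by (intro exI[of _ "x + w"]) simp
next
 fix z
 have id: "lam t * (lam t * t) = 1 - t" if "0 < t" "t <= 1" for t
  using that lam_sq[of t] by (simp add: power2_eq_square[symmetric] mult.assoc[symmetric] left_diff_distrib)
 have "z \<in> fdom R (%t. lam t * (lam t * t))"
 proof (rule fdom_bounded[OF pR, of _ 1])
  fix t :: real assume "0 <= t" "t <= 1"
  then show "\<bar>lam t * (lam t * t)\<bar> <= 1" by (cases "t = 0") (simp_all add: id)
 qed measurable
 moreover have "fc R lam (fc R lam (R z)) = fc R (%t. lam t * (lam t * t)) z"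
  using fc_fc[OF pR lam_R(3) calculation lam_meas] lam_R(2)[of z] by simp
 moreover have "... = fc R (%t. 1 - t) z" by (rule fc_Rop_cong) (rule id)
 moreover have "... = z - R z" by (simp add: fc_diff[OF pR fdom_const[OF pR] fdom_ident[OF pR]] fc_const[OF pR] fc_ident[OF pR])
 moreover have "fc R lam (R z) \<in> fdom R lam"
  using fdom_fc[OF pR lam_R(3) lam_meas, of z] calculation(1) lam_R(2)[of z] by simp
 ultimately have "(R z, fc R lam (R z)) \<in> absg a" "(fc R lam (R z), z - R z) \<in> absg a"
  using lam_R(1)[of z] by (auto simp: absg_def fcgr_def)
 then show "(R z, z - R z) \<in> absg a O absg a" by blast
qed

end

section \<open>Uniqueness of the positive square root\<close>

lemma psaD:
 assumes "positive_selfadjoint h" shows "closed_dd_op h" "adj h = h"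
  "(x, y) \<in> h ==> 0 <= Re (cinner x y)" "(x, y) \<in> h ==> (u, v) \<in> h ==> cinner y u = cinner x v"
proof -
 show "closed_dd_op h" and adj: "adj h = h"
  using assms by (auto simp: positive_selfadjoint_def)
 show "0 <= Re (cinner x y)" if "(x, y) \<in> h"
  using assms that by (fastforce simp: positive_selfadjoint_def complex_nonneg_Reals_iff)
 show "cinner y u = cinner x v" if "(x, y) \<in> h" "(u, v) \<in> h"
 proof -
  have "(u, v) \<in> adj h" using that adj by simp
  then show ?thesis using that(1) by (simp add: adj_iff)
 qed
qed

lemma psa_commute_Rop:
 assumes h: "positive_selfadjoint h" and xy: "(x, y) \<in> h" shows "(Rop h x, Rop h y) \<in> h"
proof -
 note hd = psaD(1)[OF h] and hS = cddD[OF psaD(1)[OF h]]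
 have 1: "(Bop h x, x - Rop h x) \<in> h" using Bop_graph[OF hd] psaD(2)[OF h] by simp
 have "(x - Rop h x, y - Bop h x) \<in> adj h"
  using graph_diff[OF hS(1) xy Rop_graph[OF hd]] psaD(2)[OF h] by simp
 then have "Rop h y = Bop h x" by (rule Rop_unique(1)[OF hd 1])
 then show ?thesis using Rop_graph[OF hd, of x] by simp
qed

lemma psa_commute_fc:
 assumes h: "positive_selfadjoint h" and xy: "(x, y) \<in> h" and d: "x \<in> fdom (Rop h) f" "y \<in> fdom (Rop h) f"
 shows "(fc (Rop h) f x, fc (Rop h) f y) \<in> h"
proof -
 note hS = cddD[OF psaD(1)[OF h]]
 note pR = pcon_Rop[OF psaD(1)[OF h]]
 have "(pop (Rop h) p x, pop (Rop h) p y) \<in> h" for p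
 proof (induction p rule: pCons_induct)
  case 0 then show ?case using graph_0[OF hS(1)] by simp
 next
  case (pCons c p)
  have "(c *\<^sub>R x, c *\<^sub>R y) \<in> h" using csub_scaleR[OF hS(1) xy, of c] by simp
  then show ?case using graph_add[OF hS(1) _ psa_commute_Rop[OF h pCons.IH]] by (simp add: pop_pCons[OF pR])
 qed
 moreover obtain p :: "nat => real poly" where p: "(%n. pop (Rop h) (p n) x) ---> fc (Rop h) f x" "(%n. pop (Rop h) (p n) y) ---> fc (Rop h) f y"
  using fc_lim[OF pR, of "{x, y}" f] d by auto
 ultimately show ?thesis by (intro graph_tendsto[OF hS(3) _ p])
qed

text \<open>Uniqueness of the positive square root: \<open>h\<close> and \<open>k = absg h\<close> commute and have the same
  square, so \<open>(h + k)(h - k) = 0\<close> on spectral subspaces, which forces \<open>h = k\<close>.\<close>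

lemma psa_eq_absg:
 assumes h: "positive_selfadjoint h" shows "h = absg h"
proof -
 note hd = psaD(1)[OF h] and hS = cddD[OF psaD(1)[OF h]]
 note pR = pcon_Rop[OF hd]
 let ?R = "Rop h"
 let ?k = "absg h"
 note kp = psa_absg[OF hd]
 note kS = cddD[OF psaD(1)[OF kp]]
 have sq: "h O h = ?k O ?k" using absg_square[OF hd] psaD(2)[OF h] by simp
 have dom: "Domain h = fdom ?R lam" using Domain_absg[OF hd] by (simp add: absg_def Domain_fcgr[OF pR])
 have kI: "(x, fc ?R lam x) \<in> ?k" if "x \<in> fdom ?R lam" for x using that by (auto simp: absg_def fcgr_def)
 have kD: "y = fc ?R lam x" "x \<in> fdom ?R lam" if "(x, y) \<in> ?k" for x y using that by (auto simp: absg_def fcgr_def)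
 have main: "(fc ?R (chi lam n) x, fc ?R (truncf lam n) x) \<in> h" for n x
 proof -
  let ?e = "fc ?R (chi lam n)" and ?K = "fc ?R (truncf lam n)"
  define v where "v = ?e x"
  note cd = chi_fdom[OF pR lam_meas, of _ n] and td = truncf_fdom[OF pR lam_meas, of _ n]
  have be: "bcl ?e" by (rule bcl_chi[OF pR lam_meas])
  have ee: "?e (?e w) = ?e w" for w
  proof -
   have 1: "chi lam n t * chi lam n t = chi lam n t" for t by (simp add: chi_def)
   show ?thesis using fc_fc[OF pR cd _ chi_measurable[OF lam_meas], of w n] cd by (simp add: 1)
  qed
  have Ke: "?K (?e w) = ?K w" "?e (?K w) = ?K w" for w
  proof -
   have 1: "truncf lam n t * chi lam n t = truncf lam n t" "chi lam n t * truncf lam n t = truncf lam n t" for t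
    by (simp_all add: truncf_def chi_def)
   show "?K (?e w) = ?K w" "?e (?K w) = ?K w"
    using fc_fc[OF pR cd, of w "truncf lam n"] fc_fc[OF pR td, of w "chi lam n"] td
    by (simp_all add: 1 truncf_measurable chi_measurable)
  qed
  have ed: "?e w \<in> fdom ?R lam" "fc ?R lam (?e w) = ?K w" for w
   using fc_chi[OF pR lam_meas] by auto
  have ke: "(w, ?K w) \<in> ?k" if "?e w = w" for w using kI[OF ed(1)[of w]] ed(2)[of w] that by simp
  have he: "\<exists>y. (w, y) \<in> h \<and> ?e y = y" if w: "?e w = w" for w
  proof -
   have "w \<in> Domain h" using ed(1)[of w] w dom by simp
   then obtain y where y: "(w, y) \<in> h" by blast
   then have "(?e w, ?e y) \<in> h" by (rule psa_commute_fc[OF h _ cd cd])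
   then have "?e y = y" using w y sv_eq[OF hS(2), of w] by simp
   then show ?thesis using y by blast
  qed
  have v: "?e v = v" by (simp add: v_def ee)
  obtain y where y: "(v, y) \<in> h" "?e y = y" using he[OF v] by blast
  define q where "q = y - ?K v"
  have eK: "?e (?K v) = ?K v" by (rule Ke)
  have eq: "?e q = q" by (simp add: q_def bcl_diff[OF be] y eK)
  obtain y2 where y2: "(y, y2) \<in> h" using he[OF y(2)] by blast
  have hK: "(?K v, ?K y) \<in> h" by (rule psa_commute_fc[OF h y(1) td td])
  have "(v, y2) \<in> ?k O ?k" using y(1) y2 sq by blast
  then have "y2 = ?K (?K v)"
   using ke[OF v] ke[OF eK] sv_eq[OF kS(2)] by blast
  have hq: "(q, ?K (?K v) - ?K y) \<in> h"
   using graph_diff[OF hS(1) y2 hK] by (simp add: q_def \<open>y2 = _\<close>)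
  have kq: "(q, ?K y - ?K (?K v)) \<in> ?k"
   using graph_diff[OF kS(1) ke[OF y(2)] ke[OF eK]] by (simp add: q_def)
  \<comment> \<open>The images of q under h and under k are opposite, and both operators are
    positive; so the form of k at q vanishes. Then \<open>lam\<close> is 0 almost everywhere for q,
    whence k q = 0 and h q = 0.\<close>
  have "Re (cinner q (?K y - ?K (?K v))) = 0"
   using psaD(3)[OF h hq] psaD(3)[OF kp kq] by (simp add: cinner.diff_right)
  have "?K y - ?K (?K v) = 0"
  proof -
   have qd: "q \<in> fdom ?R lam" and qe: "?K y - ?K (?K v) = fc ?R lam q" using kD[OF kq] by auto
   have "integral\<^sup>L (pmu ?R q) lam = 0"
    using \<open>Re _ = 0\<close> fc_quadratic[OF pR qd] qe by simp
   moreover have "integrable (pmu ?R q) lam"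
    using L2_integrable_mult[OF umeas_pmu[OF pR] fdom_L2[OF pR qd] fdom_L2[OF pR fdom_const[OF pR, of _ 1]]] by simp
   ultimately have "AE t in pmu ?R q. lam t = 0"
    using lam_nonneg by (subst (asm) integral_nonneg_eq_0_iff_AE) auto
   then have "fc ?R lam q = fc ?R (%_. 0) q" by (rule fc_cong_AE[OF pR])
   then show ?thesis by (simp add: qe fc_const[OF pR])
  qed
  then have 0: "(q, 0) \<in> h" "(q, 0) \<in> ?k" using hq kq by (simp_all add: algebra_simps)
  \<comment> \<open>Here q = h v - k v; moving h and k onto q, which both annihilate, gives |q|^2 =
    0.\<close>
  have "cinner q q = cinner q y - cinner q (?K v)" by (simp add: q_def cinner.diff_right)
  also have "... = cinner 0 v - cinner 0 v"
   using psaD(4)[OF h 0(1) y(1)] psaD(4)[OF kp 0(2) ke[OF v]] by simp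
  finally have "q = 0" by (simp add: cinner_self)
  then have "y = ?K x" by (simp add: q_def v_def Ke)
  then show ?thesis using y(1) by (simp add: v_def)
 qed
 have "?k \<subseteq> h"
 proof clarify
  fix x y assume "(x, y) \<in> ?k"
  then have x: "x \<in> fdom ?R lam" and y: "y = fc ?R lam x" using kD by auto
  show "(x, y) \<in> h"
   unfolding y by (rule graph_tendsto[OF hS(3) main fc_chi_tendsto[OF pR lam_meas] fc_truncf_tendsto[OF pR x]])
 qed
 moreover have "h \<subseteq> ?k"
 proof clarify
  fix x y assume xy: "(x, y) \<in> h"
  then have "(x, fc ?R lam x) \<in> ?k" using dom kI by blast
  then have "(x, fc ?R lam x) \<in> h" using \<open>?k \<subseteq> h\<close> by blast
  then show "(x, y) \<in> ?k" using \<open>(x, fc ?R lam x) \<in> ?k\<close> xy sv_eq[OF hS(2)] by metis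
 qed
 ultimately show ?thesis by blast
qed

lemma op_abs_eq: assumes a: "closed_dd_op a" shows "op_abs a = absg a"
 unfolding op_abs_def
proof (rule the_equality)
 show "positive_selfadjoint (absg a) \<and> absg a O absg a = a O adj a"
  using psa_absg[OF a] absg_square[OF a] by blast
next
 fix h assume h: "positive_selfadjoint h \<and> h O h = a O adj a"
 then have "Rop h = Rop a" using psaD(1,2)[of h] by (intro Rop_cong a) auto
 then have "absg h = absg a" by (simp add: absg_def)
 then show "h = absg a" using psa_eq_absg h by blast
qed

lemma op_abs_unique: "closed_dd_op a ==> positive_selfadjoint h ==> h O h = a O adj a ==> op_abs a = h"
proof -
 assume a: "closed_dd_op a" and h: "positive_selfadjoint h" "h O h = a O adj a"
 then have "Rop h = Rop a" using psaD(1,2)[OF h(1)] by (intro Rop_cong) auto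
 then have "absg h = absg a" by (simp add: absg_def)
 then show ?thesis using op_abs_eq[OF a] psa_eq_absg[OF h(1)] by simp
qed

lemma op_abs_psa: "positive_selfadjoint h ==> op_abs h = h"
 by (rule op_abs_unique) (auto simp only: psaD(1,2))

section \<open>Spectral measures\<close>

lemma pvmD:
 assumes "projection_valued_measure E"
 shows "B \<in> sets borel ==> projection_op (E B)" "B \<notin> sets borel ==> E B x = 0" "E UNIV x = x"
  "B \<in> sets borel ==> C \<in> sets borel ==> E (B \<inter> C) x = E B (E C x)"
  "(!!n::nat. A n \<in> sets borel) ==> disjoint_family A ==> (%n. E (A n) x) sums E (\<Union>n. A n) x"
 using assms unfolding projection_valued_measure_def by (auto simp: fun_eq_iff image_subset_iff)

lemma pvm_empty: assumes E: "projection_valued_measure E" shows "E {} x = 0"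
proof -
 have "(%n::nat. E {} x) sums E (\<Union>n::nat. {}) x" by (rule pvmD(5)[OF E]) (auto simp: disjoint_family_on_def)
 then have "(%n::nat. E {} x) ---> 0" by (intro summable_LIMSEQ_zero) (auto simp: sums_iff)
 then show ?thesis by (simp add: LIMSEQ_const_iff)
qed

lemma pvm_Compl:
 assumes E: "projection_valued_measure E" and B: "B \<in> sets borel" shows "E (- B) x = x - E B x"
proof -
 define A where "A n = (if n = 0 then B else if n = Suc 0 then - B else {})" for n :: nat
 have "(%n. E (A n) x) sums E (\<Union>n. A n) x"
  using B by (intro pvmD(5)[OF E]) (auto simp: A_def disjoint_family_on_def borel_comp)
 moreover have "(\<Union>n. A n) = UNIV" by (force simp: A_def split: if_splits)
 moreover have "(%n. E (A n) x) sums (\<Sum>n\<in>{0, 1}. E (A n) x)"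
  by (rule sums_finite) (auto simp: A_def pvm_empty[OF E])
 ultimately have "x = E B x + E (- B) x" using pvmD(3)[OF E] sums_unique2 by (fastforce simp: A_def)
 then show ?thesis by (metis add_diff_cancel_left')
qed

lemma
 assumes E: "projection_valued_measure E"
 shows sets_scalar_measure [simp]: "sets (scalar_measure E x) = sets borel"
  and space_scalar_measure [simp]: "space (scalar_measure E x) = UNIV"
  and em_scalar: "B \<in> sets borel ==> emeasure (scalar_measure E x) B = ennreal ((norm (E B x))^2)"
proof -
 have ss: "sets (borel :: real measure) \<subseteq> Pow UNIV" by simp
 have sig: "sigma_sets UNIV (sets (borel :: real measure)) = sets borel"
  using sets.sigma_sets_eq[of "borel :: real measure"] by simp
 show sets: "sets (scalar_measure E x) = sets borel" and "space (scalar_measure E x) = UNIV"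
  unfolding scalar_measure_def by (simp_all add: sig space_measure_of)
 have q: "Re (cinner x (E B x)) = (norm (E B x))^2" if "B \<in> sets borel" for B
  using proj_cinner[OF pvmD(1)[OF E that], of x] by simp
 assume B: "B \<in> sets borel"
 have "emeasure (scalar_measure E x) B = ennreal (Re (cinner x (E B x)))"
 proof (rule emeasure_measure_of[OF scalar_measure_def])
  show "positive (sets (scalar_measure E x)) (%B. ennreal (Re (cinner x (E B x))))"
   by (simp add: positive_def pvm_empty[OF E] cinner.zero_right)
  show "countably_additive (sets (scalar_measure E x)) (%B. ennreal (Re (cinner x (E B x))))"
   unfolding countably_additive_def sets
  proof (intro allI impI)
   fix A :: "nat => real set" assume A: "range A \<subseteq> sets borel" "disjoint_family A"
   have "(%n. E (A n) x) sums E (\<Union>n. A n) x" using A by (intro pvmD(5)[OF E]) auto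
   then have s: "(%n. Re (cinner x (E (A n) x))) sums Re (cinner x (E (\<Union>n. A n) x))"
    by (intro sums_Re bounded_linear.sums[OF cinner.bounded_linear_right])
   have "(\<Sum>n. ennreal (Re (cinner x (E (A n) x)))) = ennreal (\<Sum>n. Re (cinner x (E (A n) x)))"
    using s A by (intro suminf_ennreal2) (auto simp: q sums_iff)
   then show "(\<Sum>n. ennreal (Re (cinner x (E (A n) x)))) = ennreal (Re (cinner x (E (\<Union> (range A)) x)))"
    using s by (simp add: sums_iff)
  qed
 qed (use B sets in auto)
 then show "emeasure (scalar_measure E x) B = ennreal ((norm (E B x))^2)" using q[OF B] by simp
qed

lemma scalar_measure_pvm:
 assumes E: "projection_valued_measure E" and B: "B \<in> sets borel"
 shows "scalar_measure E (E B x) = density (scalar_measure E x) (ind B)"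
proof (rule measure_eqI)
 fix C assume "C \<in> sets (scalar_measure E (E B x))"
 then have C: "C \<in> sets borel" by (simp add: sets_scalar_measure[OF E])
 have "emeasure (density (scalar_measure E x) (ind B)) C = (\<integral>\<^sup>+t. ind B t * ind C t \<partial>scalar_measure E x)"
  using B C by (subst emeasure_density) (auto simp: sets_scalar_measure[OF E] measurable_cong_sets[OF sets_scalar_measure[OF E] refl])
 also have "... = (\<integral>\<^sup>+t. ind (B \<inter> C) t \<partial>scalar_measure E x)" by (simp only: indicator_inter_arith)
 also have "... = ennreal ((norm (E (C \<inter> B) x))^2)"
  using B C by (simp add: em_scalar[OF E] sets_scalar_measure[OF E] Int_commute)
 finally show "emeasure (scalar_measure E (E B x)) C = emeasure (density (scalar_measure E x) (ind B)) C"
  using B C by (simp add: em_scalar[OF E] pvmD(4)[OF E])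
qed (simp add: sets_scalar_measure[OF E])

lemma finite_scalar_measure: "projection_valued_measure E ==> finite_measure (scalar_measure E x)"
 by (rule finite_measureI) (simp add: space_scalar_measure em_scalar)

section \<open>An arbitrary spectral resolution commutes with its operator\<close>

context
 fixes k :: "'a::chilbert_space graph" and E :: "real set => 'a => 'a"
 assumes k: "positive_selfadjoint k" and E: "projection_valued_measure E" and si: "is_spectral_integral k E"
begin

private lemmas mE = measurable_cong_sets[OF sets_scalar_measure[OF E] refl]

lemma si_Domain: "x \<in> Domain k \<longleftrightarrow> (\<integral>\<^sup>+ s. ennreal (s^2) \<partial>scalar_measure E x) < \<infinity>"
 using si by (auto simp: is_spectral_integral_def)

lemma si_form: "(x, y) \<in> k ==> cinner x y = cr (\<integral>s. s \<partial>scalar_measure E x)"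
 using si by (auto simp: is_spectral_integral_def)

lemma pvm_Domain:
 assumes B: "B \<in> sets borel" and x: "x \<in> Domain k" shows "E B x \<in> Domain k"
proof -
 have "(\<integral>\<^sup>+ s. ennreal (s^2) \<partial>scalar_measure E (E B x)) = (\<integral>\<^sup>+ s. ind B s * ennreal (s^2) \<partial>scalar_measure E x)"
  unfolding scalar_measure_pvm[OF E B] using B by (subst nn_integral_density) (auto simp: mE)
 also have "... <= (\<integral>\<^sup>+ s. ennreal (s^2) \<partial>scalar_measure E x)"
  by (intro nn_integral_mono) (simp add: indicator_def)
 finally show ?thesis using x unfolding si_Domain by (rule le_less_trans)
qed

lemma pvm_integrable: assumes x: "x \<in> Domain k" shows "integrable (scalar_measure E x) (%s. s)"
proof (rule integrableI_bounded)
 have "(\<integral>\<^sup>+ s. ennreal (norm s) \<partial>scalar_measure E x) <= (\<integral>\<^sup>+ s. 1 + ennreal (s^2) \<partial>scalar_measure E x)"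
 proof (rule nn_integral_mono)
  fix s :: real
  have "\<bar>s\<bar> <= 1 + s^2" using sum_squares_bound[of "\<bar>s\<bar>" 1] by simp
  then show "ennreal (norm s) <= 1 + ennreal (s^2)" by (simp add: ennreal_leI flip: ennreal_1 ennreal_plus)
 qed
 also have "... = emeasure (scalar_measure E x) UNIV + (\<integral>\<^sup>+ s. ennreal (s^2) \<partial>scalar_measure E x)"
  by (subst nn_integral_add) (auto simp: mE space_scalar_measure[OF E])
 also have "... < \<infinity>" using x by (simp add: si_Domain em_scalar[OF E])
 finally show "(\<integral>\<^sup>+ s. ennreal (norm s) \<partial>scalar_measure E x) < \<infinity>" .
qed (simp add: mE)

text \<open>\<open>is_spectral_integral\<close> only prescribes the diagonal form. The scalar
  measure of u + v restricts to those of u and v on B and its complement, so the form is additive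
  and the sum of the two cross terms vanishes; replacing v by i v separates them.\<close>

lemma pvm_cross:
 assumes B: "B \<in> sets borel" and u: "(u, ku) \<in> k" "E B u = u" and v: "(v, kv) \<in> k" "E B v = 0"
 shows "cinner v ku = 0"
proof -
 note kS = cddD[OF psaD(1)[OF k]]
 have cr: "cinner u kv + cinner v ku = 0"
  if u: "(u, ku) \<in> k" "E B u = u" and v: "(v, kv) \<in> k" "E B v = 0" for u v ku kv
 proof -
  have b: "bcl (E B)" using projD(1)[OF pvmD(1)[OF E B]] .
  define w where "w = u + v"
  have uv: "E B w = u" "E (- B) w = v"
   using u v by (simp_all add: w_def bcl_add[OF b] pvm_Compl[OF E B])
  have w: "(w, ku + kv) \<in> k" using graph_add[OF kS(1) u(1) v(1)] by (simp add: w_def)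
  have I: "integrable (scalar_measure E w) (%s. s)" using w by (intro pvm_integrable) blast
  have dens: "(\<integral>s. s \<partial>scalar_measure E (E C w)) = (\<integral>s. ind C s * s \<partial>scalar_measure E w)" if "C \<in> sets borel" for C
   unfolding scalar_measure_pvm[OF E that] using that
   by (subst integral_density[of "%s. s" _ "ind C", simplified ennreal_indicator]) (auto simp: mE)
  have "(\<integral>s. s \<partial>scalar_measure E u) + (\<integral>s. s \<partial>scalar_measure E v) =
   (\<integral>s. ind B s * s \<partial>scalar_measure E w) + (\<integral>s. ind (- B) s * s \<partial>scalar_measure E w)"
   using dens[OF B] dens[of "- B"] B uv by (simp add: borel_comp)
  also have "... = (\<integral>s. ind B s * s + ind (- B) s * s \<partial>scalar_measure E w)"
   using B I integrable_mult_indicator[OF _ I, of B] integrable_mult_indicator[OF _ I, of "- B"]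
   by (subst Bochner_Integration.integral_add) (auto simp: sets_scalar_measure[OF E] borel_comp)
  also have "(%s. ind B s * s + ind (- B) s * s) = (%s::real. s)" by (auto simp: indicator_def)
  finally have "cinner w (ku + kv) = cinner u ku + cinner v kv"
   using si_form[OF w] si_form[OF u(1)] si_form[OF v(1)]
   by (metis of_real_add)
  then show ?thesis by (simp add: w_def cinner_add_left cinner_add_right add.commute)
 qed
 have b: "bcl (E B)" using projD(1)[OF pvmD(1)[OF E B]] .
 have "\<i> * cinner u kv - \<i> * cinner v ku = 0"
  using cr[OF u graph_scaleC[OF kS(1) v(1), of \<i>]] v(2)
  by (simp add: bcl_scaleC[OF b] scaleC.zero_right cinner_scaleC_right cinner_scaleC_left)
 then have "cinner u kv = cinner v ku" by simp
 then show ?thesis using cr[OF u v] by simp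
qed

text \<open>With y1 the image of E B x, the vanishing cross terms, tested on the dense domain, show
  that y1 lies in the range of E B and that y - y1 is annihilated by E B.\<close>

lemma pvm_commute:
 assumes B: "B \<in> sets borel" and xy: "(x, y) \<in> k" shows "(E B x, E B y) \<in> k"
proof -
 note kd = psaD(1)[OF k] and kS = cddD[OF psaD(1)[OF k]]
 note p = projD[OF pvmD(1)[OF E B]]
 obtain y1 where y1: "(E B x, y1) \<in> k" using pvm_Domain[OF B, of x] xy by blast
 have y2: "(x - E B x, y - y1) \<in> k" by (rule graph_diff[OF kS(1) xy y1])
 have pz: "E B (z - E B z) = 0" for z using p by (simp add: bcl_diff)
 have 1: "y1 - E B y1 = 0"
 proof (rule dense_cinner_zero[OF kS(4)])
  fix w assume "w \<in> Domain k"
  then obtain kw where kw: "(w, kw) \<in> k" by blast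
  obtain w1 where w1: "(E B w, w1) \<in> k" using pvm_Domain[OF B, of w] kw by blast
  have "cinner (w - E B w) y1 = 0"
   using pvm_cross[OF B y1 p(2) graph_diff[OF kS(1) kw w1] pz] .
  then show "cinner w (y1 - E B y1) = 0" by (simp add: cinner.diff_left cinner.diff_right p(3))
 qed
 have 2: "E B (y - y1) = 0"
 proof (rule dense_cinner_zero[OF kS(4)])
  fix w assume "w \<in> Domain k"
  then obtain kw where kw: "(w, kw) \<in> k" by blast
  obtain w1 where w1: "(E B w, w1) \<in> k" using pvm_Domain[OF B, of w] kw by blast
  have "cinner (x - E B x) w1 = 0" using pvm_cross[OF B w1 p(2) y2 pz] .
  then have "cinner (E B w) (y - y1) = 0" using psaD(4)[OF k w1 y2] by (metis cinner_zero_sym)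
  then show "cinner w (E B (y - y1)) = 0" by (simp add: p(3))
 qed
 have "E B y = y1" using 1 2 by (simp add: bcl_diff[OF p(1)])
 then show ?thesis using y1 by simp
qed

lemma pvm_commute_Rop:
 assumes B: "B \<in> sets borel" shows "E B (Rop k x) = Rop k (E B x)"
proof -
 note kd = psaD(1)[OF k]
 note p = projD[OF pvmD(1)[OF E B]]
 have "(Bop k x, x - Rop k x) \<in> k" using Bop_graph[OF kd] psaD(2)[OF k] by simp
 then have "(E B (Bop k x), E B x - E B (Rop k x)) \<in> adj k"
  using pvm_commute[OF B] psaD(2)[OF k] by (fastforce simp: bcl_diff[OF p(1)])
 then show ?thesis
  using Rop_unique(1)[OF kd pvm_commute[OF B Rop_graph[OF kd]]] by metis
qed

lemma pvm_support: "E B x = x ==> B \<in> sets borel ==> AE s in scalar_measure E x. s \<in> B"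
proof (rule AE_I[where N = "- B"])
 assume x: "E B x = x" and B: "B \<in> sets borel"
 have "E (- B) x = 0" using x by (simp add: pvm_Compl[OF E B])
 then show "emeasure (scalar_measure E x) (- B) = 0" using B by (simp add: em_scalar[OF E] borel_comp)
qed (auto simp: sets_scalar_measure[OF E] borel_comp)

lemma pvm_form_le:
 assumes xy: "(x, y) \<in> k" and x: "E {..s} x = x" shows "Re (cinner x y) <= s * (norm x)^2"
proof -
 interpret finite_measure "scalar_measure E x" by (rule finite_scalar_measure[OF E])
 have m: "measure (scalar_measure E x) UNIV = (norm x)^2"
  by (simp add: measure_def em_scalar[OF E] pvmD(3)[OF E])
 have "(\<integral>r. r \<partial>scalar_measure E x) <= (\<integral>r. s \<partial>scalar_measure E x)"
  using pvm_support[OF x] pvm_integrable xy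
  by (intro integral_mono_AE) (auto elim!: eventually_mono)
 then show ?thesis using si_form[OF xy] by (simp add: m space_scalar_measure[OF E] mult.commute)
qed

text \<open>The integral of the strictly positive function r - s against the scalar measure would be
  at most 0, so that measure is zero. This is what shows that spectral subspaces belonging to
  separated values meet trivially.\<close>

lemma pvm_form_gt:
 assumes xy: "(x, y) \<in> k" and x: "E {s<..} x = x" and le: "Re (cinner x y) <= s * (norm x)^2" shows "x = 0"
proof -
 interpret finite_measure "scalar_measure E x" by (rule finite_scalar_measure[OF E])
 have m: "measure (scalar_measure E x) UNIV = (norm x)^2"
  by (simp add: measure_def em_scalar[OF E] pvmD(3)[OF E])
 have I: "integrable (scalar_measure E x) (%r. r)" using pvm_integrable xy by blast
 have ae: "AE r in scalar_measure E x. s < r" using pvm_support[OF x] by auto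
 have "(\<integral>r. r - s \<partial>scalar_measure E x) = Re (cinner x y) - s * (norm x)^2"
  using I si_form[OF xy] by (simp add: m space_scalar_measure[OF E])
 moreover have "0 <= (\<integral>r. r - s \<partial>scalar_measure E x)"
  using ae by (intro integral_nonneg_AE) (auto elim!: eventually_mono)
 ultimately have "(\<integral>r. r - s \<partial>scalar_measure E x) = 0" using le by linarith
 then have "AE r in scalar_measure E x. r - s = 0"
  using I ae by (subst (asm) integral_nonneg_eq_0_iff_AE) (auto elim!: eventually_mono)
 with ae have "AE r in scalar_measure E x. False" by eventually_elim auto
 then have "emeasure (scalar_measure E x) UNIV = 0"
  by (subst (asm) AE_iff_measurable[where N = UNIV]) (auto simp: space_scalar_measure[OF E] sets_scalar_measure[OF E])
 then show ?thesis by (simp add: em_scalar[OF E] pvmD(3)[OF E])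
qed

end

text \<open>The spectral measure of |a|, pulled back along \<open>lam\<close> to the functional
  calculus of \<open>Rop a\<close>. The value 0 off the Borel sets matches
  \<open>projection_valued_measure\<close>, so that uniqueness is equality of functions.\<close>

definition sm :: "'a::chilbert_space graph => real set => 'a => 'a" where
 "sm a B = (if B \<in> sets borel then fc (Rop a) (%t. ind B (lam t)) else (%x. 0))"

context
 fixes a :: "'a::chilbert_space graph"
 assumes a: "closed_dd_op a"
begin

private abbreviation "Ra \<equiv> Rop a"
private lemmas pR1 = pcon_Rop[OF a]

lemma ind_lam:
 assumes [measurable]: "B \<in> sets borel"
 shows "(%t. ind B (lam t) :: real) \<in> bmeas" "x \<in> fdom Ra (%t. ind B (lam t))"
proof -
 show m: "(%t. ind B (lam t) :: real) \<in> bmeas" by measurable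
 show "x \<in> fdom Ra (%t. ind B (lam t))" by (rule fdom_bounded[OF pR1 m, of 1]) (auto simp: indicator_def)
qed

lemma sm_fc: "B \<in> sets borel ==> sm a B = fc Ra (%t. ind B (lam t))"
 by (simp add: sm_def)

lemma fc_sm:
 assumes f: "x \<in> fdom Ra f" and B: "B \<in> sets borel"
 shows "x \<in> fdom Ra (%t. ind B (lam t) * f t)" "sm a B (fc Ra f x) = fc Ra (%t. ind B (lam t) * f t) x"
proof -
 note [measurable] = fdom_borel[OF f] ind_lam(1)[OF B]
 show d: "x \<in> fdom Ra (%t. ind B (lam t) * f t)"
  by (rule fdom_mono[OF pR1 f]) (measurable, auto simp: indicator_def)
 show "sm a B (fc Ra f x) = fc Ra (%t. ind B (lam t) * f t) x"
  unfolding sm_fc[OF B] by (rule fc_fc[OF pR1 f d ind_lam(1)[OF B]])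
qed

lemma sm_projection: assumes B: "B \<in> sets borel" shows "projection_op (sm a B)"
proof (rule projI)
 show "bcl (sm a B)" unfolding sm_fc[OF B]
  by (rule bcl_fc[OF pR1 ind_lam(1)[OF B], of 1]) (auto simp: indicator_def)
 have e: "ind B (lam t) * ind B (lam t) = (ind B (lam t) :: real)" for t by (simp add: indicator_def)
 show "sm a B (sm a B x) = sm a B x" for x
  using fc_sm(2)[OF ind_lam(2)[OF B] B, of x] unfolding e by (simp only: sm_fc[OF B])
 show "cinner (sm a B x) y = cinner x (sm a B y)" for x y unfolding sm_fc[OF B]
  by (rule fc_sym[OF pR1 ind_lam(2)[OF B] ind_lam(2)[OF B]])
qed

lemma fc_sum:
 assumes "finite I" "!!i. i \<in> I ==> x \<in> fdom Ra (f i)"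
 shows "x \<in> fdom Ra (%t. \<Sum>i\<in>I. f i t)" "fc Ra (%t. \<Sum>i\<in>I. f i t) x = (\<Sum>i\<in>I. fc Ra (f i) x)"
proof -
 have "x \<in> fdom Ra (%t. \<Sum>i\<in>I. f i t) \<and> fc Ra (%t. \<Sum>i\<in>I. f i t) x = (\<Sum>i\<in>I. fc Ra (f i) x)"
  using assms
 proof (induction I rule: finite_induct)
  case (insert i I)
  then show ?case using fdom_add[OF pR1, of x "f i" "%t. \<Sum>i\<in>I. f i t"] fc_add[OF pR1, of x "f i" "%t. \<Sum>i\<in>I. f i t"] by simp
 qed (simp add: fdom_const[OF pR1] fc_const[OF pR1])
 then show "x \<in> fdom Ra (%t. \<Sum>i\<in>I. f i t)" "fc Ra (%t. \<Sum>i\<in>I. f i t) x = (\<Sum>i\<in>I. fc Ra (f i) x)" by auto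
qed

lemma sm_pvm: "projection_valued_measure (sm a)"
 unfolding projection_valued_measure_def
proof (intro conjI ballI allI impI)
 show "projection_op (sm a B)" if "B \<in> sets borel" for B using sm_projection that .
 show "sm a B = (%\<xi>. 0)" if "B \<notin> sets borel" for B using that by (simp add: sm_def)
 show "sm a UNIV = id" by (auto simp: sm_fc fc_const[OF pR1])
 show "sm a (B \<inter> C) = sm a B \<circ> sm a C" if B: "B \<in> sets borel" and C: "C \<in> sets borel" for B C
 proof
  fix x
  have "sm a B (sm a C x) = fc Ra (%t. ind B (lam t) * ind C (lam t)) x"
   using fc_sm(2)[OF ind_lam(2)[OF C] B] by (simp add: sm_fc[OF C])
  then show "sm a (B \<inter> C) x = (sm a B \<circ> sm a C) x"
   using B C by (simp add: sm_fc[of "B \<inter> C"] indicator_inter_arith[abs_def])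
 qed
 fix A :: "nat => real set" and x assume A: "range A \<subseteq> sets borel \<and> disjoint_family A"
 then have Am [measurable]: "A n \<in> sets borel" for n by auto
 have sm: "(%i. ind (A i) s :: real) sums ind (\<Union>i. A i) s" for s
  using A by (intro indicator_sums) (auto simp: disjoint_family_on_def)
 have "(\<Sum>i<n. sm a (A i) x) = fc Ra (%t. \<Sum>i<n. ind (A i) (lam t)) x" for n
  using ind_lam(2)[OF Am] by (subst fc_sum(2)) (auto simp: sm_fc)
 moreover have "(%n. fc Ra (%t. \<Sum>i<n. ind (A i) (lam t)) x) ---> fc Ra (%t. ind (\<Union>n. A n) (lam t)) x"
 proof (rule fc_tendsto_dominated[OF pR1 fdom_const[OF pR1, of x 1]])
  show "\<bar>\<Sum>i<n. ind (A i) (lam t)\<bar> <= \<bar>1::real\<bar>" for n t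
  proof -
   have "(\<Sum>i<n. ind (A i) (lam t)) <= (ind (\<Union>i. A i) (lam t) :: real)"
    using sm[of "lam t"] by (metis sum_le_suminf sums_unique sums_summable finite_lessThan indicator_pos_le)
   moreover have "0 <= (\<Sum>i<n. ind (A i) (lam t) :: real)" by (intro sum_nonneg) auto
   moreover have "(ind (\<Union>i. A i) (lam t) :: real) <= 1" by (simp add: indicator_def)
   ultimately show ?thesis by linarith
  qed
  show "AE t in pmu Ra x. (%n. \<Sum>i<n. ind (A i) (lam t)) ---> (ind (\<Union>n. A n) (lam t) :: real)"
   using sm by (simp add: sums_def)
 qed (auto simp: indicator_def)
 ultimately show "(%n. sm a (A n) x) sums sm a (\<Union> (range A)) x"
  by (simp add: sums_def sm_fc[of "\<Union> (range A)"])
qed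

lemma scalar_measure_sm: "scalar_measure (sm a) x = distr (pmu Ra x) borel lam"
proof (rule measure_eqI)
 show "sets (scalar_measure (sm a) x) = sets (distr (pmu Ra x) borel lam)"
  by (simp add: sets_scalar_measure[OF sm_pvm])
 fix B assume "B \<in> sets (scalar_measure (sm a) x)"
 then have B: "B \<in> sets borel" by (simp add: sets_scalar_measure[OF sm_pvm])
 have "ennreal ((norm (sm a B x))^2) = (\<integral>\<^sup>+t. ennreal ((ind B (lam t))^2) \<partial>pmu Ra x)"
  unfolding sm_fc[OF B] by (rule fc_norm_nn[OF pR1 ind_lam(2)[OF B]])
 also have "... = (\<integral>\<^sup>+t. ind B (lam t) \<partial>pmu Ra x)"
  by (intro nn_integral_cong) (simp add: indicator_def)
 also have "... = emeasure (distr (pmu Ra x) borel lam) B"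
  using B nn_integral_distr[of lam "pmu Ra x" borel "ind B"] by (simp add: measurable_cong_sets[OF sets_pmu[OF pR1] refl])
 finally show "emeasure (scalar_measure (sm a) x) B = emeasure (distr (pmu Ra x) borel lam) B"
  by (simp add: em_scalar[OF sm_pvm B])
qed

lemma sm_spectral: "is_spectral_integral (absg a) (sm a)"
 unfolding is_spectral_integral_def
proof
 have m: "lam \<in> measurable (pmu Ra x) borel" for x by (simp add: measurable_cong_sets[OF sets_pmu[OF pR1] refl])
 show "Domain (absg a) = {\<xi>. (\<integral>\<^sup>+ s. ennreal (s^2) \<partial>scalar_measure (sm a) \<xi>) < \<infinity>}"
  unfolding scalar_measure_sm absg_def Domain_fcgr[OF pR1] using m
  by (auto simp: fdom_def L2_def nn_integral_distr)
 show "\<forall>(\<xi>, \<eta>)\<in>absg a. cinner \<xi> \<eta> = cr (\<integral>s. s \<partial>scalar_measure (sm a) \<xi>)"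
  unfolding scalar_measure_sm using m by (auto simp: absg_def fcgr_def fc_quadratic[OF pR1] integral_distr)
qed

lemma sm_commute:
 assumes X: "bcl X" and XR: "!!x. X (Ra x) = Ra (X x)" shows "X (sm a B x) = sm a B (X x)"
proof (cases "B \<in> sets borel")
 case True
 show ?thesis unfolding sm_fc[OF True] by (rule fc_commute[OF pR1 X XR ind_lam(2)[OF True], symmetric])
qed (simp add: sm_def bcl_0[OF X])

lemma sm_atMost_Domain: "sm a {..s} x \<in> Domain (absg a)"
proof -
 have d: "x \<in> fdom Ra (%t. lam t * ind {..s} (lam t))"
  by (rule fdom_bounded[OF pR1, of _ "\<bar>s\<bar>"]) (use lam_nonneg in \<open>auto simp: indicator_def abs_le_iff intro: order_trans\<close>)
 then have "sm a {..s} x \<in> fdom Ra lam"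
  using fdom_fc[OF pR1 ind_lam(2) lam_meas, of "{..s}" x] by (simp add: sm_fc)
 then show ?thesis by (simp add: absg_def Domain_fcgr[OF pR1])
qed

lemma sm_atMost_tendsto: "(%n. sm a {..real n} x) ---> x"
proof -
 have "chi lam n = (%t. ind {..real n} (lam t))" for n
  by (auto simp: chi_def indicator_def lam_nonneg abs_of_nonneg)
 then show ?thesis using fc_chi_tendsto[OF pR1 lam_meas, of x] by (simp add: sm_fc)
qed

text \<open>Any resolution E of |a| commutes with \<open>Rop a\<close>, hence with
  \<open>sm a\<close>. On products of an upper half line for one measure and the complementary lower
  half line for the other, the form is both at most s and above s, so these products vanish. Half
  lines then generate the Borel sets.\<close>

lemma spectral_measure_unique:
 assumes E: "projection_valued_measure E" and si: "is_spectral_integral (absg a) E"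
 shows "E = sm a"
proof -
 let ?k = "absg a" and ?F = "sm a"
 note k = psa_absg[OF a] and F = sm_pvm and sF = sm_spectral
 have Rk: "Rop ?k = Ra" using absg_square[OF a] psaD(1,2)[OF k] by (intro Rop_cong a) auto
 have com: "E B (?F C x) = ?F C (E B x)" if "B \<in> sets borel" for B C x
  using projD(1)[OF pvmD(1)[OF E that]] pvm_commute_Rop[OF k E si that] Rk by (intro sm_commute) auto
 note pE = projD[OF pvmD(1)[OF E]] and pF = projD[OF pvmD(1)[OF F]]
 have disj: "B \<inter> C = {} ==> B \<in> sets borel ==> C \<in> sets borel ==> E B (E C x) = 0"
  "B \<inter> C = {} ==> B \<in> sets borel ==> C \<in> sets borel ==> ?F B (?F C x) = 0" for B C x
  using pvmD(4)[OF E, of B C x] pvmD(4)[OF F, of B C x] pvm_empty[OF E, of x] pvm_empty[OF F, of x] by auto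
 have gt: "E {s<..} x = ?F {s<..} x" for s x
 proof -
  have 1: "E {s<..} (?F {..s} x) = 0"
  proof -
   let ?y = "E {s<..} (?F {..s} x)"
   have "?y = ?F {..s} (E {s<..} x)" using com by simp
   then obtain w where w: "(?y, w) \<in> ?k" using sm_atMost_Domain[of s "E {s<..} x"] by (metis DomainE)
   have "?F {..s} ?y = ?y" using com[of "{s<..}" "{..s}"] pF(2)[of "{..s}"] by simp
   then have "Re (cinner ?y w) <= s * (norm ?y)^2" by (rule pvm_form_le[OF k F sF w])
   moreover have "E {s<..} ?y = ?y" by (simp add: pE(2))
   ultimately show ?thesis using pvm_form_gt[OF k E si w] by blast
  qed
  have 2: "E {..s} (?F {s<..} x) = 0"
  proof -
   let ?y = "E {..s} (?F {s<..} x)"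
   \<comment> \<open>The vector y need not lie in the domain of |a|, so the forms are compared on
     its spectral cut-offs, which tend to y.\<close>
   have "?F {..real n} ?y = 0" for n
   proof -
    let ?z = "?F {..real n} ?y"
    obtain w where w: "(?z, w) \<in> ?k" using sm_atMost_Domain[of "real n" ?y] by blast
    have "E {..s} ?z = ?z" using com[of "{..s}" "{..real n}"] pE(2)[of "{..s}"] by simp
    then have le: "Re (cinner ?z w) <= s * (norm ?z)^2" by (rule pvm_form_le[OF k E si w])
    have "?F {s<..} ?z = ?F {..real n} (E {..s} (?F {s<..} (?F {s<..} x)))"
     using com[of "{..s}" "{s<..}"] pvmD(4)[OF F, of "{s<..}" "{..real n}"] pvmD(4)[OF F, of "{..real n}" "{s<..}"]
     by (simp add: Int_commute)
    then have "?F {s<..} ?z = ?z" by (simp add: pF(2))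
    then show ?thesis using pvm_form_gt[OF k F sF w] le by blast
   qed
   then show ?thesis using sm_atMost_tendsto[of ?y] by (simp add: LIMSEQ_const_iff)
  qed
  have c: "- {..s} = {s<..}" "- {s<..} = {..s}" by auto
  have "E {s<..} x - E {s<..} (?F {s<..} x) = 0"
   using 1 pvm_Compl[OF F, of "{s<..}" x] by (simp add: c bcl_diff[OF pE(1)])
  moreover have "?F {s<..} x - E {s<..} (?F {s<..} x) = 0"
   using 2 pvm_Compl[OF E, of "{s<..}" "?F {s<..} x"] by (simp add: c)
  ultimately show ?thesis by simp
 qed
 have "E B x = ?F B x" if "B \<in> sets borel" for B x
 proof -
  have b: "sigma_sets UNIV (range (%s::real. {s<..})) = sets borel"
   by (subst borel_Ioi) simp
  have "{u<..} \<inter> {v<..} = {max u v<..}" for u v :: real by auto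
  then have "Int_stable (range (%s::real. {s<..}))" by (auto simp: Int_stable_def)
  moreover have "range (%s::real. {s<..}) \<subseteq> Pow UNIV" by simp
  moreover have "B \<in> sigma_sets UNIV (range (%s::real. {s<..}))" using that b by simp
  ultimately show ?thesis
  proof (induction rule: sigma_sets_induct_disjoint)
   case (basic A) then show ?case using gt by auto
  next
   case empty then show ?case by (simp add: pvm_empty[OF E] pvm_empty[OF F])
  next
   case (compl A)
   then have "A \<in> sets borel" using b by simp
   then show ?case using compl pvm_Compl[OF E, of A x] pvm_Compl[OF F, of A x] by (simp add: Compl_eq_Diff_UNIV)
  next
   case (union A)
   then have A: "A i \<in> sets borel" for i using b by auto
   have "(%n. ?F (A n) x) sums E (\<Union>n. A n) x" using pvmD(5)[OF E A union(1), of x] union.IH by simp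
   then show ?case using pvmD(5)[OF F A union(1), of x] by (rule sums_unique2)
  qed
 qed
 then show ?thesis using pvmD(2)[OF E] pvmD(2)[OF F] by (metis ext)
qed

lemma spectral_op_abs: "spectral_measure (op_abs a) = sm a"
 unfolding spectral_measure_def op_abs_eq[OF a]
 using sm_pvm sm_spectral spectral_measure_unique by (intro the_equality) blast+

end

section \<open>Von Neumann algebras and affiliated operators\<close>

lemma unitD:
 assumes "unitary_op u"
 shows "bcl u" "hadj u (u x) = x" "u (hadj u x) = x" "cinner (u x) (u y) = cinner x y"
proof -
 show b: "bcl u" and 1: "hadj u (u x) = x" "u (hadj u x) = x"
  using assms by (auto simp: unitary_op_def cadjoint_hadj fun_eq_iff)
 have "hadj u (u y) = y" for y using assms by (auto simp: unitary_op_def cadjoint_hadj fun_eq_iff)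
 then show "cinner (u x) (u y) = cinner x y" using cinner_hadj[OF b, of x "u y"] by simp
qed

lemma unitary_hadj: "unitary_op u ==> unitary_op (hadj u)"
proof -
 assume u: "unitary_op u"
 note b = unitD(1)[OF u]
 show ?thesis
  unfolding unitary_op_def cadjoint_hadj hadj_hadj[OF b]
  using bcl_hadj[OF b] unitD(2,3)[OF u] by (simp add: fun_eq_iff)
qed

lemma commutantD: "Y \<in> commutant S ==> bcl Y" "Y \<in> commutant S ==> X \<in> S ==> Y (X x) = X (Y x)"
 by (auto simp: commutant_def fun_eq_iff)

lemma commutantI: "bcl Y ==> (!!X x. X \<in> S ==> Y (X x) = X (Y x)) ==> Y \<in> commutant S"
 by (auto simp: commutant_def fun_eq_iff)

lemma hadj_commute:
 assumes b: "bcl X" "bcl Y" and c: "!!x. Y (hadj X x) = hadj X (Y x)"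
 shows "hadj Y (X x) = X (hadj Y x)"
proof (rule cinner_ext)
 fix z show "cinner z (hadj Y (X x)) = cinner z (X (hadj Y x))"
  by (simp add: cinner_hadj[OF b(2), symmetric] cinner_hadj'[OF b(1)] c)
qed

lemma commutant_hadj:
 assumes S: "!!X. X \<in> S ==> bcl X \<and> hadj X \<in> S" and Y: "Y \<in> commutant S"
 shows "hadj Y \<in> commutant S"
 using S Y by (intro commutantI bcl_hadj hadj_commute) (auto simp: commutantD)

text \<open>With R = (1 + Y)/2, a positive contraction, 1 - Y^2 = 4 R(1 - R); hence the root is 2
  sqrt(t(1 - t)) evaluated at R, and it commutes with whatever commutes with Y.\<close>

lemma sqrt_complement:
 assumes Y: "bcl Y" and sym: "!!x y. cinner (Y x) y = cinner x (Y y)" and n: "!!x. norm (Y x) <= norm x"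
 shows "\<exists>S. bcl S \<and> (\<forall>x y. cinner (S x) y = cinner x (S y)) \<and> (\<forall>x. S (S x) = x - Y (Y x)) \<and>
  (\<forall>Z. bcl Z --> (\<forall>x. Z (Y x) = Y (Z x)) --> (\<forall>x. Z (S x) = S (Z x)))"
proof -
 define R where "R x = (1/2) *\<^sub>R (x + Y x)" for x
 have bR: "bcl R"
  unfolding R_def by (intro bcl_rmult bcl_plus bcl_id Y)
 have pR: "pcon R"
  unfolding pcon_def
 proof (intro conjI allI bR)
  fix x y
  show "cinner (R x) y = cinner x (R y)"
   by (simp add: R_def cinner.scaleR_left cinner.scaleR_right cinner_add_left cinner_add_right sym)
  have "\<bar>Re (cinner x (Y x))\<bar> <= norm x * norm (Y x)"
   using cmod_cinner_le abs_Re_le_cmod order_trans by blast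
  also have "... <= norm x * norm x" by (intro mult_left_mono n) auto
  finally have "\<bar>Re (cinner x (Y x))\<bar> <= (norm x)^2" by (simp add: power2_eq_square)
  then show "0 <= Re (cinner x (R x))" "Re (cinner x (R x)) <= (norm x)^2"
   by (simp_all add: R_def cinner.scaleR_right cinner_add_right norm2_cinner)
 qed
 define g where "g t = (if 0 <= t \<and> t <= 1 then 2 * sqrt (t * (1 - t)) else 0)" for t :: real
 have gm: "g \<in> bmeas" unfolding g_def[abs_def] by measurable
 have gg: "g t * g t = poly [:0, 4, -4:] t" if "0 <= t" "t <= 1" for t
 proof -
  have n: "0 <= t * (1 - t)" using that by simp
  have "g t * g t = 4 * (sqrt (t * (1 - t)))^2" using that by (simp add: g_def power2_eq_square del: real_sqrt_mult_self)
  also have "... = 4 * (t * (1 - t))" using n by (simp only: real_sqrt_pow2)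
  finally show ?thesis by (simp add: algebra_simps)
 qed
 have gb: "\<bar>g t\<bar> <= 2" for t
 proof (cases "0 <= t \<and> t <= 1")
  case True
  then have "t * (1 - t) <= 1" "0 <= t * (1 - t)" by (simp_all add: mult_le_one)
  then have "0 <= sqrt (t * (1 - t))" "sqrt (t * (1 - t)) <= 1" by (simp_all only: real_sqrt_ge_zero real_sqrt_le_1_iff)
  moreover have "g t = 2 * sqrt (t * (1 - t))" using True by (simp add: g_def)
  ultimately show ?thesis by linarith
 qed (auto simp: g_def)
 have gd: "x \<in> fdom R g" for x by (rule fdom_bounded[OF pR gm gb])
 have ggd: "x \<in> fdom R (%t. g t * g t)" for x
 proof (rule fdom_bounded[OF pR, of _ 4])
  show "\<bar>g t * g t\<bar> <= 4" for t using mult_mono[OF gb[of t] gb[of t]] by (simp add: abs_mult)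
 qed (use gm in simp)
 have YR: "Y x = 2 *\<^sub>R R x - x" for x by (simp add: R_def)
 have "fc R g (fc R g x) = x - Y (Y x)" for x
 proof -
  have "fc R g (fc R g x) = pop R [:0, 4, -4:] x"
   using fc_fc[OF pR gd ggd gm, of x] fc_cong[OF pR, of "%t. g t * g t" "poly [:0, 4, -4:]" x] gg fc_poly[OF pR]
   by simp
  also have "... = 4 *\<^sub>R R x - 4 *\<^sub>R R (R x)"
   by (simp add: pop_pCons[OF pR] bcl_add[OF bR] bcl_diff[OF bR] bcl_scaleR[OF bR] bcl_0[OF bR] bcl_minus[OF bR])
  also have "... = x - Y (Y x)"
   by (simp add: YR bcl_diff[OF bR] bcl_scaleR[OF bR] algebra_simps)
    (simp flip: scaleR_add_left add: algebra_simps)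
  finally show ?thesis .
 qed
 moreover have "Z (fc R g x) = fc R g (Z x)" if "bcl Z" "\<forall>x. Z (Y x) = Y (Z x)" for Z x
  by (rule fc_commute[OF pR that(1) _ gd, symmetric])
   (simp add: R_def bcl_scaleR[OF that(1)] bcl_add[OF that(1)] that(2))
 moreover have "bcl (fc R g)" by (rule bcl_fc[OF pR gm gb])
 moreover have "cinner (fc R g x) y = cinner x (fc R g y)" for x y by (rule fc_sym[OF pR gd gd])
 ultimately show ?thesis by blast
qed

locale vn_alg =
 fixes M :: "('a::chilbert_space => 'a) set"
 assumes vn: "von_neumann_algebra M"
begin

lemma mem_bcl: "X \<in> M ==> bcl X"
 using vn by (simp add: von_neumann_algebra_def)

lemma mem_hadj: "X \<in> M ==> hadj X \<in> M"
 using vn by (simp add: von_neumann_algebra_def cadjoint_hadj)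

lemma memI: "bcl X ==> (!!Y x. Y \<in> commutant M ==> X (Y x) = Y (X x)) ==> X \<in> M"
 using vn commutantI[of X "commutant M"] by (simp add: von_neumann_algebra_def)

lemma memD: "X \<in> M ==> Y \<in> commutant M ==> X (Y x) = Y (X x)"
 by (simp add: commutantD)

lemma comm_hadj: "Y \<in> commutant M ==> hadj Y \<in> commutant M"
 using commutant_hadj[of M] mem_bcl mem_hadj by blast

lemma mem_id: "(%x. x) \<in> M"
 by (rule memI) (auto simp: bcl_id)

lemma mem_zero: "(%x. 0) \<in> M"
 by (rule memI) (auto simp: bcl_zero bcl_0 commutantD)

lemma mem_comp: "X \<in> M ==> Y \<in> M ==> (%x. X (Y x)) \<in> M"
 by (rule memI) (auto simp: bcl_comp mem_bcl memD)

lemma mem_add: "X \<in> M ==> Y \<in> M ==> (%x. X x + Y x) \<in> M"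
 by (rule memI) (auto simp: bcl_plus mem_bcl memD bcl_add commutantD(1))

lemma mem_diff: "X \<in> M ==> Y \<in> M ==> (%x. X x - Y x) \<in> M"
 by (rule memI) (auto simp: bcl_subtract mem_bcl memD bcl_diff commutantD(1))

lemma mem_compl: "X \<in> M ==> (%x. x - X x) \<in> M"
 using mem_diff[OF mem_id] .

lemma mem_setsum: "(!!i. i \<in> I ==> X i \<in> M) ==> (%x. \<Sum>i\<in>I. X i x) \<in> M"
 by (induction I rule: infinite_finite_induct) (auto simp: mem_zero mem_add)

lemma mem_limit:
 assumes "!!n::nat. X n \<in> M" "bcl Z" "!!x. (%n. X n x) ---> Z x" shows "Z \<in> M"
proof (rule memI[OF assms(2)])
 fix Y x assume Y: "Y \<in> commutant M"
 have "(%n. X n (Y x)) ---> Y (Z x)"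
  using bcl_tendsto[OF commutantD(1)[OF Y] assms(3)[of x]] by (simp add: memD[OF assms(1) Y])
 then show "Z (Y x) = Y (Z x)" using assms(3)[of "Y x"] LIMSEQ_unique by blast
qed

text \<open>The commutant is spanned by its unitaries: a self-adjoint contraction \<open>Y\<close> is the mean of
  the unitaries \<open>Y \<plusminus> \<i> \<surd>(1 - Y\<^sup>2)\<close>.\<close>

lemma unitary_test_sa:
 assumes X: "bcl X" and u: "!!u x. unitary_op u ==> u \<in> commutant M ==> X (u x) = u (X x)"
  and Y: "Y \<in> commutant M" and sym: "!!x y. cinner (Y x) y = cinner x (Y y)" and n: "!!x. norm (Y x) <= norm x"
 shows "X (Y x) = Y (X x)"
proof -
 note bY = commutantD(1)[OF Y]
 obtain S where bS: "bcl S" and sS: "!!x y. cinner (S x) y = cinner x (S y)" and SS: "!!x. S (S x) = x - Y (Y x)"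
  and cS: "!!Z x. bcl Z ==> (\<forall>x. Z (Y x) = Y (Z x)) ==> Z (S x) = S (Z x)"
  using sqrt_complement[OF bY sym n] by blast
 define v where "v c x = Y x + c *\<^sub>C S x" for c x
 have bv: "bcl (v c)" for c
  unfolding v_def by (intro bcl_plus bcl_cmult bY bS)
 have av: "hadj (v c) = v (cnj c)" for c
  by (rule hadj_eqI) (simp add: v_def cinner_add_left cinner_add_right cinner_scaleC_left cinner_scaleC_right sym sS)
 have YS: "Y (S x) = S (Y x)" for x by (rule cS[OF bY]) simp
 have prod: "v c (v (- c) x) = x" if "c * c = -1" for c x
  by (simp add: v_def bcl_add[OF bY] bcl_add[OF bS] bcl_scaleC[OF bY]
    bcl_scaleC[OF bS] bcl_diff[OF bY] bcl_diff[OF bS] YS SS scaleC_add_right scaleC_scaleC that scaleC.minus_left scaleC.minus_right scaleC.diff_right)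
 have un: "unitary_op (v c)" if "c = \<i> \<or> c = - \<i>" for c
  using prod[of c] prod[of "- c"] that unfolding unitary_op_def cadjoint_hadj av
  by (auto simp: bv fun_eq_iff)
 have vM: "v c \<in> commutant M" for c
 proof (rule commutantI[OF bv])
  fix Z x assume Z: "Z \<in> M"
  have "Z (S x) = S (Z x)" using Z Y by (intro cS mem_bcl) (auto simp: memD)
  then show "v c (Z x) = Z (v c x)"
   using mem_bcl[OF Z] memD[OF Z Y] by (simp add: v_def bcl_add bcl_scaleC)
 qed
 have Yv: "Y z = (1/2) *\<^sub>R (v \<i> z + v (- \<i>) z)" for z by (simp add: v_def scaleC.minus_left)
 show ?thesis
  unfolding Yv using u[OF un vM, of \<i> x] u[OF un vM, of "- \<i>" x] by (simp add: bcl_scaleR[OF X] bcl_add[OF X])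
qed

text \<open>An arbitrary Y of the commutant is assembled from two self-adjoint contractions, namely
  c Y plus its adjoint for c = 1 and c = i, scaled by 1/(2K).\<close>

lemma mem_unitaryI:
 assumes X: "bcl X" and u: "!!u x. unitary_op u ==> u \<in> commutant M ==> X (u x) = u (X x)"
 shows "X \<in> M"
proof (rule memI[OF X])
 fix Y x assume Y: "Y \<in> commutant M"
 note bY = commutantD(1)[OF Y] and aY = comm_hadj[OF Y]
 note baY = commutantD(1)[OF aY]
 obtain K where K: "K > 0" "!!x. norm (Y x) <= K * norm x" using bcl_bound[OF bY] by auto
 have K': "norm (hadj Y x) <= K * norm x" for x using hadj_bound[OF bY K(2)] K(1) by simp
 define W where "W c x = (1 / (2 * K)) *\<^sub>R (c *\<^sub>C Y x + cnj c *\<^sub>C hadj Y x)" for c x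
 have W: "X (W c x) = W c (X x)" if c: "cmod c = 1" for c x
 proof (rule unitary_test_sa[OF X u])
  have bW: "bcl (W c)" unfolding W_def by (intro bcl_rmult bcl_plus bcl_cmult bY baY)
  show "W c \<in> commutant M"
  proof (rule commutantI[OF bW])
   fix Z x assume Z: "Z \<in> M"
   show "W c (Z x) = Z (W c x)"
    using mem_bcl[OF Z] memD[OF Z Y] memD[OF Z aY]
    by (simp add: W_def bcl_add bcl_scaleC bcl_scaleR)
  qed
  show "cinner (W c x) y = cinner x (W c y)" for x y
   by (simp add: W_def cinner.scaleR_left cinner.scaleR_right cinner_add_left cinner_add_right cinner_scaleC_left
     cinner_scaleC_right cinner_hadj[OF bY] cinner_hadj'[OF bY] add.commute)
  show "norm (W c x) <= norm x" for x
  proof -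
   have "norm (c *\<^sub>C Y x + cnj c *\<^sub>C hadj Y x) <= norm (Y x) + norm (hadj Y x)"
    using norm_triangle_ineq[of "c *\<^sub>C Y x" "cnj c *\<^sub>C hadj Y x"] by (simp add: norm_scaleC c)
   also have "... <= 2 * K * norm x" using K(2)[of x] K'[of x] by simp
   finally have "norm (c *\<^sub>C Y x + cnj c *\<^sub>C hadj Y x) / (2 * K) <= norm x"
    using K by (simp add: divide_le_eq mult.commute)
   moreover have "norm (W c x) = norm (c *\<^sub>C Y x + cnj c *\<^sub>C hadj Y x) / (2 * K)"
    unfolding W_def norm_scaleR using K by simp
   ultimately show ?thesis by simp
  qed
 qed
 have d: "Y z = K *\<^sub>R (W 1 z + (- \<i>) *\<^sub>C W \<i> z)" for z
 proof -
  have "(- \<i>) *\<^sub>C W \<i> z = (1 / (2 * K)) *\<^sub>R (Y z - hadj Y z)"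
   by (simp add: W_def scaleC.scaleR_right scaleC_add_right scaleC_scaleC scaleC_minus1 del: scaleC.minus_left)
  moreover have "W 1 z = (1 / (2 * K)) *\<^sub>R (Y z + hadj Y z)" by (simp add: W_def)
  ultimately have "W 1 z + (- \<i>) *\<^sub>C W \<i> z = (1 / (2 * K)) *\<^sub>R (2 *\<^sub>R Y z)"
   by (simp only: scaleR_add_right[symmetric]) (simp add: scaleR_2)
  then show ?thesis using K by simp
 qed
 show "X (Y x) = Y (X x)"
  unfolding d using W[of 1 x] W[of \<i> x]
  by (simp add: bcl_scaleR[OF X] bcl_add[OF X] bcl_scaleC[OF X])
qed

lemma mem_hproj:
 assumes S: "csubspace S" "closed S" and inv: "!!u x. unitary_op u ==> u \<in> commutant M ==> x \<in> S ==> u x \<in> S"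
 shows "hproj S \<in> M"
proof (rule mem_unitaryI)
 show "bcl (hproj S)" using projD(1)[OF proj_hproj(1)[OF S]] .
 fix u x assume u: "unitary_op u" "u \<in> commutant M"
 show "hproj S (u x) = u (hproj S x)"
 proof (rule hproj_eqI[OF S])
  show "u (hproj S x) \<in> S" using inv[OF u] hproj_works(1)[OF S] .
  fix z assume "z \<in> S"
  then have "hadj u z \<in> S" using inv unitary_hadj[OF u(1)] comm_hadj[OF u(2)] by blast
  then have "cinner (hadj u z) (x - hproj S x) = 0" by (rule hproj_works(2)[OF S])
  then show "cinner z (u x - u (hproj S x)) = 0"
   using unitD(1)[OF u(1)] by (simp add: cinner_hadj' bcl_diff[symmetric])
 qed
qed

lemma affiliatedD:
 assumes "affiliated M a" "unitary_op u" "u \<in> commutant M" shows "(x, y) \<in> a ==> (u x, u y) \<in> a"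
 using assms unfolding affiliated_def by (metis image_eqI map_prod_simp)

lemma affiliatedI:
 assumes "!!u x y. unitary_op u ==> u \<in> commutant M ==> (x, y) \<in> a ==> (u x, u y) \<in> a"
 shows "affiliated M a"
 unfolding affiliated_def
proof (intro ballI impI)
 fix u assume u: "u \<in> commutant M" "unitary_op u"
 show "map_prod u u ` a = a"
 proof
  show "map_prod u u ` a \<subseteq> a" using assms u by auto
  show "a \<subseteq> map_prod u u ` a"
  proof clarify
   fix x y assume "(x, y) \<in> a"
   then have "(hadj u x, hadj u y) \<in> a" using assms u unitary_hadj comm_hadj by blast
   moreover have "(x, y) = map_prod u u (hadj u x, hadj u y)" using unitD[OF u(2)] by simp
   ultimately show "(x, y) \<in> map_prod u u ` a" by blast
  qed
 qed
qed

lemma affiliated_adjoint: assumes a: "affiliated M a" shows "affiliated M (adj a)"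
proof (rule affiliatedI)
 fix u y z assume u: "unitary_op u" "u \<in> commutant M" and yz: "(y, z) \<in> adj a"
 show "(u y, u z) \<in> adj a"
  unfolding adj_iff
 proof (intro allI impI)
  fix x w assume "(x, w) \<in> a"
  then have "(hadj u x, hadj u w) \<in> a" using affiliatedD[OF a] unitary_hadj[OF u(1)] comm_hadj[OF u(2)] by blast
  then have "cinner (hadj u w) y = cinner (hadj u x) z" using yz by (simp add: adj_iff)
  then show "cinner w (u y) = cinner x (u z)" using unitD(1)[OF u(1)] by (simp add: cinner_hadj')
 qed
qed

context
 fixes a assumes a: "closed_dd_op a" and af: "affiliated M a"
begin

lemma Rop_mem: "Rop a \<in> M" and Bop_mem: "Bop a \<in> M"
proof -
 have "Rop a (u z) = u (Rop a z)" "Bop a (u z) = u (Bop a z)" if u: "unitary_op u" "u \<in> commutant M" for u z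
 proof -
  note bu = unitD(1)[OF u(1)]
  have 1: "(u (Rop a z), u (Bop a z)) \<in> a" by (rule affiliatedD[OF af u Rop_graph[OF a]])
  have 2: "(u (Bop a z), u z - u (Rop a z)) \<in> adj a"
   using affiliatedD[OF affiliated_adjoint[OF af] u Bop_graph[OF a]] by (simp add: bcl_diff[OF bu])
  show "Rop a (u z) = u (Rop a z)" "Bop a (u z) = u (Bop a z)" using Rop_unique[OF a 1 2] by auto
 qed
 then show "Rop a \<in> M" "Bop a \<in> M"
  using bcl_Rop[OF a] bcl_Bop[OF a] by (auto intro: mem_unitaryI)
qed

lemma sm_mem: "sm a B \<in> M"
proof (cases "B \<in> sets borel")
 case True
 show ?thesis
 proof (rule memI)
  show "bcl (sm a B)" using projD(1)[OF sm_projection[OF a True]] .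
  show "sm a B (Y x) = Y (sm a B x)" if Y: "Y \<in> commutant M" for Y x
   by (rule sm_commute[OF a commutantD(1)[OF Y], symmetric]) (use memD[OF Rop_mem Y] in simp)
 qed
qed (simp add: sm_def mem_zero)

end

lemma fc_mem:
 assumes R: "pcon R" "R \<in> M" and f: "f \<in> bmeas" "!!t. 0 <= t ==> t <= 1 ==> \<bar>f t\<bar> <= B"
 shows "fc R f \<in> M"
proof (rule memI[OF bcl_fc[OF R(1) f]])
 show "fc R f (Y x) = Y (fc R f x)" if Y: "Y \<in> commutant M" for Y x
  by (rule fc_commute[OF R(1) commutantD(1)[OF Y] _ fdom_bounded[OF R(1) f]]) (use memD[OF R(2) Y] in simp_all)
qed

end

section \<open>Traces and distribution functions\<close>

text \<open>\<open>measurable_ops\<close> only asks that the range of p lie in the domain. The bound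
  on that range comes from applying this to the truncations of |a| composed with p.\<close>

lemma banach_steinhaus:
 fixes T :: "nat => 'a::chilbert_space => 'b::chilbert_space"
 assumes T: "!!n. bcl (T n)" and bd: "!!x. \<exists>C. \<forall>n. norm (T n x) <= C"
 shows "\<exists>K. \<forall>n x. norm (T n x) <= K * norm x"
proof -
 define S where "S m = {x. \<forall>n. norm (T n x) <= real m}" for m :: nat
 have cl: "closed (S m)" for m
 proof -
  have "S m = (\<Inter>n. {x. norm (T n x) <= real m})" by (auto simp: S_def)
  moreover have "closed {x. norm (T n x) <= real m}" for n
   by (intro closed_Collect_le continuous_intros bcl_continuous[OF T])
  ultimately show ?thesis by auto
 qed
 have "\<Union>(range S) = UNIV"
 proof -
  have "x \<in> \<Union>(range S)" for x
  proof -
   obtain C where "!!n. norm (T n x) <= C" using bd by blast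
   moreover obtain m where "C <= real m" using real_arch_simple by blast
   ultimately show ?thesis by (auto simp: S_def intro: order_trans)
  qed
  then show ?thesis by auto
 qed
 then have "\<exists>m. interior (S m) ~= {}"
  using Baire_category_alt[of euclidean "range S"] cl completely_metrizable_space_euclidean by fastforce
 then obtain m x0 where "x0 \<in> interior (S m)" by blast
 then obtain r where r: "r > 0" "cball x0 r \<subseteq> S m" using mem_interior_cball by blast
 have "norm (T n x) <= (2 * real m / r) * norm x" for n x
 proof (cases "x = 0")
  case True then show ?thesis using bcl_0[OF T] by simp
 next
  case False
  define z where "z = (r / norm x) *\<^sub>R x"
  have "x0 + z \<in> S m" "x0 \<in> S m" using r False by (auto simp: z_def dist_norm subset_iff)
  then have "norm (T n (x0 + z)) <= real m" "norm (T n x0) <= real m" by (auto simp: S_def)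
  moreover have "T n z = T n (x0 + z) - T n x0" by (simp add: bcl_add[OF T])
  ultimately have "norm (T n z) <= 2 * real m"
   using norm_triangle_ineq4[of "T n (x0 + z)" "T n x0"] by simp
  moreover have "norm (T n z) = (r / norm x) * norm (T n x)"
   using r by (simp add: z_def bcl_scaleR[OF T])
  ultimately show ?thesis using r False by (simp add: field_simps)
 qed
 then show ?thesis by blast
qed

lemma op_leI:
 assumes "positive_op X" "positive_op Y" "!!x. Re (cinner x (X x)) <= Re (cinner x (Y x))" shows "op_le X Y"
 unfolding op_le_def using assms positive_op_sym[OF assms(1)] positive_op_sym[OF assms(2)]
 by (intro positive_opI bcl_subtract) (auto simp: positive_op_def cinner.diff_left cinner.diff_right)

lemma op_leD: "op_le X Y ==> Re (cinner x (X x)) <= Re (cinner x (Y x))"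
 unfolding op_le_def positive_op_def by (auto simp: cinner.diff_right complex_nonneg_Reals_iff)

lemma projection_eq_kernel:
 assumes p: "projection_op p" and q: "projection_op q" and k: "!!v. p v = 0 \<longleftrightarrow> q v = 0" shows "p = q"
proof (rule ext, rule cinner_ext)
 note P = projD[OF p] and Q = projD[OF q]
 have 1: "q (p v) = q v" for v using k[of "v - p v"] P Q by (simp add: bcl_diff)
 have 2: "p (q v) = p v" for v using k[of "v - q v"] P Q by (simp add: bcl_diff)
 fix v z
 have "cinner z (p v) = cinner (p z) v" by (simp add: P)
 also have "... = cinner (p (q z)) v" by (simp add: 2)
 also have "... = cinner z (q (p v))" by (simp add: P Q)
 finally show "cinner z (p v) = cinner z (q v)" by (simp add: 1)
qed

lemma closure_image_subset:
 assumes "continuous_on UNIV u" "!!x. x \<in> S ==> u x \<in> S" "x \<in> closure S" shows "u x \<in> closure S"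
proof -
 have "u ` closure S \<subseteq> closure S"
  by (rule image_closure_subset[OF continuous_on_subset[OF assms(1)]]) (use assms(2) closure_subset in auto)
 then show ?thesis using assms(3) by blast
qed

lemma closure_graph_image:
 assumes "bcl u" "!!x y. (x, y) \<in> T ==> (u x, u y) \<in> T" "(x, y) \<in> closure T" shows "(u x, u y) \<in> closure T"
proof -
 have "map_prod u u (x, y) \<in> closure T"
  by (rule closure_image_subset[OF _ _ assms(3)])
   (use assms(2) in \<open>auto simp: map_prod_def case_prod_unfold intro!: continuous_intros bcl_continuous[OF assms(1), THEN continuous_on_compose2]\<close>)
 then show ?thesis by simp
qed

context vn_alg
begin

definition affop :: "'a graph => bool" where
 "affop a \<longleftrightarrow> closed_dd_op a \<and> affiliated M a"

lemma affopD: "affop a ==> closed_dd_op a" "affop a ==> affiliated M a"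
 by (auto simp: affop_def)

lemma affop_absg: assumes a: "affop a" shows "affop (absg a)"
 unfolding affop_def
proof
 note cd = affopD(1)[OF a]
 show "closed_dd_op (absg a)" using psaD(1)[OF psa_absg[OF cd]] .
 show "affiliated M (absg a)"
 proof (rule affiliatedI)
  fix u x y assume u: "unitary_op u" "u \<in> commutant M" and xy: "(x, y) \<in> absg a"
  have c: "u (Rop a x) = Rop a (u x)" for x using memD[OF Rop_mem[OF cd affopD(2)[OF a]] u(2)] by simp
  have x: "x \<in> fdom (Rop a) lam" and y: "y = fc (Rop a) lam x" using xy by (auto simp: absg_def fcgr_def)
  show "(u x, u y) \<in> absg a"
   using fdom_commute[OF pcon_Rop[OF cd] unitD(1)[OF u(1)] c x] fc_commute[OF pcon_Rop[OF cd] unitD(1)[OF u(1)] c x]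
   by (auto simp: absg_def fcgr_def y)
 qed
qed

text \<open>The projection onto the graph of an isometry \<open>U\<close> with closed domain maps \<open>(x, 0)\<close> to \<open>(P x, U P x) / 2\<close>,
  where \<open>P\<close> is the projection onto the domain.\<close>

lemma polar_decomposition:
 assumes a: "affop a"
 shows "\<exists>u\<in>M. (\<forall>x. norm (u x) <= norm x) \<and> (\<forall>x w. (x, w) \<in> absg a --> (x, u w) \<in> a) \<and>
  (\<forall>x y. (x, y) \<in> a --> (x, hadj u y) \<in> absg a)"
proof -
 note cd = affopD(1)[OF a]
 note aS = cddD[OF cd] and hS = cddD[OF psaD(1)[OF psa_absg[OF cd]]]
 \<comment> \<open>The isometry sending |a|x to a x, as a relation between the two ranges; equality
   of norms makes it single valued and extends to the closure.\<close>
 define U where "U = {(w, y). \<exists>x. (x, w) \<in> absg a \<and> (x, y) \<in> a}"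
 have US: "csubspace U" unfolding csubspace_def
 proof (intro conjI ballI allI)
  show "0 \<in> U" using graph_0[OF hS(1)] graph_0[OF aS(1)] by (auto simp: U_def zero_prod_def)
  show "x + y \<in> U" if "x \<in> U" "y \<in> U" for x y
   using that graph_add[OF hS(1)] graph_add[OF aS(1)] by (auto simp: U_def) blast
  show "c *\<^sub>C x \<in> U" if "x \<in> U" for c x
   using that graph_scaleC[OF hS(1)] graph_scaleC[OF aS(1)] by (auto simp: U_def scaleC_prod_def) blast
 qed
 have UN: "norm w = norm y" if "(w, y) \<in> U" for w y
  using that absg_norm[OF cd] by (auto simp: U_def)
 have form: "cinner y y' = cinner w w'" if "(w, y) \<in> U" "(w', y') \<in> U" for w y w' y'
 proof -
  have "cinner (snd (w, y)) (snd (w', y')) - cinner (fst (w, y)) (fst (w', y')) = 0"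
  proof (rule sesquilinear_diagonal_zero[OF US, where B = "%p q. cinner (snd p) (snd q) - cinner (fst p) (fst q)"])
   show "cinner (snd p) (snd p) - cinner (fst p) (fst p) = 0" if "p \<in> U" for p
    using UN[of "fst p" "snd p"] that by (simp add: cinner_self)
  qed (use that in \<open>auto simp: cinner_add_left cinner_add_right cinner_scaleC_left cinner_scaleC_right scaleC_prod_def algebra_simps\<close>)
  then show ?thesis by simp
 qed
 define C where "C = closure U"
 have C: "csubspace C" "closed C" by (simp_all add: C_def csub_closure[OF US])
 have "C \<subseteq> {p. norm (fst p) = norm (snd p)}" unfolding C_def
  by (rule closure_minimal) (use UN in \<open>auto intro!: closed_Collect_eq continuous_intros\<close>)
 then have CN: "norm (fst p) = norm (snd p)" if "p \<in> C" for p using that by blast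
 define P where "P = hproj C"
 have P: "projection_op P" "P p \<in> C" for p unfolding P_def by (rule proj_hproj(1)[OF C], rule hproj_works(1)[OF C])
 note PD = projD[OF P(1)]
 define u where "u x = snd (2 *\<^sub>R P (x, 0))" for x
 have bd: "norm (u x) <= 1 * norm x" for x
 proof -
  let ?p = "P (x, 0)"
  have "cinner x (fst ?p) = cr ((norm ?p)^2)"
   using proj_cinner[OF P(1), of "(x, 0)"] by (simp add: cinner_prod_def cinner.zero_left)
  then have "(norm ?p)^2 = cmod (cinner x (fst ?p))" by (simp add: norm_power)
  also have "... <= norm x * norm (snd ?p)" using cmod_cinner_le[of x "fst ?p"] CN[OF P(2)] by simp
  finally have "2 * norm (snd ?p) * norm (snd ?p) <= norm x * norm (snd ?p)"
   using CN[OF P(2), of "(x, 0)"] by (simp add: norm_prod_def power2_eq_square)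
  then have "2 * norm (snd ?p) <= norm x" by (cases "norm (snd ?p) = 0") auto
  then show ?thesis by (simp add: u_def)
 qed
 have u: "bcl u"
 proof (rule bclI[OF _ _ bd])
  show "u (x + y) = u x + u y" for x y
   using bcl_add[OF PD(1), of "(x, 0)" "(y, 0)"] by (simp add: u_def scaleR_add_right)
  show "u (c *\<^sub>C x) = c *\<^sub>C u x" for c x
   using bcl_scaleC[OF PD(1), of c "(x, 0)"] by (simp add: u_def scaleC_prod_def scaleC.zero_right scaleC.scaleR_right)
 qed
 have hu: "hadj u = (%y. fst (2 *\<^sub>R P (0, y)))"
 proof (rule hadj_eqI)
  show "cinner (u x) y = cinner x (fst (2 *\<^sub>R P (0, y)))" for x y
   using PD(3)[of "(x, 0)" "(0, y)"] by (simp add: u_def cinner_prod_def cinner.zero_left cinner.zero_right cinner.scaleR_left cinner.scaleR_right)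
 qed
 \<comment> \<open>The residuals are half of (w, -y) and of its negative. Both are orthogonal to the
   graph because U preserves inner products, whence the factor 2 in the definition of u.\<close>
 have half: "P (w, 0) = (1 / 2) *\<^sub>R (w, y)" "P (0, y) = (1 / 2) *\<^sub>R (w, y)" if wy: "(w, y) \<in> U" for w y
 proof -
  have mem: "(1 / 2) *\<^sub>R (w, y) \<in> C" using csub_scaleR[OF US wy] closure_subset unfolding C_def by blast
  have e: "(w, 0) - (1 / 2) *\<^sub>R (w, y) = (1 / 2) *\<^sub>R (w, - y)" "(0, y) - (1 / 2) *\<^sub>R (w, y) = (1 / 2) *\<^sub>R (- w, y)"
   using scaleR_half_double[of w] scaleR_half_double[of y] by (auto simp: algebra_simps)
  have "U \<subseteq> ocomp {(w, - y)}" using form[OF wy]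
   by (auto simp: ocomp_def cinner_prod_def cinner.minus_left)
  then have "C \<subseteq> ocomp {(w, - y)}" unfolding C_def by (rule closure_minimal[OF _ closed_ocomp])
  then have z: "cinner z (w, - y) = 0" if "z \<in> C" for z using that cinner_zero_sym by (fastforce simp: ocomp_def)
  then have "cinner z (- w, y) = 0" if "z \<in> C" for z using z[OF that] by (simp add: cinner_prod_def cinner.minus_right algebra_simps)
  with z show "P (w, 0) = (1 / 2) *\<^sub>R (w, y)" "P (0, y) = (1 / 2) *\<^sub>R (w, y)"
   unfolding P_def by (auto intro!: hproj_eqI[OF C mem] simp only: e cinner.scaleR_right scaleR_zero_right)
 qed
 have "u \<in> M"
 proof (rule mem_unitaryI[OF u])
  fix v x assume v: "unitary_op v" "v \<in> commutant M"
  have vU: "(v w, v y) \<in> C" if v: "unitary_op v" "v \<in> commutant M" and "(w, y) \<in> C" for v w y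
  proof -
   have "(v w, v y) \<in> U" if "(w, y) \<in> U" for w y
    using that affiliatedD[OF affopD(2)[OF a] v] affiliatedD[OF affopD(2)[OF affop_absg[OF a]] v] unfolding U_def by blast
   then show ?thesis using closure_graph_image[OF unitD(1)[OF v(1)], of U] that(3) unfolding C_def by blast
  qed
  obtain w y where p: "P (x, 0) = (w, y)" by (cases "P (x, 0)")
  have "P (v x, 0) = (v w, v y)" unfolding P_def
  proof (rule hproj_eqI[OF C])
   show "(v w, v y) \<in> C" using vU[OF v] P(2)[of "(x, 0)"] p by simp
   fix z assume "z \<in> C"
   then have "cinner (hadj v (fst z), hadj v (snd z)) ((x, 0) - P (x, 0)) = 0"
    unfolding P_def using vU[OF unitary_hadj[OF v(1)] comm_hadj[OF v(2)], of "fst z" "snd z"] by (intro hproj_works(2)[OF C]) simp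
   moreover have "(v x, 0) - (v w, v y) = (v (x - w), v (- y))"
    by (simp add: bcl_diff[OF unitD(1)[OF v(1)]] bcl_minus[OF unitD(1)[OF v(1)]])
   ultimately show "cinner z ((v x, 0) - (v w, v y)) = 0" by (simp add: p cinner_prod_def cinner_hadj'[OF unitD(1)[OF v(1)]])
  qed
  then show "u (v x) = v (u x)" using p by (simp add: u_def bcl_scaleR[OF unitD(1)[OF v(1)]])
 qed
 moreover have "(x, u w) \<in> a" if xw: "(x, w) \<in> absg a" for x w
 proof -
  obtain y where y: "(x, y) \<in> a" using xw Domain_absg[OF cd] by blast
  then have "(w, y) \<in> U" using xw by (auto simp: U_def)
  then show ?thesis using half(1) y by (simp add: u_def)
 qed
 moreover have "(x, hadj u y) \<in> absg a" if xy: "(x, y) \<in> a" for x y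
 proof -
  obtain w where w: "(x, w) \<in> absg a" using xy Domain_absg[OF cd] by blast
  then have "(w, y) \<in> U" using xy by (auto simp: U_def)
  then show ?thesis using half(2) w by (simp add: hu)
 qed
 ultimately show ?thesis using bd by auto
qed

end

locale traced_alg = vn_alg M for M :: "('a::chilbert_space => 'a) set" +
 fixes \<tau> :: "('a => 'a) => ennreal"
 assumes tr: "fns_trace M \<tau>"
begin

lemma pos_partI: "X \<in> M ==> positive_op X ==> X \<in> pos_part M"
 by (simp add: pos_part_def)

lemma proj_pos: "p \<in> M ==> projection_op p ==> p \<in> pos_part M"
 by (simp add: pos_partI projection_positive)

lemma tr_add: "X \<in> pos_part M ==> Y \<in> pos_part M ==> \<tau> (%x. X x + Y x) = \<tau> X + \<tau> Y"
 using tr by (simp add: fns_trace_def is_trace_def)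

lemma zero_pos: "(%x. 0) \<in> pos_part M"
 by (intro pos_partI mem_zero positive_opI bcl_zero) (auto simp: cinner.zero_left cinner.zero_right)

lemma tr_zero: "\<tau> (%x. 0) = 0"
proof -
 have "\<tau> (%x. 0 *\<^sub>R 0) = ennreal 0 * \<tau> (%x. 0)"
  using tr zero_pos unfolding fns_trace_def is_trace_def by fastforce
 then show ?thesis by simp
qed

lemma tr_mono: assumes "X \<in> pos_part M" "Y \<in> pos_part M" "op_le X Y" shows "\<tau> X <= \<tau> Y"
proof -
 have "(%x. Y x - X x) \<in> pos_part M" using assms by (auto simp: pos_part_def op_le_def mem_diff)
 then have "\<tau> (%x. X x + (Y x - X x)) = \<tau> X + \<tau> (%x. Y x - X x)" by (rule tr_add[OF assms(1)])
 then show ?thesis by simp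
qed

lemma tr_adj: "X \<in> M ==> \<tau> (%x. hadj X (X x)) = \<tau> (%x. X (hadj X x))"
 using tr by (simp add: fns_trace_def is_trace_def cadjoint_hadj o_def)

lemma tr_faithful: "X \<in> pos_part M ==> \<tau> X = 0 ==> X x = 0"
 using tr unfolding fns_trace_def faithful_trace_def by auto

text \<open>Normality is formulated with order suprema of directed sets; a strong limit of an
  increasing sequence is such a supremum because the order is tested on quadratic forms.\<close>

lemma tr_incseq:
 assumes X: "!!n::nat. X n \<in> pos_part M" and inc: "!!n x. Re (cinner x (X n x)) <= Re (cinner x (X (Suc n) x))"
  and Z: "Z \<in> pos_part M" and lim: "!!x. (%n. X n x) ---> Z x"
 shows "\<tau> Z = (SUP n. \<tau> (X n))"
proof -
 have Xp: "positive_op (X n)" for n using X by (simp add: pos_part_def)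
 have Zp: "positive_op Z" using Z by (simp add: pos_part_def)
 have mono: "Re (cinner x (X n x)) <= Re (cinner x (X m x))" if "n <= m" for n m x
  using lift_Suc_mono_le[of "%n. Re (cinner x (X n x))" n m] inc that by blast
 have l: "(%n. Re (cinner x (X n x))) ---> Re (cinner x (Z x))" for x
  by (intro tendsto_Re cinner.tendsto tendsto_const lim)
 have le: "op_le (X n) Z" for n
  by (rule op_leI[OF Xp Zp]) (rule incseq_le[OF _ l], auto simp: incseq_def mono)
 have least: "op_le Z Y" if Y: "Y \<in> pos_part M" and up: "\<forall>f\<in>range X. op_le f Y" for Y
 proof (rule op_leI[OF Zp])
  show "positive_op Y" using Y by (simp add: pos_part_def)
  show "Re (cinner x (Z x)) <= Re (cinner x (Y x))" for x
   by (rule LIMSEQ_le_const2[OF l]) (use up op_leD in blast)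
 qed
 have dir: "\<exists>h\<in>range X. op_le f h \<and> op_le g h" if fg: "f \<in> range X" "g \<in> range X" for f g
 proof -
  obtain n m where "f = X n" "g = X m" using fg by blast
  then show ?thesis by (intro bexI[of _ "X (max n m)"]) (auto intro!: op_leI Xp mono)
 qed
 have "normal_trace M \<tau>" using tr by (simp add: fns_trace_def)
 then have "\<tau> Z = (SUP f\<in>range X. \<tau> f)"
  unfolding normal_trace_def using X Z le least dir by (elim allE[of _ "range X"] allE[of _ Z]) (simp add: image_subset_iff)
 then show ?thesis by (simp add: image_image)
qed

lemma tr_sums:
 assumes P: "!!n::nat. P n \<in> M" "!!n. projection_op (P n)" and orth: "!!m n x. m ~= n ==> P m (P n x) = 0"
  and Q: "Q \<in> M" "projection_op Q" and s: "!!x. (%n. P n x) sums Q x"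
 shows "\<tau> Q = (\<Sum>n. \<tau> (P n))"
proof -
 define S where "S n x = (\<Sum>i<n. P i x)" for n x
 have Sm: "S n \<in> M" for n unfolding S_def by (rule mem_setsum) (rule P)
 have qf: "Re (cinner x (S n x)) = (\<Sum>i<n. (norm (P i x))^2)" for n x
  by (simp add: S_def cinner.sum_right proj_cinner[OF P(2)])
 have sym: "cinner (S n x) y = cinner x (S n y)" for n x y
  by (simp add: S_def cinner.sum_right cinner.sum_left projD(3)[OF P(2)])
 have Sp: "S n \<in> pos_part M" for n
  by (intro pos_partI Sm positive_opI mem_bcl sym) (simp add: qf sum_nonneg)
 have "\<tau> Q = (SUP n. \<tau> (S n))"
 proof (rule tr_incseq[OF Sp _ proj_pos[OF Q]])
  show "Re (cinner x (S n x)) <= Re (cinner x (S (Suc n) x))" for n x by (simp add: qf)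
  show "(%n. S n x) ---> Q x" for x using s by (simp add: S_def sums_def)
 qed
 also have "\<tau> (S n) = (\<Sum>i<n. \<tau> (P i))" for n
 proof (induction n)
  case 0 show ?case by (simp add: S_def tr_zero)
 next
  case (Suc n)
  have "S (Suc n) = (%x. S n x + P n x)" by (rule ext) (simp add: S_def)
  then show ?case using tr_add[OF Sp proj_pos[OF P], of n n] Suc by simp
 qed
 then have "(SUP n. \<tau> (S n)) = (\<Sum>n. \<tau> (P n))" by (simp add: suminf_eq_SUP)
 finally show ?thesis .
qed

lemma affop_graph: assumes X: "X \<in> M" shows "affop {(v, X v) | v. True}"
 unfolding affop_def closed_dd_op_def
proof (intro conjI affiliatedI)
 note b = mem_bcl[OF X]
 show "csubspace {(v, X v) | v. True}"
  unfolding csubspace_def by (auto simp: zero_prod_def scaleC_prod_def bcl_0[OF b] bcl_add[OF b] bcl_scaleC[OF b])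
 have "{(v, X v) | v. True} = {p. snd p = X (fst p)}" by auto
 also have "closed ..." by (intro closed_Collect_eq continuous_intros bounded_linear.continuous_on[OF bcl_linear[OF b]])
 finally show "closed {(v, X v) | v. True}" .
 have "Domain {(v, X v) | v. True} = UNIV" by auto
 then show "closure (Domain {(v, X v) | v. True}) = UNIV" by simp
qed (use memD[OF X] in \<open>auto intro: single_valuedI\<close>)

text \<open>The support s of X and a projection f over its range are compared through X = u|X|: the
  operator Y = u s satisfies \<open>hadj Y\<close> Y = s, while Y \<open>hadj Y\<close> is a
  contraction living under f, and the trace does not distinguish the two products. X enters as a
  closed operator through its graph so that \<open>polar_decomposition\<close> applies.\<close>

lemma tr_support:
 assumes X: "X \<in> M" and f: "f \<in> M" "projection_op f" and fX: "!!v. f (X v) = X v"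
  and s: "projection_op s" and ker: "!!v. s v = 0 \<longleftrightarrow> X v = 0"
 shows "s \<in> M" "\<tau> s <= \<tau> f"
proof -
 note b = mem_bcl[OF X]
 let ?a = "{(v, X v) | v. True}"
 have a: "affop ?a" by (rule affop_graph[OF X])
 note cd = affopD(1)[OF a]
 note hp = psa_absg[OF cd] and S = projD[OF s] and F = projD[OF f(2)]
 have N: "csubspace {v. X v = 0}" "closed {v. X v = 0}"
  using b by (auto simp: csubspace_def bcl_0 bcl_add bcl_scaleC scaleC.zero_right
    intro!: closed_Collect_eq bcl_continuous continuous_intros)
 have "hproj {v. X v = 0} \<in> M" by (rule mem_hproj[OF N]) (simp add: memD[OF X] bcl_0[OF unitD(1)])
 moreover have "s = (%v. v - hproj {v. X v = 0} v)"
 proof (rule projection_eq_kernel[OF s proj_compl[OF proj_hproj(1)[OF N]]])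
  show "s v = 0 \<longleftrightarrow> v - hproj {v. X v = 0} v = 0" for v
   using ker projection_range[OF proj_hproj(1)[OF N], of v] proj_hproj(2)[OF N] by auto
 qed
 ultimately show sM: "s \<in> M" using mem_compl by metis
 obtain u where u: "u \<in> M" "!!x. norm (u x) <= norm x" "!!x w. (x, w) \<in> absg ?a ==> (x, u w) \<in> ?a"
  "!!x y. (x, y) \<in> ?a ==> (x, hadj u y) \<in> absg ?a"
  using polar_decomposition[OF a] by blast
 note bu = mem_bcl[OF u(1)]
 have D: "\<exists>y. (z, y) \<in> absg ?a" for z
 proof -
  have "z \<in> Domain (absg ?a)" unfolding Domain_absg[OF cd] by auto
  then show ?thesis by blast
 qed
 have orth: "s z = 0" if z: "!!x w. (x, w) \<in> absg ?a ==> cinner w z = 0" for z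
 proof -
  obtain y where y: "(z, y) \<in> absg ?a" using D by blast
  have "cinner y y = 0"
  proof -
   obtain w where "(y, w) \<in> absg ?a" using D by blast
   then show ?thesis using psaD(4)[OF hp y] z cinner_zero_sym by metis
  qed
  then show ?thesis using ker absg_norm[OF cd _ y, of "X z"] by (simp add: cinner_self)
 qed
 have uu: "hadj u (u w) = w" if "(x, w) \<in> absg ?a" for x w
  using u(4)[OF u(3)[OF that]] sv_eq[OF cddD(2)[OF psaD(1)[OF hp]]] that by blast
 define Y where "Y v = u (s v)" for v
 have Y: "Y \<in> M" unfolding Y_def by (rule mem_comp[OF u(1) sM])
 note bY = mem_bcl[OF Y]
 have hY: "hadj Y v = s (hadj u v)" for v
  using hadj_comp[OF bu S(1)] hadj_eqI[OF S(3)] by (simp add: Y_def[abs_def])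
 have "hadj Y (Y v) = s v" for v
 proof -
  have "s (hadj u (u (s v)) - s v) = 0"
   by (rule orth) (simp add: cinner.diff_right cinner_hadj[OF bu, symmetric] cinner_hadj'[OF bu] uu)
  then show ?thesis by (simp add: hY Y_def bcl_diff[OF S(1)] S(2))
 qed
 then have "\<tau> s = \<tau> (%v. Y (hadj Y v))" using tr_adj[OF Y] by simp
 also have "... <= \<tau> f"
 proof -
  have q: "Re (cinner v (Y (hadj Y v))) = (norm (hadj Y v))^2" for v by (simp add: cinner_hadj'[OF bY] cinner_self)
  have p: "(%v. Y (hadj Y v)) \<in> pos_part M"
   by (intro pos_partI mem_comp[OF Y mem_hadj[OF Y]] positive_opI bcl_comp[OF bY bcl_hadj[OF bY]])
    (simp_all only: cinner_hadj[OF bY] cinner_hadj'[OF bY] cinner_self Re_complex_of_real zero_le_power2)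
  have hf: "hadj Y v = hadj Y (f v)" for v
  proof -
   have "s (hadj u (v - f v)) = 0"
   proof (rule orth)
    fix x w assume "(x, w) \<in> absg ?a"
    then have "f (u w) = u w" using u(3) fX by fastforce
    then show "cinner w (hadj u (v - f v)) = 0" by (simp add: cinner_hadj[OF bu, symmetric] cinner.diff_right F(3)[symmetric])
   qed
   then show ?thesis by (simp add: hY bcl_diff bcl_hadj[OF bu] S(1))
  qed
  have Yn: "norm (Y v) <= 1 * norm v" for v using order_trans[OF u(2) proj_norm_le[OF s]] by (simp add: Y_def)
  show ?thesis
  proof (rule tr_mono[OF p proj_pos[OF f]], rule op_leI[OF _ projection_positive[OF f(2)]])
   show "Re (cinner v (Y (hadj Y v))) <= Re (cinner v (f v))" for v
    unfolding q using hadj_bound[OF bY Yn, of "f v"] by (subst hf) (simp add: proj_cinner[OF f(2)] power_mono)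
  qed (use p in \<open>simp add: pos_part_def\<close>)
 qed
 finally show "\<tau> s <= \<tau> f" .
qed

text \<open>The operator (1 - p)e is injective on the range of e precisely because the ranges meet
  trivially. So its support is e, and its range lies under 1 - p.\<close>

lemma tr_disjoint:
 assumes e: "e \<in> M" "projection_op e" and p: "p \<in> M" "projection_op p" and disj: "!!v. e v = v ==> p v = v ==> v = 0"
 shows "\<tau> e <= \<tau> (%v. v - p v)"
proof (rule tr_support(2)[where X = "%v. e v - p (e v)"])
 note P = projD[OF p(2)] and E = projD[OF e(2)]
 show "(%v. e v - p (e v)) \<in> M" by (rule mem_diff[OF e(1) mem_comp[OF p(1) e(1)]])
 show "(%v. v - p v) \<in> M" "projection_op (%v. v - p v)" by (rule mem_compl[OF p(1)], rule proj_compl[OF p(2)])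
 show "e v - p (e v) - p (e v - p (e v)) = e v - p (e v)" for v by (simp add: bcl_diff[OF P(1)] P(2))
 show "e v = 0 \<longleftrightarrow> e v - p (e v) = 0" for v using disj[of "e v"] E(2) bcl_0[OF P(1)] by auto
qed (rule e)

section \<open>Distribution functions of affiliated operators\<close>

definition distf :: "'a graph => real => ennreal" where
 "distf a s = \<tau> (sm a {s<..})"

definition tmeas :: "'a graph => real measure" where
 "tmeas a = measure_of UNIV (sets borel) (%B. \<tau> (sm a B))"

lemma affop_adjoint: "affop a ==> affop (adj a)"
 by (simp add: affop_def closed_dd_op_adjoint affiliated_adjoint)

context
 fixes a assumes aff: "affop a"
begin

private lemma a: "closed_dd_op a" and af: "affiliated M a"
 using aff by (auto simp: affop_def)

private lemmas pR2 = pcon_Rop[OF a]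
private lemmas smP = sm_projection[OF a]
private lemmas smM = sm_mem[OF a af]
private lemmas smV = sm_pvm[OF a]

lemma sets_tmeas [simp]: "sets (tmeas a) = sets borel" and space_tmeas [simp]: "space (tmeas a) = UNIV"
 and emeasure_tmeas: "B \<in> sets borel ==> emeasure (tmeas a) B = \<tau> (sm a B)"
proof -
 have sig: "sigma_sets UNIV (sets (borel :: real measure)) = sets borel"
  using sets.sigma_sets_eq[of "borel :: real measure"] by simp
 show sets: "sets (tmeas a) = sets borel" and "space (tmeas a) = UNIV"
  unfolding tmeas_def by (simp_all add: sig space_measure_of)
 assume B: "B \<in> sets borel"
 show "emeasure (tmeas a) B = \<tau> (sm a B)"
 proof (rule emeasure_measure_of[OF tmeas_def])
  have "sm a {} = (%x. 0)" using pvm_empty[OF smV] by auto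
  then show "positive (sets (tmeas a)) (%B. \<tau> (sm a B))" by (simp add: positive_def tr_zero)
  show "countably_additive (sets (tmeas a)) (%B. \<tau> (sm a B))"
   unfolding countably_additive_def sets
  proof (intro allI impI)
   fix A :: "nat => real set" assume A: "range A \<subseteq> sets borel" "disjoint_family A"
   then have Am: "A n \<in> sets borel" for n by auto
   have "sm a (A m) (sm a (A n) x) = 0" if "m ~= n" for m n x
    using pvmD(4)[OF smV Am Am, of m n x] A(2) that pvm_empty[OF smV] by (auto simp: disjoint_family_on_def)
   then show "(\<Sum>n. \<tau> (sm a (A n))) = \<tau> (sm a (\<Union> (range A)))"
    using pvmD(5)[OF smV Am A(2)] Am by (intro tr_sums[symmetric] smM smP) auto
  qed
 qed (use B sets in auto)
qed

lemma dist_tmeas: "distf a s = emeasure (tmeas a) {s<..}"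
 by (simp add: distf_def emeasure_tmeas)

lemma dist_antimono: "s <= t ==> distf a t <= distf a s"
 unfolding dist_tmeas by (intro emeasure_mono) auto

lemma sm_atMost_norm:
 assumes s: "0 <= s" and x: "sm a {..s} x = x"
 shows "x \<in> Domain a" "(x, y) \<in> a ==> norm y <= s * norm x"
proof -
 show "x \<in> Domain a" using sm_atMost_Domain[OF a, of s x] x Domain_absg[OF a] by simp
 have d: "x \<in> fdom (Rop a) lam" using sm_atMost_Domain[OF a, of s x] x by (simp add: absg_def Domain_fcgr[OF pR2])
 have "fc (Rop a) lam x = fc (Rop a) (%t. lam t * ind {..s} (lam t)) x"
  using fc_fc[OF pR2 ind_lam(2)[OF a] _ lam_meas, of "{..s}" x] fdom_fc[OF pR2 ind_lam(2)[OF a] lam_meas, of "{..s}" x] d x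
  by (simp add: sm_fc[OF a])
 then have "norm (fc (Rop a) lam x) <= s * norm x"
  using fc_norm_bound[OF pR2, of "%t. lam t * ind {..s} (lam t)" s x] s
  by (simp add: indicator_def lam_nonneg)
 moreover assume "(x, y) \<in> a"
 ultimately show "norm y <= s * norm x"
  using absg_norm[OF a _, of x y "fc (Rop a) lam x"] d by (auto simp: absg_def fcgr_def)
qed

lemma sm_Compl_atMost: "(%v. v - sm a {..s} v) = sm a {s<..}"
proof -
 have "- {..s} = {s<..}" by auto
 then show ?thesis using pvm_Compl[OF smV, of "{..s}"] by auto
qed

text \<open>On the spectral subspace for (s, \<infinity>) the form of |a| strictly exceeds s, while
  on the range of p it is at most s; the two meet in 0 and \<open>tr_disjoint\<close>
  applies.\<close>

lemma dist_le:
 assumes p: "p \<in> M" "projection_op p" and s: "0 <= s" and bd: "!!x. p x = x ==> \<exists>y. (x, y) \<in> a \<and> norm y <= s * norm x"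
 shows "distf a s <= \<tau> (%v. v - p v)"
 unfolding distf_def
proof (rule tr_disjoint[OF smM smP p])
 fix v assume v: "sm a {s<..} v = v" "p v = v"
 obtain y where y: "(v, y) \<in> a" "norm y <= s * norm v" using bd v by blast
 obtain w where w: "(v, w) \<in> absg a" using y Domain_absg[OF a] by blast
 have "Re (cinner v w) <= norm v * norm w" using complex_Re_le_cmod cmod_cinner_le order_trans by blast
 also have "... = norm v * norm y" using absg_norm[OF a y(1) w] by simp
 also have "... <= s * (norm v)^2" using mult_left_mono[OF y(2), of "norm v"] by (simp add: power2_eq_square algebra_simps)
 finally show "v = 0" by (rule pvm_form_gt[OF psa_absg[OF a] smV sm_spectral[OF a] w v(1)])
qed simp

text \<open>Dual to \<open>dist_le\<close>, with p playing against the spectral subspace for values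
  at most s. The strict gap s < s' is what forces a common vector to vanish.\<close>

lemma dist_ge:
 assumes p: "p \<in> M" "projection_op p" and s: "0 <= s" "s < s'" and bd: "!!x y. p x = x ==> (x, y) \<in> a ==> s' * norm x <= norm y"
 shows "\<tau> p <= distf a s"
 unfolding distf_def sm_Compl_atMost[symmetric]
proof (rule tr_disjoint[OF p smM smP])
 fix v assume v: "p v = v" "sm a {..s} v = v"
 then obtain y where y: "(v, y) \<in> a" using sm_atMost_norm(1)[OF s(1) v(2)] by blast
 have "s' * norm v <= s * norm v" using bd[OF v(1) y] sm_atMost_norm(2)[OF s(1) v(2) y] by simp
 then show "v = 0" using s by (simp add: mult_le_cancel_right)
qed simp

lemma dist_right_cont: "distf a s = (SUP n. distf a (s + 1 / real (Suc n)))"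
proof -
 have "(SUP n. emeasure (tmeas a) {s + 1 / real (Suc n)<..}) = emeasure (tmeas a) (\<Union>n. {s + 1 / real (Suc n)<..})"
 proof (rule SUP_emeasure_incseq)
  show "incseq (%n. {s + 1 / real (Suc n)<..})"
  proof (rule incseq_SucI)
   fix n
   have "1 / real (Suc (Suc n)) <= 1 / real (Suc n)" by (intro divide_left_mono) auto
   then show "{s + 1 / real (Suc n)<..} \<subseteq> {s + 1 / real (Suc (Suc n))<..}" by (auto simp del: of_nat_Suc)
  qed
 qed auto
 moreover have "(\<Union>n. {s + 1 / real (Suc n)<..}) = {s<..}"
 proof (intro set_eqI iffI)
  fix t assume "t \<in> (\<Union>n. {s + 1 / real (Suc n)<..})"
  then obtain n where "s + 1 / real (Suc n) < t" by auto
  moreover have "0 < 1 / real (Suc n)" by simp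
  ultimately show "t \<in> {s<..}" unfolding greaterThan_iff by linarith
 next
  fix t assume "t \<in> {s<..}"
  then obtain n where "inverse (real (Suc n)) < t - s" using reals_Archimedean[of "t - s"] by auto
  then show "t \<in> (\<Union>n. {s + 1 / real (Suc n)<..})" by (auto simp: field_simps)
 qed
 ultimately show ?thesis by (simp add: dist_tmeas)
qed

lemma dist_small:
 assumes fin: "distf a s0 < \<infinity>" and d: "0 < d" shows "\<exists>s\<ge>0. distf a s <= ennreal d"
proof -
 have "(%n. emeasure (tmeas a) {s0 + real n<..}) ---> emeasure (tmeas a) (\<Inter>n. {s0 + real n<..})"
 proof (rule Lim_emeasure_decseq)
  show "decseq (%n. {s0 + real n<..})" by (auto simp: decseq_def)
  show "emeasure (tmeas a) {s0 + real n<..} ~= \<infinity>" for n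
  proof -
   have "distf a (s0 + real n) <= distf a s0" by (rule dist_antimono) simp
   also note fin
   finally show ?thesis by (simp add: dist_tmeas)
  qed
 qed auto
 moreover have "(\<Inter>n. {s0 + real n<..}) = {}"
 proof -
  have "\<exists>n. \<not> s0 + real n < t" for t
  proof -
   obtain n where "t - s0 <= real n" using real_arch_simple by blast
   then show ?thesis by (intro exI[of _ n]) linarith
  qed
  then show ?thesis by auto
 qed
 ultimately have l: "(%n. distf a (s0 + real n)) ---> 0" by (simp add: dist_tmeas)
 have "\<forall>\<^sub>F n in sequentially. distf a (s0 + real n) < ennreal d"
  using d by (intro order_tendstoD(2)[OF l]) simp
 then obtain n where "distf a (s0 + real n) < ennreal d" by (auto simp: eventually_sequentially)
 then have "distf a (max 0 (s0 + real n)) <= ennreal d"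
  using dist_antimono[of "s0 + real n" "max 0 (s0 + real n)"] by (meson less_imp_le max.cobounded2 order_trans)
 then show ?thesis by (intro exI[of _ "max 0 (s0 + real n)"]) simp
qed

end

end

section \<open>Polar decomposition and measurable operators\<close>

lemma csubspace_relcomp: "csubspace S ==> csubspace T ==> csubspace (S O T)"
proof -
 assume S: "csubspace S" and T: "csubspace T"
 show ?thesis unfolding csubspace_def
 proof (intro conjI ballI allI)
  show "0 \<in> S O T" using graph_0[OF S] graph_0[OF T] by (auto simp: zero_prod_def)
  show "x + y \<in> S O T" if "x \<in> S O T" "y \<in> S O T" for x y
   using that graph_add[OF S] graph_add[OF T] by (auto simp: relcomp_unfold) blast
  show "c *\<^sub>C x \<in> S O T" if "x \<in> S O T" for c x
   using that graph_scaleC[OF S] graph_scaleC[OF T] by (auto simp: relcomp_unfold scaleC_prod_def) blast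
 qed
qed

lemma projection_ker:
 assumes X: "bcl X"
 shows "\<exists>s. projection_op s \<and> (\<forall>v. s v = 0 \<longleftrightarrow> X v = 0)"
proof -
 define N where "N = {v. X v = 0}"
 have N: "csubspace N" "closed N"
  unfolding N_def using X by (auto simp: csubspace_def bcl_0 bcl_add bcl_scaleC scaleC.zero_right
    intro!: closed_Collect_eq bcl_continuous continuous_intros)
 have "v - hproj N v = 0 \<longleftrightarrow> X v = 0" for v
  using projection_range[OF proj_hproj(1)[OF N], of v] proj_hproj(2)[OF N] by (auto simp: N_def)
 then show ?thesis using proj_compl[OF proj_hproj(1)[OF N]] by blast
qed

lemma lam_cut:
 fixes s :: real
 shows "(%t. ind {..s} (lam t) * lam t) \<in> bmeas" "0 <= s ==> \<bar>ind {..s} (lam t) * lam t\<bar> <= s"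
proof -
 show "(%t. ind {..s} (lam t) * lam t) \<in> bmeas" by measurable
 show "0 <= s ==> \<bar>ind {..s} (lam t) * lam t\<bar> <= s" using lam_nonneg[of t] by (auto simp: indicator_def)
qed

context traced_alg
begin

text \<open>On the spectral subspace of x for values at most s the operator z is bounded by s. With
  Y the identity this is monotonicity under graph inclusion; with a partial isometry it compares an
  operator with its absolute value.\<close>

lemma dist_le_of_graph:
 assumes x: "affop x" and z: "affop z" and Y: "!!v. norm (Y v) <= norm v" and sub: "!!v w. (v, w) \<in> x ==> (v, Y w) \<in> z" and s: "0 <= s"
 shows "distf z s <= distf x s"
proof -
 have "distf z s <= \<tau> (%v. v - sm x {..s} v)"
 proof (rule dist_le[OF z sm_mem[OF affopD[OF x]] sm_projection[OF affopD(1)[OF x]] s])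
  fix v assume v: "sm x {..s} v = v"
  then obtain w where w: "(v, w) \<in> x" using sm_atMost_norm(1)[OF x s] by blast
  have "norm (Y w) <= s * norm v" using Y[of w] sm_atMost_norm(2)[OF x s v w] by linarith
  then show "\<exists>y. (v, y) \<in> z \<and> norm y <= s * norm v" using sub[OF w] by blast
 qed simp
 then show ?thesis unfolding sm_Compl_atMost[OF x] distf_def .
qed

lemma dist_mono_graph: "affop x ==> affop z ==> x \<subseteq> z ==> 0 <= s ==> distf z s <= distf x s"
 by (rule dist_le_of_graph[where Y = "%v. v"]) auto

lemma absg_cut:
 assumes a: "affop a" and xw: "(x, w) \<in> absg a"
 shows "sm a {..s} w = fc (Rop a) (%t. ind {..s} (lam t) * lam t) x"
 using fc_sm(2)[OF affopD(1)[OF a], of x lam "{..s}"] xw by (auto simp: absg_def fcgr_def)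

text \<open>With a = u|a| and E the spectral projection for (s, \<infinity>), f = u E
  \<open>hadj u\<close> is a projection of the same trace as E. On its kernel the adjoint acts as
  the part of |a| below s, applied after \<open>hadj u\<close>. Positivity of s puts the range of E
  inside the range of |a|, where \<open>hadj u\<close> inverts u.\<close>

lemma dist_adjoint_le_pos:
 assumes a: "affop a" and s: "0 < s" shows "distf (adj a) s <= distf a s"
proof -
 note cd = affopD(1)[OF a]
 note pR = pcon_Rop[OF cd]
 obtain u where u: "u \<in> M" "!!x. norm (u x) <= norm x" "!!x w. (x, w) \<in> absg a ==> (x, u w) \<in> a"
  "!!x y. (x, y) \<in> a ==> (x, hadj u y) \<in> absg a"
  using polar_decomposition[OF a] by blast
 note bu = mem_bcl[OF u(1)] and aS = cddD[OF cd] and hS = cddD[OF psaD(1)[OF psa_absg[OF cd]]]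
 let ?E = "sm a {s<..}" and ?H = "fc (Rop a) (%t. ind {..s} (lam t) * lam t)"
 have EM: "?E \<in> M" by (rule sm_mem[OF affopD[OF a]])
 have EP: "projection_op ?E" by (rule sm_projection[OF cd]) simp
 note P = projD[OF EP]
 have uu: "hadj u (u w) = w" if "(x, w) \<in> absg a" for x w
  using u(4)[OF u(3)[OF that]] sv_eq[OF hS(2)] that by blast
 have uE: "hadj u (u (?E v)) = ?E v" for v
 proof (rule uu)
  define g where "g t = (if s < lam t then 1 / lam t else 0)" for t
  have gm: "g \<in> bmeas" unfolding g_def[abs_def] by measurable
  have gb: "\<bar>g t\<bar> <= 1 / s" for t
  proof (cases "s < lam t")
   case True
   then have "1 / lam t <= 1 / s" using s by (intro divide_left_mono) auto
   then show ?thesis using True s by (simp add: g_def)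
  qed (use s in \<open>simp add: g_def\<close>)
  have lg: "lam t * g t = ind {s<..} (lam t)" for t using s by (auto simp: g_def)
  have gd: "v \<in> fdom (Rop a) g" by (rule fdom_bounded[OF pR gm gb])
  have lgd: "v \<in> fdom (Rop a) (%t. lam t * g t)" unfolding lg by (rule ind_lam(2)[OF cd]) simp
  have "fc (Rop a) lam (fc (Rop a) g v) = ?E v"
   using fc_fc[OF pR gd lgd lam_meas] by (simp add: lg sm_fc[OF cd])
  moreover have "fc (Rop a) g v \<in> fdom (Rop a) lam" using fdom_fc[OF pR gd lam_meas] lgd by simp
  ultimately show "(fc (Rop a) g v, ?E v) \<in> absg a" by (auto simp: absg_def fcgr_def)
 qed
 define f where "f v = u (?E (hadj u v))" for v
 have fM: "f \<in> M" unfolding f_def by (rule mem_comp[OF u(1) mem_comp[OF EM mem_hadj[OF u(1)]]])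
 have fP: "projection_op f"
  by (rule projI[OF mem_bcl[OF fM]])
   (simp_all add: f_def uE P(2), simp add: cinner_hadj[OF bu] cinner_hadj'[OF bu] P(3))
 have yM: "(%v. u (?E v)) \<in> M" by (rule mem_comp[OF u(1) EM])
 have hy: "hadj (%v. u (?E v)) = (%v. ?E (hadj u v))"
  by (rule hadj_eqI) (simp add: cinner_hadj[OF bu] P(3))
 have tf: "\<tau> f = distf a s"
  using tr_adj[OF yM] unfolding hy by (simp add: uE P(2) f_def[abs_def] distf_def)
 have "distf (adj a) s <= \<tau> (%v. v - (v - f v))"
 proof (rule dist_le[OF affop_adjoint[OF a] mem_compl[OF fM] proj_compl[OF fP]])
  show "0 <= s" using s by simp
  fix n assume "n - f n = n"
  then have "f n = 0" by simp
  then have "cinner n (f n) = 0" by (simp add: cinner.zero_right)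
  then have "cinner (?E (hadj u n)) (?E (hadj u n)) = 0"
   using P(2) by (simp add: f_def cinner_hadj'[OF bu] P(3))
  then have En: "?E (hadj u n) = 0" by (simp add: cinner_self)
  have Hd: "x \<in> fdom (Rop a) (%t. ind {..s} (lam t) * lam t)" for x
   using s by (intro fdom_bounded[OF pR lam_cut(1) lam_cut(2)]) auto
  have "(n, ?H (hadj u n)) \<in> adj a"
   unfolding adj_iff
  proof (intro allI impI)
   fix x y assume xy: "(x, y) \<in> a"
   let ?w = "hadj u y"
   have w: "(x, ?w) \<in> absg a" by (rule u(4)[OF xy])
   have y: "y = u ?w" using u(3)[OF w] sv_eq[OF aS(2) xy] by blast
   have "cinner y n = cinner ?w (hadj u n)" by (subst y) (rule cinner_hadj[OF bu])
   also have "?w = sm a {..s} ?w + ?E ?w"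
    using fun_cong[OF sm_Compl_atMost[OF a, of s], of ?w] by (simp add: algebra_simps)
   also have "cinner (sm a {..s} ?w + ?E ?w) (hadj u n) = cinner (sm a {..s} ?w) (hadj u n)"
    by (simp add: cinner_add_left P(3) En cinner.zero_right)
   also have "... = cinner x (?H (hadj u n))"
    unfolding absg_cut[OF a w] by (rule fc_sym[OF pR Hd Hd])
   finally show "cinner y n = cinner x (?H (hadj u n))" .
  qed
  moreover have "norm (?H (hadj u n)) <= s * norm n"
  proof -
   have "norm (?H (hadj u n)) <= s * norm (hadj u n)"
    using s by (intro fc_norm_bound[OF pR lam_cut(1) lam_cut(2)]) auto
   also have "... <= s * norm n" using hadj_bound[OF bu, of 1 n] u(2) s by (intro mult_left_mono) auto
   finally show ?thesis .
  qed
  ultimately show "\<exists>y. (n, y) \<in> adj a \<and> norm y <= s * norm n" by blast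
 qed
 then show ?thesis using tf by simp
qed

text \<open>Right continuity of both distribution functions reaches s = 0 from the positive
  arguments s + 1/(n+1).\<close>

lemma dist_adjoint_le: assumes a: "affop a" and s: "0 <= s" shows "distf (adj a) s <= distf a s"
 unfolding dist_right_cont[OF a, of s] dist_right_cont[OF affop_adjoint[OF a], of s]
 using s by (intro SUP_mono' dist_adjoint_le_pos[OF a]) (simp add: add_nonneg_pos)

lemma dist_adjoint: assumes a: "affop a" and s: "0 <= s" shows "distf (adj a) s = distf a s"
proof -
 have "adj (adj a) = a" by (intro op_adjoint_op_adjoint cddD affopD a)
 then show ?thesis using dist_adjoint_le[OF a s] dist_adjoint_le[OF affop_adjoint[OF a] s] by (simp add: order_antisym)
qed

text \<open>Measurability in terms of the distribution function. Finiteness at one point already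
  gives arbitrarily small values further out (\<open>measop_small\<close>).\<close>

definition measop :: "'a graph => bool" where
 "measop a \<longleftrightarrow> affop a \<and> (\<exists>s. distf a s < \<infinity>)"

lemma meas_aff: "measop a ==> affop a" by (simp add: measop_def)

lemma measop_small: "measop a ==> 0 < d ==> \<exists>s\<ge>0. distf a s <= ennreal d"
 using dist_small by (auto simp: measop_def)

lemma measop_adjoint: assumes "measop a" shows "measop (adj a)"
proof -
 obtain s where "0 <= s" "distf a s <= ennreal 1" using measop_small[OF assms, of 1] by auto
 then have "distf (adj a) s < \<infinity>" using dist_adjoint[OF meas_aff[OF assms]] by (simp add: le_less_trans)
 then show ?thesis using assms affop_adjoint by (auto simp: measop_def)
qed

text \<open>Spectral projections of |a| serve as the required p. Conversely, the truncations of |a|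
  composed with p are pointwise bounded, hence uniformly, and \<open>dist_le\<close> applies to that
  bound.\<close>

lemma measurable_ops_iff: "a \<in> measurable_ops M \<tau> \<longleftrightarrow> measop a"
proof
 assume m: "measop a"
 note a = meas_aff[OF m]
 show "a \<in> measurable_ops M \<tau>"
  unfolding measurable_ops_def
 proof (intro CollectI conjI allI impI affopD a)
  fix d :: real assume "0 < d"
  then obtain s where s: "0 <= s" "distf a s <= ennreal d" using measop_small[OF m] by blast
  have P: "projection_op (sm a {..s})" by (rule sm_projection[OF affopD(1)[OF a]]) simp
  have "range (sm a {..s}) \<subseteq> Domain a"
   using sm_atMost_norm(1)[OF a s(1)] projection_range[OF P] by blast
  then show "\<exists>p\<in>M. projection_op p \<and> range p \<subseteq> Domain a \<and> \<tau> (%\<xi>. \<xi> - p \<xi>) <= ennreal d"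
   using s(2) P sm_mem[OF affopD[OF a]] by (intro bexI[of _ "sm a {..s}"]) (auto simp: sm_Compl_atMost[OF a] distf_def)
 qed
next
 assume m: "a \<in> measurable_ops M \<tau>"
 then have a: "affop a" by (simp add: measurable_ops_def affop_def)
 note cd = affopD(1)[OF a]
 note pR = pcon_Rop[OF cd]
 have "\<forall>\<delta>>0. \<exists>p\<in>M. projection_op p \<and> range p \<subseteq> Domain a \<and> \<tau> (%\<xi>. \<xi> - p \<xi>) <= ennreal \<delta>"
  using m unfolding measurable_ops_def by blast
 then obtain p where p: "p \<in> M" "projection_op p" "range p \<subseteq> Domain a" "\<tau> (%\<xi>. \<xi> - p \<xi>) <= ennreal 1"
  using zero_less_one by blast
 let ?T = "%n x. fc (Rop a) (truncf lam n) (p x)"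
 have px: "p x \<in> fdom (Rop a) lam" for x using p(3) Domain_absg[OF cd] by (auto simp: absg_def Domain_fcgr[OF pR])
 have bt: "bcl (fc (Rop a) (truncf lam n))" for n
  by (rule bcl_fc[OF pR truncf_measurable[OF lam_meas], of _ "real n"]) (auto simp: truncf_def)
 have "\<exists>K. \<forall>n x. norm (?T n x) <= K * norm x"
 proof (rule banach_steinhaus)
  show "bcl (?T n)" for n by (rule bcl_comp[OF bt mem_bcl[OF p(1)]])
  show "\<exists>C. \<forall>n. norm (?T n x) <= C" for x using truncf_norm_le[OF pR px] by blast
 qed
 then obtain K where K: "!!n x. norm (?T n x) <= K * norm x" by blast
 have "distf a (max 0 K) <= \<tau> (%v. v - p v)"
 proof (rule dist_le[OF a p(1,2)])
  fix x assume x: "p x = x"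
  then obtain y where y: "(x, y) \<in> a" using p(3) by (metis DomainE rangeI subsetD)
  have "norm (fc (Rop a) lam (p x)) <= K * norm x"
   by (rule LIMSEQ_le_const2[OF tendsto_norm[OF fc_truncf_tendsto[OF pR px]]]) (use K in blast)
  also have "... <= max 0 K * norm x" by (intro mult_right_mono) auto
  finally have "norm (fc (Rop a) lam x) <= max 0 K * norm x" using x by simp
  moreover have "(x, fc (Rop a) lam x) \<in> absg a" using px[of x] x by (auto simp: absg_def fcgr_def)
  ultimately show "\<exists>y. (x, y) \<in> a \<and> norm y <= max 0 K * norm x" using absg_norm[OF cd y] y by metis
 qed simp
 also note p(4)
 finally have "distf a (max 0 K) < \<infinity>" by (simp add: le_less_trans)
 then show "measop a" using a by (auto simp: measop_def)
qed

subsection \<open>Products\<close>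

text \<open>The projection onto the closure of D belongs to M by invariance; its complement lies
  under every 1 - r, so it has trace 0 and vanishes by faithfulness.\<close>

lemma tau_dense:
 assumes D: "csubspace D" and inv: "!!u x. unitary_op u ==> u \<in> commutant M ==> x \<in> D ==> u x \<in> D"
  and r: "!!d. 0 < d ==> \<exists>r\<in>M. projection_op r \<and> \<tau> (%v. v - r v) <= ennreal d \<and> (\<forall>x. r x = x --> x \<in> D)"
 shows "closure D = UNIV"
proof -
 let ?e = "hproj (closure D)"
 have cS: "csubspace (closure D)" by (rule csub_closure[OF D])
 note h = proj_hproj[OF cS closed_closure]
 note H = projD[OF h(1)]
 have eM: "?e \<in> M"
 proof (rule mem_hproj[OF cS closed_closure])
  show "u x \<in> closure D" if "unitary_op u" "u \<in> commutant M" "x \<in> closure D" for u x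
   by (rule closure_image_subset[OF bcl_continuous[OF unitD(1)[OF that(1)]] inv[OF that(1,2)] that(3)])
 qed
 have ce: "(%v. v - ?e v) \<in> M" "projection_op (%v. v - ?e v)" by (rule mem_compl[OF eM], rule proj_compl[OF h(1)])
 have "\<tau> (%v. v - ?e v) <= ennreal d" if d: "0 < d" for d
 proof -
  obtain r where r: "r \<in> M" "projection_op r" "\<tau> (%v. v - r v) <= ennreal d" "!!x. r x = x ==> x \<in> D" using r[OF d] by blast
  have cr: "(%v. v - r v) \<in> M" "projection_op (%v. v - r v)" by (rule mem_compl[OF r(1)], rule proj_compl[OF r(2)])
  have "\<tau> (%v. v - ?e v) <= \<tau> (%v. v - r v)"
  proof (rule tr_mono[OF proj_pos[OF ce] proj_pos[OF cr]], rule op_leI[OF projection_positive[OF ce(2)] projection_positive[OF cr(2)]])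
   fix x
   have "r x \<in> closure D" using r(4)[of "r x"] projD(2)[OF r(2)] closure_subset by blast
   then have "?e (r x) = r x" using h projection_range[OF h(1)] by blast
   then have "x - ?e x = (x - r x) - ?e (x - r x)" by (simp add: bcl_diff[OF H(1)])
   then have "norm (x - ?e x) <= norm (x - r x)" using proj_norm_le[OF ce(2), of "x - r x"] by metis
   then show "Re (cinner x (x - ?e x)) <= Re (cinner x (x - r x))"
    using proj_cinner[OF ce(2), of x] proj_cinner[OF cr(2), of x] by (simp add: power_mono)
  qed
  also note r(3)
  finally show ?thesis .
 qed
 then have "\<tau> (%v. v - ?e v) <= 0 + ennreal d" if "0 < d" for d using that by simp
 then have "\<tau> (%v. v - ?e v) <= 0" using ennreal_le_epsilon by blast
 then have "v - ?e v = 0" for v using tr_faithful[OF proj_pos[OF ce]] by simp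
 then have "?e v = v" for v by (metis eq_iff_diff_eq_0)
 then show ?thesis using h(2) projection_range[OF h(1)] by auto
qed

text \<open>With p and q spectral cut-offs of b and a and T = b p bounded, the vectors of the range
  of p that T sends into the range of q are those killed by the support k of (1 - q)T. By
  \<open>tr_support\<close> k costs no more trace than 1 - q.\<close>

lemma prod_domain:
 assumes a: "measop a" and b: "measop b" and d: "0 < d"
 shows "\<exists>r\<in>M. projection_op r \<and> \<tau> (%v. v - r v) <= ennreal d \<and> (\<exists>C\<ge>0. \<forall>x. r x = x --> (\<exists>z. (x, z) \<in> b O a \<and> norm z <= C * norm x))"
proof -
 note aa = meas_aff[OF a] and ab = meas_aff[OF b]
 note cb = affopD(1)[OF ab]
 note pR = pcon_Rop[OF cb]
 obtain s where s: "0 <= s" "distf b s <= ennreal (d / 2)" using measop_small[OF b] d by (meson half_gt_zero)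
 obtain t where t: "0 <= t" "distf a t <= ennreal (d / 2)" using measop_small[OF a] d by (meson half_gt_zero)
 obtain u where u: "u \<in> M" "!!x. norm (u x) <= norm x" "!!x w. (x, w) \<in> absg b ==> (x, u w) \<in> b"
  using polar_decomposition[OF ab] by blast
 let ?p = "sm b {..s}" and ?q = "sm a {..t}"
 let ?H = "fc (Rop b) (%t. ind {..s} (lam t) * lam t)"
 have pM: "?p \<in> M" and pP: "projection_op ?p" by (rule sm_mem[OF affopD[OF ab]], rule sm_projection[OF cb]) simp
 have qM: "?q \<in> M" and qP: "projection_op ?q" by (rule sm_mem[OF affopD[OF aa]], rule sm_projection[OF affopD(1)[OF aa]]) simp
 note P = projD[OF pP] and Q = projD[OF qP]
 have HM: "?H \<in> M" by (rule fc_mem[OF pR Rop_mem[OF affopD[OF ab]] lam_cut(1) lam_cut(2)[OF s(1)]])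
 define T where "T v = u (?H v)" for v
 have TM: "T \<in> M" unfolding T_def by (rule mem_comp[OF u(1) HM])
 have Tn: "norm (T v) <= s * norm v" for v
  using u(2)[of "?H v"] fc_norm_bound[OF pR lam_cut(1) lam_cut(2)[OF s(1)], of v] unfolding T_def by linarith
 have Hp: "?H (?p v) = ?H v" for v
 proof -
  have Hd: "v \<in> fdom (Rop b) (%t. ind {..s} (lam t) * lam t)" for v
   by (rule fdom_bounded[OF pR lam_cut(1) lam_cut(2)[OF s(1)]])
  have "ind {..s} (lam t) * lam t * ind {..s} (lam t) = ind {..s} (lam t) * lam t" for t
   by (simp add: indicator_def)
  from fc_fc[OF pR ind_lam(2)[OF cb] _ lam_cut(1), of "{..s}" v s, unfolded this] show ?thesis
   using Hd[of v] by (simp add: sm_fc[OF cb])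
 qed
 have bT: "(v, T v) \<in> b" if v: "?p v = v" for v
 proof -
  obtain w where w: "(v, w) \<in> absg b" using sm_atMost_Domain[OF cb, of s v] v by auto
  have "(?p v, ?p w) \<in> absg b"
   by (rule pvm_commute[OF psa_absg[OF cb] sm_pvm[OF cb] sm_spectral[OF cb] _ w]) simp
  then show ?thesis using u(3) v absg_cut[OF ab w, of s] by (auto simp: T_def)
 qed
 define X where "X v = T v - ?q (T v)" for v
 have XM: "X \<in> M" unfolding X_def by (rule mem_diff[OF TM mem_comp[OF qM TM]])
 obtain k where k: "projection_op k" "!!v. k v = 0 \<longleftrightarrow> X v = 0" using projection_ker[OF mem_bcl[OF XM]] by blast
 note K = projD[OF k(1)]
 have kM: "k \<in> M" and kt: "\<tau> k <= \<tau> (%v. v - ?q v)"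
  by (rule tr_support[OF XM mem_compl[OF qM] proj_compl[OF qP] _ k], simp add: X_def bcl_diff[OF Q(1)] Q(2))+
 have kp: "k (?p v) = k v" for v
 proof -
  have "?H (v - ?p v) = 0" using Hp[of v] by (simp add: bcl_diff[OF mem_bcl[OF HM]])
  then have "X (v - ?p v) = 0" by (simp add: X_def T_def bcl_0[OF mem_bcl[OF u(1)]] bcl_0[OF Q(1)])
  then have "k (v - ?p v) = 0" using k(2) by simp
  then show ?thesis by (simp add: bcl_diff[OF K(1)])
 qed
 have pk: "?p (k v) = k v" for v
  by (rule cinner_ext) (simp add: P(3)[symmetric] K(3)[symmetric] kp)
 define r where "r v = ?p v - k v" for v
 have rM: "r \<in> M" unfolding r_def by (rule mem_diff[OF pM kM])
 have rP: "projection_op r"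
  by (rule projI[OF mem_bcl[OF rM]])
   (simp_all add: r_def bcl_diff[OF P(1)] bcl_diff[OF K(1)] pk kp P(2) K(2) cinner.diff_left cinner.diff_right P(3) K(3))
 \<comment> \<open>Since k lies under p, r = p - k is a projection whose complement is the
   orthogonal sum of 1 - p and k; each has trace at most d/2.\<close>
 have "(%v. v - r v) = (%v. (v - ?p v) + k v)" by (auto simp: r_def)
 then have "\<tau> (%v. v - r v) = \<tau> (%v. v - ?p v) + \<tau> k"
  using tr_add[OF proj_pos[OF mem_compl[OF pM] proj_compl[OF pP]] proj_pos[OF kM k(1)]] by simp
 also have "... <= ennreal (d / 2) + ennreal (d / 2)"
  using kt s(2) t(2) unfolding sm_Compl_atMost[OF ab] sm_Compl_atMost[OF aa] distf_def by (intro add_mono) auto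
 also have "... = ennreal d" using d by (simp flip: ennreal_plus)
 finally have tr: "\<tau> (%v. v - r v) <= ennreal d" .
 have "\<exists>z. (x, z) \<in> b O a \<and> norm z <= (t * s) * norm x" if x: "r x = x" for x
 proof -
  have px: "?p x = x" using pk x by (metis P(2) bcl_diff[OF P(1)] r_def)
  have "k x = k (r x)" using x by simp
  also have "... = 0" by (simp add: r_def bcl_diff[OF K(1)] kp K(2))
  finally have "?q (T x) = T x" using k(2) by (simp add: X_def)
  then obtain z where z: "(T x, z) \<in> a" "norm z <= t * norm (T x)"
   using sm_atMost_norm[OF aa t(1)] by blast
  have "t * norm (T x) <= t * (s * norm x)" using Tn t(1) by (intro mult_left_mono) auto
  then show ?thesis using z bT[OF px] by (intro exI[of _ z]) auto
 qed
 then show ?thesis using rM rP tr s t by (intro bexI[of _ r] conjI exI[of _ "t * s"]) auto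
qed

lemma affiliated_relcomp: "affop a ==> affop b ==> unitary_op u ==> u \<in> commutant M ==> (x, z) \<in> b O a ==> (u x, u z) \<in> b O a"
 using affiliatedD[OF affopD(2)] by blast

lemma prod_dense:
 assumes a: "measop a" and b: "measop b" shows "closure (Domain (b O a)) = UNIV"
proof (rule tau_dense)
 note aa = meas_aff[OF a] and ab = meas_aff[OF b]
 show "csubspace (Domain (b O a))"
  by (intro csubspace_Domain csubspace_relcomp cddD(1)[OF affopD(1)] aa ab)
 show "u x \<in> Domain (b O a)" if "unitary_op u" "u \<in> commutant M" "x \<in> Domain (b O a)" for u x
  using affiliated_relcomp[OF aa ab that(1,2)] that(3) by (meson DomainE Domain.DomainI)
 show "\<exists>r\<in>M. projection_op r \<and> \<tau> (%v. v - r v) <= ennreal d \<and> (\<forall>x. r x = x --> x \<in> Domain (b O a))" if "0 < d" for d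
  using prod_domain[OF a b that] by (meson Domain.DomainI)
qed

lemma relcomp_adjoint: "(x, z) \<in> b O a ==> (y, w) \<in> adj a O adj b ==> cinner z y = cinner x w"
proof -
 assume "(x, z) \<in> b O a" "(y, w) \<in> adj a O adj b"
 then obtain p v where "(x, p) \<in> b" "(p, z) \<in> a" "(y, v) \<in> adj a" "(v, w) \<in> adj b" by blast
 then have "cinner z y = cinner p v" "cinner p v = cinner x w" by (simp_all add: adj_iff)
 then show ?thesis by simp
qed

lemma strong_prod_adjoint: "adj a O adj b \<subseteq> adj (strong_prod a b)"
proof clarify
 fix y v w assume yw: "(y, v) \<in> adj a" "(v, w) \<in> adj b"
 have "closed {p. cinner (snd p) y = cinner (fst p) w}"
  by (intro closed_Collect_eq cinner.continuous_on continuous_intros)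
 moreover have "b O a \<subseteq> {p. cinner (snd p) y = cinner (fst p) w}"
  using relcomp_adjoint[OF _ relcompI[OF yw]] by force
 ultimately have "strong_prod a b \<subseteq> {p. cinner (snd p) y = cinner (fst p) w}"
  unfolding strong_prod_def by (intro closure_minimal)
 then show "(y, w) \<in> adj (strong_prod a b)" by (auto simp: adj_iff)
qed

text \<open>Closability comes from duality: the product of the adjoints in reverse order is densely
  defined and lies in the adjoint of the closure, so no vertical vector survives in the closed
  graph.\<close>

lemma measop_prod:
 assumes a: "measop a" and b: "measop b" shows "measop (strong_prod a b)"
proof -
 note aa = meas_aff[OF a] and ab = meas_aff[OF b]
 let ?c = "strong_prod a b"
 have cc: "csubspace ?c" unfolding strong_prod_def
  by (intro csub_closure csubspace_relcomp cddD(1)[OF affopD(1)] aa ab)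
 have sub: "b O a \<subseteq> ?c" unfolding strong_prod_def by (rule closure_subset)
 have "closure (Domain ?c) = UNIV"
  using prod_dense[OF a b] closure_mono[of "Domain (b O a)" "Domain ?c"] sub by auto
 moreover have "single_valued ?c"
 proof (rule single_valuedI)
  fix x y z assume "(x, y) \<in> ?c" "(x, z) \<in> ?c"
  then have 0: "(0, y - z) \<in> ?c" using graph_diff[OF cc] by fastforce
  have "y - z = 0"
  proof (rule dense_cinner_zero[OF prod_dense[OF measop_adjoint[OF b] measop_adjoint[OF a]]])
   fix v assume "v \<in> Domain (adj a O adj b)"
   then obtain w where "(v, w) \<in> adj ?c" using strong_prod_adjoint by blast
   then have "cinner (y - z) v = cinner 0 w" using 0 by (simp add: adj_iff)
   then show "cinner v (y - z) = 0" by (simp add: cinner.zero_left cinner_zero_sym[of v])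
  qed
  then show "y = z" by simp
 qed
 ultimately have cd: "closed_dd_op ?c" using cc by (simp add: closed_dd_op_def) (simp add: strong_prod_def)
 have "affiliated M ?c"
 proof (rule affiliatedI)
  fix u x y assume u: "unitary_op u" "u \<in> commutant M" and xy: "(x, y) \<in> ?c"
  show "(u x, u y) \<in> ?c"
   using closure_graph_image[OF unitD(1)[OF u(1)] affiliated_relcomp[OF aa ab u]] xy
   unfolding strong_prod_def by blast
 qed
 then have ac: "affop ?c" using cd by (simp add: affop_def)
 obtain r C where r: "r \<in> M" "projection_op r" "\<tau> (%v. v - r v) <= ennreal 1" "0 <= C"
  "!!x. r x = x ==> \<exists>z. (x, z) \<in> b O a \<and> norm z <= C * norm x"
  using prod_domain[OF a b, of 1] by auto
 have "distf ?c C <= \<tau> (%v. v - r v)"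
  using r(5) sub by (intro dist_le[OF ac r(1,2,4)]) blast
 also note r(3)
 finally have "distf ?c C < \<infinity>" by (simp add: le_less_trans)
 then show ?thesis using ac by (auto simp: measop_def)
qed

text \<open>For a spectral cut-off p of b, the vectors that u sends into the range of p are the
  kernel of (1 - p)u, whose support has trace at most that of 1 - p. As u is a contraction, the
  bound s is kept there.\<close>

lemma right_mult:
 assumes b: "measop b" and u: "u \<in> M" "!!x. norm (u x) <= norm x"
 shows "measop {(x, y). (u x, y) \<in> b}" "0 <= s ==> distf {(x, y). (u x, y) \<in> b} s <= distf b s"
proof -
 let ?c = "{(x, y). (u x, y) \<in> b}"
 note ab = meas_aff[OF b]
 note cb = affopD(1)[OF ab]
 note bS = cddD[OF cb] and bu = mem_bcl[OF u(1)]
 have r: "\<exists>r\<in>M. projection_op r \<and> \<tau> (%v. v - r v) <= distf b s \<and> (\<forall>x. r x = x --> (\<exists>y. (x, y) \<in> ?c \<and> norm y <= s * norm x))"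
  if s: "0 <= s" for s
 proof -
  let ?p = "sm b {..s}"
  have pM: "?p \<in> M" and pP: "projection_op ?p" by (rule sm_mem[OF affopD[OF ab]], rule sm_projection[OF cb]) simp
  note P = projD[OF pP]
  define X where "X v = u v - ?p (u v)" for v
  have XM: "X \<in> M" unfolding X_def by (rule mem_diff[OF u(1) mem_comp[OF pM u(1)]])
  obtain k where k: "projection_op k" "!!v. k v = 0 \<longleftrightarrow> X v = 0" using projection_ker[OF mem_bcl[OF XM]] by blast
  have kM: "k \<in> M" and kt: "\<tau> k <= \<tau> (%v. v - ?p v)"
   by (rule tr_support[OF XM mem_compl[OF pM] proj_compl[OF pP] _ k], simp add: X_def bcl_diff[OF P(1)] P(2))+
  have "\<exists>y. (x, y) \<in> ?c \<and> norm y <= s * norm x" if "x - k x = x" for x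
  proof -
   have "?p (u x) = u x" using that k(2)[of x] by (simp add: X_def)
   then obtain y where y: "(u x, y) \<in> b" "norm y <= s * norm (u x)" using sm_atMost_norm[OF ab s] by blast
   moreover have "s * norm (u x) <= s * norm x" using u(2) s by (intro mult_left_mono) auto
   ultimately show ?thesis by (intro exI[of _ y]) auto
  qed
  then show ?thesis
   using mem_compl[OF kM] proj_compl[OF k(1)] kt
   by (intro bexI[of _ "%v. v - k v"]) (auto simp: sm_Compl_atMost[OF ab] distf_def)
 qed
 have cS: "csubspace ?c"
  using graph_0[OF bS(1)] graph_add[OF bS(1)] graph_scaleC[OF bS(1)]
  by (auto simp: csubspace_def zero_prod_def scaleC_prod_def bcl_0[OF bu] bcl_add[OF bu] bcl_scaleC[OF bu])
 have inv: "(v x, v y) \<in> ?c" if "unitary_op v" "v \<in> commutant M" "(x, y) \<in> ?c" for v x y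
  using affiliatedD[OF affopD(2)[OF ab] that(1,2)] that(3) memD[OF u(1) that(2)] by auto
 have "closed ((%p. (u (fst p), snd p)) -` b)"
  by (intro closed_vimage bS(3) continuous_intros bcl_continuous[OF bu, THEN continuous_on_compose2, of UNIV]) auto
 moreover have "(%p. (u (fst p), snd p)) -` b = ?c" by auto
 ultimately have cl: "closed ?c" by simp
 have sv: "single_valued ?c" using bS(2) by (auto simp: single_valued_def)
 have "closure (Domain ?c) = UNIV"
 proof (rule tau_dense[OF csubspace_Domain[OF cS]])
  show "v x \<in> Domain ?c" if v: "unitary_op v" "v \<in> commutant M" "x \<in> Domain ?c" for v x
   using inv[OF v(1,2)] v(3) by (meson DomainE Domain.DomainI)
  show "\<exists>r\<in>M. projection_op r \<and> \<tau> (%v. v - r v) <= ennreal d \<and> (\<forall>x. r x = x --> x \<in> Domain ?c)" if "0 < d" for d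
  proof -
   obtain s where s: "0 <= s" "distf b s <= ennreal d" using measop_small[OF b \<open>0 < d\<close>] by blast
   obtain r where "r \<in> M" "projection_op r" "\<tau> (%v. v - r v) <= distf b s" "\<forall>x. r x = x --> (\<exists>y. (x, y) \<in> ?c \<and> norm y <= s * norm x)"
    using r[OF s(1)] by blast
   then show ?thesis using s(2) by (intro bexI[of _ r] conjI) (auto intro: order_trans)
  qed
 qed
 then have ac: "affop ?c" using cS cl sv inv by (auto simp: affop_def closed_dd_op_def intro!: affiliatedI)
 have le: "distf ?c s <= distf b s" if s: "0 <= s" for s
 proof -
  obtain r where r: "r \<in> M" "projection_op r" "\<tau> (%v. v - r v) <= distf b s" "\<forall>x. r x = x --> (\<exists>y. (x, y) \<in> ?c \<and> norm y <= s * norm x)"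
   using r[OF s] by blast
  have "distf ?c s <= \<tau> (%v. v - r v)" using r(4) by (intro dist_le[OF ac r(1,2) s]) blast
  also note r(3)
  finally show ?thesis .
 qed
 then show "0 <= s ==> distf ?c s <= distf b s" .
 obtain t where "0 <= t" "distf b t <= ennreal 1" using measop_small[OF b, of 1] by auto
 then have "distf ?c t < \<infinity>" using le_less_trans[OF order_trans[OF le[OF \<open>0 <= t\<close>] \<open>distf b t <= ennreal 1\<close>] ennreal_less_top] by simp
 then show "measop ?c" using ac by (auto simp: measop_def)
qed

text \<open>Uses only that the adjoint of the product contains the reversed product of adjoints,
  together with invariance of the distribution function under adjoints; the inclusion is enough
  because \<open>sup_swap\<close> applies the estimate in both directions.\<close>

lemma dist_prod_adjoint:
 assumes a: "measop a" and b: "measop b" and s: "0 <= s"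
 shows "distf (strong_prod a b) s <= distf (strong_prod (adj b) (adj a)) s"
proof -
 have c: "affop (strong_prod a b)" using measop_prod[OF a b] meas_aff by blast
 have d: "affop (strong_prod (adj b) (adj a))"
  using measop_prod[OF measop_adjoint[OF b] measop_adjoint[OF a]] meas_aff by blast
 have "strong_prod (adj b) (adj a) \<subseteq> adj (strong_prod a b)"
  unfolding strong_prod_def[of "adj b"] by (rule closure_minimal[OF strong_prod_adjoint closed_op_adjoint])
 then have "distf (adj (strong_prod a b)) s <= distf (strong_prod (adj b) (adj a)) s"
  by (rule dist_mono_graph[OF d affop_adjoint[OF c] _ s])
 then show ?thesis by (simp add: dist_adjoint[OF c s])
qed

lemma dist_left_mult:
 assumes x: "affop (strong_prod a b)" and z: "affop (strong_prod c b)" and Y: "bcl Y" "!!v. norm (Y v) <= norm v"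
  and ac: "!!v w. (v, w) \<in> a ==> (v, Y w) \<in> c" and s: "0 <= s"
 shows "distf (strong_prod c b) s <= distf (strong_prod a b) s"
proof (rule dist_le_of_graph[OF x z Y(2) _ s])
 fix v w assume "(v, w) \<in> strong_prod a b"
 then obtain f where f: "!!n::nat. f n \<in> b O a" "f ---> (v, w)" unfolding strong_prod_def closure_sequential by blast
 have "(%n. (fst (f n), Y (snd (f n)))) ---> (v, Y w)"
  using tendsto_fst[OF f(2)] bcl_tendsto[OF Y(1) tendsto_snd[OF f(2)]] by (intro tendsto_Pair) auto
 moreover have "(fst (f n), Y (snd (f n))) \<in> b O c" for n
 proof -
  obtain p q r where "f n = (p, q)" "(p, r) \<in> b" "(r, q) \<in> a" using f(1)[of n] by (metis relcompE)
  then show ?thesis using ac by auto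
 qed
 ultimately show "(v, Y w) \<in> strong_prod c b" unfolding strong_prod_def closure_sequential by (intro exI conjI allI) auto
qed

end

section \<open>Layer cake formula and symmetry of suprema\<close>

lemma nn_ennreal_below: "(\<integral>\<^sup>+u. ind {u. 0 < u \<and> ennreal u < c} u \<partial>lborel) = c"
proof (cases c)
 case (real r)
 have "{u. 0 < u \<and> ennreal u < c} = {0<..<r}" using real by (auto simp: ennreal_less_iff)
 then show ?thesis using real by simp
next
 case top
 have "{u::real. 0 < u \<and> ennreal u < c} = {0<..}" using top by auto
 moreover have "emeasure lborel {0::real<..} = \<infinity>" 
 proof -
  have "ennreal (real n) <= emeasure lborel {0::real<..}" for n
  proof -
   have "emeasure lborel {0<..<real n} <= emeasure lborel {0::real<..}" by (rule emeasure_mono) auto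
   then show ?thesis by simp
  qed
  then have "(SUP n. ennreal (real n)) <= emeasure lborel {0::real<..}" by (intro SUP_least)
  then show ?thesis by (simp add: ennreal_SUP_of_nat_eq_top ennreal_of_nat_eq_real_of_nat[symmetric] top_unique)
 qed
 ultimately show ?thesis using top by simp
qed

text \<open>The measure, later \<open>tmeas a\<close>, may fail to be sigma-finite. If some
  superlevel set has infinite measure, both sides are infinite; otherwise the restriction to {f > 0}
  is sigma-finite and Fubini applies.\<close>

lemma nn_integral_layer_cake:
 fixes f :: "'x => ennreal"
 assumes [measurable]: "f \<in> borel_measurable N"
 shows "(\<integral>\<^sup>+x. f x \<partial>N) = (\<integral>\<^sup>+u\<in>{0<..}. emeasure N {x\<in>space N. ennreal u < f x} \<partial>lborel)"
proof (cases "\<exists>u>0. emeasure N {x\<in>space N. ennreal u < f x} = \<infinity>")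
 case True
 then obtain u where u: "u > 0" "emeasure N {x\<in>space N. ennreal u < f x} = \<infinity>" by blast
 have "\<infinity> = ennreal u * emeasure N {x\<in>space N. ennreal u < f x}" using u by (simp add: ennreal_mult_top)
 also have "... = (\<integral>\<^sup>+x. ennreal u * ind {x\<in>space N. ennreal u < f x} x \<partial>N)" by (simp add: nn_integral_cmult_indicator)
 also have "... <= (\<integral>\<^sup>+x. f x \<partial>N)" by (intro nn_integral_mono) (auto simp: indicator_def)
 finally have 1: "(\<integral>\<^sup>+x. f x \<partial>N) = \<infinity>" by (simp add: top_unique)
 have inf: "emeasure N {x\<in>space N. ennreal v < f x} = \<infinity>" if v: "0 < v" "v <= u" for v
 proof -
  have "{x\<in>space N. ennreal u < f x} \<subseteq> {x\<in>space N. ennreal v < f x}"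
   using v by (auto intro: le_less_trans ennreal_leI)
  then have "emeasure N {x\<in>space N. ennreal u < f x} <= emeasure N {x\<in>space N. ennreal v < f x}" by (intro emeasure_mono) auto
  then show ?thesis using u by (simp add: top_unique)
 qed
 have "\<infinity> = (\<integral>\<^sup>+v. \<infinity> * ind {0<..<u} v \<partial>lborel)" using u by (subst nn_integral_cmult_indicator) (auto simp: ennreal_top_mult)
 also have "... <= (\<integral>\<^sup>+v\<in>{0<..}. emeasure N {x\<in>space N. ennreal v < f x} \<partial>lborel)"
  by (intro nn_integral_mono) (auto simp: indicator_def inf)
 finally show ?thesis using 1 by (simp add: top_unique)
next
 case False
 define N' where "N' = density N (ind {x\<in>space N. 0 < f x})"
 have sN: "sets N' = sets N" "space N' = space N" by (simp_all add: N'_def)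
 note [measurable_cong] = sN(1)
 have em: "emeasure N' {x\<in>space N. ennreal u < f x} = emeasure N {x\<in>space N. ennreal u < f x}" if "0 <= u" for u
 proof -
  have "emeasure N' {x\<in>space N. ennreal u < f x} = (\<integral>\<^sup>+x. ind {x\<in>space N. 0 < f x} x * ind {x\<in>space N. ennreal u < f x} x \<partial>N)"
   unfolding N'_def by (subst emeasure_density) auto
  also have "... = (\<integral>\<^sup>+x. ind {x\<in>space N. ennreal u < f x} x \<partial>N)"
   by (intro nn_integral_cong) (auto simp: indicator_def intro: le_less_trans[of 0])
  finally show ?thesis by simp
 qed
 have "sigma_finite_measure N'"
 proof
  let ?A = "%n::nat. {x\<in>space N. ennreal (1 / real (Suc n)) < f x} \<union> {x\<in>space N. f x = 0}"
  have "emeasure N' (?A n) ~= \<infinity>" for n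
  proof -
   have "emeasure N' {x\<in>space N. f x = 0} = (\<integral>\<^sup>+x. ind {x\<in>space N. 0 < f x} x * ind {x\<in>space N. f x = 0} x \<partial>N)"
    unfolding N'_def by (subst emeasure_density) auto
   also have "... = (\<integral>\<^sup>+x. 0 \<partial>N)" by (intro nn_integral_cong) (auto simp: indicator_def)
   finally have z: "emeasure N' {x\<in>space N. f x = 0} = 0" by simp
   have "emeasure N' (?A n) <= emeasure N' {x\<in>space N. ennreal (1 / real (Suc n)) < f x} + emeasure N' {x\<in>space N. f x = 0}"
    by (rule emeasure_subadditive) measurable
   also have "... = emeasure N {x\<in>space N. ennreal (1 / real (Suc n)) < f x}" using em[of "1 / real (Suc n)"] z by simp
   finally show ?thesis using False by (auto simp: top_unique)
  qed
  moreover have "(\<Union>n. ?A n) = space N'"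
  proof -
   have "\<exists>n. ennreal (1 / real (Suc n)) < f x" if "f x ~= 0" for x
   proof (cases "f x")
    case (real r)
    then have "0 < r" using that by (cases "r = 0") auto
    then obtain n where "1 / real (Suc n) < r" using reals_Archimedean[of r] by (auto simp: divide_inverse)
    then show ?thesis using real by (intro exI[of _ n]) (auto simp: ennreal_less_iff)
   qed auto
   then show ?thesis by (auto simp: sN)
  qed
  ultimately show "\<exists>A. countable A \<and> A \<subseteq> sets N' \<and> \<Union> A = space N' \<and> (\<forall>a\<in>A. emeasure N' a ~= \<infinity>)"
   by (intro exI[of _ "range ?A"]) auto
 qed
 then interpret pair_sigma_finite N' lborel
  unfolding pair_sigma_finite_def using sigma_finite_lborel by blast
 let ?h = "%(x, u). ind {p. 0 < snd p \<and> ennreal (snd p) < f (fst p)} (x, u) :: ennreal"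
 have "(\<integral>\<^sup>+x. f x \<partial>N) = (\<integral>\<^sup>+x. ind {x\<in>space N. 0 < f x} x * f x \<partial>N)"
  by (intro nn_integral_cong) (auto simp: indicator_def zero_less_iff_neq_zero)
 also have "... = (\<integral>\<^sup>+x. f x \<partial>N')" unfolding N'_def by (subst nn_integral_density) auto
 also have "... = (\<integral>\<^sup>+x. (\<integral>\<^sup>+u. ?h (x, u) \<partial>lborel) \<partial>N')"
 proof (intro nn_integral_cong)
  fix x
  have "(\<integral>\<^sup>+u. ?h (x, u) \<partial>lborel) = (\<integral>\<^sup>+u. ind {u. 0 < u \<and> ennreal u < f x} u \<partial>lborel)"
   by (intro nn_integral_cong) (auto simp: indicator_def)
  then show "f x = (\<integral>\<^sup>+u. ?h (x, u) \<partial>lborel)" by (simp only: nn_ennreal_below)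
 qed
 also have "... = (\<integral>\<^sup>+u. (\<integral>\<^sup>+x. ?h (x, u) \<partial>N') \<partial>lborel)"
  by (rule Fubini'[symmetric]) measurable
 also have "... = (\<integral>\<^sup>+u\<in>{0<..}. emeasure N {x\<in>space N. ennreal u < f x} \<partial>lborel)"
 proof (intro nn_integral_cong)
  fix u :: real
  have "(\<integral>\<^sup>+x. ?h (x, u) \<partial>N') = (\<integral>\<^sup>+x. ind {0<..} u * ind {x\<in>space N. ennreal u < f x} x \<partial>N')"
   by (intro nn_integral_cong) (auto simp: indicator_def sN)
  also have "... = ind {0<..} u * emeasure N' {x\<in>space N. ennreal u < f x}"
   by (subst nn_integral_cmult_indicator) (auto simp: sN)
  also have "... = emeasure N {x\<in>space N. ennreal u < f x} * ind {0<..} u"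
   using em[of u] by (auto simp: indicator_def)
  finally show "(\<integral>\<^sup>+x. ?h (x, u) \<partial>N') = emeasure N {x\<in>space N. ennreal u < f x} * ind {0<..} u" .
 qed
 finally show ?thesis .
qed

context traced_alg
begin

lemma trace_fun_tmeas: "affop a ==> trace_fun \<tau> f (op_abs a) = (\<integral>\<^sup>+ s\<in>{0..}. f s \<partial>tmeas a)"
 by (simp add: trace_fun_def tmeas_def spectral_op_abs affopD(1))

text \<open>Here \<open>g\<close> is a generalized inverse of \<open>f\<close>.\<close>

lemma trace_fun_distf:
 assumes a: "affop a" and g: "!!u s. 0 < u ==> 0 <= s ==> ennreal u < f s \<longleftrightarrow> g u < s" and g0: "!!u. 0 < u ==> 0 <= g u"
 shows "trace_fun \<tau> f (op_abs a) = (\<integral>\<^sup>+u\<in>{0<..}. distf a (g u) \<partial>lborel)"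
proof -
 let ?f = "%s. f s * ind {0..} s"
 have lev: "{s. ennreal u < ?f s} = {g u<..}" if "0 < u" for u
  using g[OF that] g0[OF that] by (auto simp: indicator_def split: if_splits)
 have "?f \<in> bmeas"
 proof (rule borel_measurableI_greater)
  fix c :: ennreal
  show "{s\<in>space borel. c < ?f s} \<in> sets borel"
  proof (cases c)
   case (real r)
   show ?thesis
   proof (cases "r = 0")
    case False
    then show ?thesis using real lev[of r] by simp
   next
    case True
    have "{s\<in>space borel. c < ?f s} = (\<Union>n. {s. ennreal (1 / real (Suc n)) < ?f s})"
    proof (intro set_eqI iffI)
     fix s assume "s \<in> {s\<in>space borel. c < ?f s}"
     then have p: "0 < ?f s" using real True by simp
     show "s \<in> (\<Union>n. {s. ennreal (1 / real (Suc n)) < ?f s})"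
     proof (cases "?f s")
      case (real q)
      then have "0 < q" using p by (metis ennreal_0 less_irrefl order_le_less)
      then obtain n where "1 / real (Suc n) < q" using reals_Archimedean[of q] by (auto simp: divide_inverse)
      then have "ennreal (1 / real (Suc n)) < ?f s" using real by (metis ennreal_lessI \<open>0 < q\<close>)
      then show ?thesis by blast
     next
      case top
      then have "ennreal (1 / real (Suc 0)) < ?f s" by (simp only: ennreal_less_top)
      then show ?thesis by blast
     qed
    next
     fix s assume "s \<in> (\<Union>n. {s. ennreal (1 / real (Suc n)) < ?f s})"
     then obtain n where "ennreal (1 / real (Suc n)) < ?f s" by blast
     then show "s \<in> {s\<in>space borel. c < ?f s}" using real True by (auto intro: le_less_trans[OF zero_le])
    qed
    then show ?thesis using lev by simp
   qed
  qed simp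
 qed
 then have m: "?f \<in> borel_measurable (tmeas a)" by (simp cong: measurable_cong_sets add: sets_tmeas[OF a])
 have "trace_fun \<tau> f (op_abs a) = (\<integral>\<^sup>+u\<in>{0<..}. emeasure (tmeas a) {s. ennreal u < ?f s} \<partial>lborel)"
  using nn_integral_layer_cake[OF m] by (simp add: trace_fun_tmeas[OF a] space_tmeas[OF a])
 also have "... = (\<integral>\<^sup>+u\<in>{0<..}. distf a (g u) \<partial>lborel)"
 proof (intro nn_integral_cong)
  fix u :: real
  show "emeasure (tmeas a) {s. ennreal u < ?f s} * ind {0<..} u = distf a (g u) * ind {0<..} u"
   by (cases "0 < u") (simp_all only: lev dist_tmeas[OF a], simp)
 qed
 finally show ?thesis .
qed

lemma trace_pos_distf: "affop a ==> trace_pos \<tau> (op_abs a) = (\<integral>\<^sup>+u\<in>{0<..}. distf a u \<partial>lborel)"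
 unfolding trace_pos_def by (rule trace_fun_distf) (auto simp: ennreal_less_iff)

lemma trace_pos_mono:
 assumes "affop a" "affop b" "!!s. 0 <= s ==> distf a s <= distf b s"
 shows "trace_pos \<tau> (op_abs a) <= trace_pos \<tau> (op_abs b)"
 unfolding trace_pos_distf[OF assms(1)] trace_pos_distf[OF assms(2)]
 using assms(3) by (intro nn_integral_mono) (auto simp: indicator_def)

text \<open>With the polar decomposition \<open>a = u h\<close>, \<open>h = u\<^sup>* a\<close> and \<open>(h b)\<^sup>* = b\<^sup>* h\<close>, both suprema
  agree with the ones for \<open>h\<close>.\<close>

lemma sup_swap:
 assumes a: "measop a" and B: "!!b. b \<in> B ==> measop b"
  and Bc: "!!b c. b \<in> B ==> measop c ==> (!!s. 0 <= s ==> distf c s <= distf b s) ==> c \<in> B"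
 shows "(SUP b\<in>B. trace_pos \<tau> (op_abs (strong_prod a b))) = (SUP b\<in>B. trace_pos \<tau> (op_abs (strong_prod b a)))"
proof -
 let ?t = "%x. trace_pos \<tau> (op_abs x)"
 define h where "h = absg a"
 note aa = meas_aff[OF a]
 obtain u where u: "u \<in> M" "!!x. norm (u x) <= norm x" "!!x w. (x, w) \<in> h ==> (x, u w) \<in> a"
  "!!x y. (x, y) \<in> a ==> (x, hadj u y) \<in> h"
  using polar_decomposition[OF aa] unfolding h_def by blast
 note bu = mem_bcl[OF u(1)]
 have hu: "norm (hadj u x) <= norm x" for x using hadj_bound[OF bu, of 1 x] u(2) by simp
 have ha: "affop h" unfolding h_def by (rule affop_absg[OF aa])
 have "distf h s <= distf a s" if "0 <= s" for s by (rule dist_le_of_graph[OF aa ha hu u(4) that])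
 moreover obtain s where "0 <= s" "distf a s <= ennreal 1" using measop_small[OF a, of 1] by auto
 ultimately have "distf h s < \<infinity>" using ennreal_less_top by (metis infinity_ennreal_def le_less_trans order_trans)
 then have h: "measop h" using ha unfolding measop_def by blast
 have hh: "adj h = h" unfolding h_def by (rule psaD(2)[OF psa_absg[OF affopD(1)[OF aa]]])
 have aff: "affop (strong_prod x y)" if "measop x" "measop y" for x y
  using meas_aff[OF measop_prod[OF that]] .
 have star: "adj b \<in> B" if "b \<in> B" for b
  using Bc[OF that measop_adjoint[OF B[OF that]]] dist_adjoint[OF meas_aff[OF B[OF that]]] by simp
 have star2: "adj (adj b) = b" if "b \<in> B" for b
  by (intro op_adjoint_op_adjoint cddD affopD meas_aff B that)
 have "(SUP b\<in>B. ?t (strong_prod a b)) = (SUP b\<in>B. ?t (strong_prod h b))"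
 proof (rule antisym)
  show "(SUP b\<in>B. ?t (strong_prod a b)) <= (SUP b\<in>B. ?t (strong_prod h b))"
  proof (rule SUP_mono)
   fix b assume b: "b \<in> B"
   then show "\<exists>c\<in>B. ?t (strong_prod a b) <= ?t (strong_prod h c)"
    by (intro bexI[of _ b] trace_pos_mono aff a h B dist_left_mult[of h b a u] bu u(2,3)) auto
  qed
  show "(SUP b\<in>B. ?t (strong_prod h b)) <= (SUP b\<in>B. ?t (strong_prod a b))"
  proof (rule SUP_mono)
   fix b assume b: "b \<in> B"
   then show "\<exists>c\<in>B. ?t (strong_prod h b) <= ?t (strong_prod a c)"
    by (intro bexI[of _ b] trace_pos_mono aff a h B dist_left_mult[of a b h "hadj u"] bcl_hadj[OF bu] hu u(4)) auto
  qed
 qed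
 also have "... = (SUP b\<in>B. ?t (strong_prod b h))"
 proof (rule antisym)
  show "(SUP b\<in>B. ?t (strong_prod h b)) <= (SUP b\<in>B. ?t (strong_prod b h))"
  proof (rule SUP_mono)
   fix b assume b: "b \<in> B"
   have "?t (strong_prod h b) <= ?t (strong_prod (adj b) h)"
    using dist_prod_adjoint[OF h B[OF b]] b by (intro trace_pos_mono aff h B star) (simp_all add: hh)
   then show "\<exists>c\<in>B. ?t (strong_prod h b) <= ?t (strong_prod c h)" using star[OF b] by blast
  qed
  show "(SUP b\<in>B. ?t (strong_prod b h)) <= (SUP b\<in>B. ?t (strong_prod h b))"
  proof (rule SUP_mono)
   fix b assume b: "b \<in> B"
   have "?t (strong_prod b h) <= ?t (strong_prod h (adj b))"
    using dist_prod_adjoint[OF B[OF b] h] b by (intro trace_pos_mono aff h B star) (simp_all add: hh)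
   then show "\<exists>c\<in>B. ?t (strong_prod b h) <= ?t (strong_prod h c)" using star[OF b] by blast
  qed
 qed
 also have "... = (SUP b\<in>B. ?t (strong_prod b a))"
 proof (rule antisym)
  have "Domain h = Domain a" unfolding h_def by (rule Domain_absg[OF affopD(1)[OF aa]])
  have sa: "single_valued a" "single_valued h" using cddD(2)[OF affopD(1)] aa ha by auto
  show "(SUP b\<in>B. ?t (strong_prod b h)) <= (SUP b\<in>B. ?t (strong_prod b a))"
  proof (rule SUP_mono)
   fix b assume b: "b \<in> B"
   \<comment> \<open>Right multiplication of b by \<open>hadj u\<close>. Since h =
     \<open>hadj u\<close> a, the product of b with h is the product of this operator with a, and by
     \<open>right_mult\<close> it stays in B.\<close>
   let ?c = "{(x, y). (hadj u x, y) \<in> b}"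
   have "?c \<in> B" using right_mult[OF B[OF b] mem_hadj[OF u(1)] hu] by (intro Bc[OF b]) auto
   moreover have "h O b = a O ?c"
   proof safe
    fix x w z assume xw: "(x, w) \<in> h" "(w, z) \<in> b"
    then have "(x, u w) \<in> a" "hadj u (u w) = w"
     using u(3)[OF xw(1)] sv_eq[OF sa(2) xw(1) u(4)[OF u(3)[OF xw(1)]]] by auto
    then show "(x, z) \<in> a O ?c" using xw(2) by auto
   next
    fix x y z assume "(x, y) \<in> a" "(hadj u y, z) \<in> b"
    then show "(x, z) \<in> h O b" using u(4) by blast
   qed
   then have "strong_prod b h = strong_prod ?c a" by (simp add: strong_prod_def)
   ultimately show "\<exists>c\<in>B. ?t (strong_prod b h) <= ?t (strong_prod c a)" by (metis order_refl)
  qed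
  show "(SUP b\<in>B. ?t (strong_prod b a)) <= (SUP b\<in>B. ?t (strong_prod b h))"
  proof (rule SUP_mono)
   fix b assume b: "b \<in> B"
   let ?c = "{(x, y). (u x, y) \<in> b}"
   have "?c \<in> B" using right_mult[OF B[OF b] u(1,2)] by (intro Bc[OF b]) auto
   moreover have "a O b = h O ?c"
   proof safe
    fix x w z assume xw: "(x, w) \<in> a" "(w, z) \<in> b"
    then have "(x, hadj u w) \<in> h" "u (hadj u w) = w"
     using u(4)[OF xw(1)] sv_eq[OF sa(1) xw(1) u(3)[OF u(4)[OF xw(1)]]] by auto
    then show "(x, z) \<in> h O ?c" using xw(2) by auto
   next
    fix x y z assume "(x, y) \<in> h" "(u y, z) \<in> b"
    then show "(x, z) \<in> a O b" using u(3) by blast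
   qed
   then have "strong_prod b a = strong_prod ?c h" by (simp add: strong_prod_def)
   ultimately show "\<exists>c\<in>B. ?t (strong_prod b a) <= ?t (strong_prod c h)" by (metis order_refl)
  qed
 qed
 finally show ?thesis .
qed

end

section \<open>Elementary operators on the tensor product\<close>

abbreviation "sqi \<equiv> square_integrable"

definition bm :: "(real => real) => bool" where
 "bm m \<longleftrightarrow> m \<in> bmeas \<and> (\<exists>C. \<forall>t. \<bar>m t\<bar> <= C)"

lemma bmI: "m \<in> bmeas ==> (!!t. \<bar>m t\<bar> <= C) ==> bm m"
 by (auto simp: bm_def)

lemma bm_mult: assumes "bm m" "bm k" shows "bm (%t. m t * k t)"
proof -
 obtain C D where CD: "!!t. \<bar>m t\<bar> <= C" "!!t. \<bar>k t\<bar> <= D" using assms unfolding bm_def by blast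
 have [measurable]: "m \<in> bmeas" "k \<in> bmeas" using assms unfolding bm_def by auto
 show ?thesis by (rule bmI[of _ "C * D"]) (auto simp: abs_mult intro!: mult_mono CD order_trans[OF abs_ge_zero CD(1)])
qed

lemma bm_ind: "A \<in> sets borel ==> bm (ind A)"
 by (rule bmI[of _ 1]) (auto simp: indicator_def)

lemma bm_const: "bm (%t. c)"
 by (rule bmI[of _ "\<bar>c\<bar>"]) auto

lemma sqi_measurable: "sqi f ==> f \<in> bmeas"
 by (simp add: square_integrable_def)

lemma cnj_measurable [measurable]: "cnj \<in> bmeas"
 by (intro borel_measurable_continuous_onI continuous_intros)

lemma sqi_prod: assumes "sqi f" "sqi g" shows "integrable lborel (%t. cnj (f t) * g t)"
proof (rule Bochner_Integration.integrable_bound)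
 show "integrable lborel (%t. (cmod (f t))^2 + (cmod (g t))^2)"
  using assms by (auto simp: square_integrable_def)
 show "AE t in lborel. norm (cnj (f t) * g t) <= norm ((cmod (f t))^2 + (cmod (g t))^2)"
 proof (rule AE_I2)
  fix t
  have "2 * (cmod (f t) * cmod (g t)) <= (cmod (f t))^2 + (cmod (g t))^2" using sum_squares_bound[of "cmod (f t)" "cmod (g t)"] by simp
  then have "cmod (f t) * cmod (g t) <= (cmod (f t))^2 + (cmod (g t))^2"
   using mult_nonneg_nonneg[OF norm_ge_zero[of "f t"] norm_ge_zero[of "g t"]] by linarith
  then show "norm (cnj (f t) * g t) <= norm ((cmod (f t))^2 + (cmod (g t))^2)" by (simp add: norm_mult)
 qed
 have [measurable]: "f \<in> bmeas" "g \<in> bmeas" using assms by (auto intro: sqi_measurable)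
 show "(%t. cnj (f t) * g t) \<in> borel_measurable lborel" by measurable
qed

lemma sqi_bound:
 assumes g: "sqi g" and [measurable]: "f \<in> borel_measurable lborel" and le: "AE t in lborel. cmod (f t) <= C * cmod (g t)"
 shows "sqi f"
 unfolding square_integrable_def
proof
 show "integrable lborel (%t. (cmod (f t))^2)"
 proof (rule Bochner_Integration.integrable_bound)
  show "integrable lborel (%t. C^2 * (cmod (g t))^2)" using g by (auto simp: square_integrable_def)
  show "AE t in lborel. norm ((cmod (f t))^2) <= norm (C^2 * (cmod (g t))^2)"
   using le
  proof eventually_elim
   case (elim t)
   then have "(cmod (f t))^2 <= (C * cmod (g t))^2" by (rule power_mono) simp
   then show ?case by (simp add: power_mult_distrib)
  qed
 qed measurable
qed simp

lemma sqi_bm: assumes "bm m" "sqi g" shows "sqi (%t. cr (m t) * g t)"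
proof -
 obtain C where C: "!!t. \<bar>m t\<bar> <= C" using assms unfolding bm_def by blast
 have [measurable]: "m \<in> bmeas" "g \<in> borel_measurable lborel" using assms by (auto simp: bm_def square_integrable_def)
 show ?thesis by (rule sqi_bound[OF assms(2), of _ C]) (auto simp: norm_mult intro!: mult_right_mono C)
qed

lemma sqi_cmult: assumes "sqi g" shows "sqi (%t. c * g t)"
proof -
 have [measurable]: "g \<in> borel_measurable lborel" using assms by (auto simp: square_integrable_def)
 show ?thesis by (rule sqi_bound[OF assms, of _ "cmod c"]) (auto simp: norm_mult)
qed

lemma sqi_diff: assumes "sqi f" "sqi g" shows "sqi (%t. f t - g t)"
 unfolding square_integrable_def
proof
 have [measurable]: "f \<in> borel_measurable lborel" "g \<in> borel_measurable lborel" using assms by (auto simp: square_integrable_def)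
 show "(%t. f t - g t) \<in> borel_measurable lborel" by measurable
 show "integrable lborel (%t. (cmod (f t - g t))^2)"
 proof (rule Bochner_Integration.integrable_bound)
  show "integrable lborel (%t. 2 * (cmod (f t))^2 + 2 * (cmod (g t))^2)"
   using assms by (auto simp: square_integrable_def)
  show "AE t in lborel. norm ((cmod (f t - g t))^2) <= norm (2 * (cmod (f t))^2 + 2 * (cmod (g t))^2)"
  proof (rule AE_I2)
   fix t
   have "(cmod (f t - g t))^2 <= (cmod (f t) + cmod (g t))^2" by (rule power_mono[OF norm_triangle_ineq4]) simp
   also have "... <= 2 * (cmod (f t))^2 + 2 * (cmod (g t))^2"
    using sum_squares_bound[of "cmod (f t)" "cmod (g t)"] unfolding power2_sum by linarith
   finally show "norm ((cmod (f t - g t))^2) <= norm (2 * (cmod (f t))^2 + 2 * (cmod (g t))^2)" by simp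
  qed
 qed measurable
qed

locale tensor =
 fixes T :: "'h::chilbert_space => (real => complex) => 'k::chilbert_space"
 assumes tensor: "L2_tensor T"
begin

lemma cinner_T: "sqi f ==> sqi g ==> cinner (T \<xi> f) (T \<eta> g) = cinner \<xi> \<eta> * (\<integral>t. cnj (f t) * g t \<partial>lborel)"
 using tensor by (simp add: L2_tensor_def)

lemma total_mem: assumes "csubspace V" "closed V" "!!\<xi> g. sqi g ==> T \<xi> g \<in> V" shows "\<zeta> \<in> V"
 using closed_cspan_minimal[of "{T \<xi> f |\<xi> f. sqi f}" V] tensor assms unfolding L2_tensor_def by auto

text \<open>All algebraic rules for T below, bilinearity included, are read off from the inner
  product formula by testing against elementary tensors.\<close>

lemma total_ext: assumes "!!\<xi> g. sqi g ==> cinner (T \<xi> g) x = cinner (T \<xi> g) y" shows "x = y"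
proof -
 have "x - y \<in> ocomp {x - y}"
 proof (rule total_mem[OF csubspace_ocomp closed_ocomp])
  fix \<xi> g assume "sqi g"
  then have "cinner (T \<xi> g) (x - y) = 0" using assms by (simp add: cinner.diff_right)
  then show "T \<xi> g \<in> ocomp {x - y}" by (simp add: ocomp_def cinner_zero_sym)
 qed
 then show ?thesis by (simp add: ocomp_def cinner_self)
qed

lemma total_eq:
 assumes Y: "bcl Y" "bcl Z" and "!!\<xi> g. sqi g ==> Y (T \<xi> g) = Z (T \<xi> g)" shows "Y \<zeta> = Z \<zeta>"
proof -
 have "\<zeta> \<in> {v. Y v = Z v}"
 proof (rule total_mem)
  show "csubspace {v. Y v = Z v}" using Y by (auto simp: csubspace_def bcl_0 bcl_add bcl_scaleC)
  show "closed {v. Y v = Z v}" by (intro closed_Collect_eq bcl_continuous Y)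
 qed (use assms in auto)
 then show ?thesis by simp
qed

lemma T_add_left: "sqi g ==> T (\<xi> + \<eta>) g = T \<xi> g + T \<eta> g"
 by (rule total_ext) (simp add: cinner_T cinner_add_right algebra_simps)

lemma T_scale_left: "sqi g ==> T (c *\<^sub>C \<xi>) g = c *\<^sub>C T \<xi> g"
 by (rule total_ext) (simp add: cinner_T cinner_scaleC_right)

lemma T_scale_right: "sqi g ==> T \<xi> (%t. c * g t) = c *\<^sub>C T \<xi> g"
 by (rule total_ext) (simp add: cinner_T sqi_cmult cinner_scaleC_right mult.left_commute[of _ c])

lemma T_diff_right: "sqi g ==> sqi h ==> T \<xi> (%t. g t - h t) = T \<xi> g - T \<xi> h"
 by (rule total_ext) (simp add: cinner_T sqi_diff sqi_prod cinner.diff_right right_diff_distrib)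

lemma norm_T: assumes "sqi g" shows "norm (T \<xi> g) = norm \<xi> * sqrt (\<integral>t. (cmod (g t))^2 \<partial>lborel)"
proof -
 have "cinner (T \<xi> g) (T \<xi> g) = cinner \<xi> \<xi> * (\<integral>t. cr ((cmod (g t))^2) \<partial>lborel)"
  unfolding cinner_T[OF assms assms] by (metis complex_norm_square mult.commute of_real_power)
 then have "cr ((norm (T \<xi> g))^2) = cr ((norm \<xi>)^2 * (\<integral>t. (cmod (g t))^2 \<partial>lborel))"
  unfolding cinner_self integral_complex_of_real of_real_mult .
 then have "(norm (T \<xi> g))^2 = (norm \<xi>)^2 * (\<integral>t. (cmod (g t))^2 \<partial>lborel)" unfolding of_real_eq_iff .
 then have "sqrt ((norm (T \<xi> g))^2) = sqrt ((norm \<xi>)^2 * (\<integral>t. (cmod (g t))^2 \<partial>lborel))" by (rule arg_cong)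
 then show ?thesis by (simp add: real_sqrt_mult)
qed

lemma bcl_T: "sqi g ==> bcl (%\<xi>. T \<xi> g)"
 by (rule bclI[where K = "sqrt (\<integral>t. (cmod (g t))^2 \<partial>lborel)"]) (simp_all add: T_add_left T_scale_left norm_T)

definition tt :: "('h \<times> (real => complex)) list => 'k" where
 "tt L = (\<Sum>p\<leftarrow>L. T (fst p) (snd p))"

text \<open>A list is a formal sum of elementary tensors: \<open>tt\<close> is its vector in the
  abstract tensor product, while \<open>ev\<close> reads it as a function with values in H. By
  \<open>tt_norm\<close> the passage is isometric into L2(R; H), although that space is never
  formed.\<close>

definition ev :: "('h \<times> (real => complex)) list => real => 'h" where
 "ev L t = (\<Sum>p\<leftarrow>L. snd p t *\<^sub>C fst p)"

lemma tt_inner: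
 assumes "!!p. p \<in> set L ==> sqi (snd p)" "!!p. p \<in> set L' ==> sqi (snd p)"
 shows "has_bochner_integral lborel (%t. cinner (ev L t) (ev L' t)) (cinner (tt L) (tt L'))"
 using assms(1)
proof (induction L)
 case (Cons p L)
 have p: "sqi (snd p)" using Cons.prems[of p] by simp
 have "has_bochner_integral lborel (%t. cinner (snd p t *\<^sub>C fst p) (ev L' t)) (cinner (T (fst p) (snd p)) (tt L'))"
  using assms(2)
 proof (induction L')
  case (Cons q L')
  have "has_bochner_integral lborel (%t. cinner (fst p) (fst q) * (cnj (snd p t) * snd q t)) (cinner (T (fst p) (snd p)) (T (fst q) (snd q)))"
   using Cons.prems[of q] p
   by (subst cinner_T) (auto intro!: has_bochner_integral_mult_right has_bochner_integral_integrable sqi_prod)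
  from has_bochner_integral_add[OF this Cons.IH] show ?case using Cons.prems
   by (auto simp: tt_def ev_def cinner_add_right cinner_scaleC_left cinner_scaleC_right algebra_simps)
 qed (simp add: tt_def ev_def cinner.zero_right has_bochner_integral_zero)
 from has_bochner_integral_add[OF this Cons.IH] Cons.prems show ?case
  by (simp add: tt_def ev_def cinner_add_left)
qed (simp add: tt_def ev_def cinner.zero_left has_bochner_integral_zero)

lemma tt_norm:
 assumes "!!p. p \<in> set L ==> sqi (snd p)"
 shows "has_bochner_integral lborel (%t. (norm (ev L t))^2) ((norm (tt L))^2)"
 using has_bochner_integral_bounded_linear[OF bounded_linear_Re tt_inner[of L L]] assms by (simp add: norm2_cinner)

text \<open>Read as functions of t, the image satisfies |m(t) x(v(t))| \<le> K C |v(t)| pointwise.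
  Integrating gives the bound on formal sums, which also settles well-definedness through
  \<open>bounded_extension\<close>.\<close>

lemma elementary_exists:
 assumes x: "bcl x" "!!\<xi>. norm (x \<xi>) <= K * norm \<xi>" "0 <= K" and m: "m \<in> bmeas" "!!t. \<bar>m t\<bar> <= C"
 shows "\<exists>y. is_elementary T x (%t. cr (m t)) y \<and> (\<forall>\<zeta>. norm (y \<zeta>) <= K * C * norm \<zeta>)"
proof -
 have bm: "bm m" using m by (rule bmI)
 have C: "0 <= C" using m(2)[of 0] by simp
 let ?w = "%p::'h \<times> (real => complex). (x (fst p), %t. cr (m t) * snd p t)"
 let ?ok = "%L. \<forall>p\<in>set L. sqi (snd p)"
 define V where "V = {(tt L, tt (map ?w L)) | L. ?ok L}"
 have scale: "c *\<^sub>C tt L = tt (map (%p. (fst p, %t. c * snd p t)) L)" if "?ok L" for c L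
  using that by (induction L) (simp_all add: tt_def T_scale_right scaleC_add_right scaleC.zero_right)
 have V: "csubspace V" unfolding csubspace_def
 proof (intro conjI ballI allI)
  have "(tt [], tt (map ?w [])) \<in> V" unfolding V_def by force
  then show "0 \<in> V" by (simp add: tt_def zero_prod_def)
 next
  fix p q assume "p \<in> V" "q \<in> V"
  then obtain L L' where L: "p = (tt L, tt (map ?w L))" "?ok L" "q = (tt L', tt (map ?w L'))" "?ok L'" unfolding V_def by blast
  have "(tt (L @ L'), tt (map ?w (L @ L'))) \<in> V" unfolding V_def using L(2,4) by force
  then show "p + q \<in> V" using L by (simp add: tt_def)
 next
  fix c p assume "p \<in> V"
  then obtain L where L: "p = (tt L, tt (map ?w L))" "?ok L" unfolding V_def by blast
  let ?L = "map (%p. (fst p, %t. c * snd p t)) L"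
  have "?ok ?L" using L(2) by (auto intro: sqi_cmult)
  moreover have "c *\<^sub>C tt (map ?w L) = tt (map ?w ?L)"
   using L(2) bm by (subst scale) (auto simp: o_def sqi_bm mult.left_commute)
  ultimately have "(c *\<^sub>C tt L, c *\<^sub>C tt (map ?w L)) \<in> V" unfolding V_def scale[OF L(2), of c] by blast
  then show "c *\<^sub>C p \<in> V" using L by (simp add: scaleC_prod_def)
 qed
 have gen: "(T \<xi> g, T (x \<xi>) (%t. cr (m t) * g t)) \<in> V" if "sqi g" for \<xi> g
 proof -
  have "(tt [(\<xi>, g)], tt (map ?w [(\<xi>, g)])) \<in> V" unfolding V_def using that by force
  then show ?thesis by (simp add: tt_def)
 qed
 have "\<zeta> \<in> closure (Domain V)" for \<zeta>
  by (rule total_mem[OF csub_closure[OF csubspace_Domain[OF V]]]) (use gen closure_subset in \<open>auto intro!: subsetD[OF closure_subset]\<close>)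
 then have dense: "closure (Domain V) = UNIV" by auto
 have "norm \<theta> <= K * C * norm \<zeta>" if v: "(\<zeta>, \<theta>) \<in> V" for \<zeta> \<theta>
 proof -
  obtain L where L: "\<zeta> = tt L" "\<theta> = tt (map ?w L)" "?ok L" using v unfolding V_def by blast
  have ew: "ev (map ?w L) t = cr (m t) *\<^sub>C x (ev L t)" for t
   by (induction L) (simp_all add: ev_def bcl_0[OF x(1)] scaleC.zero_right bcl_add[OF x(1)] bcl_scaleC[OF x(1)] scaleC_add_right scaleC_scaleC)
  have h: "has_bochner_integral lborel (%t. (norm (ev (map ?w L) t))^2) ((norm \<theta>)^2)"
   unfolding L(2) using L(3) sqi_bm[OF bm] by (intro tt_norm) force
  have "has_bochner_integral lborel (%t. (K * C)^2 * (norm (ev L t))^2) ((K * C)^2 * (norm \<zeta>)^2)"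
   unfolding L(1) using L(3) by (intro has_bochner_integral_mult_right[OF tt_norm]) blast
  with h have "(norm \<theta>)^2 <= (K * C)^2 * (norm \<zeta>)^2"
   unfolding has_bochner_integral_iff
  proof (elim conjE, elim subst, intro integral_mono)
   fix t
   have "norm (ev (map ?w L) t) <= C * (K * norm (ev L t))"
    unfolding ew norm_scaleC norm_of_real using m(2) x(2) C by (intro mult_mono) auto
   then have "(norm (ev (map ?w L) t))^2 <= (C * (K * norm (ev L t)))^2" by (rule power_mono) simp
   then show "(norm (ev (map ?w L) t))^2 <= (K * C)^2 * (norm (ev L t))^2" by (simp add: power_mult_distrib mult_ac)
  qed
  then have "(norm \<theta>)^2 <= (K * C * norm \<zeta>)^2" by (simp only: power_mult_distrib)
  then show ?thesis by (rule power2_le_imp_le) (use x(3) C in simp)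
 qed
 from bounded_extension[OF V this dense] obtain y where y: "bcl y" "\<forall>(\<zeta>, \<theta>)\<in>V. y \<zeta> = \<theta>" "\<forall>\<zeta>. norm (y \<zeta>) <= K * C * norm \<zeta>" by blast
 moreover have "y (T \<xi> g) = T (x \<xi>) (%t. cr (m t) * g t)" if "sqi g" for \<xi> g using bspec[OF y(2) gen[OF that]] by simp
 ultimately show ?thesis unfolding is_elementary_def by blast
qed

definition el :: "('h => 'h) => (real => real) => 'k => 'k" where
 "el x m = (SOME y. is_elementary T x (%t. cr (m t)) y)"

lemma elementary_el: assumes "bcl x" "bm m" shows "is_elementary T x (%t. cr (m t)) (el x m)"
proof -
 obtain K where "0 < K" "!!\<xi>. norm (x \<xi>) <= K * norm \<xi>" using bcl_bound[OF assms(1)] by blast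
 then show ?thesis unfolding el_def using assms elementary_exists[of x K m] unfolding bm_def
  by (metis (mono_tags, lifting) less_imp_le someI_ex)
qed

lemma bounded_el: "bcl x ==> bm m ==> bcl (el x m)"
 and el_T: "bcl x ==> bm m ==> sqi g ==> el x m (T \<xi> g) = T (x \<xi>) (%t. cr (m t) * g t)"
 using elementary_el[of x m] by (simp_all add: is_elementary_def)

lemma el_norm:
 assumes x: "bcl x" "!!\<xi>. norm (x \<xi>) <= K * norm \<xi>" "0 <= K" and m: "m \<in> bmeas" "!!t. \<bar>m t\<bar> <= C"
 shows "norm (el x m \<zeta>) <= K * C * norm \<zeta>"
proof -
 obtain y where y: "is_elementary T x (%t. cr (m t)) y" "!!\<zeta>. norm (y \<zeta>) <= K * C * norm \<zeta>" using elementary_exists[OF assms] by blast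
 have "el x m \<zeta> = y \<zeta>"
  by (rule total_eq[of "el x m" y]) (use y(1) x(1) bmI[OF m] in \<open>auto simp: is_elementary_def el_T bounded_el\<close>)
 then show ?thesis using y(2) by simp
qed

lemma el_comp:
 assumes "bcl x" "bcl x'" "bm m" "bm m'" "!!\<xi>. x (x' \<xi>) = z \<xi>" "!!t. m t * m' t = k t"
 shows "el x m (el x' m' \<zeta>) = el z k \<zeta>"
proof -
 have e: "z = (%\<xi>. x (x' \<xi>))" "k = (%t. m t * m' t)" using assms(5,6) by auto
 show ?thesis unfolding e
  by (rule total_eq[of "%v. el x m (el x' m' v)" "el (%\<xi>. x (x' \<xi>)) (%t. m t * m' t)"])
   (use assms(1-4) in \<open>simp_all add: bounded_el el_T bcl_comp bm_mult sqi_bm mult.assoc\<close>)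
qed

lemma el_hadj:
 assumes x: "bcl x" and m: "bm m" shows "cinner (el x m \<zeta>) \<theta> = cinner \<zeta> (el (hadj x) m \<theta>)"
proof -
 have "hadj (el x m) \<theta> = el (hadj x) m \<theta>"
 proof (rule total_eq[of "hadj (el x m)" "el (hadj x) m"])
  fix \<xi> g assume g: "sqi g"
  show "hadj (el x m) (T \<xi> g) = el (hadj x) m (T \<xi> g)"
  proof (rule total_ext)
   fix \<eta> h assume h: "sqi h"
   show "cinner (T \<eta> h) (hadj (el x m) (T \<xi> g)) = cinner (T \<eta> h) (el (hadj x) m (T \<xi> g))"
   proof -
    have "cinner (T \<eta> h) (hadj (el x m) (T \<xi> g)) = cinner (x \<eta>) \<xi> * (\<integral>t. cnj (cr (m t) * h t) * g t \<partial>lborel)"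
     using g h x m by (simp only: cinner_hadj[OF bounded_el[OF x m], symmetric] el_T cinner_T sqi_bm)
    also have "... = cinner \<eta> (hadj x \<xi>) * (\<integral>t. cnj (h t) * (cr (m t) * g t) \<partial>lborel)"
     by (simp add: cinner_hadj[OF x] mult_ac)
    also have "... = cinner (T \<eta> h) (el (hadj x) m (T \<xi> g))"
     using g h x m by (simp only: bcl_hadj el_T cinner_T sqi_bm)
    finally show ?thesis .
   qed
  qed
 qed (simp_all add: bcl_hadj bounded_el x m)
 then show ?thesis using cinner_hadj[OF bounded_el[OF x m]] by simp
qed

lemma el_sym:
 assumes x: "bcl x" "!!\<xi> \<eta>. cinner (x \<xi>) \<eta> = cinner \<xi> (x \<eta>)" and m: "bm m"
 shows "cinner (el x m \<zeta>) \<theta> = cinner \<zeta> (el x m \<theta>)"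
 using el_hadj[OF x(1) m] hadj_eqI[OF x(2)] by simp

lemma el_projection:
 assumes e: "projection_op e" and A: "A \<in> sets borel" shows "projection_op (el e (ind A))"
 using projD[OF e] bm_ind[OF A]
 by (intro projI bounded_el el_comp el_sym) (auto simp: indicator_def)

text \<open>Projections are uniformly bounded, so the vectors for which convergence holds form a
  closed subspace; on elementary tensors dominated convergence decides.\<close>

lemma el_tendsto:
 assumes e: "!!n::nat. projection_op (e n)" "!!\<xi>. (%n. e n \<xi>) ---> \<xi>"
  and A: "!!n. A n \<in> sets borel" "!!t. (%n. ind (A n) t :: real) ---> 1"
 shows "(%n. el (e n) (ind (A n)) \<zeta>) ---> \<zeta>"
proof -
 let ?P = "%n. el (e n) (ind (A n))"
 have P: "projection_op (?P n)" for n by (rule el_projection[OF e(1) A(1)])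
 note PD = projD[OF P]
 have "\<zeta> \<in> {v. (%n. ?P n v) ---> v}"
 proof (rule total_mem)
  show "csubspace {v. (%n. ?P n v) ---> v}"
   unfolding csubspace_def
   by (auto simp: bcl_0[OF PD(1)] bcl_add[OF PD(1)] bcl_scaleC[OF PD(1)] intro!: tendsto_add bcl_tendsto[OF bcl_cmult[OF bcl_id(1)]])
  show "closed {v. (%n. ?P n v) ---> v}"
  proof (rule closed_sequential_limits[THEN iffD2], intro allI impI, elim conjE)
   fix f l assume f: "\<forall>k. f k \<in> {v. (%n. ?P n v) ---> v}" "f ---> l"
   have "(%n. ?P n l) ---> l"
   proof (rule LIMSEQ_I)
    fix r :: real assume r: "0 < r"
    obtain k where k: "norm (f k - l) < r / 3" using LIMSEQ_D[OF f(2), of "r / 3"] r by auto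
    obtain N where N: "!!n. n \<ge> N ==> norm (?P n (f k) - f k) < r / 3" using LIMSEQ_D[of "%n. ?P n (f k)" "f k" "r / 3"] f(1) r by auto
    have "norm (?P n l - l) < r" if "n \<ge> N" for n
    proof -
     have "?P n l - l = - ?P n (f k - l) + (?P n (f k) - f k) + (f k - l)" by (simp add: bcl_diff[OF PD(1)])
     then have "norm (?P n l - l) <= norm (?P n (f k - l)) + norm (?P n (f k) - f k) + norm (f k - l)"
      by (metis (no_types, lifting) add_right_mono norm_minus_cancel norm_triangle_ineq order_trans)
     then show ?thesis using proj_norm_le[OF P, of n "f k - l"] N[OF that] k by linarith
    qed
    then show "\<exists>N. \<forall>n\<ge>N. norm (?P n l - l) < r" by blast
   qed
   then show "l \<in> {v. (%n. ?P n v) ---> v}" by simp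
  qed
  fix \<xi> g assume g: "sqi g"
  have [measurable]: "g \<in> borel_measurable lborel" using g by (simp add: square_integrable_def)
  note [measurable] = A(1)
  let ?h = "%n t. cr (ind (A n) t) * g t"
  have h: "sqi (?h n)" for n by (rule sqi_bm[OF bm_ind[OF A(1)] g])
  have d: "sqi (%t. ?h n t - g t)" for n by (rule sqi_diff[OF h g])
  have "(%n. (\<integral>t. (cmod (?h n t - g t))^2 \<partial>lborel)) ---> (\<integral>t. 0 \<partial>(lborel :: real measure))"
  proof (rule integral_dominated_convergence[where w = "%t. (cmod (g t))^2"])
   show "integrable lborel (%t. (cmod (g t))^2)" using g by (simp add: square_integrable_def)
   show "AE t in lborel. (%n. (cmod (?h n t - g t))^2) ---> 0"
   proof (rule AE_I2)
    fix t
    have "(%n. (cmod (?h n t - g t))^2) ---> (cmod (cr 1 * g t - g t))^2" by (intro tendsto_intros A(2))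
    then show "(%n. (cmod (?h n t - g t))^2) ---> 0" by simp
   qed
  qed (auto simp: indicator_def)
  then have "(%n. sqrt (\<integral>t. (cmod (?h n t - g t))^2 \<partial>lborel)) ---> 0" using tendsto_real_sqrt by force
  then have "(%n. norm (e n \<xi> - \<xi>) * sqrt (\<integral>t. (cmod (g t))^2 \<partial>lborel) + norm \<xi> * sqrt (\<integral>t. (cmod (?h n t - g t))^2 \<partial>lborel)) ---> 0 * sqrt (\<integral>t. (cmod (g t))^2 \<partial>lborel) + norm \<xi> * 0"
   by (intro tendsto_intros tendsto_norm_zero LIM_zero e(2))
  then have lim: "(%n. norm (e n \<xi> - \<xi>) * sqrt (\<integral>t. (cmod (g t))^2 \<partial>lborel) + norm \<xi> * sqrt (\<integral>t. (cmod (?h n t - g t))^2 \<partial>lborel)) ---> 0" by simp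
  have "(%n. ?P n (T \<xi> g) - T \<xi> g) ---> 0"
  proof (rule Lim_null_comparison[OF _ lim], rule always_eventually, rule allI)
   fix n
   have "?P n (T \<xi> g) - T \<xi> g = T (e n \<xi> - \<xi>) (?h n) + T \<xi> (%t. ?h n t - g t)"
    using bcl_diff[OF bcl_T[OF h]]
    by (simp add: el_T projD(1)[OF e(1)] bm_ind[OF A(1)] g T_diff_right h)
   also have "norm ... <= norm (T (e n \<xi> - \<xi>) (?h n)) + norm (T \<xi> (%t. ?h n t - g t))" by (rule norm_triangle_ineq)
   also have "... <= norm (e n \<xi> - \<xi>) * sqrt (\<integral>t. (cmod (g t))^2 \<partial>lborel) + norm \<xi> * sqrt (\<integral>t. (cmod (?h n t - g t))^2 \<partial>lborel)"
    unfolding norm_T[OF h] norm_T[OF d]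
   proof (intro add_right_mono mult_left_mono real_sqrt_le_mono integral_mono)
    show "integrable lborel (%t. (cmod (?h n t))^2)" "integrable lborel (%t. (cmod (g t))^2)"
     using g h[of n] by (simp_all only: square_integrable_def)
   qed (auto simp: indicator_def)
   finally show "norm (?P n (T \<xi> g) - T \<xi> g) <= ..." .
  qed
  then show "T \<xi> g \<in> {v. (%n. ?P n v) ---> v}" by (simp add: LIM_zero_iff)
 qed
 then show ?thesis by simp
qed

end

section \<open>Tensor products of closed operators with multiplication operators\<close>

text \<open>If U carries h to x and its adjoint carries x back to h, then x and h have the same
  resolvent by \<open>Rop_unique\<close>, and the absolute value depends only on the
  resolvent.\<close>

lemma op_abs_polarI:
 assumes x: "closed_dd_op x" and h: "positive_selfadjoint h" and U: "bcl U"
  and hx: "!!\<zeta> w. (\<zeta>, w) \<in> h ==> (\<zeta>, U w) \<in> x" and xh: "!!\<zeta> \<theta>. (\<zeta>, \<theta>) \<in> x ==> (\<zeta>, hadj U \<theta>) \<in> h"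
 shows "op_abs x = h"
proof -
 have "Rop x z = Rop h z" for z
 proof (rule Rop_unique(1)[OF x])
  show "(Rop h z, U (Bop h z)) \<in> x" by (rule hx[OF Rop_graph[OF psaD(1)[OF h]]])
  show "(U (Bop h z), z - Rop h z) \<in> adj x"
   unfolding adj_iff using Bop_graph[OF psaD(1)[OF h], of z] xh cinner_hadj'[OF U] unfolding adj_iff by auto
 qed
 then have "Rop x = Rop h" ..
 then show ?thesis unfolding op_abs_eq[OF x] by (metis absg_def psa_eq_absg[OF h])
qed

text \<open>The bounded pieces of h that tensor with bounded functions: e cuts the spectrum at r and
  k = h e. The root s of k is there because positivity of a tensor product is seen by writing it as
  a square.\<close>

lemma psa_cut:
 fixes r :: real
 assumes h: "positive_selfadjoint h" and r: "0 <= r"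
 defines "e \<equiv> sm h {..r}" and "k \<equiv> fc (Rop h) (%t. ind {..r} (lam t) * lam t)"
 shows "projection_op e" "bcl k" "cinner (k x) y = cinner x (k y)" "(e x, k x) \<in> h" "(x, w) \<in> h ==> e w = k x"
  "norm (k x) <= r * norm x"
  "\<exists>s. bcl s \<and> (\<forall>x y. cinner (s x) y = cinner x (s y)) \<and> (\<forall>x. s (s x) = k x)"
proof -
 note cd = psaD(1)[OF h] and R = pcon_Rop[OF psaD(1)[OF h]]
 have hh: "h = fcgr (Rop h) lam" using psa_eq_absg[OF h] by (simp add: absg_def)
 have B: "{..r} \<in> sets borel" by simp
 show "projection_op e" unfolding e_def by (rule sm_projection[OF cd B])
 have kb: "\<bar>ind {..r} (lam t) * lam t\<bar> <= r" for t by (rule lam_cut(2)[OF r])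
 have kd: "x \<in> fdom (Rop h) (%t. ind {..r} (lam t) * lam t)" for x
  by (rule fdom_bounded[OF R lam_cut(1) kb])
 show "bcl k" unfolding k_def by (rule bcl_fc[OF R lam_cut(1) kb])
 show "norm (k x) <= r * norm x" unfolding k_def by (rule fc_norm_bound[OF R lam_cut(1) kb])
 show "cinner (k x) y = cinner x (k y)" unfolding k_def by (rule fc_sym[OF R kd kd])
 have "x \<in> fdom (Rop h) (%t. lam t * ind {..r} (lam t))" using kd[of x] by (simp add: mult.commute)
 then have "e x \<in> fdom (Rop h) lam" "fc (Rop h) lam (e x) = k x"
  using fdom_fc[OF R ind_lam(2)[OF cd B] lam_meas] fc_fc[OF R ind_lam(2)[OF cd B] _ lam_meas]
  by (simp_all add: e_def k_def sm_fc[OF cd B] mult.commute)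
 then show "(e x, k x) \<in> h" by (subst hh) (auto simp: fcgr_def)
 show "e w = k x" if "(x, w) \<in> h"
 proof -
  have "x \<in> fdom (Rop h) lam" "w = fc (Rop h) lam x" using that by (subst (asm) hh, auto simp: fcgr_def)+
  then show ?thesis using fc_sm(2)[OF cd _ B, of x lam] by (simp add: e_def k_def)
 qed
 define q where "q t = ind {..r} (lam t) * sqrt (lam t)" for t
 have qm: "q \<in> bmeas" unfolding q_def[abs_def] by measurable
 have qb: "\<bar>q t\<bar> <= sqrt r" for t using lam_nonneg[of t] r by (auto simp: q_def indicator_def)
 have qd: "x \<in> fdom (Rop h) q" for x by (rule fdom_bounded[OF R qm qb])
 have qq: "q t * q t = ind {..r} (lam t) * lam t" for t using lam_nonneg[of t] by (auto simp: q_def indicator_def)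
 have "fc (Rop h) q (fc (Rop h) q x) = k x" for x
  using fc_fc[OF R qd _ qm, of x] kd[of x] unfolding qq k_def by simp
 then show "\<exists>s. bcl s \<and> (\<forall>x y. cinner (s x) y = cinner x (s y)) \<and> (\<forall>x. s (s x) = k x)"
  using bcl_fc[OF R qm qb] fc_sym[OF R qd qd] by blast
qed

definition cutI :: "nat => real set" where "cutI n = {- real n..real n}"

lemma cutI_borel [measurable]: "cutI n \<in> sets borel" by (simp add: cutI_def)

lemma cutI_tendsto: "(%n. ind (cutI n) t :: real) ---> 1"
proof (rule tendsto_eventually)
 obtain N where "\<bar>t\<bar> <= real N" using real_arch_simple by blast
 then have "\<forall>n\<ge>N. (ind (cutI n) t :: real) = 1" by (auto simp: cutI_def indicator_def)
 then show "\<forall>\<^sub>F n in sequentially. (ind (cutI n) t :: real) = 1" unfolding eventually_sequentially by blast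
qed

text \<open>What is needed for both f and 1/f to become bounded multipliers after restriction to
  each \<open>cutI n\<close>.\<close>

definition reg :: "(real => real) => bool" where
 "reg f \<longleftrightarrow> f \<in> bmeas \<and> (\<forall>t. 0 < f t) \<and> (\<forall>n. \<exists>C. \<forall>t\<in>cutI n. f t <= C \<and> 1 / f t <= C)"

lemma reg_cut: assumes f: "reg f" shows "bm (%t. ind (cutI n) t * f t)" "bm (%t. ind (cutI n) t / f t)"
proof -
 have [measurable]: "f \<in> bmeas" using f by (simp add: reg_def)
 obtain C where C: "!!t. t \<in> cutI n ==> f t <= C \<and> 1 / f t <= C" "!!t. 0 < f t" using f unfolding reg_def by blast
 have "0 \<in> cutI n" by (simp add: cutI_def)
 then have "0 <= C" using C(1)[of 0] C(2)[of 0] by linarith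
 then show "bm (%t. ind (cutI n) t * f t)" "bm (%t. ind (cutI n) t / f t)"
  using C by (auto intro!: bmI[of _ C] simp: indicator_def abs_of_pos)
qed

lemma reg_mult: assumes f: "reg f" and g: "reg g" shows "reg (%t. f t * g t)"
 unfolding reg_def
proof (intro conjI allI)
 have [measurable]: "f \<in> bmeas" "g \<in> bmeas" using f g by (simp_all add: reg_def)
 show "(%t. f t * g t) \<in> bmeas" by measurable
 have p: "0 < f t" "0 < g t" for t using f g by (simp_all add: reg_def)
 then show "0 < f t * g t" for t by simp
 fix n
 obtain C D where CD: "!!t. t \<in> cutI n ==> f t <= C \<and> 1 / f t <= C" "!!t. t \<in> cutI n ==> g t <= D \<and> 1 / g t <= D"
  using f g unfolding reg_def by metis
 have "f t * g t <= C * D \<and> 1 / (f t * g t) <= C * D" if "t \<in> cutI n" for t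
 proof -
  have "0 <= C" "0 <= D" using CD[OF that] p[of t] by linarith+
  then have "f t * g t <= C * D" "1 / f t * (1 / g t) <= C * D"
   using CD[OF that] p[of t] mult_mono[of "f t" C "g t" D] mult_mono[of "1 / f t" C "1 / g t" D] by simp_all
  then show ?thesis by simp
 qed
 then show "\<exists>C. \<forall>t\<in>cutI n. f t * g t <= C \<and> 1 / (f t * g t) <= C" by blast
qed

context tensor
begin

definition tens :: "'h graph => (real => real) => 'k graph" where
 "tens a f = closed_cspan {(T \<xi> g, T \<eta> (%t. cr (f t) * g t)) |\<xi> \<eta> g.
   (\<xi>, \<eta>) \<in> a \<and> sqi g \<and> sqi (%t. cr (f t) * g t)}"

lemma op_tensor_tens: "op_tensor T a F = tens a (%t. F (exp t))"
 by (simp add: op_tensor_def tens_def)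

lemma csub_tens: "csubspace (tens a f)" and closed_tens: "closed (tens a f)"
 by (simp_all add: tens_def csubspace_closed_cspan closed_closed_cspan)

lemma tens_gen: "(\<xi>, \<eta>) \<in> a ==> sqi g ==> sqi (%t. cr (f t) * g t) ==> (T \<xi> g, T \<eta> (%t. cr (f t) * g t)) \<in> tens a f"
 unfolding tens_def by (rule subsetD[OF closed_cspan_superset]) blast

lemma tens_map:
 assumes W: "csubspace W" "closed W" and Y: "bcl Y" and Z: "bcl Z"
  and gen: "!!\<xi> \<eta> g. (\<xi>, \<eta>) \<in> a ==> sqi g ==> sqi (%t. cr (f t) * g t) ==> (Y (T \<xi> g), Z (T \<eta> (%t. cr (f t) * g t))) \<in> W"
  and p: "(\<zeta>, \<theta>) \<in> tens a f"
 shows "(Y \<zeta>, Z \<theta>) \<in> W"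
proof -
 let ?V = "(%p. (Y (fst p), Z (snd p))) -` W"
 have "tens a f \<subseteq> ?V" unfolding tens_def
 proof (rule closed_cspan_minimal)
  show "csubspace ?V"
   using graph_0[OF W(1)] graph_add[OF W(1)] graph_scaleC[OF W(1)] unfolding csubspace_def
   by (auto simp: bcl_0 bcl_add bcl_scaleC Y Z scaleC_prod_def)
  have "continuous_on UNIV (%p. (Y (fst p), Z (snd p)))"
   by (intro continuous_on_Pair bounded_linear.continuous_on[OF bcl_linear[OF Y]]
     bounded_linear.continuous_on[OF bcl_linear[OF Z]] continuous_intros)
  then show "closed ?V" using W(2) by (intro closed_vimage) auto
 qed (use gen in auto)
 then show ?thesis using p by auto
qed

lemma tens_eq:
 fixes Y Z :: "'k => 'z::chilbert_space"
 assumes "bcl Y" "bcl Z"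
  and "!!\<xi> \<eta> g. (\<xi>, \<eta>) \<in> a ==> sqi g ==> sqi (%t. cr (f t) * g t) ==> Y (T \<xi> g) = Z (T \<eta> (%t. cr (f t) * g t))"
  and "(\<zeta>, \<theta>) \<in> tens a f"
 shows "Y \<zeta> = Z \<theta>"
proof -
 have cl: "closed (Id :: 'z graph)"
 proof -
  have "(Id :: 'z graph) = {p. fst p = snd p}" by auto
  also have "closed ..." by (intro closed_Collect_eq continuous_intros)
  finally show ?thesis .
 qed
 have cs: "csubspace (Id :: 'z graph)" by (auto simp: csubspace_def zero_prod_def scaleC_prod_def)
 have "(Y \<zeta>, Z \<theta>) \<in> Id" by (rule tens_map[OF cs cl assms(1,2) _ assms(4)]) (simp add: assms(3))
 then show ?thesis by simp
qed

text \<open>Partial inner product with w in the L2 factor. It recovers statements about operators on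
  H from statements about their tensor products.\<close>

definition slice :: "(real => complex) => 'k => 'h" where "slice w = hadj (%\<xi>. T \<xi> w)"

lemma bounded_slice: "sqi w ==> bcl (slice w)"
 unfolding slice_def by (rule bcl_hadj[OF bcl_T])

lemma cinner_slice: "sqi w ==> cinner \<xi> (slice w \<zeta>) = cinner (T \<xi> w) \<zeta>"
 unfolding slice_def by (rule cinner_hadj[OF bcl_T, symmetric])

lemma cinner_slice': "sqi w ==> cinner (slice w \<zeta>) \<xi> = cinner \<zeta> (T \<xi> w)"
 by (metis cinner_slice cinner_commute)

lemma slice_T: "sqi w ==> sqi g ==> slice w (T \<xi> g) = (\<integral>t. cnj (w t) * g t \<partial>lborel) *\<^sub>C \<xi>"
 by (rule cinner_ext) (simp add: cinner_slice cinner_T cinner_scaleC_right)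

text \<open>The real multiplier f moves from the right-hand vector onto the test function w; on
  generators both slices scale a point of a by the same number.\<close>

lemma slice_tens:
 assumes a: "csubspace a" "closed a" and w: "sqi w" "sqi (%t. cr (f t) * w t)" and p: "(\<zeta>, \<theta>) \<in> tens a f"
 shows "(slice (%t. cr (f t) * w t) \<zeta>, slice w \<theta>) \<in> a"
proof (rule tens_map[OF a bounded_slice[OF w(2)] bounded_slice[OF w(1)] _ p])
 fix \<xi> \<eta> g assume g: "(\<xi>, \<eta>) \<in> a" "sqi g" "sqi (%t. cr (f t) * g t)"
 have "(\<integral>t. cnj (cr (f t) * w t) * g t \<partial>lborel) = (\<integral>t. cnj (w t) * (cr (f t) * g t) \<partial>lborel)" by (simp add: mult_ac)
 then show "(slice (%t. cr (f t) * w t) (T \<xi> g), slice w (T \<eta> (%t. cr (f t) * g t))) \<in> a"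
  using graph_scaleC[OF a(1) g(1)] g w by (simp only: slice_T)
qed

text \<open>Takes the generator with w the normalized indicator of [0,1] and slices it with w/f, so
  that f cancels and both scalar factors are 1.\<close>

lemma tens_inj:
 assumes b: "csubspace b" "closed b" and f: "reg f" and ab: "tens a f \<subseteq> tens b f" shows "a \<subseteq> b"
proof safe
 fix \<xi> \<eta> assume xy: "(\<xi>, \<eta>) \<in> a"
 define w where "w = (ind {0..1} :: real => complex)"
 have ww: "cnj (w t) * w t = cr (ind {0..1} t)" "(cmod (w t))^2 = ind {0..1} t" for t by (auto simp: w_def indicator_def)
 have w: "sqi w" unfolding square_integrable_def ww by (simp add: w_def)
 have wf: "sqi (%t. cr (f t) * w t)" "sqi (%t. cr (1 / f t) * w t)"
 proof -
  have e: "cr (f t) * w t = cr (ind (cutI 1) t * f t) * w t" "cr (1 / f t) * w t = cr (ind (cutI 1) t / f t) * w t" for t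
   by (auto simp: w_def cutI_def indicator_def)
  show "sqi (%t. cr (f t) * w t)" "sqi (%t. cr (1 / f t) * w t)" unfolding e by (rule sqi_bm[OF reg_cut(1)[OF f] w] sqi_bm[OF reg_cut(2)[OF f] w])+
 qed
 have e: "(%t. cr (f t) * (cr (1 / f t) * w t)) = w" 
 proof
  fix t
  have "f t ~= 0" using f by (simp add: reg_def less_imp_neq[symmetric])
  then show "cr (f t) * (cr (1 / f t) * w t) = w t" by simp
 qed
 have "(T \<xi> w, T \<eta> (%t. cr (f t) * w t)) \<in> tens b f" using tens_gen[OF xy w wf(1)] ab by blast
 from slice_tens[OF b wf(2) _ this] have "(slice w (T \<xi> w), slice (%t. cr (1 / f t) * w t) (T \<eta> (%t. cr (f t) * w t))) \<in> b" using w by (simp only: e)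
 moreover have "(\<integral>t. cnj (w t) * w t \<partial>lborel) = 1"
  unfolding ww integral_complex_of_real by simp
 moreover have "(\<integral>t. cnj (cr (1 / f t) * w t) * (cr (f t) * w t) \<partial>lborel) = (\<integral>t. cnj (w t) * w t \<partial>lborel)"
 proof (rule Bochner_Integration.integral_cong[OF refl])
  fix t
  have "f t ~= 0" using f by (simp add: reg_def less_imp_neq[symmetric])
  then show "cnj (cr (1 / f t) * w t) * (cr (f t) * w t) = cnj (w t) * w t" by simp
 qed
 ultimately show "(\<xi>, \<eta>) \<in> b" using w wf by (simp only: slice_T scaleC_one)
qed

definition cutP :: "'h graph => nat => 'k => 'k" where
 "cutP h n = el (sm h {..real n}) (ind (cutI n))"

text \<open>The tensor operator h \<otimes> f restricted by the projection \<open>cutP h n\<close>,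
  written directly as a bounded elementary operator.\<close>

definition cutB :: "'h graph => (real => real) => nat => 'k => 'k" where
 "cutB h f n = el (fc (Rop h) (%t. ind {..real n} (lam t) * lam t)) (%t. ind (cutI n) t * f t)"

context
 fixes h :: "'h graph" and f :: "real => real"
 assumes h: "positive_selfadjoint h" and f: "reg f"
begin

lemma cutP_projection: "projection_op (cutP h n)"
 unfolding cutP_def by (rule el_projection[OF psa_cut(1)[OF h of_nat_0_le_iff] cutI_borel])

lemma cutP_tendsto: "(%n. cutP h n \<zeta>) ---> \<zeta>"
 unfolding cutP_def by (rule el_tendsto[OF psa_cut(1)[OF h of_nat_0_le_iff] sm_atMost_tendsto[OF psaD(1)[OF h]] cutI_borel cutI_tendsto])

lemma bounded_cutB: "bcl (cutB h f n)"
 unfolding cutB_def by (rule bounded_el[OF psa_cut(2)[OF h of_nat_0_le_iff] reg_cut(1)[OF f]])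

lemma cutB_sym: "cinner (cutB h f n \<zeta>) \<theta> = cinner \<zeta> (cutB h f n \<theta>)"
 unfolding cutB_def by (rule el_sym[OF psa_cut(2,3)[OF h of_nat_0_le_iff] reg_cut(1)[OF f]])

lemma cut_T:
 assumes g: "sqi g"
 shows "cutP h n (T \<xi> g) = T (sm h {..real n} \<xi>) (%t. cr (ind (cutI n) t) * g t)"
  "cutB h f n (T \<xi> g) = T (fc (Rop h) (%t. ind {..real n} (lam t) * lam t) \<xi>) (%t. cr (f t) * (cr (ind (cutI n) t) * g t))"
 unfolding cutP_def cutB_def el_T[OF projD(1)[OF psa_cut(1)[OF h of_nat_0_le_iff]] bm_ind[OF cutI_borel] g]
  el_T[OF psa_cut(2)[OF h of_nat_0_le_iff] reg_cut(1)[OF f] g] by (simp_all add: mult_ac)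

lemma cut_graph: "(cutP h n \<zeta>, cutB h f n \<zeta>) \<in> tens h f"
proof -
 have "\<zeta> \<in> Domain {p. (cutP h n (fst p), cutB h f n (fst p)) \<in> tens h f \<and> snd p = fst p}"
 proof (rule total_mem)
  let ?D = "{p. (cutP h n (fst p), cutB h f n (fst p)) \<in> tens h f \<and> snd p = fst p}"
  have e: "Domain ?D = (%v. (cutP h n v, cutB h f n v)) -` tens h f" by auto
  note b = projD(1)[OF cutP_projection] bounded_cutB
  show "csubspace (Domain ?D)" unfolding e csubspace_def
   using graph_0[OF csub_tens] graph_add[OF csub_tens] graph_scaleC[OF csub_tens]
   by (auto simp: bcl_0 bcl_add bcl_scaleC b)
  show "closed (Domain ?D)" unfolding e
   by (intro closed_vimage closed_tens continuous_on_Pair bcl_continuous b)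
  fix \<xi> g assume g: "sqi g"
  let ?g = "%t. cr (ind (cutI n) t) * g t"
  have "(T (sm h {..real n} \<xi>) ?g, T (fc (Rop h) (%t. ind {..real n} (lam t) * lam t) \<xi>) (%t. cr (f t) * ?g t)) \<in> tens h f"
   using sqi_bm[OF reg_cut(1)[OF f] g, of n]
   by (intro tens_gen psa_cut(4)[OF h of_nat_0_le_iff] sqi_bm[OF bm_ind g] cutI_borel) (simp add: mult_ac)
  then show "T \<xi> g \<in> Domain ?D" unfolding e by (simp add: cut_T[OF g])
 qed
 then show ?thesis by auto
qed

lemma cut_eq: "(\<zeta>, \<theta>) \<in> tens h f ==> cutB h f n \<zeta> = cutP h n \<theta>"
proof (rule tens_eq[OF bounded_cutB projD(1)[OF cutP_projection]])
 fix \<xi> \<eta> g assume g: "(\<xi>, \<eta>) \<in> h" "sqi g" "sqi (%t. cr (f t) * g t)"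
 then show "cutB h f n (T \<xi> g) = cutP h n (T \<eta> (%t. cr (f t) * g t))"
  by (simp add: cut_T psa_cut(5)[OF h of_nat_0_le_iff]) (simp add: mult.left_commute)
qed

text \<open>A point (\<zeta>, \<theta>) lies in the graph iff \<open>cutB\<close> \<zeta> =
  \<open>cutP\<close> \<theta> for every n: \<open>cut_eq\<close> gives one direction and
  convergence of the cut-offs the other. The criterion is symmetric under adjoints since
  \<open>cutB\<close> and \<open>cutP\<close> are; positivity holds because \<open>cutB\<close> is
  the square of a self-adjoint elementary operator.\<close>

lemma psa_tens: "positive_selfadjoint (tens h f)"
proof -
 note P = projD[OF cutP_projection]
 have lim: "(\<zeta>, \<theta>) \<in> tens h f" if "!!n. cutB h f n \<zeta> = cutP h n \<theta>" for \<zeta> \<theta>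
 proof (rule graph_tendsto[OF closed_tens])
  show "(cutP h n \<zeta>, cutP h n \<theta>) \<in> tens h f" for n using cut_graph[of n \<zeta>] that by simp
 qed (rule cutP_tendsto)+
 have cl: "closed_dd_op (tens h f)" unfolding closed_dd_op_def
 proof (intro conjI csub_tens closed_tens)
  have "\<theta> = \<theta>'" if p: "(\<zeta>, \<theta>) \<in> tens h f" "(\<zeta>, \<theta>') \<in> tens h f" for \<zeta> \<theta> \<theta>'
  proof (rule LIMSEQ_unique[OF cutP_tendsto])
   show "(%n. cutP h n \<theta>) ---> \<theta>'" using cutP_tendsto[of \<theta>'] unfolding cut_eq[OF p(1), symmetric] cut_eq[OF p(2), symmetric] .
  qed
  then show "single_valued (tens h f)" by (auto intro: single_valuedI)
  have "\<zeta> \<in> closure (Domain (tens h f))" for \<zeta>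
   unfolding closure_sequential by (intro exI[of _ "%n. cutP h n \<zeta>"] conjI allI DomainI[OF cut_graph] cutP_tendsto)
  then show "closure (Domain (tens h f)) = UNIV" by blast
 qed
 moreover have "adj (tens h f) = tens h f"
 proof safe
  fix \<eta> \<omega> assume p: "(\<eta>, \<omega>) \<in> adj (tens h f)"
  show "(\<eta>, \<omega>) \<in> tens h f"
  proof (rule lim)
   fix n
   show "cutB h f n \<eta> = cutP h n \<omega>"
    by (rule cinner_ext) (use p cut_graph in \<open>auto simp: adj_iff cutB_sym[symmetric] P(3)[symmetric]\<close>)
  qed
 next
  fix \<eta> \<omega> assume p: "(\<eta>, \<omega>) \<in> tens h f"
  show "(\<eta>, \<omega>) \<in> adj (tens h f)" unfolding adj_iff
  proof (intro allI impI)
   fix \<zeta> \<theta> assume q: "(\<zeta>, \<theta>) \<in> tens h f"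
   have "(%n. cinner (cutP h n \<theta>) \<eta>) ---> cinner \<theta> \<eta>" by (intro cinner.tendsto cutP_tendsto tendsto_const)
   moreover have "cinner (cutP h n \<theta>) \<eta> = cinner \<zeta> (cutP h n \<omega>)" for n
    using cut_eq[OF q, of n] cut_eq[OF p, of n] cutB_sym[of n \<zeta> \<eta>] by simp
   moreover have "(%n. cinner \<zeta> (cutP h n \<omega>)) ---> cinner \<zeta> \<omega>" by (intro cinner.tendsto cutP_tendsto tendsto_const)
   ultimately show "cinner \<theta> \<eta> = cinner \<zeta> \<omega>" using LIMSEQ_unique by auto
  qed
 qed
 moreover have "cinner \<zeta> \<theta> \<in> \<real>\<^sub>\<ge>\<^sub>0" if p: "(\<zeta>, \<theta>) \<in> tens h f" for \<zeta> \<theta>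
 proof -
  have "cinner \<zeta> (cutB h f n \<zeta>) \<in> \<real>\<^sub>\<ge>\<^sub>0" for n
  proof -
   obtain s where s: "bcl s" "!!x y. cinner (s x) y = cinner x (s y)"
     "!!x. s (s x) = fc (Rop h) (%t. ind {..real n} (lam t) * lam t) x"
    using psa_cut(7)[OF h of_nat_0_le_iff, of n] by blast
   let ?m = "%t. sqrt (ind (cutI n) t * f t)"
   have f0: "0 <= ind (cutI n) t * f t" for t using f by (simp add: reg_def less_imp_le)
   obtain C where C: "!!t. \<bar>ind (cutI n) t * f t\<bar> <= C" using reg_cut(1)[OF f, of n] unfolding bm_def by blast
   have "bm ?m" using reg_cut(1)[OF f, of n] f0 C unfolding bm_def
    by (auto intro!: exI[of _ "sqrt C"] order_trans[OF abs_ge_self C])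
   then have "cutB h f n \<zeta> = el s ?m (el s ?m \<zeta>)" "cinner \<zeta> (el s ?m (el s ?m \<zeta>)) = cinner (el s ?m \<zeta>) (el s ?m \<zeta>)"
    unfolding cutB_def using s f0 by (auto simp: el_sym intro!: el_comp[symmetric])
   then show ?thesis by (simp add: cinner_self)
  qed
  moreover have "(%n. cinner \<zeta> (cutB h f n \<zeta>)) ---> cinner \<zeta> \<theta>"
   unfolding cut_eq[OF p] by (intro cinner.tendsto cutP_tendsto tendsto_const)
  ultimately show ?thesis by (rule closed_sequentially[OF closed_nonneg_Reals_complex])
 qed
 ultimately show ?thesis unfolding positive_selfadjoint_def by auto
qed

end

end

locale tensor_alg = traced_alg M \<tau> + tensor T
 for M :: "('h::chilbert_space => 'h) set" and \<tau> :: "('h => 'h) => ennreal"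
  and T :: "'h => (real => complex) => 'k::chilbert_space"
begin

text \<open>The partial isometry u of a, amplified to u \<otimes> 1, intertwines the tensor products
  of a and |a|. Thus statements proved for positive operators carry over to general a.\<close>

lemma tens_polar:
 assumes a: "affop a"
 shows "\<exists>u\<in>M. (\<forall>x. norm (u x) <= norm x) \<and> (\<forall>x y. (x, y) \<in> a --> (x, hadj u y) \<in> absg a \<and> u (hadj u y) = y) \<and>
  (\<forall>\<zeta> w. (\<zeta>, w) \<in> tens (absg a) f --> (\<zeta>, el u (%t. 1) w) \<in> tens a f) \<and>
  (\<forall>\<zeta> \<theta>. (\<zeta>, \<theta>) \<in> tens a f --> (\<zeta>, el (hadj u) (%t. 1) \<theta>) \<in> tens (absg a) f \<and> el u (%t. 1) (el (hadj u) (%t. 1) \<theta>) = \<theta>)"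
proof -
 obtain u where u: "u \<in> M" "!!x. norm (u x) <= norm x" "!!x w. (x, w) \<in> absg a ==> (x, u w) \<in> a"
  "!!x y. (x, y) \<in> a ==> (x, hadj u y) \<in> absg a"
  using polar_decomposition[OF a] by blast
 have uu: "u (hadj u y) = y" if "(x, y) \<in> a" for x y
  using sv_eq[OF cddD(2)[OF affopD(1)[OF a]] u(3)[OF u(4)[OF that]] that] .
 note bu = mem_bcl[OF u(1)]
 note b = bu bcl_hadj[OF bu] bounded_el[OF bu bm_const] bounded_el[OF bcl_hadj[OF bu] bm_const]
 have U: "el u (%t. 1) (T \<eta> g) = T (u \<eta>) g" "el (hadj u) (%t. 1) (T \<eta> g) = T (hadj u \<eta>) g" if "sqi g" for \<eta> g
  using that by (simp_all add: el_T b bm_const)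
 have "(\<zeta>, el u (%t. 1) w) \<in> tens a f" if "(\<zeta>, w) \<in> tens (absg a) f" for \<zeta> w
  by (rule tens_map[OF csub_tens closed_tens bcl_id(1) b(3) _ that]) (auto simp: U intro!: tens_gen u(3))
 moreover have "(\<zeta>, el (hadj u) (%t. 1) \<theta>) \<in> tens (absg a) f" if "(\<zeta>, \<theta>) \<in> tens a f" for \<zeta> \<theta>
  by (rule tens_map[OF csub_tens closed_tens bcl_id(1) b(4) _ that]) (auto simp: U intro!: tens_gen u(4))
 moreover have "el u (%t. 1) (el (hadj u) (%t. 1) \<theta>) = \<theta>" if "(\<zeta>, \<theta>) \<in> tens a f" for \<zeta> \<theta>
  using tens_eq[OF bcl_zero bcl_subtract[OF bcl_comp[OF b(3) b(4)] bcl_id(1)] _ that]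
  by (simp add: U uu)
 ultimately show ?thesis using u(1,2,4) uu by blast
qed

lemma psa_tens_absg: "affop a ==> reg f ==> positive_selfadjoint (tens (absg a) f)"
 by (rule psa_tens[OF psa_absg[OF affopD(1)]])

lemma closed_dd_tens: assumes a: "affop a" and f: "reg f" shows "closed_dd_op (tens a f)"
proof -
 obtain u where u: "!!\<zeta> w. (\<zeta>, w) \<in> tens (absg a) f ==> (\<zeta>, el u (%t. 1) w) \<in> tens a f"
   "!!\<zeta> \<theta>. (\<zeta>, \<theta>) \<in> tens a f ==> (\<zeta>, el (hadj u) (%t. 1) \<theta>) \<in> tens (absg a) f \<and> el u (%t. 1) (el (hadj u) (%t. 1) \<theta>) = \<theta>"
  using tens_polar[OF a, of f] by metis
 note X = cddD[OF psaD(1)[OF psa_tens_absg[OF a f]]]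
 have "Domain (tens a f) = Domain (tens (absg a) f)" using u by blast
 moreover have "single_valued (tens a f)"
 proof (rule single_valuedI)
  fix \<zeta> \<theta> \<theta>' assume "(\<zeta>, \<theta>) \<in> tens a f" "(\<zeta>, \<theta>') \<in> tens a f"
  then show "\<theta> = \<theta>'" using u(2) sv_eq[OF X(2)] by metis
 qed
 ultimately show ?thesis using X(4) by (simp add: closed_dd_op_def csub_tens closed_tens)
qed

lemma op_abs_tens: assumes a: "affop a" and f: "reg f" shows "op_abs (tens a f) = tens (absg a) f"
proof -
 obtain u where u: "u \<in> M" "!!\<zeta> w. (\<zeta>, w) \<in> tens (absg a) f ==> (\<zeta>, el u (%t. 1) w) \<in> tens a f"
   "!!\<zeta> \<theta>. (\<zeta>, \<theta>) \<in> tens a f ==> (\<zeta>, el (hadj u) (%t. 1) \<theta>) \<in> tens (absg a) f"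
  using tens_polar[OF a, of f] by metis
 note bu = mem_bcl[OF u(1)]
 have "hadj (el u (%t. 1)) = el (hadj u) (%t. 1)" by (rule hadj_eqI[OF el_hadj[OF bu bm_const]])
 then show ?thesis using u(3)
  by (intro op_abs_polarI[OF closed_dd_tens[OF a f] psa_tens_absg[OF a f] bounded_el[OF bu bm_const] u(2)]) auto
qed

abbreviation "N \<equiv> crossed_product T M"

text \<open>The generators are closed under adjoints, so the commutants are too, and a triple
  commutant equals the single one.\<close>

lemma crossed_vn: "von_neumann_algebra N"
proof -
 let ?G = "{y. \<exists>x\<in>M. \<exists>f. ess_bounded f \<and> is_elementary T x f y}"
 have G: "bcl y \<and> hadj y \<in> ?G" if yG: "y \<in> ?G" for y
 proof -
  obtain x f where y: "x \<in> M" "ess_bounded f" "is_elementary T x f y" using yG by auto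
  note bx = mem_bcl[OF y(1)]
  have by': "bcl y" and yT: "!!\<xi> g. sqi g ==> y (T \<xi> g) = T (x \<xi>) (%t. f t * g t)" using y(3) by (auto simp: is_elementary_def)
  have fm: "f \<in> bmeas" using y(2) by (simp add: ess_bounded_def)
  obtain C where C: "AE t in lborel. cmod (f t) <= C" using y(2) unfolding ess_bounded_def by blast
  have fb: "sqi (%t. f t * g t)" "sqi (%t. cnj (f t) * g t)" if g: "sqi g" for g
  proof -
   note [measurable] = sqi_measurable[OF g] fm
   have "AE t in lborel. cmod (f t * g t) <= C * cmod (g t)" "AE t in lborel. cmod (cnj (f t) * g t) <= C * cmod (g t)"
    using C by (eventually_elim, simp add: norm_mult mult_right_mono)+
   then show "sqi (%t. f t * g t)" "sqi (%t. cnj (f t) * g t)" by (auto intro!: sqi_bound[OF g])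
  qed
  have "hadj y (T \<xi> g) = T (hadj x \<xi>) (%t. cnj (f t) * g t)" if g: "sqi g" for \<xi> g
  proof (rule total_ext)
   fix \<eta> k assume k: "sqi k"
   have "cinner (T \<eta> k) (hadj y (T \<xi> g)) = cinner (x \<eta>) \<xi> * (\<integral>t. cnj (f t * k t) * g t \<partial>lborel)"
    using fb(1)[OF k] g k by (simp only: cinner_hadj[OF by', symmetric] yT cinner_T)
   also have "... = cinner \<eta> (hadj x \<xi>) * (\<integral>t. cnj (k t) * (cnj (f t) * g t) \<partial>lborel)" by (simp add: cinner_hadj[OF bx] mult_ac)
   also have "... = cinner (T \<eta> k) (T (hadj x \<xi>) (%t. cnj (f t) * g t))"
    using fb(2)[OF g] k by (simp only: cinner_T)
   finally show "cinner (T \<eta> k) (hadj y (T \<xi> g)) = ..." .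
  qed
  then have "is_elementary T (hadj x) (%t. cnj (f t)) (hadj y)" using bcl_hadj[OF by'] by (simp add: is_elementary_def)
  moreover have "ess_bounded (%t. cnj (f t))" using C fm unfolding ess_bounded_def by auto
  ultimately show ?thesis using by' mem_hadj[OF y(1)] by blast
 qed
 have c1: "bcl y \<and> hadj y \<in> commutant ?G" if "y \<in> commutant ?G" for y
  using commutant_hadj[OF G that] commutantD(1)[OF that] by blast
 have c2: "hadj y \<in> N" if "y \<in> N" for y
  using commutant_hadj[OF c1 that[unfolded crossed_product_def]] unfolding crossed_product_def .
 have anti: "commutant B \<subseteq> commutant A" if "A \<subseteq> B" for A B :: "('k => 'k) set" using that by (auto simp: commutant_def)
 have dbl: "A \<subseteq> commutant (commutant A)" if "!!y. y \<in> A ==> bcl y" for A :: "('k => 'k) set"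
  using that by (auto simp: commutant_def)
 have "commutant (commutant (commutant ?G)) = commutant ?G"
  by (rule antisym[OF anti[OF dbl] dbl]) (use G commutantD(1) in blast)+
 then show ?thesis unfolding von_neumann_algebra_def
  using c2 commutantD(1) by (auto simp: cadjoint_hadj crossed_product_def)
qed

lemma el_mem: assumes "x \<in> M" "bm m" shows "el x m \<in> N"
proof -
 let ?G = "{y. \<exists>x\<in>M. \<exists>f. ess_bounded f \<and> is_elementary T x f y}"
 have "ess_bounded (%t. cr (m t))" using assms(2) by (auto simp: bm_def ess_bounded_def)
 then have G: "el x m \<in> ?G" using elementary_el[OF mem_bcl[OF assms(1)] assms(2)] assms(1) by blast
 show ?thesis unfolding crossed_product_def
 proof (rule commutantI[OF bounded_el[OF mem_bcl[OF assms(1)] assms(2)]])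
  show "el x m (X v) = X (el x m v)" if "X \<in> commutant ?G" for X v
   by (rule commutantD(2)[OF that G, symmetric])
 qed
qed

text \<open>A unitary of the commutant commutes with all \<open>cutP\<close> and
  \<open>cutB\<close>, which are elements of N; hence it preserves the criterion describing the
  tensor graph.\<close>

lemma affiliated_tens: assumes a: "affop a" and f: "reg f" shows "affiliated N (tens a f)"
proof -
 interpret N: vn_alg N by (rule vn_alg.intro[OF crossed_vn])
 let ?h = "absg a"
 note hp = psa_absg[OF affopD(1)[OF a]]
 have ha: "affop ?h" by (rule affop_absg[OF a])
 obtain u where u: "u \<in> M" "!!\<zeta> w. (\<zeta>, w) \<in> tens ?h f ==> (\<zeta>, el u (%t. 1) w) \<in> tens a f"
   "!!\<zeta> \<theta>. (\<zeta>, \<theta>) \<in> tens a f ==> (\<zeta>, el (hadj u) (%t. 1) \<theta>) \<in> tens ?h f \<and> el u (%t. 1) (el (hadj u) (%t. 1) \<theta>) = \<theta>"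
  using tens_polar[OF a, of f] by metis
 show ?thesis
 proof (rule N.affiliatedI)
  fix v \<zeta> \<theta> assume v: "unitary_op v" "v \<in> commutant N" and p: "(\<zeta>, \<theta>) \<in> tens a f"
  let ?w = "el (hadj u) (%t. 1) \<theta>"
  have w: "(\<zeta>, ?w) \<in> tens ?h f" using u(3)[OF p] by blast
  have P: "cutP ?h n (v x) = v (cutP ?h n x)" for n x
   unfolding cutP_def by (rule N.memD[OF el_mem[OF sm_mem[OF affopD[OF ha]] bm_ind[OF cutI_borel]] v(2)])
  have B: "cutB ?h f n (v x) = v (cutB ?h f n x)" for n x
   unfolding cutB_def by (rule N.memD[OF el_mem[OF fc_mem[OF pcon_Rop[OF affopD(1)[OF ha]] Rop_mem[OF affopD[OF ha]] lam_cut(1) lam_cut(2)] reg_cut(1)[OF f]] v(2)]) simp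
  have "(v \<zeta>, v ?w) \<in> tens ?h f"
  proof (rule graph_tendsto[OF closed_tens])
   show "(cutP ?h n (v \<zeta>), cutP ?h n (v ?w)) \<in> tens ?h f" for n
    using cut_graph[OF hp f, of n "v \<zeta>"] cut_eq[OF hp f w, of n] by (simp add: P B)
  qed (rule cutP_tendsto[OF hp f])+
  from u(2)[OF this] have "(v \<zeta>, v (el u (%t. 1) ?w)) \<in> tens a f"
   by (simp add: N.memD[OF el_mem[OF u(1) bm_const] v(2)])
  then show "(v \<zeta>, v \<theta>) \<in> tens a f" using u(3)[OF p] by simp
 qed
qed

text \<open>For one inclusion, test functions are cut to bounded intervals, where multiplication by
  f and g keeps them square integrable, and points of the closed product ab are approximated by
  algebraic ones. The other inclusion argues by slices and self-adjointness of the tensor product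
  with |ab|.\<close>

lemma strong_prod_tens:
 assumes a: "measop a" and b: "measop b" and f: "reg f" and g: "reg g"
 shows "strong_prod (tens a f) (tens b g) = tens (strong_prod a b) (%t. f t * g t)"
proof
 let ?c = "strong_prod a b" and ?h = "%t. f t * g t"
 have c: "affop ?c" by (rule meas_aff[OF measop_prod[OF a b]])
 note h = reg_mult[OF f g]
 note A = cddD[OF affopD(1)[OF meas_aff[OF a]]] and B = cddD[OF affopD(1)[OF meas_aff[OF b]]]
 have cut: "sqi (%t. cr (k t) * w t)" if "reg k" "sqi u" "w = (%t. cr (ind (cutI n) t) * u t)" for k u w n
  using sqi_bm[OF reg_cut(1)[OF that(1)] that(2), of n] unfolding that(3) by (simp add: mult_ac)
 let ?e = "%n. el (%x. x) (ind (cutI n))"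
 have eP: "projection_op (?e n)" for n by (rule el_projection[OF _ cutI_borel]) (auto intro: projI bcl_id)
 have e: "(%n. ?e n \<zeta>) ---> \<zeta>" for \<zeta>
  by (rule el_tendsto[OF _ _ cutI_borel cutI_tendsto]) (auto intro: projI bcl_id)
 have eT: "?e n (T \<xi> v) = T \<xi> (%t. cr (ind (cutI n) t) * v t)" if "sqi v" for n \<xi> v
  using that by (simp add: el_T bcl_id bm_ind)
 show "tens ?c ?h \<subseteq> strong_prod (tens a f) (tens b g)" unfolding tens_def[of ?c]
 proof (rule closed_cspan_minimal)
  let ?S = "strong_prod (tens a f) (tens b g)"
  show "csubspace ?S" unfolding strong_prod_def by (intro csub_closure csubspace_relcomp csub_tens)
  show cS: "closed ?S" by (simp add: strong_prod_def)
  have "(T \<xi> u, T \<eta> (%t. cr (?h t) * u t)) \<in> ?S" if c: "(\<xi>, \<eta>) \<in> ?c" and u: "sqi u" "sqi (%t. cr (?h t) * u t)" for \<xi> \<eta> u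
  proof -
   obtain X where X: "!!k. X k \<in> b O a" "X ---> (\<xi>, \<eta>)" using c unfolding strong_prod_def closure_sequential by blast
   let ?u = "%n t. cr (ind (cutI n) t) * u t"
   have su: "sqi (?u n)" for n by (rule sqi_bm[OF bm_ind[OF cutI_borel] u(1)])
   have "(T (fst (X k)) (?u n), T (snd (X k)) (%t. cr (?h t) * ?u n t)) \<in> ?S" for k n
   proof -
    obtain x y z where x: "X k = (x, z)" "(x, y) \<in> b" "(y, z) \<in> a" using X(1)[of k] by auto
    have "(T x (?u n), T y (%t. cr (g t) * ?u n t)) \<in> tens b g"
     by (rule tens_gen[OF x(2) su cut[OF g u(1) refl]])
    moreover have "(T y (%t. cr (g t) * ?u n t), T z (%t. cr (f t) * (cr (g t) * ?u n t))) \<in> tens a f"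
     using cut[OF h u(1) refl, of n] by (intro tens_gen[OF x(3) cut[OF g u(1) refl]]) (simp add: mult_ac)
    ultimately have "(T x (?u n), T z (%t. cr (?h t) * ?u n t)) \<in> tens b g O tens a f" by (auto simp: mult_ac)
    then show ?thesis unfolding strong_prod_def x(1) by (simp add: subsetD[OF closure_subset])
   qed
   then have "(T \<xi> (?u n), T \<eta> (%t. cr (?h t) * ?u n t)) \<in> ?S" for n
   proof (rule graph_tendsto[OF cS])
    show "(%k. T (fst (X k)) (?u n)) ---> T \<xi> (?u n)"
     using bcl_tendsto[OF bcl_T[OF su] tendsto_fst[OF X(2)]] by simp
    show "(%k. T (snd (X k)) (%t. cr (?h t) * ?u n t)) ---> T \<eta> (%t. cr (?h t) * ?u n t)"
     using bcl_tendsto[OF bcl_T[OF cut[OF h u(1) refl]] tendsto_snd[OF X(2)]] by simp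
   qed
   note 1 = this
   show ?thesis
   proof (rule graph_tendsto[OF cS])
    show "(T \<xi> (?u n), T \<eta> (%t. cr (?h t) * ?u n t)) \<in> ?S" for n by (rule 1)
    show "(%n. T \<xi> (?u n)) ---> T \<xi> u" unfolding eT[OF u(1), symmetric] by (rule e)
    have "(%t. cr (?h t) * ?u n t) = (%t. cr (ind (cutI n) t) * (cr (?h t) * u t))" for n by (simp add: mult_ac)
    then show "(%n. T \<eta> (%t. cr (?h t) * ?u n t)) ---> T \<eta> (%t. cr (?h t) * u t)"
     unfolding eT[OF u(2), symmetric] using e[of "T \<eta> (%t. cr (?h t) * u t)"] eT[OF u(2)] by simp
   qed
  qed
  then show "{(T \<xi> u, T \<eta> (%t. cr (?h t) * u t)) |\<xi> \<eta> u. (\<xi>, \<eta>) \<in> ?c \<and> sqi u \<and> sqi (%t. cr (?h t) * u t)} \<subseteq> ?S" by blast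
 qed
 \<comment> \<open>Slicing by boundedly supported functions puts pairs of slices into the graph of c
   = ab. With c = u|c| this shows that (\<zeta>, (\<open>hadj u\<close> \<otimes> 1)\<theta>) is in
   the adjoint of the tensor product of |c|, which is self-adjoint; then u \<otimes> 1 is
   applied.\<close>
 have "(\<zeta>, \<theta>) \<in> tens ?c ?h" if p: "(\<zeta>, \<omega>) \<in> tens b g" "(\<omega>, \<theta>) \<in> tens a f" for \<zeta> \<omega> \<theta>
 proof -
  obtain u where u: "u \<in> M" "!!x y. (x, y) \<in> ?c ==> (x, hadj u y) \<in> absg ?c \<and> u (hadj u y) = y"
    "!!\<zeta> w. (\<zeta>, w) \<in> tens (absg ?c) ?h ==> (\<zeta>, el u (%t. 1) w) \<in> tens ?c ?h"
   using tens_polar[OF c, of ?h] by metis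
  note bu = mem_bcl[OF u(1)] and hp = psa_absg[OF affopD(1)[OF c]]
  note hb = bcl_hadj[OF bu]
  have sl: "(slice (%t. cr (?h t) * w t) \<zeta>, slice w \<theta>) \<in> ?c" if v: "sqi v" and w: "w = (%t. cr (ind (cutI n) t) * v t)" for v w n
  proof -
   have sw: "sqi w" unfolding w by (rule sqi_bm[OF bm_ind[OF cutI_borel] v])
   have "(slice (%t. cr (f t) * w t) \<omega>, slice w \<theta>) \<in> a" by (rule slice_tens[OF A(1,3) sw cut[OF f v w] p(2)])
   moreover have "(slice (%t. cr (g t) * (cr (f t) * w t)) \<zeta>, slice (%t. cr (f t) * w t) \<omega>) \<in> b"
    using cut[OF h v w] by (intro slice_tens[OF B(1,3) cut[OF f v w] _ p(1)]) (simp add: mult_ac)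
   ultimately have "(slice (%t. cr (?h t) * w t) \<zeta>, slice w \<theta>) \<in> b O a" by (auto simp: mult_ac)
   then show ?thesis unfolding strong_prod_def by (rule subsetD[OF closure_subset])
  qed
  have sel: "slice w (el x (%t. 1) v) = x (slice w v)" if w: "sqi w" and x: "bcl x" for w x v
  proof (rule cinner_ext)
   fix \<xi>
   have "cinner \<xi> (slice w (el x (%t. 1) v)) = cinner (el (hadj x) (%t. 1) (T \<xi> w)) v"
    using el_hadj[OF bcl_hadj[OF x] bm_const] by (simp add: cinner_slice[OF w] hadj_hadj[OF x])
   also have "... = cinner \<xi> (x (slice w v))"
    using w by (simp add: el_T bcl_hadj[OF x] bm_const cinner_slice[OF w, symmetric] cinner_hadj'[OF x])
   finally show "cinner \<xi> (slice w (el x (%t. 1) v)) = cinner \<xi> (x (slice w v))" .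
  qed
  let ?X = "tens (absg ?c) ?h" and ?\<theta> = "el (hadj u) (%t. 1) \<theta>"
  have "(\<alpha>, \<beta>) \<in> adj {(\<zeta>, ?\<theta>)}" if ab: "(\<alpha>, \<beta>) \<in> ?X" for \<alpha> \<beta>
  proof (rule graph_tendsto[OF closed_op_adjoint _ e e])
   fix n
   show "(?e n \<alpha>, ?e n \<beta>) \<in> adj {(\<zeta>, ?\<theta>)}"
   proof (rule tens_map[OF csub_adjoint closed_op_adjoint projD(1)[OF eP] projD(1)[OF eP] _ ab])
    fix \<xi> \<eta> v assume v: "(\<xi>, \<eta>) \<in> absg ?c" "sqi v" "sqi (%t. cr (?h t) * v t)"
    define w where "w = (%t. cr (ind (cutI n) t) * v t)"
    have sw: "sqi w" unfolding w_def by (rule sqi_bm[OF bm_ind[OF cutI_borel] v(2)])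
    have "cinner ?\<theta> (T \<xi> w) = cinner (hadj u (slice w \<theta>)) \<xi>" by (simp add: cinner_slice'[OF sw, symmetric] sel[OF sw hb])
    also have "... = cinner (slice (%t. cr (?h t) * w t) \<zeta>) \<eta>"
     using psaD(4)[OF hp] u(2)[OF sl[OF v(2) w_def]] v(1) by blast
    also have "... = cinner \<zeta> (T \<eta> (%t. cr (?h t) * w t))" by (rule cinner_slice'[OF cut[OF h v(2) w_def]])
    also have "(%t. cr (?h t) * w t) = (%t. cr (ind (cutI n) t) * (cr (?h t) * v t))" by (simp add: w_def mult_ac)
    finally show "(?e n (T \<xi> v), ?e n (T \<eta> (%t. cr (?h t) * v t))) \<in> adj {(\<zeta>, ?\<theta>)}"
     unfolding eT[OF v(2)] eT[OF v(3)] w_def[symmetric] by (simp add: adj_iff)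
   qed
  qed
  then have "cinner ?\<theta> \<alpha> = cinner \<zeta> \<beta>" if "(\<alpha>, \<beta>) \<in> ?X" for \<alpha> \<beta> using that by (simp add: adj_iff)
  then have "cnj (cinner ?\<theta> \<alpha>) = cnj (cinner \<zeta> \<beta>)" if "(\<alpha>, \<beta>) \<in> ?X" for \<alpha> \<beta> using that by simp
  then have "(\<zeta>, ?\<theta>) \<in> adj ?X" unfolding adj_iff cinner_commute[symmetric] by simp
  then have "(\<zeta>, el u (%t. 1) ?\<theta>) \<in> tens ?c ?h" using u(3) psaD(2)[OF psa_tens[OF hp h]] by simp
  \<comment> \<open>That u \<open>hadj u\<close> fixes \<theta> is known only for its slices, which
    lie in the range of c; so it is checked behind the cut-offs.\<close>
  moreover have "?e n (el u (%t. 1) ?\<theta>) = ?e n \<theta>" for n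
  proof (rule total_ext)
   fix \<xi> v assume v: "sqi v"
   define w where "w = (%t. cr (ind (cutI n) t) * v t)"
   have sw: "sqi w" unfolding w_def by (rule sqi_bm[OF bm_ind[OF cutI_borel] v])
   have "slice w (el u (%t. 1) ?\<theta>) = slice w \<theta>" using u(2)[OF sl[OF v w_def]] by (simp add: sel[OF sw] bu hb)
   then show "cinner (T \<xi> v) (?e n (el u (%t. 1) ?\<theta>)) = cinner (T \<xi> v) (?e n \<theta>)"
    unfolding projD(3)[OF eP, symmetric] eT[OF v] w_def[symmetric] cinner_slice[OF sw, symmetric] by simp
  qed
  then have "el u (%t. 1) ?\<theta> = \<theta>" using LIMSEQ_unique[OF e[of "el u (%t. 1) ?\<theta>"]] e[of \<theta>] by simp
  ultimately show ?thesis by simp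
 qed
 then have "tens b g O tens a f \<subseteq> tens ?c ?h" by blast
 then show "strong_prod (tens a f) (tens b g) \<subseteq> tens ?c ?h" unfolding strong_prod_def[of "tens a f"]
  by (rule closure_minimal[OF _ closed_tens])
qed

end

section \<open>The distribution function of a tensor product\<close>

lemma orth_norm_sum:
 fixes y :: "'i => 'a::chilbert_space"
 assumes "finite I" "!!m n. m ~= n ==> cinner (y m) (y n) = 0"
 shows "(norm (\<Sum>i\<in>I. y i))^2 = (\<Sum>i\<in>I. (norm (y i))^2)"
 using assms(1)
proof induction
 case (insert i I)
 have "cinner (y i) (\<Sum>i\<in>I. y i) = (\<Sum>j\<in>I. cinner (y i) (y j))" by (rule cinner.sum_right)
 also have "... = 0" using insert.hyps by (intro sum.neutral ballI assms(2)) auto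
 finally show ?case using insert by (simp add: norm_add_sq_orth)
qed simp

text \<open>Bessel's inequality makes the series summable. The identity of squared norms is kept
  because the estimates in \<open>dist_tens_step\<close> are made piece by piece and then
  added.\<close>

lemma orth_sums:
 fixes P :: "nat => 'a::chilbert_space => 'a"
 assumes P: "!!n. projection_op (P n)" and orth: "!!m n x. m ~= n ==> P m (P n x) = 0"
 shows "\<exists>Q. projection_op Q \<and> (\<forall>x. (%n. P n x) sums Q x \<and> (%n. (norm (P n x))^2) sums (norm (Q x))^2 \<and> (\<forall>n. P n (Q x) = P n x))"
proof -
 note PD = projD[OF P]
 have o: "cinner (P m x) (P n x) = 0" if "m ~= n" for m n x
  using orth[OF that] by (simp add: PD(3) cinner.zero_right)
 have os: "(norm (\<Sum>k\<in>I. P k x))^2 = (\<Sum>k\<in>I. (norm (P k x))^2)" if "finite I" for I x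
  by (rule orth_norm_sum[OF that o])
 have bd: "(\<Sum>k\<in>I. (norm (P k x))^2) <= (norm x)^2" if I: "finite I" for I x
 proof -
  let ?S = "\<Sum>k\<in>I. P k x"
  have "cinner ?S x = (\<Sum>k\<in>I. cinner (P k x) x)" by (rule cinner.sum_left)
  also have "... = (\<Sum>k\<in>I. cr ((norm (P k x))^2))" by (simp add: PD(3) proj_cinner[OF P])
  also have "... = cr ((norm ?S)^2)" unfolding os[OF I] by simp
  finally have e: "cinner ?S x = cr ((norm ?S)^2)" .
  have "(norm ?S)^2 = cmod (cinner ?S x)" unfolding e norm_of_real by simp
  also have "... <= norm ?S * norm x" by (rule cmod_cinner_le)
  finally have "norm ?S <= norm x" unfolding power2_eq_square
   by (cases "norm ?S = 0") (simp, metis mult_left_le_imp_le norm_ge_zero order_le_less)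
  then show ?thesis unfolding os[OF I, symmetric] by (rule power_mono) simp
 qed
 have sq: "summable (%n. (norm (P n x))^2)" for x
  by (rule summableI_nonneg_bounded[where x = "(norm x)^2"]) (auto intro: bd)
 have s: "summable (%n. P n x)" for x
  unfolding summable_Cauchy
 proof (intro allI impI)
  fix e :: real assume "0 < e"
  then have "0 < e^2" by simp
  then obtain N where N: "!!m n. m \<ge> N ==> norm (\<Sum>k=m..<n. (norm (P k x))^2) < e^2"
   using sq[of x] unfolding summable_Cauchy by blast
  have "norm (\<Sum>k=m..<n. P k x) < e" if "m \<ge> N" for m n
  proof (rule power2_less_imp_less)
   show "(norm (\<Sum>k=m..<n. P k x))^2 < e^2" unfolding os[OF finite_atLeastLessThan] using N[OF that, of n] by simp
  qed (use \<open>0 < e\<close> in simp)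
  then show "\<exists>N. \<forall>m\<ge>N. \<forall>n. norm (\<Sum>k=m..<n. P k x) < e" by blast
 qed
 define Q where "Q x = (\<Sum>n. P n x)" for x
 have Q: "(%n. P n x) sums Q x" for x unfolding Q_def by (rule summable_sums[OF s])
 have nQ: "(%n. (norm (P n x))^2) sums (norm (Q x))^2" for x
  unfolding sums_def os[OF finite_lessThan, symmetric] by (intro tendsto_intros Q[unfolded sums_def])
 have PQ: "P n (Q x) = P n x" for n x
 proof -
  have "(%k. P n (P k x)) sums P n (Q x)" by (rule bounded_linear.sums[OF bcl_linear[OF PD(1)] Q])
  moreover have "(%k. P n (P k x)) sums (\<Sum>k\<in>{n}. P n (P k x))" by (rule sums_finite) (auto simp: orth)
  ultimately show ?thesis using sums_unique2 PD(2) by fastforce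
 qed
 have "projection_op Q"
 proof (rule projI)
  show "bcl Q"
  proof (rule bclI[where K = 1])
   show "Q (x + y) = Q x + Q y" for x y
    using sums_add[OF Q[of x] Q[of y]] Q[of "x + y"] unfolding bcl_add[OF PD(1)] by (rule sums_unique2[symmetric])
   show "Q (c *\<^sub>C x) = c *\<^sub>C Q x" for c x
    using bounded_linear.sums[OF scaleC.bounded_linear_right Q, of c x] Q[of "c *\<^sub>C x"] unfolding bcl_scaleC[OF PD(1)] by (rule sums_unique2[symmetric])
   fix x
   have "(norm (Q x))^2 <= (norm x)^2"
    using sums_unique[OF nQ[of x]] suminf_le_const[OF sq[of x], of "(norm x)^2"] bd by simp
   then show "norm (Q x) <= 1 * norm x" by simp
  qed
  show "Q (Q x) = Q x" for x unfolding Q_def[of "Q x"] PQ by (simp add: Q_def)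
  show "cinner (Q x) y = cinner x (Q y)" for x y
  proof (rule sums_unique2)
   show "(%n. cinner (P n x) y) sums cinner (Q x) y" by (rule bounded_linear.sums[OF cinner.bounded_linear_left Q])
   show "(%n. cinner (P n x) y) sums cinner x (Q y)" unfolding PD(3) by (rule bounded_linear.sums[OF cinner.bounded_linear_right Q])
  qed
 qed
 then show ?thesis using Q nQ PQ by blast
qed

text \<open>The operator l is the inverse of h on the spectral subspace for (c, \<infinity>),
  bounded by 1/c; it gives lower norm bounds the form of upper ones.\<close>

lemma psa_inverse_cut:
 assumes h: "positive_selfadjoint h" and c: "0 < c"
 shows "\<exists>l. bcl l \<and> (\<forall>x. norm (l x) <= 1 / c * norm x) \<and> (\<forall>x y. (x, y) \<in> h --> l y = sm h {c<..} x)"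
proof -
 note cd = psaD(1)[OF h] and R = pcon_Rop[OF psaD(1)[OF h]]
 define q where "q t = (if c < lam t then 1 / lam t else 0)" for t
 have qm: "q \<in> bmeas" unfolding q_def[abs_def] by measurable
 have qb: "\<bar>q t\<bar> <= 1 / c" for t
 proof (cases "c < lam t")
  case True
  then have "1 / lam t <= 1 / c" using c by (intro divide_left_mono) auto
  then show ?thesis using True c by (simp add: q_def)
 qed (use c in \<open>simp add: q_def\<close>)
 have ql: "q t * lam t = ind {c<..} (lam t)" for t using c by (auto simp: q_def)
 have "fc (Rop h) q y = sm h {c<..} x" if "(x, y) \<in> h" for x y
 proof -
  have "h = fcgr (Rop h) lam" using psa_eq_absg[OF h] by (simp add: absg_def)
  then have xy: "x \<in> fdom (Rop h) lam" "y = fc (Rop h) lam x" using that by (auto simp: fcgr_def)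
  have "x \<in> fdom (Rop h) (%t. q t * lam t)" unfolding ql by (rule ind_lam(2)[OF cd]) simp
  then show ?thesis using fc_fc[OF R xy(1) _ qm] unfolding xy(2) ql by (simp add: sm_fc[OF cd])
 qed
 then show ?thesis using bcl_fc[OF R qm qb] fc_norm_bound[OF R qm qb] by blast
qed

lemma sm_op_abs: assumes "closed_dd_op a" shows "sm (op_abs a) = sm a"
 using spectral_op_abs[OF assms] spectral_op_abs[OF psaD(1)[OF psa_absg[OF assms]]]
 by (simp add: op_abs_eq[OF assms] op_abs_psa[OF psa_absg[OF assms]])

text \<open>The last condition says that \<open>s \<mapsto> F(s) / s\<close> is nonincreasing, where \<open>f(t) = F(e\<^sup>t)\<close>.\<close>

definition adm :: "(real => real) => bool" where
 "adm f \<longleftrightarrow> (\<forall>t. 0 < f t) \<and> mono f \<and> (\<forall>t t'. t <= t' --> f t' <= exp (t' - t) * f t)"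

lemma adm_reg: assumes f: "adm f" shows "reg f"
 unfolding reg_def
proof (intro conjI allI)
 show "f \<in> bmeas" using f by (intro borel_measurable_mono) (simp add: adm_def)
 show p: "0 < f t" for t using f by (simp add: adm_def)
 fix n
 have "f t <= max (f n) (1 / f (- real n)) \<and> 1 / f t <= max (f n) (1 / f (- real n))" if "t \<in> cutI n" for t
 proof -
  have "f t <= f n" "f (- real n) <= f t" using that f by (auto simp: cutI_def adm_def mono_def)
  then show ?thesis using p[of "- real n"] p[of t] by (auto simp: le_max_iff_disj intro!: divide_left_mono)
 qed
 then show "\<exists>C. \<forall>t\<in>cutI n. f t <= C \<and> 1 / f t <= C" by blast
qed

context traced_alg
begin

text \<open>Unlike in \<open>dist_le\<close>, vectors fixed by p are not known to lie in the domain
  of a. Spectral subspaces for bounded intervals (s, n] do lie there, and continuity from below lets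
  n grow.\<close>

lemma dist_le_domain:
 assumes a: "affop a" and p: "p \<in> M" "projection_op p" and s: "0 <= s" and bd: "!!x y. p x = x ==> (x, y) \<in> a ==> norm y <= s * norm x"
 shows "distf a s <= \<tau> (%v. v - p v)"
proof -
 note cd = affopD(1)[OF a]
 have "(SUP n. emeasure (tmeas a) {s<..real n}) = emeasure (tmeas a) (\<Union>n. {s<..real n})"
  by (rule SUP_emeasure_incseq) (auto simp: incseq_def sets_tmeas[OF a])
 also have "(\<Union>n. {s<..real n}) = {s<..}" by (auto intro: real_arch_simple)
 finally have "distf a s = (SUP n. emeasure (tmeas a) {s<..real n})" by (simp add: dist_tmeas[OF a])
 also have "... <= \<tau> (%v. v - p v)"
 proof (rule SUP_least)
  fix n :: nat
  show "emeasure (tmeas a) {s<..real n} <= \<tau> (%v. v - p v)"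
  proof (subst emeasure_tmeas[OF a], simp, rule tr_disjoint[OF sm_mem[OF affopD[OF a]] sm_projection[OF cd] p])
   fix v assume v: "sm a {s<..real n} v = v" "p v = v"
   have sub: "sm a B v = v" if B: "B \<in> sets borel" "{s<..real n} \<subseteq> B" for B
    using pvmD(4)[OF sm_pvm[OF cd], of B "{s<..real n}" v] B v(1) by (simp add: Int_absorb1)
   have "sm a {..real n} v = v" by (rule sub) auto
   then obtain y where y: "(v, y) \<in> a" using sm_atMost_norm(1)[OF a of_nat_0_le_iff] by blast
   obtain w where w: "(v, w) \<in> absg a" using y Domain_absg[OF cd] by blast
   have "Re (cinner v w) <= norm v * norm w" using complex_Re_le_cmod cmod_cinner_le order_trans by blast
   also have "... = norm v * norm y" using absg_norm[OF cd y(1) w] by simp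
   also have "... <= s * (norm v)^2" using mult_left_mono[OF bd[OF v(2) y], of "norm v"] by (simp add: power2_eq_square algebra_simps)
   finally have le: "Re (cinner v w) <= s * (norm v)^2" .
   have "sm a {s<..} v = v" by (rule sub) auto
   then show "v = 0" using pvm_form_gt[OF psa_absg[OF cd] sm_pvm[OF cd] sm_spectral[OF cd] w _ le] by blast
  qed simp
 qed
 finally show ?thesis .
qed

end

context tensor
begin

lemma el_zero: "bcl x ==> el x (%t. 0) \<zeta> = 0"
 using bcl_bound[of x] el_norm[of x _ "%t. 0" 0 \<zeta>] by (metis abs_zero borel_measurable_const less_imp_le mult_zero_left mult_zero_right norm_le_zero_iff order_refl)

lemma el_sum:
 assumes x: "bcl x" and k: "bm k" "bm l"
 shows "el x (%t. k t + l t) \<zeta> = el x k \<zeta> + el x l \<zeta>"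
proof -
 have kl: "bm (%t. k t + l t)"
 proof -
  obtain C D where "!!t. \<bar>k t\<bar> <= C" "!!t. \<bar>l t\<bar> <= D" using k unfolding bm_def by blast
  then have "\<bar>k t + l t\<bar> <= C + D" for t by (intro order_trans[OF abs_triangle_ineq] add_mono)
  then show ?thesis using k unfolding bm_def by auto
 qed
 show ?thesis
 proof (rule total_eq[of "el x (%t. k t + l t)" "%\<zeta>. el x k \<zeta> + el x l \<zeta>"])
  fix \<xi> g assume g: "sqi g"
  show "el x (%t. k t + l t) (T \<xi> g) = el x k (T \<xi> g) + el x l (T \<xi> g)"
   using T_diff_right[OF sqi_bm[OF kl g] sqi_bm[OF k(1) g], of "x \<xi>"] k kl g x by (simp add: el_T algebra_simps)
 qed (intro bounded_el bcl_plus x k kl)+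
qed

text \<open>Decomposes \<zeta> orthogonally along a partition of the line; the finite partial sums
  are cut-offs to growing unions, which tend to the identity.\<close>

lemma el_partition:
 assumes I: "disjoint_family I" "(\<Union>k. I k) = UNIV" "!!k::nat. I k \<in> sets borel"
 shows "(%k. (norm (el (%x. x) (ind (I k)) \<zeta>))^2) sums (norm \<zeta>)^2"
proof -
 let ?R = "%k. el (%x. x) (ind (I k))"
 have id: "projection_op (%x. x)" by (auto intro: projI bcl_id)
 have R: "projection_op (?R k)" for k by (rule el_projection[OF id I(3)])
 have Ro: "?R k (?R l x) = 0" if "k ~= l" for k l x
  using el_comp[OF bcl_id(1) bcl_id(1) bm_ind[OF I(3)] bm_ind[OF I(3)] refl, of k l "%t. 0" x]
   I(1) that el_zero[OF bcl_id(1)] by (auto simp: disjoint_family_on_def indicator_def)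
 from orth_sums[of ?R, OF R Ro] obtain Q where Q: "!!x. (%n. ?R n x) sums Q x" "!!x. (%n. (norm (?R n x))^2) sums (norm (Q x))^2" by blast
 have U: "(\<Union>k<n. I k) \<in> sets borel" for n using I(3) by auto
 have part: "(\<Sum>k<n. ?R k \<zeta>) = el (%x. x) (ind (\<Union>k<n. I k)) \<zeta>" for n
 proof (induction n)
  case 0
  have "ind {} = (%t::real. 0 :: real)" by auto
  then show ?case by (simp add: el_zero[OF bcl_id(1)])
 next
  case (Suc n)
  have "I n \<inter> I k = {}" if "k < n" for k using I(1) that by (simp add: disjoint_family_on_def)
  then have d: "I n \<inter> (\<Union>k<n. I k) = {}" by blast
  have "ind (\<Union>k<Suc n. I k) t = ind (\<Union>k<n. I k) t + (ind (I n) t :: real)" for t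
   using d by (auto simp: indicator_def less_Suc_eq)
  then have "ind (\<Union>k<Suc n. I k) = (%t. ind (\<Union>k<n. I k) t + (ind (I n) t :: real))" by blast
  then show ?case using Suc by (simp add: el_sum[OF bcl_id(1) bm_ind[OF U] bm_ind[OF I(3)]])
 qed
 have "(%n. el (%x. x) (ind (\<Union>k<n. I k)) \<zeta>) ---> \<zeta>"
 proof (rule el_tendsto[OF id _ U])
  fix t
  obtain k where k: "t \<in> I k" using I(2) by blast
  then have "\<forall>n\<ge>Suc k. (ind (\<Union>k<n. I k) t :: real) = 1" by (auto simp: indicator_def)
  then show "(%n. ind (\<Union>k<n. I k) t :: real) ---> 1"
   by (intro tendsto_eventually) (auto simp: eventually_sequentially)
 qed simp
 then have "(%n. ?R n \<zeta>) sums \<zeta>" unfolding sums_def part .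
 then have "Q \<zeta> = \<zeta>" using Q(1) sums_unique2 by blast
 then show ?thesis using Q(2)[of \<zeta>] by simp
qed

end

locale crossed_alg = tensor_alg M \<tau> T
 for M :: "('h::chilbert_space => 'h) set" and \<tau> :: "('h => 'h) => ennreal"
  and T :: "'h => (real => complex) => 'k::chilbert_space" +
 fixes \<tau>A :: "('k => 'k) => ennreal"
 assumes ct: "canonical_trace T M \<tau> \<tau>A"
begin

sublocale A: traced_alg "crossed_product T M" \<tau>A
 using ct by unfold_locales (auto simp: canonical_trace_def crossed_vn)

lemma ctr: "x \<in> pos_part M ==> (!!t. 0 <= f t) ==> ess_bounded (%t. cr (f t)) ==> is_elementary T x (%t. cr (f t)) y ==>
  \<tau>A y = \<tau> x * (\<integral>\<^sup>+ t. ennreal (f t * exp (- t)) \<partial>lborel)"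
 using ct unfolding canonical_trace_def by blast

lemma affop_tens: "affop a ==> reg f ==> A.affop (tens a f)"
 unfolding A.affop_def using closed_dd_tens affiliated_tens by blast

lemma dist_op_abs: assumes a: "affop a" shows "distf (absg a) s = distf a s"
 using sm_op_abs[OF affopD(1)[OF a]] by (simp add: distf_def op_abs_eq[OF affopD(1)[OF a]])

lemma dist_tens_absg: assumes a: "affop a" and f: "reg f" shows "A.distf (tens a f) s = A.distf (tens (absg a) f) s"
 using sm_op_abs[OF closed_dd_tens[OF a f]] by (simp add: A.distf_def op_abs_tens[OF a f])

definition gdist :: "'h graph => (real => real) => real => ennreal" where
 "gdist a f s = (\<integral>\<^sup>+ t. distf a (s / f t) * ennreal (exp (- t)) \<partial>lborel)"

text \<open>On each interval \<open>I k\<close> the function \<open>f\<close> is constant up to a factor \<open>e\<^sup>\<epsilon>\<close>, so that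
  \<open>\<Sum>k. e\<^sub>k \<otimes> \<chi>\<^sub>I\<^sub>k\<close>, where \<open>e\<^sub>k\<close> is the spectral projection of \<open>h\<close> for \<open>(s / f(t\<^sub>k), \<infinity>)\<close>, approximates the
  spectral projection of \<open>h \<otimes> f\<close> for \<open>(s, \<infinity>)\<close>.\<close>

lemma dist_tens_step:
 assumes h: "positive_selfadjoint h" "affop h" and f: "adm f" and s: "0 < s" and \<epsilon>: "0 < \<epsilon>"
 shows "\<exists>q. A.distf (tens h f) (s * exp \<epsilon>) <= q \<and> (\<forall>r. 0 <= r --> r < s --> q <= A.distf (tens h f) r) \<and>
  q <= gdist h f s \<and> gdist h f (s * exp \<epsilon>) <= q"
proof -
 note fr = adm_reg[OF f] and cd = psaD(1)[OF h(1)]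
 have f0: "0 < f t" for t using f by (simp add: adm_def)
 have A: "A.affop (tens h f)" by (rule affop_tens[OF h(2) fr])
 \<comment> \<open>The left end points of a grid of mesh \<epsilon> over all of the line, indexed by
   naturals so that the pieces can be summed as sequences.\<close>
 define t where "t k = \<epsilon> * real_of_int (int_decode k)" for k
 define I where "I k = {t k..<t k + \<epsilon>}" for k
 have mem: "x \<in> I k \<longleftrightarrow> int_decode k = \<lfloor>x / \<epsilon>\<rfloor>" for x k
 proof -
  have "x \<in> I k \<longleftrightarrow> real_of_int (int_decode k) <= x / \<epsilon> \<and> x / \<epsilon> < real_of_int (int_decode k) + 1"
   using \<epsilon> by (simp add: I_def t_def field_simps)
  then show ?thesis by (metis floor_unique of_int_floor_le real_of_int_floor_add_one_gt)
 qed
 have dis: "disjoint_family I"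
  unfolding disjoint_family_on_def using mem inj_int_decode[THEN injD] by (metis disjoint_iff)
 have UN: "(\<Union>k. I k) = UNIV" using mem by (metis (mono_tags, lifting) UNIV_eq_I UN_I int_encode_inverse UNIV_I)
 have Ib: "I k \<in> sets borel" for k by (simp add: I_def)
 \<comment> \<open>This is where both halves of \<open>adm\<close> enter: f increases, but by at
   most the factor exp(x - t_k), which is at most exp \<epsilon> on the piece.\<close>
 have fI: "f (t k) <= f x" "f x <= exp \<epsilon> * f (t k)" if x: "x \<in> I k" for x k
 proof -
  have "t k <= x" "x - t k <= \<epsilon>" using x by (auto simp: I_def)
  then have "f x <= exp (x - t k) * f (t k)" "exp (x - t k) <= exp \<epsilon>" "f (t k) <= f x" using f by (auto simp: adm_def mono_def)
  then show "f (t k) <= f x" "f x <= exp \<epsilon> * f (t k)"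
   using mult_right_mono[OF \<open>exp (x - t k) <= exp \<epsilon>\<close> less_imp_le[OF f0[of "t k"]]] by linarith+
 qed
 have fm: "f \<in> bmeas" using fr by (simp add: reg_def)
 define c where "c k = s / f (t k)" for k
 have c: "0 < c k" for k using s f0 by (simp add: c_def)
 define E where "E k = sm h {c k<..}" for k
 have E: "projection_op (E k)" "E k \<in> M" for k unfolding E_def by (rule sm_projection[OF cd], simp, rule sm_mem[OF affopD[OF h(2)]])
 define P where "P k = el (E k) (ind (I k))" for k
 let ?R = "%k. el (%x. x) (ind (I k))"
 note Ibm = bm_ind[OF Ib]
 have P: "projection_op (P k)" "P k \<in> N" for k unfolding P_def by (rule el_projection[OF E(1) Ib], rule el_mem[OF E(2) Ibm])
 have orth: "P k (P l x) = 0" if "k ~= l" for k l x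
 proof -
  note b = projD(1)[OF E(1)]
  have "P k (P l x) = el (%\<xi>. E k (E l \<xi>)) (%t. 0) x"
   unfolding P_def using dis that by (intro el_comp[OF b b Ibm Ibm refl]) (auto simp: disjoint_family_on_def indicator_def)
  then show ?thesis by (simp only: el_zero[OF bcl_comp[OF b b]])
 qed
 obtain Q where Q: "projection_op Q" "!!x. (%n. P n x) sums Q x" "!!x. (%n. (norm (P n x))^2) sums (norm (Q x))^2" "!!n x. P n (Q x) = P n x"
  using orth_sums[of P, OF P(1) orth] by blast
 have QN: "Q \<in> N"
 proof (rule A.mem_limit)
  show "(%x. \<Sum>k<n. P k x) \<in> N" for n by (rule A.mem_setsum[OF P(2)])
  show "(%n. \<Sum>k<n. P k x) ---> Q x" for x using Q(2) by (simp add: sums_def)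
 qed (rule projD(1)[OF Q(1)])
 have part: "(%k. (norm (?R k \<zeta>))^2) sums (norm \<zeta>)^2" for \<zeta> by (rule el_partition[OF dis UN Ib])
 \<comment> \<open>When Q \<zeta> = 0, on the k-th piece only the part of h below c_k acts, and f is
   at most exp \<epsilon> f(t_k); the product of these bounds is s exp \<epsilon> for every
   k.\<close>
 have up: "norm \<theta> <= s * exp \<epsilon> * norm \<zeta>" if z: "Q \<zeta> = 0" "(\<zeta>, \<theta>) \<in> tens h f" for \<zeta> \<theta>
 proof -
  have k: "norm (?R k \<theta>) <= s * exp \<epsilon> * norm (?R k \<zeta>)" for k
  proof -
   let ?k = "fc (Rop h) (%t. ind {..c k} (lam t) * lam t)" and ?m = "%t. ind (I k) t * f t"
   note cut = psa_cut[OF h(1) less_imp_le[OF c[of k]]]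
   have mb: "\<bar>?m x\<bar> <= exp \<epsilon> * f (t k)" for x using fI[of x k] f0[of x] f0[of "t k"] by (auto simp: indicator_def)
   have mm: "?m \<in> bmeas" using fm Ib by simp
   note m = bmI[OF mm mb]
   have comm: "(P k \<zeta>, P k \<theta>) \<in> tens h f"
   proof (rule tens_map[OF csub_tens closed_tens projD(1)[OF P(1)] projD(1)[OF P(1)] _ z(2)])
    fix \<xi> \<eta> g assume g: "(\<xi>, \<eta>) \<in> h" "sqi g" "sqi (%t. cr (f t) * g t)"
    have "(E k \<xi>, E k \<eta>) \<in> h" unfolding E_def by (rule pvm_commute[OF h(1) sm_pvm[OF cd] _ _ g(1)]) (use sm_spectral[OF cd] psa_eq_absg[OF h(1)] in auto)
    from tens_gen[OF this sqi_bm[OF Ibm g(2), of k]] sqi_bm[OF Ibm g(3), of k]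
    show "(P k (T \<xi> g), P k (T \<eta> (%t. cr (f t) * g t))) \<in> tens h f"
     unfolding P_def using g by (simp add: el_T projD(1)[OF E(1)] Ibm mult.left_commute)
   qed
   have "P k \<zeta> = 0" using Q(4)[of k \<zeta>] z(1) bcl_0[OF projD(1)[OF P(1)]] by simp
   then have P0: "P k \<theta> = 0"
    using sv_eq[OF cddD(2)[OF A.affopD(1)[OF A]] comm, of 0] graph_0[OF csub_tens] by simp
   have "el ?k ?m \<zeta> = ?R k \<theta> - P k \<theta>"
   proof (rule tens_eq[OF bounded_el[OF cut(2) m] bcl_subtract[OF bounded_el[OF bcl_id(1) Ibm] projD(1)[OF P(1)]] _ z(2)])
    fix \<xi> \<eta> g assume g: "(\<xi>, \<eta>) \<in> h" "sqi g" "sqi (%t. cr (f t) * g t)"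
    have "?k \<xi> = \<eta> - E k \<eta>" using cut(5)[OF g(1)] sm_Compl_atMost[OF h(2), of "c k"] unfolding E_def by (metis add_diff_cancel_left' diff_add_cancel)
    then have "T (?k \<xi>) (%t. cr (ind (I k) t) * (cr (f t) * g t)) = T \<eta> (%t. cr (ind (I k) t) * (cr (f t) * g t)) - T (E k \<eta>) (%t. cr (ind (I k) t) * (cr (f t) * g t))"
     using bcl_diff[OF bcl_T[OF sqi_bm[OF Ibm g(3)]]] by simp
    then show "el ?k ?m (T \<xi> g) = ?R k (T \<eta> (%t. cr (f t) * g t)) - P k (T \<eta> (%t. cr (f t) * g t))"
     unfolding P_def el_T[OF cut(2) m g(2)] el_T[OF bcl_id(1) Ibm g(3)] el_T[OF projD(1)[OF E(1)] Ibm g(3)]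
     by (simp add: mult.assoc)
   qed
   then have "?R k \<theta> = el ?k ?m (?R k \<zeta>)"
    unfolding P0 using el_comp[OF cut(2) bcl_id(1) m Ibm refl, of k ?m \<zeta>] by (simp add: indicator_def)
   also have "norm ... <= c k * (exp \<epsilon> * f (t k)) * norm (?R k \<zeta>)"
    by (rule el_norm[OF cut(2) cut(6) less_imp_le[OF c] mm mb])
   also have "c k * (exp \<epsilon> * f (t k)) = s * exp \<epsilon>" using f0[of "t k"] by (simp add: c_def)
   finally show ?thesis .
  qed
  have "(norm \<theta>)^2 <= (s * exp \<epsilon>)^2 * (norm \<zeta>)^2"
  proof (rule sums_le[OF _ part[of \<theta>] sums_mult[OF part[of \<zeta>]]])
   show "(norm (?R k \<theta>))^2 <= (s * exp \<epsilon>)^2 * (norm (?R k \<zeta>))^2" for k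
    using power_mono[OF k[of k], of 2] by (simp add: power_mult_distrib)
  qed
  then have "(norm \<theta>)^2 <= (s * exp \<epsilon> * norm \<zeta>)^2" by (simp only: power_mult_distrib)
  then show ?thesis by (rule power2_le_imp_le) (use s in simp)
 qed
 \<comment> \<open>On the k-th piece h is inverted above c_k and f is inverted with 1/f \<le>
   1/f(t_k); the combined inverse has norm at most 1/s for every k.\<close>
 have low: "s * norm \<zeta> <= norm \<theta>" if z: "Q \<zeta> = \<zeta>" "(\<zeta>, \<theta>) \<in> tens h f" for \<zeta> \<theta>
 proof -
  have k: "norm (P k \<zeta>) <= 1 / s * norm (?R k \<theta>)" for k
  proof -
   obtain l where l: "bcl l" "!!x. norm (l x) <= 1 / c k * norm x" "!!x y. (x, y) \<in> h ==> l y = E k x"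
    using psa_inverse_cut[OF h(1) c[of k]] unfolding E_def by blast
   let ?m = "%t. ind (I k) t / f t"
   have mb: "\<bar>?m x\<bar> <= 1 / f (t k)" for x using fI(1)[of x k] f0[of x] f0[of "t k"] by (auto simp: indicator_def intro!: divide_left_mono)
   have mm: "?m \<in> bmeas" using fm Ib by simp
   note m = bmI[OF mm mb]
   have "P k \<zeta> = el l ?m \<theta>"
   proof (rule tens_eq[OF projD(1)[OF P(1)] bounded_el[OF l(1) m] _ z(2)])
    fix \<xi> \<eta> g assume g: "(\<xi>, \<eta>) \<in> h" "sqi g" "sqi (%t. cr (f t) * g t)"
    have "f t ~= 0" for t using f0[of t] by simp
    then have "(%t. cr (?m t) * (cr (f t) * g t)) = (%t. cr (ind (I k) t) * g t)" by auto
    then show "P k (T \<xi> g) = el l ?m (T \<eta> (%t. cr (f t) * g t))"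
     unfolding P_def el_T[OF l(1) m g(3)] el_T[OF projD(1)[OF E(1)] Ibm g(2)] l(3)[OF g(1)] by simp
   qed
   also have "... = el l ?m (?R k \<theta>)"
    using el_comp[OF l(1) bcl_id(1) m Ibm refl, of k ?m \<theta>] by (simp add: indicator_def)
   also have "norm ... <= 1 / c k * (1 / f (t k)) * norm (?R k \<theta>)"
    by (rule el_norm[OF l(1,2) _ mm mb]) (use c[of k] in simp)
   also have "1 / c k * (1 / f (t k)) = 1 / s" using f0[of "t k"] by (simp add: c_def)
   finally show ?thesis .
  qed
  have "(norm \<zeta>)^2 <= (1 / s)^2 * (norm \<theta>)^2"
  proof (rule sums_le[OF _ _ sums_mult[OF part[of \<theta>]]])
   show "(%n. (norm (P n \<zeta>))^2) sums (norm \<zeta>)^2" using Q(3)[of \<zeta>] z(1) by simp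
   show "(norm (P k \<zeta>))^2 <= (1 / s)^2 * (norm (?R k \<theta>))^2" for k
    using power_mono[OF k[of k], of 2] by (simp add: power_mult_distrib power_divide)
  qed
  then have "(norm \<zeta>)^2 <= (1 / s * norm \<theta>)^2" by (simp only: power_mult_distrib)
  then have "norm \<zeta> <= 1 / s * norm \<theta>" by (rule power2_le_imp_le) (use s in simp)
  then show ?thesis using s by (simp add: field_simps)
 qed
 have "A.distf (tens h f) (s * exp \<epsilon>) <= \<tau>A (%v. v - (v - Q v))"
  by (rule A.dist_le_domain[OF A A.mem_compl[OF QN] proj_compl[OF Q(1)]]) (use s up in auto)
 moreover have "\<tau>A Q <= A.distf (tens h f) r" if "0 <= r" "r < s" for r
  by (rule A.dist_ge[OF A QN Q(1) that low])
 \<comment> \<open>The trace of Q is the exact integral for the step function c_k; it lies between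
   the values of \<open>gdist\<close> at s exp \<epsilon> and at s.\<close>
 moreover have tQ: "\<tau>A Q = (\<integral>\<^sup>+x. (\<Sum>k. distf h (c k) * ind (I k) x) * ennreal (exp (- x)) \<partial>lborel)"
 proof -
  have "\<tau>A Q = (\<Sum>k. \<tau>A (P k))" by (rule A.tr_sums[OF P(2,1) orth QN Q(1,2)])
  also have "... = (\<Sum>k. \<integral>\<^sup>+x. distf h (c k) * ind (I k) x * ennreal (exp (- x)) \<partial>lborel)"
  proof (rule suminf_cong)
   fix k
   have "is_elementary T (E k) (%t. cr (ind (I k) t)) (P k)" unfolding P_def by (rule elementary_el[OF projD(1)[OF E(1)] Ibm])
   moreover have "ess_bounded (%t. cr (ind (I k) t))" using Ib unfolding ess_bounded_def by (auto intro!: exI[of _ 1] simp: indicator_def)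
   ultimately have "\<tau>A (P k) = \<tau> (E k) * (\<integral>\<^sup>+ t. ennreal (ind (I k) t * exp (- t)) \<partial>lborel)"
    using ctr[OF proj_pos[OF E(2,1)], of "ind (I k)" k "P k"] by simp
   also have "... = (\<integral>\<^sup>+x. distf h (c k) * ennreal (ind (I k) x * exp (- x)) \<partial>lborel)"
    using Ib by (subst nn_integral_cmult) (auto simp: distf_def E_def)
   also have "... = (\<integral>\<^sup>+x. distf h (c k) * ind (I k) x * ennreal (exp (- x)) \<partial>lborel)"
    by (intro nn_integral_cong) (auto simp: indicator_def)
   finally show "\<tau>A (P k) = ..." .
  qed
  also have "... = (\<integral>\<^sup>+x. (\<Sum>k. distf h (c k) * ind (I k) x * ennreal (exp (- x))) \<partial>lborel)"
   using Ib by (intro nn_integral_suminf[symmetric]) auto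
  finally show ?thesis by simp
 qed
 have val: "(\<Sum>k. distf h (c k) * ind (I k) x) = distf h (c k)" if "x \<in> I k" for x k
  by (rule suminf_cmult_indicator[OF dis that])
 have "\<tau>A Q <= gdist h f s" unfolding tQ gdist_def
 proof (intro nn_integral_mono mult_right_mono)
  fix x
  obtain k where k: "x \<in> I k" using UN by blast
  have "s / f x <= c k" unfolding c_def using fI(1)[OF k] f0 s by (intro divide_left_mono) (auto intro!: mult_pos_pos)
  then show "(\<Sum>k. distf h (c k) * ind (I k) x) <= distf h (s / f x)" unfolding val[OF k] by (rule dist_antimono[OF h(2)])
 qed simp
 moreover have "gdist h f (s * exp \<epsilon>) <= \<tau>A Q" unfolding tQ gdist_def
 proof (intro nn_integral_mono mult_right_mono)
  fix x
  obtain k where k: "x \<in> I k" using UN by blast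
  have "c k <= s * exp \<epsilon> / f x" unfolding c_def using fI(2)[OF k] f0[of x] f0[of "t k"] s by (simp add: field_simps)
  then show "distf h (s * exp \<epsilon> / f x) <= (\<Sum>k. distf h (c k) * ind (I k) x)" unfolding val[OF k] by (rule dist_antimono[OF h(2)])
 qed simp
 ultimately show ?thesis by (intro exI[of _ "\<tau>A Q"]) auto
qed

lemma gdist_absg: "affop a ==> gdist (absg a) f s = gdist a f s"
 by (simp add: gdist_def dist_op_abs)

text \<open>Takes \<epsilon> = ln(s'/s) in \<open>dist_tens_step\<close>. For the second inequality
  the step is started at the midpoint of s and s', leaving s strictly below it as the lower
  comparison requires.\<close>

lemma dist_tens:
 assumes a: "affop a" and f: "adm f" and s: "0 < s" "s < s'"
 shows "A.distf (tens a f) s' <= gdist a f s" "gdist a f s' <= A.distf (tens a f) s"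
proof -
 note h = psa_absg[OF affopD(1)[OF a]] affop_absg[OF a]
 have "0 < ln (s' / s)" "s * exp (ln (s' / s)) = s'" using s by simp_all
 then show "A.distf (tens a f) s' <= gdist a f s"
  using dist_tens_step[OF h f s(1), of "ln (s' / s)"] unfolding dist_tens_absg[OF a adm_reg[OF f]] gdist_absg[OF a] by auto
 let ?r = "(s + s') / 2"
 have "0 < ?r" "s < ?r" "0 < ln (s' / ?r)" "?r * exp (ln (s' / ?r)) = s'" using s by (simp_all add: field_simps)
 then show "gdist a f s' <= A.distf (tens a f) s"
  using dist_tens_step[OF h f \<open>0 < ?r\<close>, of "ln (s' / ?r)"] s unfolding dist_tens_absg[OF a adm_reg[OF f]] gdist_absg[OF a]
  by (auto intro: order_trans)
qed

end

section \<open>Inverses of Orlicz functions\<close>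

text \<open>Star-shapedness is the part of convexity retained here: it carries the calculus of right
  inverses, and \<open>conj_sl\<close> passes it on to the conjugate and the double
  conjugate.\<close>

definition sl :: "(real => ennreal) => bool" where
 "sl \<Phi> \<longleftrightarrow> \<Phi> 0 = 0 \<and> (\<forall>r x. 0 <= r \<and> r <= 1 \<and> 0 <= x --> \<Phi> (r * x) <= ennreal r * \<Phi> x) \<and>
   (\<exists>u>0. \<Phi> u < \<infinity>) \<and> (\<forall>t. \<exists>u>0. ennreal t < \<Phi> u)"

lemma orlicz_sl: assumes o: "orlicz_function \<psi>" shows "sl \<psi>"
 unfolding sl_def
proof (intro conjI allI impI)
 fix r x :: real assume "0 <= r \<and> r <= 1 \<and> 0 <= x"
 then have "\<psi> ((1 - r) * 0 + r * x) <= ennreal (1 - r) * \<psi> 0 + ennreal r * \<psi> x" using o unfolding orlicz_function_def by auto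
 then show "\<psi> (r * x) <= ennreal r * \<psi> x" using o by (simp add: orlicz_function_def)
next
 fix t
 have "(\<psi> \<longlongrightarrow> \<infinity>) at_top" using o by (simp add: orlicz_function_def)
 then have "\<forall>\<^sub>F u in at_top. ennreal t < \<psi> u" by (rule order_tendstoD) simp
 then obtain K where "!!u. u \<ge> K ==> ennreal t < \<psi> u" unfolding eventually_at_top_linorder by blast
 then show "\<exists>u>0. ennreal t < \<psi> u" by (intro exI[of _ "max 1 K"]) auto
qed (use o in \<open>auto simp: orlicz_function_def less_top\<close>)

context
 fixes \<Phi> :: "real => ennreal"
 assumes sl: "sl \<Phi>"
begin

lemma sl_scale: "0 <= r ==> r <= 1 ==> 0 <= x ==> \<Phi> (r * x) <= ennreal r * \<Phi> x"
 using sl unfolding sl_def by blast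

lemma sl_mono: assumes "0 <= x" "x <= y" shows "\<Phi> x <= \<Phi> y"
proof (cases "y = 0")
 case False
 then have "\<Phi> (x / y * y) <= ennreal (x / y) * \<Phi> y" using assms by (intro sl_scale) auto
 also have "... <= 1 * \<Phi> y" using assms False by (intro mult_right_mono) auto
 finally show ?thesis using False by simp
qed (use assms in simp)

lemma inv_bdd: "bdd_above {s. 0 <= s \<and> \<Phi> s <= ennreal t}"
proof -
 obtain u where u: "0 < u" "ennreal t < \<Phi> u" using sl unfolding sl_def by blast
 have "s <= u" if "0 <= s" "\<Phi> s <= ennreal t" for s
  using sl_mono[of u s] u that by (meson less_imp_le linear not_less order_trans)
 then show ?thesis by (intro bdd_aboveI) auto
qed

lemma inv_ge: "0 <= s ==> \<Phi> s <= ennreal t ==> s <= orlicz_inv \<Phi> t"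
 unfolding orlicz_inv_def by (rule cSup_upper[OF _ inv_bdd]) simp

lemma inv_gt: "0 <= s ==> orlicz_inv \<Phi> t < s ==> ennreal t < \<Phi> s"
 using inv_ge[of s t] by (cases "\<Phi> s <= ennreal t") auto

lemma inv_le: assumes "!!s. 0 <= s ==> \<Phi> s <= ennreal t ==> s <= c" shows "orlicz_inv \<Phi> t <= c"
proof -
 have "\<Phi> 0 <= ennreal t" using sl by (simp add: sl_def)
 then show ?thesis unfolding orlicz_inv_def using assms by (intro cSup_least) auto
qed

lemma inv_lt: assumes "0 <= s" "s < orlicz_inv \<Phi> t" shows "\<Phi> s <= ennreal t"
proof (rule ccontr)
 assume n: "\<not> \<Phi> s <= ennreal t"
 have "orlicz_inv \<Phi> t <= s"
 proof (rule inv_le)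
  show "x <= s" if "0 <= x" "\<Phi> x <= ennreal t" for x
   using sl_mono[OF assms(1), of x] n that order_trans by (meson linear)
 qed
 then show False using assms by simp
qed

lemma inv_mono: "t <= t' ==> orlicz_inv \<Phi> t <= orlicz_inv \<Phi> t'"
 by (intro inv_le inv_ge) (auto intro: order_trans ennreal_leI)

lemma inv_pos: assumes t: "0 < t" shows "0 < orlicz_inv \<Phi> t"
proof -
 obtain u where u: "0 < u" "\<Phi> u < \<infinity>" using sl unfolding sl_def by blast
 then obtain p where p: "\<Phi> u = ennreal p" "0 <= p" by (cases "\<Phi> u") auto
 \<comment> \<open>Shrinks u until star-shapedness forces the value at r u below t; the summand 1
   covers p = 0.\<close>
 define r where "r = min 1 (t / (1 + p))"
 have r: "0 < r" "r <= 1" "r * p <= t"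
 proof -
  show "0 < r" "r <= 1" using t p by (auto simp: r_def)
  have "r * p <= t / (1 + p) * (1 + p)" using t p by (intro mult_mono) (auto simp: r_def)
  then show "r * p <= t" using p by simp
 qed
 have "\<Phi> (r * u) <= ennreal r * \<Phi> u" using r u by (intro sl_scale) auto
 also have "... <= ennreal t" using r p ennreal_leI[OF r(3)] by (simp add: ennreal_mult[symmetric])
 finally have "r * u <= orlicz_inv \<Phi> t" using r u by (intro inv_ge) auto
 then show ?thesis using r u by (meson less_le_trans mult_pos_pos)
qed

lemma inv_scale: assumes "0 < r" "r <= 1" "0 <= t" shows "r * orlicz_inv \<Phi> t <= orlicz_inv \<Phi> (r * t)"
proof -
 have "orlicz_inv \<Phi> t <= orlicz_inv \<Phi> (r * t) / r"
 proof (rule inv_le)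
  fix s assume s: "0 <= s" "\<Phi> s <= ennreal t"
  have "\<Phi> (r * s) <= ennreal r * ennreal t" using sl_scale[of r s] s assms by (meson less_imp_le mult_left_mono order_trans zero_le)
  then have "r * s <= orlicz_inv \<Phi> (r * t)" using s assms by (intro inv_ge) (auto simp: ennreal_mult)
  then show "s <= orlicz_inv \<Phi> (r * t) / r" using assms by (simp add: field_simps)
 qed
 then show ?thesis using assms by (simp add: field_simps)
qed

lemma fund_lux_exp: "fund_lux \<Phi> (exp t) = 1 / orlicz_inv \<Phi> (exp (- t))"
 by (simp add: fund_lux_def exp_minus inverse_eq_divide)

lemma adm_fund_lux: "adm (%t. fund_lux \<Phi> (exp t))"
 unfolding adm_def fund_lux_exp
proof (intro conjI allI impI monoI)
 have p: "0 < orlicz_inv \<Phi> (exp (- t))" for t by (rule inv_pos) simp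
 then show "0 < 1 / orlicz_inv \<Phi> (exp (- t))" for t by simp
 fix t t' :: real assume t: "t <= t'"
 have "orlicz_inv \<Phi> (exp (- t')) <= orlicz_inv \<Phi> (exp (- t))" using t by (intro inv_mono) simp
 then show "1 / orlicz_inv \<Phi> (exp (- t)) <= 1 / orlicz_inv \<Phi> (exp (- t'))" using p by (intro divide_left_mono) auto
 have "exp (t - t') * orlicz_inv \<Phi> (exp (- t)) <= orlicz_inv \<Phi> (exp (t - t') * exp (- t))" using t by (intro inv_scale) auto
 also have "exp (t - t') * exp (- t) = exp (- t')" by (simp add: exp_add[symmetric])
 finally have "orlicz_inv \<Phi> (exp (- t)) <= exp (t' - t) * orlicz_inv \<Phi> (exp (- t'))"
  by (simp add: exp_diff field_simps)
 then show "1 / orlicz_inv \<Phi> (exp (- t')) <= exp (t' - t) * (1 / orlicz_inv \<Phi> (exp (- t)))"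
  using p[of t] p[of t'] by (simp add: field_simps)
qed

section \<open>Conjugates and Young inequalities\<close>

lemma conj_le_iff: "orlicz_conj \<Phi> w <= ennreal t \<longleftrightarrow> (\<forall>v>0. ennreal (w * v) <= \<Phi> v + ennreal t)"
 unfolding orlicz_conj_def SUP_le_iff by (auto simp: ennreal_minus_le_iff)

lemma young_ineq: assumes "0 < v" "0 <= c" "orlicz_conj \<Phi> w <= ennreal c" "\<Phi> v <= ennreal d" "0 <= d" shows "w * v <= c + d"
proof -
 have "ennreal (w * v) <= ennreal d + ennreal c" using assms conj_le_iff[of w c] add_right_mono order_trans by blast
 then show ?thesis using assms by (simp add: ennreal_plus[symmetric] del: ennreal_plus)
qed

text \<open>With J the inverse at t, star-shapedness puts the function above the line of slope t/J
  through 0 once v > J, and for v \<le> J the line itself is at most t.\<close>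

lemma conj_at_inv: assumes t: "0 < t" shows "orlicz_conj \<Phi> (t / orlicz_inv \<Phi> t) <= ennreal t"
 unfolding conj_le_iff
proof (intro allI impI)
 let ?J = "orlicz_inv \<Phi> t"
 note J = inv_pos[OF t]
 fix v :: real assume v: "0 < v"
 show "ennreal (t / ?J * v) <= \<Phi> v + ennreal t"
 proof (cases "\<Phi> v")
  case (real p)
  have "t / ?J * v <= p + t"
  proof (cases "v <= ?J")
   case True
   then have "t * v <= t * ?J" using t by (intro mult_left_mono) auto
   then have "t / ?J * v <= t" using J by (simp add: field_simps)
   then show ?thesis using real by simp
  next
   case False
   have "t * v / p <= ?J" if "t < p"
   proof (rule ccontr)
    assume n: "\<not> t * v / p <= ?J"
    have "\<Phi> (t / p * v) <= ennreal (t / p) * \<Phi> v" using t that v by (intro sl_scale) auto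
    also have "... = ennreal t" using real that t by (simp add: ennreal_mult[symmetric])
    finally show False using inv_ge[of "t / p * v" t] n t that v by simp
   qed
   moreover have "t < p" using inv_gt[of v t] False v real t by (simp add: ennreal_less_iff)
   ultimately have "t * v <= ?J * p" using t by (simp add: field_simps)
   then have "t / ?J * v <= p" using J by (simp add: field_simps)
   then show ?thesis using t by simp
  qed
  then show ?thesis using real t by (simp add: ennreal_plus[symmetric] del: ennreal_plus)
 qed simp
qed

lemma conj_sl: "sl (orlicz_conj \<Phi>)"
 unfolding sl_def
proof (intro conjI allI impI)
 show "orlicz_conj \<Phi> 0 = 0" by (simp add: orlicz_conj_def)
 show "orlicz_conj \<Phi> (r * x) <= ennreal r * orlicz_conj \<Phi> x" if r: "0 <= r \<and> r <= 1 \<and> 0 <= x" for r x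
 proof (cases "orlicz_conj \<Phi> x")
  case (real c)
  have "orlicz_conj \<Phi> (r * x) <= ennreal (r * c)" unfolding conj_le_iff
  proof (intro allI impI)
   fix v :: real assume v: "0 < v"
   show "ennreal (r * x * v) <= \<Phi> v + ennreal (r * c)"
   proof (cases "\<Phi> v")
    case (real p)
    have "x * v <= c + p" using young_ineq[OF v, of c x p] \<open>orlicz_conj \<Phi> x = ennreal c\<close> \<open>0 <= c\<close> real by simp
    then have "r * (x * v) <= r * c + r * p" using r by (metis distrib_left mult_left_mono)
    also have "r * p <= p" using r real mult_right_mono[of r 1 p] by simp
    finally show ?thesis using r real \<open>0 <= c\<close> by (simp add: ennreal_plus[symmetric] mult.assoc add.commute del: ennreal_plus)
   qed simp
  qed
  then show ?thesis using r real by (simp add: ennreal_mult)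
 next
  case top
  then show ?thesis using r by (cases "r = 0") (simp add: orlicz_conj_def, simp add: ennreal_mult_top)
 qed
 have "orlicz_conj \<Phi> (1 / orlicz_inv \<Phi> 1) < \<infinity>" using conj_at_inv[of 1] by (metis ennreal_less_top infinity_ennreal_def le_less_trans zero_less_one)
 then show "\<exists>u>0. orlicz_conj \<Phi> u < \<infinity>" using inv_pos[of 1] by (intro exI[of _ "1 / orlicz_inv \<Phi> 1"]) simp
 fix t
 obtain y where y: "0 < y" "\<Phi> y < \<infinity>" using sl unfolding sl_def by blast
 then obtain p where p: "\<Phi> y = ennreal p" "0 <= p" by (cases "\<Phi> y") auto
 \<comment> \<open>A slope for which the single point y, where the function is finite, already
   contributes \<open>max 0 t\<close> + 1 to the supremum defining the conjugate.\<close>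
 define u where "u = (p + max 0 t + 1) / y"
 have "0 < p + max 0 t + 1" using p(2) by linarith
 then have "0 < u" "u * y = p + max 0 t + 1" using y(1) by (simp_all only: u_def divide_pos_pos) simp
 moreover have "ennreal t < orlicz_conj \<Phi> u"
 proof (rule ccontr)
  assume "\<not> ennreal t < orlicz_conj \<Phi> u"
  then have "orlicz_conj \<Phi> u <= ennreal (max 0 t)" by (simp add: not_less ennreal_max_0)
  then have "u * y <= max 0 t + p" using young_ineq[OF y(1) _ _ _ p(2)] p(1) by simp
  then show False using \<open>u * y = p + max 0 t + 1\<close> by simp
 qed
 ultimately show "\<exists>u>0. ennreal t < orlicz_conj \<Phi> u" by blast
qed

end

text \<open>A conjugate is a supremum of affine functions, hence lower semicontinuous, so the
  supremum defining its inverse is attained. This makes \<open>conj_gt_iff\<close> an exact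
  equivalence, which equality of norms requires.\<close>

lemma conj_le_inv: assumes sl: "sl \<Phi>" and t: "0 <= t" shows "orlicz_conj \<Phi> (orlicz_inv (orlicz_conj \<Phi>) t) <= ennreal t"
 unfolding conj_le_iff[OF sl]
proof (intro allI impI)
 let ?J = "orlicz_inv (orlicz_conj \<Phi>) t"
 fix v :: real assume v: "0 < v"
 show "ennreal (?J * v) <= \<Phi> v + ennreal t"
 proof (cases "\<Phi> v")
  case (real p)
  have "?J <= (t + p) / v"
  proof (rule ccontr)
   assume "\<not> ?J <= (t + p) / v"
   moreover define w where "w = ((t + p) / v + ?J) / 2"
   ultimately have w: "(t + p) / v < w" "w < ?J" by auto
   have "0 <= (t + p) / v" using t real v by simp
   then have "orlicz_conj \<Phi> w <= ennreal t" using w by (intro inv_lt[OF conj_sl[OF sl]]) auto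
   then have "w * v <= t + p" using young_ineq[OF sl v t _ _ real(1)] real by simp
   then show False using w v by (simp add: field_simps)
  qed
  then have "?J * v <= p + t" using v by (simp add: field_simps)
  then show ?thesis using real t by (simp add: ennreal_plus[symmetric] del: ennreal_plus)
 qed simp
qed

lemma conj_gt_iff: "sl \<Phi> ==> 0 <= t ==> 0 <= s ==> ennreal t < orlicz_conj \<Phi> s \<longleftrightarrow> orlicz_inv (orlicz_conj \<Phi>) t < s"
 using inv_gt[OF conj_sl] conj_le_inv[of \<Phi> t] sl_mono[OF conj_sl, of \<Phi> s "orlicz_inv (orlicz_conj \<Phi>) t"]
 by (meson leD not_le order_trans)

text \<open>The lower bound is the slope t/J of \<open>conj_at_inv\<close>; the upper one is Young's
  inequality with both function values at most t. It is the source of the factor 2 between the two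
  fundamental functions.\<close>

lemma inv_young:
 assumes sl: "sl \<Phi>" and t: "0 < t"
 shows "t <= orlicz_inv \<Phi> t * orlicz_inv (orlicz_conj \<Phi>) t" "orlicz_inv \<Phi> t * orlicz_inv (orlicz_conj \<Phi>) t <= 2 * t"
proof -
 let ?J = "orlicz_inv \<Phi> t" and ?K = "orlicz_inv (orlicz_conj \<Phi>) t"
 note J = inv_pos[OF sl t] and K = inv_pos[OF conj_sl[OF sl] t]
 have "t / ?J <= ?K" using t J conj_at_inv[OF sl t] by (intro inv_ge[OF conj_sl[OF sl]]) auto
 then show "t <= ?J * ?K" using J by (simp add: field_simps)
 have "?J <= 2 * t / ?K"
 proof (rule inv_le[OF sl])
  fix s assume s: "0 <= s" "\<Phi> s <= ennreal t"
  have "?K * s <= t + t" if "0 < s" using young_ineq[OF sl that _ conj_le_inv[OF sl] s(2), of t] t by simp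
  then show "s <= 2 * t / ?K" using K s t by (cases "s = 0") (auto simp: field_simps)
 qed
 then show "?J * ?K <= 2 * t" using K by (simp add: field_simps)
qed

text \<open>The line through \<open>(s\<^sub>0, t')\<close> with the smallest possible slope \<open>v\<close> lies below \<open>\<psi>\<close>.\<close>

lemma conj_conj_gt:
 assumes o: "orlicz_function \<psi>" and t: "0 < t" and s: "orlicz_inv \<psi> t < s"
 shows "ennreal t < orlicz_conj (orlicz_conj \<psi>) s"
proof -
 note sl = orlicz_sl[OF o]
 let ?J = "orlicz_inv \<psi> t"
 have J: "0 < ?J" by (rule inv_pos[OF sl t])
 \<comment> \<open>The two alternatives are what later bounds the slopes q: either a finite value to
   the right of the base point dominates them by convexity, or the function is infinite from some b
   before the base point, which keeps the denominators away from 0.\<close>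
 have "\<exists>s0. ?J < s0 \<and> s0 < s \<and> ((\<exists>z>s0. \<psi> z < \<infinity>) \<or> (\<exists>b<s0. \<forall>x>b. \<psi> x = \<infinity>))"
 proof (cases "\<exists>z>?J. \<psi> z < \<infinity>")
  case True
  then obtain z where "?J < z" "\<psi> z < \<infinity>" by blast
  then show ?thesis using s by (intro exI[of _ "(?J + min s z) / 2"] conjI disjI1 exI[of _ z]) auto
 next
  case False
  then have "\<forall>x>?J. \<psi> x = \<infinity>" by (auto simp: less_top[symmetric])
  then show ?thesis using s by (intro exI[of _ "(?J + s) / 2"] conjI disjI2 exI[of _ ?J]) auto
 qed
 then obtain s0 where s0: "?J < s0" "s0 < s" "(\<exists>z>s0. \<psi> z < \<infinity>) \<or> (\<exists>b<s0. \<forall>x>b. \<psi> x = \<infinity>)" by blast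
 have "ennreal t < \<psi> s0" using inv_gt[OF sl] s0 J by auto
 \<comment> \<open>The height of the pivot of the supporting line: below the graph at s0, so that a
   line can pass under it, yet above t, so that the final inequality is strict.\<close>
 then obtain y where y: "ennreal t < y" "y < \<psi> s0" using dense by blast
 then obtain t' where t': "y = ennreal t'" "0 <= t'" by (cases y) auto
 have tt': "t < t'" using y t t' by (simp add: ennreal_less_iff)
 define X where "X = {x. 0 <= x \<and> x < s0 \<and> \<psi> x < \<infinity>}"
 define p where "p x = enn2real (\<psi> x)" for x
 define q where "q x = (t' - p x) / (s0 - x)" for x
 have p: "\<psi> x = ennreal (p x)" "0 <= p x" if "\<psi> x < \<infinity>" for x using that by (simp_all add: p_def less_top)
 have key: "q x <= (p z - t') / (z - s0)" if x: "x \<in> X" and z: "s0 < z" "\<psi> z < \<infinity>" for x z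
 proof -
  have xs: "0 <= x" "x < s0" "\<psi> x < \<infinity>" using x by (auto simp: X_def)
  define r where "r = (s0 - x) / (z - x)"
  have r: "0 <= r" "r <= 1" "r * (z - x) = s0 - x" using xs z by (auto simp: r_def)
  have "(1 - r) * x + r * z = s0" using r(3) by (simp add: algebra_simps)
  then have "\<psi> s0 <= ennreal (1 - r) * \<psi> x + ennreal r * \<psi> z"
   using o r xs z unfolding orlicz_function_def by (metis atLeastAtMost_iff less_imp_le order_trans)
  also have "... = ennreal ((1 - r) * p x + r * p z)" using r p[OF xs(3)] p[OF z(2)] by (simp add: ennreal_mult)
  finally have "t' <= (1 - r) * p x + r * p z" using y t' by (metis (no_types) ennreal_less_iff leI less_le_trans order_less_asym)
  then have "t' - p x <= r * (p z - p x)" by (simp add: algebra_simps)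
  then have "(t' - p x) * (z - x) <= r * (z - x) * (p z - p x)" using xs z mult_right_mono[of _ _ "z - x"] by (simp add: mult_ac)
  then have "(t' - p x) * (z - s0) <= (p z - t') * (s0 - x)" unfolding r(3) by (simp add: algebra_simps)
  then show ?thesis using xs z by (simp add: q_def field_simps)
 qed
 have bdd: "bdd_above (q ` X)" using s0(3)
 proof (elim disjE exE conjE)
  fix z assume "z > s0" "\<psi> z < \<infinity>"
  then show ?thesis using key by (intro bdd_aboveI2) blast
 next
  fix b assume b: "b < s0" "\<forall>x>b. \<psi> x = \<infinity>"
  have "q x <= t' / (s0 - b)" if "x \<in> X" for x
  proof -
   have "x <= b" "0 <= p x" "x < s0" using that b p[of x] unfolding X_def by (auto simp: not_less[symmetric])
   then show ?thesis unfolding q_def using t' b by (intro frac_le) auto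
  qed
  then show ?thesis by (rule bdd_aboveI2)
 qed
 define v where "v = (SUP x\<in>X. q x)"
 have p0: "\<psi> 0 = 0" using o by (simp add: orlicz_function_def)
 then have X0: "0 \<in> X" "q 0 = t' / s0" using s0 J by (auto simp: X_def q_def p_def)
 have qv: "q x <= v" if "x \<in> X" for x unfolding v_def by (rule cSUP_upper[OF that bdd])
 have v: "t' / s0 <= v" using qv[OF X0(1)] X0(2) by simp
 moreover have "0 < t' / s0" using tt' t s0 J by simp
 ultimately have v0: "0 < v" "t' <= v * s0" using s0 J by (linarith, simp add: field_simps)
 have "orlicz_conj \<psi> v <= ennreal (v * s0 - t')" unfolding conj_le_iff[OF sl]
 proof (intro allI impI)
  fix x :: real assume x: "0 < x"
  show "ennreal (v * x) <= \<psi> x + ennreal (v * s0 - t')"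
  proof (cases "\<psi> x < \<infinity>")
   case True
   consider "x < s0" | "x = s0" | "s0 < x" by linarith
   then have "v * x <= p x + (v * s0 - t')"
   proof cases
    case 1
    then have "(t' - p x) / (s0 - x) <= v" using qv[of x] x True by (simp add: X_def q_def)
    then have "t' - p x <= v * (s0 - x)" using 1 by (simp add: pos_divide_le_eq)
    then show ?thesis by (simp add: algebra_simps)
   next
    case 2
    then show ?thesis using y t' p[OF True] by (simp add: ennreal_less_iff)
   next
    case 3
    have "v <= (p x - t') / (x - s0)" unfolding v_def using X0(1) key[OF _ 3 True] by (intro cSUP_least) auto
    then have "v * (x - s0) <= p x - t'" using 3 by (simp add: pos_le_divide_eq)
    then show ?thesis by (simp add: algebra_simps)
   qed
   then show ?thesis using p[OF True] v0 by (simp add: ennreal_plus[symmetric] del: ennreal_plus)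
  qed (simp add: less_top[symmetric])
 qed
 then have "ennreal (s * v) - ennreal (v * s0 - t') <= ennreal (s * v) - orlicz_conj \<psi> v" by (rule ennreal_minus_mono[OF order_refl])
 also have "... <= orlicz_conj (orlicz_conj \<psi>) s" unfolding orlicz_conj_def[of _ s] by (rule SUP_upper) (use v0 in simp)
 finally have "ennreal (s * v - (v * s0 - t')) <= orlicz_conj (orlicz_conj \<psi>) s" using v0 by (simp add: ennreal_minus)
 moreover have "t < s * v - (v * s0 - t')" using tt' mult_strict_right_mono[OF s0(2) v0(1)] by (simp add: algebra_simps)
 ultimately show ?thesis using t by (meson ennreal_lessI less_le_trans less_trans)
qed

text \<open>The fundamental functions see the double conjugate only through its inverse at positive
  arguments, so the biconjugate theorem is stated at that level. One inequality is Young's, the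
  other is \<open>conj_conj_gt\<close>.\<close>

lemma inv_conj_conj:
 assumes o: "orlicz_function \<psi>" and t: "0 < t" shows "orlicz_inv (orlicz_conj (orlicz_conj \<psi>)) t = orlicz_inv \<psi> t"
proof (rule antisym)
 note sl = orlicz_sl[OF o]
 note sl2 = conj_sl[OF conj_sl[OF sl]]
 show "orlicz_inv (orlicz_conj (orlicz_conj \<psi>)) t <= orlicz_inv \<psi> t"
  using conj_conj_gt[OF o t] by (intro inv_le[OF sl2]) (meson leD not_le)
 show "orlicz_inv \<psi> t <= orlicz_inv (orlicz_conj (orlicz_conj \<psi>)) t"
 proof (rule inv_le[OF sl])
  fix s assume s: "0 <= s" "\<psi> s <= ennreal t"
  have "orlicz_conj (orlicz_conj \<psi>) s <= ennreal t" unfolding conj_le_iff[OF conj_sl[OF sl]]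
  proof (intro allI impI)
   fix w :: real assume w: "0 < w"
   show "ennreal (s * w) <= orlicz_conj \<psi> w + ennreal t"
   proof (cases "orlicz_conj \<psi> w")
    case (real c)
    then have "s * w <= c + t" using young_ineq[OF sl, of s c w t] s t by (cases "s = 0") (auto simp: mult.commute)
    then show ?thesis using real t by (simp add: ennreal_plus[symmetric] del: ennreal_plus)
   qed simp
  qed
  then show "s <= orlicz_inv (orlicz_conj (orlicz_conj \<psi>)) t" by (rule inv_ge[OF sl2 s(1)])
 qed
qed

text \<open>Dividing exp t by an admissible function exchanges the two conditions: monotonicity of
  one is the growth bound of the other.\<close>

lemma adm_fund_orl: assumes sl: "sl \<Phi>" shows "adm (%t. fund_orl \<Phi> (exp t))"
proof -
 let ?f = "%t. fund_lux (orlicz_conj \<Phi>) (exp t)"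
 have f: "0 < ?f t" "t <= t' ==> ?f t <= ?f t'" "t <= t' ==> ?f t' <= exp (t' - t) * ?f t" for t t'
  using adm_fund_lux[OF conj_sl[OF sl]] unfolding adm_def mono_def by auto
 have e: "fund_orl \<Phi> (exp t) = exp t / ?f t" for t by (simp add: fund_orl_def)
 show ?thesis unfolding adm_def e
 proof (intro conjI allI impI monoI)
  show "0 < exp t / ?f t" for t using f(1)[of t] by simp
  fix t t' :: real assume t: "t <= t'"
  have ee: "exp t' = exp (t' - t) * exp t" by (simp add: exp_add[symmetric])
  have "exp t * ?f t' <= exp t * (exp (t' - t) * ?f t)" by (rule mult_left_mono[OF f(3)[OF t]]) simp
  then have "exp t / ?f t <= exp (t' - t) * exp t / ?f t'"
   using f(1)[of t] f(1)[of t'] by (simp add: pos_divide_le_eq pos_le_divide_eq mult_ac)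
  then show "exp t / ?f t <= exp t' / ?f t'" by (simp only: ee)
  have "exp t' * ?f t <= exp t' * ?f t'" by (rule mult_left_mono[OF f(2)[OF t]]) simp
  then have "exp t' / ?f t' <= exp t' / ?f t" using f(1)[of t] f(1)[of t'] by (simp add: pos_divide_le_eq pos_le_divide_eq)
  then show "exp t' / ?f t' <= exp (t' - t) * (exp t / ?f t)" by (simp only: ee times_divide_eq_right)
 qed
qed

lemma fund_product:
 assumes o: "orlicz_function \<psi>" shows "fund_lux \<psi> (exp t) * fund_orl (orlicz_conj \<psi>) (exp t) = exp t"
proof -
 note sl = orlicz_sl[OF o]
 have "0 < orlicz_inv \<psi> (exp (- t))" by (rule inv_pos[OF sl]) simp
 then show ?thesis
  by (simp add: fund_orl_def fund_lux_exp[OF sl] fund_lux_exp[OF conj_sl[OF conj_sl[OF sl]]] inv_conj_conj[OF o])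
qed

section \<open>Orlicz spaces via distribution functions\<close>

lemma antimono_measurable:
 fixes g :: "real => ennreal"
 assumes "!!u v. 0 < u ==> u <= v ==> g v <= g u"
 shows "(%u. g u * ind {0<..} u) \<in> bmeas"
proof (rule borel_measurableI_greater)
 fix c :: ennreal
 have "is_interval {u. 0 < u \<and> c < g u}" unfolding is_interval_1 using assms by (blast intro: less_le_trans)
 then have "{u. 0 < u \<and> c < g u} \<in> sets borel" by (rule real_interval_borel_measurable)
 also have "{u. 0 < u \<and> c < g u} = {u\<in>space borel. c < g u * ind {0<..} u}" by (auto simp: indicator_def)
 finally show "{u\<in>space borel. c < g u * ind {0<..} u} \<in> sets borel" .
qed

lemma mult_indicator_mono: "(x \<in> A ==> f <= g) ==> f * ind A x <= g * (ind A x :: ennreal)"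
 by (simp add: indicator_def)

lemma ennreal_below:
 "{t::real. 0 < t \<and> ennreal t < c} \<in> sets borel" "emeasure lborel {t. 0 < t \<and> ennreal t < c} = c"
proof -
 have "is_interval {t::real. 0 < t \<and> ennreal t < c}" unfolding is_interval_1 by (auto intro: le_less_trans[OF ennreal_leI])
 then show m: "{t::real. 0 < t \<and> ennreal t < c} \<in> sets borel" by (rule real_interval_borel_measurable)
 show "emeasure lborel {t. 0 < t \<and> ennreal t < c} = c" using nn_ennreal_below[of c] m by simp
qed

text \<open>The substitution u = exp(-t) on compact intervals exhausting the line;
  \<open>Suc n\<close> keeps those intervals nondegenerate.\<close>

lemma nn_integral_exp_subst:
 fixes F :: "real => ennreal"
 assumes m: "(%u. F u * ind {0<..} u) \<in> bmeas"
 shows "(\<integral>\<^sup>+ t. F (exp (- t)) * ennreal (exp (- t)) \<partial>lborel) = (\<integral>\<^sup>+u\<in>{0<..}. F u \<partial>lborel)"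
proof -
 define G where "G u = F u * ind {0<..} u" for u
 have [measurable]: "G \<in> bmeas" using m by (simp add: G_def[abs_def])
 have "(\<integral>\<^sup>+ t. F (exp (- t)) * ennreal (exp (- t)) \<partial>lborel) = (\<integral>\<^sup>+ t. G (exp (- t)) * ennreal (exp (- t)) \<partial>lborel)" by (simp add: G_def)
 also have "... = (\<integral>\<^sup>+ t. G (exp t) * ennreal (exp t) \<partial>lborel)"
  using nn_integral_real_affine[of "%t. G (exp t) * ennreal (exp t)" "-1" 0] by simp
 also have "... = emeasure (density lborel (%t. G (exp t) * ennreal (exp t))) UNIV" by (simp add: emeasure_density)
 also have "... = (SUP n. emeasure (density lborel (%t. G (exp t) * ennreal (exp t))) {- real (Suc n)..real (Suc n)})"
 proof (subst SUP_emeasure_incseq)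
  have "\<exists>n. x \<in> {- real (Suc n)..real (Suc n)}" for x
  proof -
   obtain n where "\<bar>x\<bar> <= real n" using real_arch_simple by blast
   then show ?thesis by (intro exI[of _ n]) auto
  qed
  then have "(\<Union>n. {- real (Suc n)..real (Suc n)}) = UNIV" by blast
  then show "emeasure (density lborel (%t. G (exp t) * ennreal (exp t))) UNIV = emeasure (density lborel (%t. G (exp t) * ennreal (exp t))) (\<Union>n. {- real (Suc n)..real (Suc n)})" by simp
 qed (auto simp: incseq_def)
 also have "... = (SUP n. emeasure (density lborel G) {exp (- real (Suc n))..exp (real (Suc n))})"
 proof (rule SUP_cong[OF refl])
  fix n
  show "emeasure (density lborel (%t. G (exp t) * ennreal (exp t))) {- real (Suc n)..real (Suc n)} = emeasure (density lborel G) {exp (- real (Suc n))..exp (real (Suc n))}"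
   using nn_integral_substitution_aux[of G "- real (Suc n)" "real (Suc n)" exp exp]
   by (simp add: emeasure_density DERIV_exp continuous_on_exp del: of_nat_Suc)
 qed
 also have "... = emeasure (density lborel G) {0<..}"
 proof (subst SUP_emeasure_incseq)
  have "\<exists>n. x \<in> {exp (- real (Suc n))..exp (real (Suc n))}" if "0 < x" for x :: real
  proof -
   obtain n where "\<bar>ln x\<bar> <= real n" using real_arch_simple by blast
   then have "exp (- real (Suc n)) <= exp (ln x)" "exp (ln x) <= exp (real (Suc n))" by auto
   then show ?thesis using that by auto
  qed
  then have "(\<Union>n. {exp (- real (Suc n))..exp (real (Suc n))}) = {0<..}" by (auto intro: less_le_trans[OF exp_gt_zero])
  then show "emeasure (density lborel G) (\<Union>n. {exp (- real (Suc n))..exp (real (Suc n))}) = emeasure (density lborel G) {0<..}" by simp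
 qed (auto simp: incseq_def)
 also have "... = (\<integral>\<^sup>+u\<in>{0<..}. F u \<partial>lborel)"
  by (subst emeasure_density) (auto intro!: nn_integral_cong simp: G_def indicator_def)
 finally show ?thesis .
qed

context traced_alg
begin

lemma singular_value_distf: "affop a ==> singular_value \<tau> t a = (INF s\<in>{s. 0 <= s \<and> distf a s <= ennreal t}. ennreal s)"
 by (simp add: singular_value_def spectral_op_abs affopD(1) distf_def)

text \<open>Right continuity of the distribution function makes the infimum attained, so the weak
  inequalities correspond exactly.\<close>

lemma singular_value_le_iff:
 assumes a: "affop a" and s: "0 <= s" shows "singular_value \<tau> t a <= ennreal s \<longleftrightarrow> distf a s <= ennreal t"
proof
 assume "distf a s <= ennreal t"
 then show "singular_value \<tau> t a <= ennreal s" unfolding singular_value_distf[OF a] using s by (intro INF_lower) simp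
next
 assume sv: "singular_value \<tau> t a <= ennreal s"
 have "distf a (s + 1 / real (Suc n)) <= ennreal t" for n
 proof -
  have "ennreal s < ennreal (s + 1 / real (Suc n))" using s by (intro ennreal_lessI) (auto simp: add_nonneg_pos)
  then have "singular_value \<tau> t a < ennreal (s + 1 / real (Suc n))" using sv by (rule le_less_trans[rotated])
  then obtain r where r: "0 <= r" "distf a r <= ennreal t" "ennreal r < ennreal (s + 1 / real (Suc n))"
   unfolding singular_value_distf[OF a] INF_less_iff by blast
  then have "r <= s + 1 / real (Suc n)" by (simp only: ennreal_less_iff)
  then show ?thesis using dist_antimono[OF a] r(2) order_trans by blast
 qed
 then show "distf a s <= ennreal t" unfolding dist_right_cont[OF a, of s] by (rule SUP_least)
qed

lemma singular_value_finite: assumes a: "measop a" and t: "0 < t" shows "singular_value \<tau> t a < \<infinity>"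
proof -
 obtain r where "0 <= r" "distf a r <= ennreal t" using measop_small[OF a t] by blast
 then have "singular_value \<tau> t a <= ennreal r" by (simp add: singular_value_le_iff meas_aff[OF a])
 then show ?thesis using le_less_trans by fastforce
qed

lemma singular_value_gt:
 assumes a: "measop a" and t: "0 < t" and s: "0 <= s"
 shows "s < enn2real (singular_value \<tau> t a) \<longleftrightarrow> ennreal t < distf a s"
proof -
 have "s < enn2real (singular_value \<tau> t a) \<longleftrightarrow> \<not> singular_value \<tau> t a <= ennreal s"
  using singular_value_finite[OF a t] s by (cases "singular_value \<tau> t a") (auto simp: not_le ennreal_less_iff)
 then show ?thesis using singular_value_le_iff[OF meas_aff[OF a] s] by (simp add: not_le)
qed

lemma singular_value_antimono:
 assumes a: "measop a" and t: "0 < t" "t <= t'"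
 shows "enn2real (singular_value \<tau> t' a) <= enn2real (singular_value \<tau> t a)"
proof (rule enn2real_mono)
 show "singular_value \<tau> t' a <= singular_value \<tau> t a" unfolding singular_value_distf[OF meas_aff[OF a]]
  using t by (intro INF_superset_mono) (auto intro: order_trans[OF _ ennreal_leI])
qed (use singular_value_finite[OF a t(1)] in simp)

text \<open>Layer cake form of the modular, the trace of \<Phi>(|a|/s), when J is the right inverse
  of \<Phi>.\<close>

definition odist :: "'a graph => (real => real) => real => ennreal" where
 "odist a J s = (\<integral>\<^sup>+u\<in>{0<..}. distf a (s * J u) \<partial>lborel)"

lemma odist_measop: assumes a: "affop a" and f: "odist a J s < \<infinity>" shows "measop a"
proof (rule ccontr)
 assume "\<not> measop a"
 then have "distf a r = \<infinity>" for r using a by (auto simp: measop_def less_top[symmetric])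
 then have "(\<integral>\<^sup>+u. ind {u. 0 < u \<and> ennreal u < \<infinity>} u \<partial>lborel) <= odist a J s"
  unfolding odist_def by (intro nn_integral_mono) (auto simp: indicator_def)
 then show False using f nn_ennreal_below[of \<infinity>] by simp
qed

text \<open>For a general \<Phi>, \<Phi>(x) > u only yields x \<ge> J(u), whereas x > J(u) is what
  suffices for the converse. Halving the scale turns the weak inequality into a strict one,
  harmlessly, since only the existence of a scale matters.\<close>

lemma orlicz_space_iff:
 assumes sl: "sl \<Phi>"
 shows "a \<in> orlicz_space M \<tau> \<Phi> \<longleftrightarrow> affop a \<and> (\<exists>s>0. odist a (orlicz_inv \<Phi>) s < \<infinity>)"
proof -
 let ?J = "orlicz_inv \<Phi>"
 have J: "0 < ?J u" if "0 < u" for u by (rule inv_pos[OF sl that])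
 define m where "m t = enn2real (singular_value \<tau> t a)" for t
 have mf: "m = (%t. enn2real (singular_value \<tau> t a))" by (simp add: m_def[abs_def])
 have m0: "0 <= m t" for t by (simp add: m_def)
 let ?K = "%\<alpha>. \<integral>\<^sup>+ t\<in>{0<..}. \<Phi> (\<alpha> * \<bar>m t\<bar>) \<partial>lborel"
 have main: "odist a ?J (1 / \<alpha>) <= ?K \<alpha>" "?K \<alpha> <= odist a ?J (1 / (2 * \<alpha>))" if a: "measop a" and \<alpha>: "0 < \<alpha>" for \<alpha>
 proof -
  let ?f = "%t. \<Phi> (\<alpha> * \<bar>m t\<bar>) * ind {0<..} t"
  have fm: "?f \<in> bmeas"
  proof (rule antimono_measurable)
   fix u v :: real assume "0 < u" "u <= v"
   then have "m v <= m u" unfolding m_def by (rule singular_value_antimono[OF a])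
   then show "\<Phi> (\<alpha> * \<bar>m v\<bar>) <= \<Phi> (\<alpha> * \<bar>m u\<bar>)" using \<alpha> m0 by (intro sl_mono[OF sl]) auto
  qed
  have lc: "?K \<alpha> = (\<integral>\<^sup>+u\<in>{0<..}. emeasure lborel {t. ennreal u < ?f t} \<partial>lborel)"
   using nn_integral_layer_cake[of ?f lborel] fm by simp
  have lev: "{t. 0 < t \<and> s < m t} \<in> sets borel" "emeasure lborel {t. 0 < t \<and> s < m t} = distf a s" if "0 <= s" for s
  proof -
   have "{t. 0 < t \<and> s < m t} = {t. 0 < t \<and> ennreal t < distf a s}" using singular_value_gt[OF a _ that] by (auto simp: m_def)
   then show "{t. 0 < t \<and> s < m t} \<in> sets borel" "emeasure lborel {t. 0 < t \<and> s < m t} = distf a s" using ennreal_below by simp_all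
  qed
  have set: "{t. ennreal u < ?f t} \<in> sets borel" for u
   using borel_measurable_less[OF borel_measurable_const fm, of "ennreal u"] by (simp only: space_borel UNIV_I simp_thms)
  have lo: "distf a (1 / \<alpha> * ?J u) <= emeasure lborel {t. ennreal u < ?f t}" if u: "0 < u" for u
  proof -
   have p: "0 <= 1 / \<alpha> * ?J u" using J[OF u] \<alpha> by simp
   have sub: "{t. 0 < t \<and> 1 / \<alpha> * ?J u < m t} \<subseteq> {t. ennreal u < ?f t}"
   proof safe
    fix t assume t: "0 < t" "1 / \<alpha> * ?J u < m t"
    then have "?J u < \<alpha> * \<bar>m t\<bar>" using \<alpha> m0[of t] by (simp add: field_simps)
    then show "ennreal u < ?f t" using t J[OF u] inv_gt[OF sl, of "\<alpha> * \<bar>m t\<bar>" u] by simp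
   qed
   have "emeasure lborel {t. 0 < t \<and> 1 / \<alpha> * ?J u < m t} <= emeasure lborel {t. ennreal u < ?f t}"
    by (rule emeasure_mono[OF sub]) (simp only: sets_lborel set)
   then show ?thesis unfolding lev(2)[OF p] .
  qed
  have up: "emeasure lborel {t. ennreal u < ?f t} <= distf a (1 / (2 * \<alpha>) * ?J u)" if u: "0 < u" for u
  proof -
   have p: "0 <= 1 / (2 * \<alpha>) * ?J u" using J[OF u] \<alpha> by simp
   have sub: "{t. ennreal u < ?f t} \<subseteq> {t. 0 < t \<and> 1 / (2 * \<alpha>) * ?J u < m t}"
   proof safe
    fix t assume t: "ennreal u < ?f t"
    then show "0 < t" by (cases "0 < t") auto
    have "\<not> \<alpha> * \<bar>m t\<bar> < ?J u"
    proof
     assume "\<alpha> * \<bar>m t\<bar> < ?J u"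
     then have "\<Phi> (\<alpha> * \<bar>m t\<bar>) <= ennreal u" using \<alpha> by (intro inv_lt[OF sl]) auto
     then show False using t \<open>0 < t\<close> by (simp add: leD)
    qed
    then show "1 / (2 * \<alpha>) * ?J u < m t" using \<alpha> m0[of t] J[OF u] by (simp add: field_simps)
   qed
   have "emeasure lborel {t. ennreal u < ?f t} <= emeasure lborel {t. 0 < t \<and> 1 / (2 * \<alpha>) * ?J u < m t}"
    by (rule emeasure_mono[OF sub]) (simp only: sets_lborel lev(1)[OF p])
   then show ?thesis unfolding lev(2)[OF p] .
  qed
  show "odist a ?J (1 / \<alpha>) <= ?K \<alpha>" unfolding lc odist_def
   by (intro nn_integral_mono mult_indicator_mono lo) auto
  show "?K \<alpha> <= odist a ?J (1 / (2 * \<alpha>))" unfolding lc odist_def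
   by (intro nn_integral_mono mult_indicator_mono up) auto
 qed
 have meas: "set_borel_measurable lborel {0<..} m" if a: "measop a"
 proof -
  have "(%t. ennreal (m t) * ind {0<..} t) \<in> bmeas"
   using singular_value_antimono[OF a] by (intro antimono_measurable ennreal_leI) (simp add: m_def)
  from measurable_compose[OF this borel_measurable_enn2real[OF measurable_ident]]
  have "(%t. enn2real (ennreal (m t) * ind {0<..} t)) \<in> bmeas" by simp
  moreover have "(%t. enn2real (ennreal (m t) * ind {0<..} t)) = (%t. ind {0<..} t *\<^sub>R m t)" using m0 by (auto simp: indicator_def)
  ultimately show ?thesis by (simp add: set_borel_measurable_def)
 qed
 have "a \<in> orlicz_space M \<tau> \<Phi> \<longleftrightarrow> measop a \<and> (\<exists>\<alpha>>0. ?K \<alpha> < \<infinity>)"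
  using meas unfolding orlicz_space_def orlicz_half_line_def mem_Collect_eq mf[symmetric] unfolding m_def[symmetric] by (auto simp: measurable_ops_iff)
 also have "... \<longleftrightarrow> affop a \<and> (\<exists>s>0. odist a ?J s < \<infinity>)"
 proof safe
  fix \<alpha> :: real assume a: "measop a" "0 < \<alpha>" "?K \<alpha> < \<infinity>"
  show "affop a" by (rule meas_aff[OF a(1)])
  show "\<exists>s>0. odist a ?J s < \<infinity>"
   using a(2) le_less_trans[OF main(1)[OF a(1,2)] a(3)] by (intro exI[of _ "1 / \<alpha>"] conjI) simp_all
 next
  fix s :: real assume a: "affop a" "0 < s" "odist a ?J s < \<infinity>"
  show m: "measop a" by (rule odist_measop[OF a(1,3)])
  have "1 / (2 * (1 / (2 * s))) = s" using a(2) by simp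
  then have "?K (1 / (2 * s)) <= odist a ?J s" using main(2)[OF m, of "1 / (2 * s)"] a(2) by simp
  then show "\<exists>\<alpha>>0. ?K \<alpha> < \<infinity>" using le_less_trans[OF _ a(3)] a(2) by (intro exI[of _ "1 / (2 * s)"] conjI) simp_all
 qed
 finally show ?thesis .
qed

text \<open>For a conjugate function the level sets match exactly by \<open>conj_gt_iff\<close>, so
  no scale is lost and the norms themselves agree.\<close>

lemma luxemburg_odist:
 assumes sl: "sl \<Phi>" and a: "affop a"
 shows "luxemburg_norm \<tau> (orlicz_conj \<Phi>) a = (INF r\<in>{r. 0 < r \<and> odist a (orlicz_inv (orlicz_conj \<Phi>)) r <= 1}. ennreal r)"
proof -
 let ?J = "orlicz_inv (orlicz_conj \<Phi>)"
 have "trace_fun \<tau> (%s. orlicz_conj \<Phi> (s / r)) (op_abs a) = odist a ?J r" if r: "0 < r" for r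
  unfolding odist_def
 proof (rule trace_fun_distf[OF a])
  fix u s :: real assume "0 < u" "0 <= s"
  then show "ennreal u < orlicz_conj \<Phi> (s / r) \<longleftrightarrow> r * ?J u < s" using r conj_gt_iff[OF sl, of u "s / r"] by (simp add: field_simps)
 qed (use r inv_pos[OF conj_sl[OF sl]] in \<open>simp add: less_imp_le\<close>)
 then show ?thesis unfolding luxemburg_norm_def by (intro INF_cong) auto
qed

end

context crossed_alg
begin

lemma gdist_subst:
 assumes a: "affop a" and f: "adm f" and s: "0 <= s"
 shows "gdist a f s = (\<integral>\<^sup>+u\<in>{0<..}. distf a (s / f (- ln u)) \<partial>lborel)"
proof -
 have f0: "0 < f t" for t using f by (simp add: adm_def)
 have "(%u. distf a (s / f (- ln u)) * ind {0<..} u) \<in> bmeas"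
 proof (rule antimono_measurable, rule dist_antimono[OF a])
  fix u v :: real assume "0 < u" "u <= v"
  then have "f (- ln v) <= f (- ln u)" using f by (auto simp: adm_def mono_def)
  then show "s / f (- ln u) <= s / f (- ln v)" using s f0 by (intro divide_left_mono) auto
 qed
 from nn_integral_exp_subst[OF this] show ?thesis by (simp add: gdist_def)
qed

lemma gdist_fund_lux:
 assumes sl: "sl \<Phi>" and a: "affop a" and s: "0 <= s"
 shows "gdist a (%t. fund_lux \<Phi> (exp t)) s = odist a (orlicz_inv \<Phi>) s"
 unfolding gdist_subst[OF a adm_fund_lux[OF sl] s] odist_def
 by (intro nn_integral_cong) (auto simp: indicator_def fund_lux_exp[OF sl] split: if_splits)

text \<open>With J and K the inverses of \<Phi> and its conjugate, the argument
  s/\<open>fund_orl\<close> becomes s u/K(u), and \<open>inv_young\<close> places u/K(u) between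
  J(u)/2 and J(u).\<close>

lemma gdist_fund_orl:
 assumes sl: "sl \<Phi>" and a: "affop a" and s: "0 <= s"
 shows "odist a (orlicz_inv \<Phi>) s <= gdist a (%t. fund_orl \<Phi> (exp t)) s"
  "gdist a (%t. fund_orl \<Phi> (exp t)) s <= odist a (orlicz_inv \<Phi>) (s / 2)"
proof -
 let ?J = "orlicz_inv \<Phi>" and ?K = "orlicz_inv (orlicz_conj \<Phi>)"
 have e: "s / fund_orl \<Phi> (exp (- ln u)) = s * (u / ?K u)" if "0 < u" for u
 proof -
  have "fund_lux (orlicz_conj \<Phi>) (exp (- ln u)) = 1 / ?K u" using that by (simp only: fund_lux_exp[OF conj_sl[OF sl]] minus_minus exp_ln)
  moreover have "exp (- ln u) = 1 / u" using that by (simp add: exp_minus inverse_eq_divide)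
  ultimately show ?thesis by (simp add: fund_orl_def)
 qed
 have b: "?J u / 2 <= u / ?K u" "u / ?K u <= ?J u" if "0 < u" for u
  using inv_young[OF sl that] inv_pos[OF conj_sl[OF sl] that] by (simp_all add: field_simps)
 show "odist a ?J s <= gdist a (%t. fund_orl \<Phi> (exp t)) s" "gdist a (%t. fund_orl \<Phi> (exp t)) s <= odist a ?J (s / 2)"
  unfolding gdist_subst[OF a adm_fund_orl[OF sl] s] odist_def
  by (intro nn_integral_mono mult_indicator_mono; use mult_left_mono[OF b(1) s] mult_left_mono[OF b(2) s] in \<open>auto simp: e intro!: dist_antimono[OF a]\<close>)+
qed

lemma orlicz_space_tens:
 assumes sl: "sl \<Phi>" and a: "affop a"
 shows "a \<in> orlicz_space M \<tau> \<Phi> \<longleftrightarrow> op_tensor T a (fund_orl \<Phi>) \<in> measurable_ops (crossed_product T M) \<tau>A"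
proof -
 let ?f = "%t. fund_orl \<Phi> (exp t)"
 note adm = adm_fund_orl[OF sl]
 have A: "A.affop (tens a ?f)" by (rule affop_tens[OF a adm_reg[OF adm]])
 have "a \<in> orlicz_space M \<tau> \<Phi> \<longleftrightarrow> (\<exists>s>0. gdist a ?f s < \<infinity>)" unfolding orlicz_space_iff[OF sl]
 proof safe
  fix s :: real assume s: "0 < s" "odist a (orlicz_inv \<Phi>) s < \<infinity>"
  have "gdist a ?f (2 * s) <= odist a (orlicz_inv \<Phi>) s" using gdist_fund_orl(2)[OF sl a, of "2 * s"] s by simp
  then show "\<exists>s>0. gdist a ?f s < \<infinity>" using s by (intro exI[of _ "2 * s"]) (auto intro: le_less_trans)
 next
  fix s :: real assume s: "0 < s" "gdist a ?f s < \<infinity>"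
  show "\<exists>s>0. odist a (orlicz_inv \<Phi>) s < \<infinity>"
   using le_less_trans[OF gdist_fund_orl(1)[OF sl a less_imp_le[OF s(1)]] s(2)] s(1) by blast
 qed (rule a)
 also have "... \<longleftrightarrow> A.measop (tens a ?f)" unfolding A.measop_def
 proof safe
  fix s :: real assume s: "0 < s" "gdist a ?f s < \<infinity>"
  show "\<exists>s. A.distf (tens a ?f) s < \<infinity>" using le_less_trans[OF dist_tens(1)[OF a adm s(1), of "2 * s"] s(2)] s(1) by auto
 next
  fix s assume s: "A.distf (tens a ?f) s < \<infinity>"
  \<comment> \<open>\<open>dist_tens\<close> needs a positive argument, whereas the s from
    \<open>measop\<close> may be any real.\<close>
  have "A.distf (tens a ?f) (max s 1) < \<infinity>" using le_less_trans[OF A.dist_antimono[OF A] s] by simp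
  then show "\<exists>s>0. gdist a ?f s < \<infinity>"
   using le_less_trans[OF dist_tens(2)[OF a adm, of "max s 1" "max s 1 + 1"]] by (intro exI[of _ "max s 1 + 1"]) auto
 qed (rule A)
 finally show ?thesis by (simp add: op_tensor_tens A.measurable_ops_iff)
qed

text \<open>The distribution functions are comparable only across a gap s < s'. The auxiliary fact
  \<open>eq\<close> identifies two infima whenever each bound on one carries over to the other after
  an arbitrarily small increase.\<close>

lemma singular_value_luxemburg:
 assumes sl: "sl \<Phi>" and b: "affop b"
 shows "singular_value \<tau>A 1 (op_tensor T b (fund_lux (orlicz_conj \<Phi>))) = luxemburg_norm \<tau> (orlicz_conj \<Phi>) b"
proof -
 let ?f = "%t. fund_lux (orlicz_conj \<Phi>) (exp t)" and ?J = "orlicz_inv (orlicz_conj \<Phi>)"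
 note sl' = conj_sl[OF sl]
 note adm = adm_fund_lux[OF sl']
 have A: "A.affop (tens b ?f)" by (rule affop_tens[OF b adm_reg[OF adm]])
 have g: "gdist b ?f s = odist b ?J s" if "0 < s" for s using gdist_fund_lux[OF sl' b] that by simp
 have eq: "x = y" if "!!s s'. 0 <= s ==> s < s' ==> x <= ennreal s ==> y <= ennreal s'" "!!s s'. 0 <= s ==> s < s' ==> y <= ennreal s ==> x <= ennreal s'" for x y :: ennreal
 proof -
  have *: "y <= x" if h: "!!s s'. 0 <= s ==> s < s' ==> x <= ennreal s ==> y <= ennreal s'" for x y :: ennreal
  proof (cases x)
   case (real r)
   show ?thesis
   proof (rule ennreal_le_epsilon)
    fix e :: real assume "0 < e"
    then show "y <= x + ennreal e" using h[of r "r + e"] real by simp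
   qed
  qed simp
  show ?thesis by (rule antisym; rule *) (use that in blast)+
 qed
 show ?thesis unfolding op_tensor_tens A.singular_value_distf[OF A] luxemburg_odist[OF sl b]
 proof (rule eq)
  fix s s' :: real
  let ?X = "INF s\<in>{s. 0 <= s \<and> A.distf (tens b ?f) s <= ennreal 1}. ennreal s"
  let ?Y = "INF r\<in>{r. 0 < r \<and> odist b ?J r <= 1}. ennreal r"
  assume s: "0 <= s" "s < s'"
  { assume "?X <= ennreal s"
   then have "?X < ennreal s'" using s by (meson ennreal_lessI le_less_trans)
   then obtain r where r: "0 <= r" "A.distf (tens b ?f) r <= ennreal 1" "ennreal r < ennreal s'" unfolding INF_less_iff by blast
   then have rs: "r < s'" by (simp add: ennreal_less_iff)
   have "gdist b ?f s' <= A.distf (tens b ?f) ((r + s') / 2)" using r(1) rs s by (intro dist_tens[OF b adm]) auto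
   also have "... <= A.distf (tens b ?f) r" using rs by (intro A.dist_antimono[OF A]) auto
   finally have "odist b ?J s' <= 1" using r(2) g[of s'] s by simp
   then show "?Y <= ennreal s'" using s by (intro INF_lower) auto }
  { assume "?Y <= ennreal s"
   then have "?Y < ennreal s'" using s by (meson ennreal_lessI le_less_trans)
   then obtain r where r: "0 < r" "odist b ?J r <= 1" "ennreal r < ennreal s'" unfolding INF_less_iff by blast
   then have rs: "r < s'" by (simp add: ennreal_less_iff)
   have "A.distf (tens b ?f) s' <= gdist b ?f r" by (rule dist_tens(1)[OF b adm r(1) rs])
   then have "A.distf (tens b ?f) s' <= ennreal 1" using r(2) g[OF r(1)] by simp
   then show "?X <= ennreal s'" using s by (intro INF_lower) auto }
 qed
qed

text \<open>\<open>tens_inj\<close> makes the description in \<open>haagerup_tr\<close> unambiguous,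
  with |c| as its value. If the trace of |c| is infinite, the operator is outside the Haagerup space
  and the default value there is also infinite.\<close>

lemma haagerup_tr_tens:
 assumes c: "affop c"
 shows "haagerup_tr T M \<tau> (op_abs (tens c exp)) = trace_pos \<tau> (op_abs c)"
proof -
 have "adm exp" by (simp add: adm_def mono_def exp_add[symmetric])
 note er = adm_reg[OF this]
 let ?h = "absg c"
 have h: "affop ?h" "positive_selfadjoint ?h" by (rule affop_absg[OF c], rule psa_absg[OF affopD(1)[OF c]])
 have oh: "op_abs ?h = ?h" "op_abs c = ?h" by (rule op_abs_psa[OF h(2)], rule op_abs_eq[OF affopD(1)[OF c]])
 have L: "closed_dd_op g" if "g \<in> L1_ops M \<tau>" for g using that by (simp add: L1_ops_def measurable_ops_iff measop_def affopD)
 have inj: "g = ?h" if "g \<in> L1_ops M \<tau>" "tens ?h exp = tens g exp" for g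
  using tens_inj[OF cddD(1,3)[OF L[OF that(1)]] er, of ?h] tens_inj[OF cddD(1,3)[OF affopD(1)[OF h(1)]] er, of g] that(2) by blast
 have "?h \<in> L1_ops M \<tau>" if "trace_pos \<tau> ?h < \<infinity>"
 proof -
  have "(\<integral>\<^sup>+u\<in>{0<..}. distf ?h u \<partial>lborel) < \<infinity>" using that trace_pos_distf[OF h(1)] by (simp add: oh)
  then have "measop ?h" using odist_measop[OF h(1), of "%u. u" 1] by (simp add: odist_def)
  then show ?thesis using that by (simp add: L1_ops_def measurable_ops_iff oh)
 qed
 moreover have "(THE g. g \<in> L1_ops M \<tau> \<and> tens ?h exp = tens g exp) = ?h" if "?h \<in> L1_ops M \<tau>"
  by (rule the_equality) (use that inj in blast)+
 moreover have "tens ?h exp \<in> haagerup_L1 T M \<tau> \<longleftrightarrow> ?h \<in> L1_ops M \<tau>"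
  using inj by (auto simp: haagerup_L1_def op_tensor_tens)
 ultimately show ?thesis
  unfolding op_abs_tens[OF c er] oh haagerup_tr_def op_tensor_tens
  by (cases "trace_pos \<tau> ?h = \<infinity>") (auto simp: less_top[symmetric])
qed

lemma haagerup_tr_prod:
 assumes o: "orlicz_function \<psi>" and a: "measop a" and b: "measop b"
 shows "haagerup_tr T M \<tau> (op_abs (strong_prod (op_tensor T a (fund_lux \<psi>)) (op_tensor T b (fund_orl (orlicz_conj \<psi>))))) = trace_pos \<tau> (op_abs (strong_prod a b))"
  "haagerup_tr T M \<tau> (op_abs (strong_prod (op_tensor T b (fund_orl (orlicz_conj \<psi>))) (op_tensor T a (fund_lux \<psi>)))) = trace_pos \<tau> (op_abs (strong_prod b a))"
proof -
 note sl = orlicz_sl[OF o]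
 note f = adm_reg[OF adm_fund_lux[OF sl]] adm_reg[OF adm_fund_orl[OF conj_sl[OF sl]]]
 have p: "(%t. fund_lux \<psi> (exp t) * fund_orl (orlicz_conj \<psi>) (exp t)) = exp" using fund_product[OF o] by auto
 then have q: "(%t. fund_orl (orlicz_conj \<psi>) (exp t) * fund_lux \<psi> (exp t)) = exp" by (simp add: mult.commute)
 show "haagerup_tr T M \<tau> (op_abs (strong_prod (op_tensor T a (fund_lux \<psi>)) (op_tensor T b (fund_orl (orlicz_conj \<psi>))))) = trace_pos \<tau> (op_abs (strong_prod a b))"
  unfolding op_tensor_tens strong_prod_tens[OF a b f] p by (rule haagerup_tr_tens[OF meas_aff[OF measop_prod[OF a b]]])
 show "haagerup_tr T M \<tau> (op_abs (strong_prod (op_tensor T b (fund_orl (orlicz_conj \<psi>))) (op_tensor T a (fund_lux \<psi>)))) = trace_pos \<tau> (op_abs (strong_prod b a))"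
  unfolding op_tensor_tens strong_prod_tens[OF b a f(2,1)] q by (rule haagerup_tr_tens[OF meas_aff[OF measop_prod[OF b a]]])
qed

end

theorem proposition2p5:
  fixes M :: "('h::chilbert_space \<Rightarrow> 'h) set"
    and \<tau> :: "('h \<Rightarrow> 'h) \<Rightarrow> ennreal"
    and T :: "'h \<Rightarrow> (real \<Rightarrow> complex) \<Rightarrow> 'k::chilbert_space"
    and \<tau>A :: "('k \<Rightarrow> 'k) \<Rightarrow> ennreal"
    and \<psi> :: "real \<Rightarrow> ennreal"
    and a :: "'h graph"
  assumes "von_neumann_algebra M"
    and "fns_trace M \<tau>"
    and "L2_tensor T"
    and "canonical_trace T M \<tau> \<tau>A"
    and "orlicz_function \<psi>"
    and "closed_dd_op a"
    and "affiliated M a"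
  shows "(a \<in> orlicz_space M \<tau> \<psi> \<longleftrightarrow>
            op_tensor T a (fund_orl \<psi>) \<in> measurable_ops (crossed_product T M) \<tau>A) \<and>
         (a \<in> orlicz_space M \<tau> \<psi> \<longrightarrow>
            orlicz_norm M \<tau> \<psi> a =
              (SUP b \<in> {b \<in> orlicz_space M \<tau> (orlicz_conj \<psi>).
                          singular_value \<tau>A 1 (op_tensor T b (fund_lux (orlicz_conj \<psi>))) \<le> 1}.
                 haagerup_tr T M \<tau>
                   (op_abs (strong_prod (op_tensor T a (fund_lux \<psi>))
                                        (op_tensor T b (fund_orl (orlicz_conj \<psi>)))))) \<and>
            orlicz_norm M \<tau> \<psi> a =
              (SUP b \<in> {b \<in> orlicz_space M \<tau> (orlicz_conj \<psi>).
                          singular_value \<tau>A 1 (op_tensor T b (fund_lux (orlicz_conj \<psi>))) \<le> 1}.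
                 haagerup_tr T M \<tau>
                   (op_abs (strong_prod (op_tensor T b (fund_orl (orlicz_conj \<psi>)))
                                        (op_tensor T a (fund_lux \<psi>))))))"
proof -
 interpret crossed_alg M \<tau> T \<tau>A using assms by unfold_locales
 have a: "affop a" using assms by (simp add: affop_def)
 note o = assms(5)
 note sl = orlicz_sl[OF o]
 note sl' = conj_sl[OF sl]
 let ?S = "orlicz_space M \<tau> (orlicz_conj \<psi>)" and ?J = "orlicz_inv (orlicz_conj \<psi>)"
 define B where "B = {b\<in>?S. luxemburg_norm \<tau> (orlicz_conj \<psi>) b <= 1}"
 have S: "measop b" if "b \<in> ?S" for b using that by (simp add: orlicz_space_def measurable_ops_iff)
 have Beq: "{b\<in>?S. singular_value \<tau>A 1 (op_tensor T b (fund_lux (orlicz_conj \<psi>))) <= 1} = B"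
  unfolding B_def using singular_value_luxemburg[OF sl meas_aff[OF S]] by auto
 have Bm: "measop b" if "b \<in> B" for b using that S by (simp add: B_def)
 \<comment> \<open>The closure property required by \<open>sup_swap\<close>: membership in the space
   and the Luxemburg norm are both expressed by \<open>odist\<close>, which is monotone in the
   distribution function.\<close>
 have Bc: "c \<in> B" if b: "b \<in> B" and c: "measop c" and le: "!!s. 0 <= s ==> distf c s <= distf b s" for b c
 proof -
  have J: "0 <= ?J u" if "0 < u" for u using inv_pos[OF sl' that] by simp
  have od: "odist c ?J s <= odist b ?J s" if "0 < s" for s
   unfolding odist_def using that le J by (intro nn_integral_mono) (auto simp: indicator_def)
  have "b \<in> ?S" using b by (simp add: B_def)
  then have "c \<in> ?S" unfolding orlicz_space_iff[OF sl'] using meas_aff[OF c] le_less_trans[OF od] by blast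
  moreover have "luxemburg_norm \<tau> (orlicz_conj \<psi>) c <= luxemburg_norm \<tau> (orlicz_conj \<psi>) b"
   unfolding luxemburg_odist[OF sl meas_aff[OF c]] luxemburg_odist[OF sl meas_aff[OF Bm[OF b]]]
   using od by (intro INF_superset_mono) (auto intro: order_trans)
  ultimately show ?thesis using b by (simp add: B_def order_trans)
 qed
 have on: "orlicz_norm M \<tau> \<psi> a = (SUP b\<in>B. trace_pos \<tau> (op_abs (strong_prod a b)))" by (simp add: orlicz_norm_def B_def)
 show ?thesis unfolding Beq
 proof (intro conjI impI)
  show "a \<in> orlicz_space M \<tau> \<psi> \<longleftrightarrow> op_tensor T a (fund_orl \<psi>) \<in> measurable_ops N \<tau>A" by (rule orlicz_space_tens[OF sl a])
  assume "a \<in> orlicz_space M \<tau> \<psi>"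
  then have am: "measop a" by (simp add: orlicz_space_def measurable_ops_iff)
  show "orlicz_norm M \<tau> \<psi> a = (SUP b\<in>B. haagerup_tr T M \<tau> (op_abs (strong_prod (op_tensor T a (fund_lux \<psi>)) (op_tensor T b (fund_orl (orlicz_conj \<psi>))))))"
   unfolding on by (intro SUP_cong refl haagerup_tr_prod(1)[OF o am Bm, symmetric])
  have "orlicz_norm M \<tau> \<psi> a = (SUP b\<in>B. trace_pos \<tau> (op_abs (strong_prod b a)))" unfolding on by (rule sup_swap[OF am Bm Bc])
  also have "... = (SUP b\<in>B. haagerup_tr T M \<tau> (op_abs (strong_prod (op_tensor T b (fund_orl (orlicz_conj \<psi>))) (op_tensor T a (fund_lux \<psi>)))))"
   by (intro SUP_cong refl haagerup_tr_prod(2)[OF o am Bm, symmetric])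
  finally show "orlicz_norm M \<tau> \<psi> a = (SUP b\<in>B. haagerup_tr T M \<tau> (op_abs (strong_prod (op_tensor T b (fund_orl (orlicz_conj \<psi>))) (op_tensor T a (fund_lux \<psi>)))))" .
 qed
qed

end
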